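(* Let $T:X\to X$ be a Gibbs-Markov map for a partition $\alpha$ of a probability metric space $(X,\mathcal{B},m,d)$, preserving the ergodic probability measure $m$. Let $f:X\to\mathbb{R}$ be such that $\sum_{a\in\alpha} m(a)Df(a)<\infty$, such that $f$ belongs to a domain of attraction (condition I, II or III of the context), and such that $\int f\,dm=0$. Define $B_n$ and the law $\mathcal{W}$ as follows: (i) if $f\in L^2$ (condition I), $B_n=\sqrt n$ and $\mathcal{W}=\mathcal{N}(0,\sigma^2)$, where $\sigma^2\ge 0$ is the number such that $S_nf/\sqrt n$ converges in distribution to $\mathcal{N}(0,\sigma^2)$ (such a $\sigma^2$ exists by a known theorem); (ii) if condition II holds, $B_n$ is a renormalizing sequence with $nL(B_n)\sim B_n^2$, and $\mathcal{W}=\mathcal{N}(0,1)$; (iii) if condition III holds, $B_n$ is a renormalizing sequence with $nL(B_n)\sim B_n^p$, and $\mathcal{W}$ is the law with characteristic function $E(e^{it\mathcal{W}})=\exp\left(-c|t|^p\left(1-i\beta\,\mathrm{sgn}(t)\tan\left(\tfrac{p\pi}{2}\right)\right)\right)$, where $c=(c_1+c_2)\Gamma(1-p)\cos\left(\tfrac{p\pi}{2}\right)$ and $\beta=\frac{c_1-c_2}{c_1+c_2}$. Then $S_nf/B_n$ converges with tight maxima to $\mathcal{W}$. Moreover, $S_nf/B_n$ satisfies an almost sure limit theorem towards $\mathcal{W}$.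
   Context: Notation: $S_nf=f+f\circ T+\cdots+f\circ T^{n-1}$. For $X'\subset X$, $Df(X')=\sup\{|f(x)-f(y)|/d(x,y) : x,y\in X',\ x\ne y\}$. Gibbs-Markov map. A non-singular map $T:X\to X$ on a probability metric space $(X,\mathcal{B},m,d)$ of bounded diameter, preserving the probability measure $m$, is Gibbs-Markov if there is a countable measurable partition $\alpha$ of $X$ such that: (1) for all $a\in\alpha$, $T$ is injective on $a$ and $T(a)$ is a union of elements of $\alpha$; (2) there is $\lambda>1$ such that $d(Tx,Ty)\ge\lambda d(x,y)$ for all $a\in\alpha$ and $x,y\in a$; (3) writing $\mathrm{Jac}$ for the inverse of the Jacobian of $T$ (with respect to $m$), there is $C>0$ such that $\left|1-\frac{\mathrm{Jac}(x)}{\mathrm{Jac}(y)}\right|\le C\,d(Tx,Ty)$ for all $a\in\alpha$ and $x,y\in a$; (4) $\inf_{a\in\alpha}m(Ta)>0$. Slow variation. A continuous function $L:(0,\infty)\to(0,\infty)$ is slowly varying if $L(\lambda x)/L(x)\to1$ as $x\to\infty$ for all $\lambda>0$; it is normalized if it is $C^1$ and $L'(x)=o(L(x)/x)$ as $x\to\infty$. Domain of attraction. A function $f$ on a probability space with measure $m$ belongs to a domain of attraction if one of the following holds. I. $f\in L^2$. II. $\int 1_{\{|f|>x\}}dm\sim x^{-2}\ell(x)$ for some function $\ell$ such that $L(x):=2\int_1^x\frac{\ell(u)}{u}du$ is of slow variation and unbounded. III. There is $p\in(1,2)$ such that $\int 1_{\{f>x\}}dm=(c_1+o(1))x^{-p}L(x)$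 and $\int 1_{\{f<-x\}}dm=(c_2+o(1))x^{-p}L(x)$, where $c_1,c_2\ge0$, $c_1+c_2>0$, and $L$ is of slow variation. Renormalizing sequence: a sequence $B_n=B(n)$ where $B(x)=x^dL_0(x)$ on $(0,\infty)$ with $d>0$ and $L_0$ a normalized slowly varying function. Convergence with tight maxima: for random variables $S_n$ and a renormalizing sequence $B_n$, $S_n/B_n$ converges with tight maxima to $\mathcal{W}$ if $S_n/B_n$ converges in law to $\mathcal{W}$ and the sequence $(\max_{1\le k\le n}|S_k|)/B_n$, $n\ge1$, is tight. Almost sure limit theorem: $S_n/B_n$ satisfies an almost sure limit theorem towards $\mathcal{W}$ if, for almost all $\omega$, the measures $\frac{1}{\log N}\sum_{k=1}^N\frac1k\delta_{S_k(\omega)/B_k}$ converge weakly as $N\to\infty$ to the law of $\mathcal{W}$ ($\delta_x$ is the Dirac mass at $x$). *)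

theory Defs
  imports "HOL-Probability.Probability" "HOL-Library.Landau_Symbols"
begin

section \<open>Gibbs-Markov maps\<close>

text \<open>
  The function \<open>J\<close> is (a version of) the inverse of the Jacobian of \<open>T\<close> with respect to \<open>M\<close>:
  on each partition element \<open>a\<close>, the measure \<open>E \<mapsto> M (T E)\<close> has density \<open>1 / J\<close> with respect to \<open>M\<close>.
  A Gibbs-Markov map sends measurable subsets of a partition element to measurable sets as soon
  as the sigma-algebra is the Borel one (which is then generated by the cylinders) or its
  completion, so the measurability clause only makes the Jacobian meaningful.
\<close>
definition inverse_jacobian ::
    "'a measure \<Rightarrow> ('a \<Rightarrow> 'a) \<Rightarrow> 'a set set \<Rightarrow> ('a \<Rightarrow> real) \<Rightarrow> bool" where
  "inverse_jacobian M T \<alpha> J \<longleftrightarrow>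
     J \<in> borel_measurable M \<and> (\<forall>x\<in>space M. J x > 0) \<and>
     (\<forall>a\<in>\<alpha>. \<forall>E\<in>sets M. E \<subseteq> a \<longrightarrow>
        T ` E \<in> sets M \<and> emeasure M (T ` E) = (\<integral>\<^sup>+x\<in>E. ennreal (1 / J x) \<partial>M))"

text \<open>
  The space is \<open>X = space M\<close> with the metric \<open>d\<close>; its sigma-algebra has to contain the open sets
  (so it may be the Borel sigma-algebra or a completion of it). Non-singularity of \<open>T\<close> is a
  consequence of the invariance of the measure.
\<close>
definition gibbs_markov ::
    "'a measure \<Rightarrow> ('a \<Rightarrow> 'a \<Rightarrow> real) \<Rightarrow> ('a \<Rightarrow> 'a) \<Rightarrow> 'a set set \<Rightarrow> bool" where
  "gibbs_markov M d T \<alpha> \<longleftrightarrow>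
     prob_space M \<and> Metric_space (space M) d \<and>
     (\<forall>U. openin (Metric_space.mtopology (space M) d) U \<longrightarrow> U \<in> sets M) \<and>
     Metric_space.mbounded (space M) d (space M) \<and>
     T \<in> measurable M M \<and> distr M M T = M \<and>
     countable \<alpha> \<and> \<alpha> \<subseteq> sets M \<and> partition_on (space M) \<alpha> \<and>
     (\<forall>a\<in>\<alpha>. inj_on T a \<and> (\<exists>\<beta>\<subseteq>\<alpha>. T ` a = \<Union>\<beta>)) \<and>
     (\<exists>\<kappa>>1. \<forall>a\<in>\<alpha>. \<forall>x\<in>a. \<forall>y\<in>a. d (T x) (T y) \<ge> \<kappa> * d x y) \<and>
     (\<exists>J. inverse_jacobian M T \<alpha> J \<and>
        (\<exists>C>0. \<forall>a\<in>\<alpha>. \<forall>x\<in>a. \<forall>y\<in>a. \<bar>1 - J x / J y\<bar> \<le> C * d (T x) (T y))) \<and>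
     (INF a\<in>\<alpha>. measure M (T ` a)) > 0"

definition ergodic_map :: "'a measure \<Rightarrow> ('a \<Rightarrow> 'a) \<Rightarrow> bool" where
  "ergodic_map M T \<longleftrightarrow>
     (\<forall>A\<in>sets M. T -` A \<inter> space M = A \<longrightarrow> measure M A = 0 \<or> measure M A = 1)"

definition birkhoff_sum :: "('a \<Rightarrow> 'a) \<Rightarrow> ('a \<Rightarrow> real) \<Rightarrow> nat \<Rightarrow> 'a \<Rightarrow> real" where
  "birkhoff_sum T f n x = (\<Sum>k<n. f ((T ^^ k) x))"

text \<open>
  The best Lipschitz constant \<open>Df(A)\<close>, possibly infinite.
\<close>
definition lip_const :: "('a \<Rightarrow> 'a \<Rightarrow> real) \<Rightarrow> ('a \<Rightarrow> real) \<Rightarrow> 'a set \<Rightarrow> ennreal" where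
  "lip_const d f A =
     (SUP (x, y)\<in>{(x, y). x \<in> A \<and> y \<in> A \<and> x \<noteq> y}. ennreal (\<bar>f x - f y\<bar> / d x y))"


section \<open>Slow variation and domains of attraction\<close>

definition slowly_varying :: "(real \<Rightarrow> real) \<Rightarrow> bool" where
  "slowly_varying L \<longleftrightarrow>
     continuous_on {0<..} L \<and> (\<forall>x>0. L x > 0) \<and>
     (\<forall>r>0. ((\<lambda>x. L (r * x) / L x) \<longlongrightarrow> 1) at_top)"

definition normalized_slowly_varying :: "(real \<Rightarrow> real) \<Rightarrow> bool" where
  "normalized_slowly_varying L \<longleftrightarrow>
     slowly_varying L \<and>
     (\<exists>L'. (\<forall>x>0. (L has_real_derivative L' x) (at x)) \<and> continuous_on {0<..} L' \<and>
           L' \<in> o[at_top](\<lambda>x. L x / x))"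

definition renormalizing_sequence :: "(nat \<Rightarrow> real) \<Rightarrow> bool" where
  "renormalizing_sequence B \<longleftrightarrow>
     (\<exists>r>0. \<exists>L0. normalized_slowly_varying L0 \<and>
        (\<forall>n\<ge>1. B n = real n powr r * L0 (real n)))"

definition attraction_I :: "'a measure \<Rightarrow> ('a \<Rightarrow> real) \<Rightarrow> bool" where
  "attraction_I M f \<longleftrightarrow> f \<in> borel_measurable M \<and> integrable M (\<lambda>x. (f x)\<^sup>2)"

definition log_integral :: "(real \<Rightarrow> real) \<Rightarrow> real \<Rightarrow> real" where
  "log_integral l x = 2 * (LBINT u:{1..x}. l u / u)"

text \<open>
  Since \<open>log_integral l\<close> vanishes at \<open>1\<close>, it cannot be positive on all of the half-line; its slow
  variation, a property at infinity, means that it eventually agrees with a slowly varying function.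
\<close>
definition attraction_II :: "'a measure \<Rightarrow> ('a \<Rightarrow> real) \<Rightarrow> (real \<Rightarrow> real) \<Rightarrow> bool" where
  "attraction_II M f l \<longleftrightarrow>
     f \<in> borel_measurable M \<and>
     (\<lambda>x. measure M {y\<in>space M. \<bar>f y\<bar> > x}) \<sim>[at_top] (\<lambda>x. x powr (-2) * l x) \<and>
     (\<forall>x\<ge>1. set_integrable lborel {1..x} (\<lambda>u. l u / u)) \<and>
     (\<exists>L. slowly_varying L \<and> (\<forall>\<^sub>F x in at_top. log_integral l x = L x)) \<and>
     \<not> bounded (log_integral l ` {1..})"

definition attraction_III ::
    "'a measure \<Rightarrow> ('a \<Rightarrow> real) \<Rightarrow> real \<Rightarrow> real \<Rightarrow> real \<Rightarrow> (real \<Rightarrow> real) \<Rightarrow> bool" where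
  "attraction_III M f p c1 c2 L \<longleftrightarrow>
     f \<in> borel_measurable M \<and> 1 < p \<and> p < 2 \<and> c1 \<ge> 0 \<and> c2 \<ge> 0 \<and> c1 + c2 > 0 \<and>
     slowly_varying L \<and>
     (\<exists>e1. (e1 \<longlongrightarrow> 0) at_top \<and>
        (\<forall>x>0. measure M {y\<in>space M. f y > x} = (c1 + e1 x) * x powr (-p) * L x)) \<and>
     (\<exists>e2. (e2 \<longlongrightarrow> 0) at_top \<and>
        (\<forall>x>0. measure M {y\<in>space M. f y < - x} = (c2 + e2 x) * x powr (-p) * L x))"


section \<open>Limit laws\<close>

text \<open>
  The normal law with mean \<open>0\<close> and variance \<open>v \<ge> 0\<close>, which is the Dirac mass at \<open>0\<close> when \<open>v = 0\<close>.
\<close>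
definition centered_normal :: "real \<Rightarrow> real measure" where
  "centered_normal v =
     (if v = 0 then return borel 0 else density lborel (\<lambda>x. ennreal (normal_density 0 (sqrt v) x)))"

text \<open>
  \<open>W\<close> is the law with characteristic function
  \<open>exp (- c |t|^p (1 - i \<beta> sgn t tan (p \<pi> / 2)))\<close>; it is unique since characteristic functions
  determine laws.
\<close>
definition is_stable_law :: "real \<Rightarrow> real \<Rightarrow> real \<Rightarrow> real measure \<Rightarrow> bool" where
  "is_stable_law p c \<beta> W \<longleftrightarrow>
     real_distribution W \<and>
     (\<forall>t. char W t =
        exp (- complex_of_real (c * \<bar>t\<bar> powr p) *
             (1 - \<i> * complex_of_real (\<beta> * sgn t * tan (p * pi / 2)))))"


section \<open>Modes of convergence\<close>

text \<open>
  The renormalized maxima are indexed by \<open>Suc n\<close> because the sequence starts at \<open>1\<close>.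
\<close>
definition converges_with_tight_maxima ::
    "'a measure \<Rightarrow> (nat \<Rightarrow> 'a \<Rightarrow> real) \<Rightarrow> (nat \<Rightarrow> real) \<Rightarrow> real measure \<Rightarrow> bool" where
  "converges_with_tight_maxima M S B W \<longleftrightarrow>
     weak_conv_m (\<lambda>n. distr M borel (\<lambda>x. S n x / B n)) W \<and>
     tight (\<lambda>n. distr M borel (\<lambda>x. (MAX k\<in>{1..Suc n}. \<bar>S k x\<bar>) / B (Suc n)))"

text \<open>
  The measure \<open>(1 / log N) \<Sum>\<^sub>k\<^sub>\<le>\<^sub>N (1 / k) \<delta>(y k)\<close>. It is in general not a probability measure, so
  its weak convergence is expressed below with bounded continuous test functions.
\<close>
definition log_empirical_measure :: "(nat \<Rightarrow> real) \<Rightarrow> nat \<Rightarrow> real measure" where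
  "log_empirical_measure y N =
     distr (point_measure {1..N} (\<lambda>k. ennreal (1 / ln (real N) * (1 / real k)))) borel y"

definition weakly_converges :: "(nat \<Rightarrow> real measure) \<Rightarrow> real measure \<Rightarrow> bool" where
  "weakly_converges \<mu> \<nu> \<longleftrightarrow>
     (\<forall>\<phi>::real \<Rightarrow> real. continuous_on UNIV \<phi> \<longrightarrow> bounded (range \<phi>) \<longrightarrow>
        (\<lambda>N. integral\<^sup>L (\<mu> N) \<phi>) \<longlonglongrightarrow> integral\<^sup>L \<nu> \<phi>)"

definition almost_sure_limit_theorem ::
    "'a measure \<Rightarrow> (nat \<Rightarrow> 'a \<Rightarrow> real) \<Rightarrow> (nat \<Rightarrow> real) \<Rightarrow> real measure \<Rightarrow> bool" where
  "almost_sure_limit_theorem M S B W \<longleftrightarrow>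
     (AE x in M. weakly_converges (log_empirical_measure (\<lambda>k. S k x / B k)) W)"

end

theory Submission
 imports Defs "HOL-Complex_Analysis.Great_Picard" "HOL-Real_Asymp.Real_Asymp"
begin

text \<open>
 By bounded distortion, the transfer operator turns an observable \<open>\<psi>\<close> with \<open>\<Sum> m(a) D\<psi>(a) < \<infinity>\<close> into a Lipschitz
 function. Ergodicity and compactness let one solve \<open>v = w - \<L> w\<close> for Lipschitz \<open>v\<close> of mean zero, so no
 spectral gap is needed: \<open>\<integral> \<psi> H \<circ> T\<close> differs from \<open>\<integral> \<psi> \<integral> H\<close> by at most a constant times \<open>\<integral> |H - H \<circ> T|\<close>.
 With \<open>H = exp (i s S\<^sub>k)\<close> this compares the characteristic function of \<open>S\<^sub>n\<close> at \<open>s\<close> with \<open>(\<integral> exp (i s f))\<^sup>n\<close> up to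
 \<open>O(n s\<^sup>2)\<close>, which is negligible for \<open>s = t / B\<^sub>n\<close> when \<open>n = o(B\<^sub>n\<^sup>2)\<close>; the limit then depends only on the tails
 of \<open>f\<close>. For square integrable \<open>f\<close>, a bounded coboundary is subtracted first, leaving a reversed martingale difference.
 The same decomposition of the truncated observable and Doob's inequality give tight maxima, and the decorrelation
 of \<open>S\<^sub>k\<close> from \<open>S\<^sub>n - S\<^sub>k\<close> bounds the covariances behind the almost sure limit theorem.
\<close>

section \<open>The transfer operator\<close>

text \<open>Ergodicity leaves room for periodicity, so correlations of \<open>T\<close> need not
  decay: the equation \<open>v = w - \<L> w\<close> is solved by Cesaro means, and decorrelation is
  claimed only against almost invariant functions. Functions of Birkhoff sums are almost invariant
  because \<open>S\<^sub>k - S\<^sub>k \<circ> T = f - f \<circ> T\<^sup>k\<close> does not grow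
  with \<open>k\<close>. A second obstacle is that Lipschitz estimates are pointwise, while a
  transfer operator is naturally defined almost everywhere. Here it is a concrete sum over inverse
  branches, and pointwise work is confined to a set \<open>G\<close> of full measure, closed under
  images and preimages, on which the operator fixes the constant 1. For square integrable
  \<open>f\<close> an error \<open>O(n s\<^sup>2)\<close> at \<open>s = t / sqrt n\<close> does not
  vanish. The martingale property then allows \<open>sin (s F) - s F\<close> in place of
  \<open>sin (s F)\<close>; this function and \<open>cos (s F) - 1\<close> are of second order in
  \<open>s\<close>, and the error becomes \<open>o(1)\<close> although the bounds on the elements
  are only summable against \<open>m\<close>, not square summable.\<close>

abbreviation ev_seq :: "(nat \<Rightarrow> bool) \<Rightarrow> bool" (binder "EV " 10) where "ev_seq P \<equiv> eventually P sequentially"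

lemmas int_cong = Bochner_Integration.integral_cong
lemmas int_dom = Bochner_Integration.integrable_bound
lemmas int_diff = Bochner_Integration.integrable_diff
lemmas lint_diff = Bochner_Integration.integral_diff
lemmas int_add = Bochner_Integration.integrable_add
lemmas lint_add = Bochner_Integration.integral_add
lemmas int_nonneg = Bochner_Integration.integral_nonneg

text \<open>The existential witnesses of \<open>gibbs_markov\<close> become parameters, so that all
  estimates share them: \<open>J\<close> and \<open>C0\<close> for the distortion,
  \<open>\<kappa>\<close> for the expansion, \<open>\<delta>\<close> for the diameter,
  \<open>\<eta>\<close> for the lower bound on the measures of images.\<close>

locale gm_map = prob_space M for M :: "'a measure" +
 fixes d :: "'a \<Rightarrow> 'a \<Rightarrow> real" and T :: "'a \<Rightarrow> 'a" and \<alpha> :: "'a set set"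
  and \<kappa> :: real and J :: "'a \<Rightarrow> real" and C0 \<delta> \<eta> :: real
 assumes d_nonneg: "0 \<le> d x y"
  and d_bound: "\<lbrakk>x \<in> space M; y \<in> space M\<rbrakk> \<Longrightarrow> d x y \<le> \<delta>" and \<delta>_pos: "\<delta> > 0"
  and T_meas [measurable]: "T \<in> measurable M M" and T_inv: "distr M M T = M"
  and \<alpha>_countable: "countable \<alpha>" and \<alpha>_sets: "\<alpha> \<subseteq> sets M" and \<alpha>_part: "partition_on (space M) \<alpha>"
  and inj: "a \<in> \<alpha> \<Longrightarrow> inj_on T a" and image_union: "a \<in> \<alpha> \<Longrightarrow> \<exists>\<beta>\<subseteq>\<alpha>. T ` a = \<Union>\<beta>"
  and \<kappa>_gt_1: "\<kappa> > 1"
  and expanding: "\<lbrakk>a \<in> \<alpha>; x \<in> a; y \<in> a\<rbrakk> \<Longrightarrow> \<kappa> * d x y \<le> d (T x) (T y)"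
  and jacobian: "inverse_jacobian M T \<alpha> J"
  and C0_nonneg: "C0 \<ge> 0"
  and distortion: "\<lbrakk>a \<in> \<alpha>; x \<in> a; y \<in> a\<rbrakk> \<Longrightarrow> \<bar>1 - J x / J y\<bar> \<le> C0 * d (T x) (T y)"
  and \<eta>_pos: "\<eta> > 0" and big_image: "a \<in> \<alpha> \<Longrightarrow> \<eta> \<le> measure M (T ` a)"
begin

abbreviation cs :: "'a set measure" where "cs \<equiv> count_space \<alpha>"

abbreviation rv :: "('a \<Rightarrow> real) \<Rightarrow> bool" where "rv X \<equiv> random_variable borel X"

abbreviation Sn :: "('a \<Rightarrow> real) \<Rightarrow> nat \<Rightarrow> 'a \<Rightarrow> real" where "Sn \<equiv> birkhoff_sum T"

section \<open>Elementary facts about the partition, the expansion and the invariance\<close>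

lemma J_meas [measurable]: "rv J"
 and J_pos: "x \<in> space M \<Longrightarrow> 0 < J x"
 and image_sets: "\<lbrakk>a \<in> \<alpha>; E \<in> sets M; E \<subseteq> a\<rbrakk> \<Longrightarrow> T ` E \<in> sets M"
 and emeasure_image: "\<lbrakk>a \<in> \<alpha>; E \<in> sets M; E \<subseteq> a\<rbrakk>
  \<Longrightarrow> emeasure M (T ` E) = (\<integral>\<^sup>+x\<in>E. ennreal (1 / J x) \<partial>M)"
 using jacobian unfolding inverse_jacobian_def by auto

lemma sets_\<alpha>: "a \<in> \<alpha> \<Longrightarrow> a \<in> sets M"
 using \<alpha>_sets by auto

lemma in_space: "\<lbrakk>a \<in> \<alpha>; x \<in> a\<rbrakk> \<Longrightarrow> x \<in> space M"
 using sets_\<alpha> sets.sets_into_space by blast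

lemma T_space: "x \<in> space M \<Longrightarrow> T x \<in> space M"
 using measurable_space[OF T_meas] .

lemma ex_element: "x \<in> space M \<Longrightarrow> \<exists>a\<in>\<alpha>. x \<in> a"
 using \<alpha>_part unfolding partition_on_def by auto

lemma unique_element: "\<lbrakk>a \<in> \<alpha>; b \<in> \<alpha>; x \<in> a; x \<in> b\<rbrakk> \<Longrightarrow> a = b"
 using \<alpha>_part unfolding partition_on_def disjoint_def by (metis disjoint_iff)

text \<open>The set \<open>T a\<close> is a union of elements, so it contains a given element or
  misses it. Two points of one element therefore have the same inverse branches, which is what
  allows comparing \<open>\<L> u\<close> at them branch by branch.\<close>

lemma image_saturated: "\<lbrakk>a \<in> \<alpha>; b \<in> \<alpha>; y \<in> b; y' \<in> b; y \<in> T ` a\<rbrakk> \<Longrightarrow> y' \<in> T ` a"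
proof -
 assume *: "a \<in> \<alpha>" "b \<in> \<alpha>" "y \<in> b" "y' \<in> b" "y \<in> T ` a"
 obtain \<beta> where \<beta>: "\<beta> \<subseteq> \<alpha>" "T ` a = \<Union>\<beta>" using image_union[OF *(1)] by auto
 then obtain c where "c \<in> \<beta>" "y \<in> c" using * by auto
 then have "c = b" using unique_element \<beta> * by blast
 then show "y' \<in> T ` a" using \<open>c \<in> \<beta>\<close> \<beta> * by auto
qed

lemma expanding': "\<lbrakk>a \<in> \<alpha>; x \<in> a; y \<in> a\<rbrakk> \<Longrightarrow> d x y \<le> d (T x) (T y) / \<kappa>"
 using expanding[of a x y] \<kappa>_gt_1 by (simp add: field_simps)

lemma expanding_le: "\<lbrakk>a \<in> \<alpha>; x \<in> a; y \<in> a\<rbrakk> \<Longrightarrow> d x y \<le> d (T x) (T y)"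
 using expanding[of a x y] \<kappa>_gt_1 d_nonneg[of x y]
 by (smt (verit) mult_le_cancel_right1)

lemma emeasure_T_vimage: "A \<in> sets M \<Longrightarrow> emeasure M (T -` A \<inter> space M) = emeasure M A"
 using emeasure_distr[OF T_meas, of A] T_inv by simp

lemma AE_T: "AE x in M. Q x \<Longrightarrow> AE x in M. Q (T x)"
proof -
 assume Q: "AE x in M. Q x"
 then obtain N where N: "N \<in> null_sets M" "{x \<in> space M. \<not> Q x} \<subseteq> N"
  by (auto simp: eventually_ae_filter)
 then have "T -` N \<inter> space M \<in> null_sets M"
  using emeasure_T_vimage[of N] by (auto simp: null_sets_def)
 then show ?thesis
  apply (rule AE_I')
  using N T_space by auto
qed

lemma integral_T: "rv h \<Longrightarrow> (LINT x|M. h (T x)) = (LINT x|M. h x)" for h :: "'a \<Rightarrow> real"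
 using integral_distr[OF T_meas, of h] T_inv by simp

lemma integrable_T: "integrable M h \<Longrightarrow> integrable M (\<lambda>x. h (T x))" for h :: "'a \<Rightarrow> real"
 using integrable_distr[OF T_meas, of h] T_inv by simp

text \<open>Off \<open>T a\<close> the value is an arbitrary point of \<open>a\<close>: this keeps
  \<open>branch a\<close> total, measurable and with values in \<open>a\<close>, while
  \<open>weight\<close> vanishes there.\<close>

definition branch :: "'a set \<Rightarrow> 'a \<Rightarrow> 'a" where
 "branch a y = (if y \<in> T ` a then inv_into a T y else (SOME x. x \<in> a))"

definition weight :: "'a set \<Rightarrow> 'a \<Rightarrow> real" where
 "weight a y = (if y \<in> T ` a then J (branch a y) else 0)"

text \<open>The transfer operator as a function and not as an \<open>L1\<close> class, since
  Lipschitz bounds need values at points. The sum over preimages is an integral over the counting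
  measure on \<alpha>, so that Fubini with \<open>M\<close> yields the duality; its value is 0
  wherever it does not converge absolutely.\<close>

definition \<L> :: "('a \<Rightarrow> real) \<Rightarrow> 'a \<Rightarrow> real" where
 "\<L> u y = (LINT a|cs. weight a y * u (branch a y))"

lemma nonempty_\<alpha>: "a \<in> \<alpha> \<Longrightarrow> a \<noteq> {}"
 using \<alpha>_part unfolding partition_on_def by auto

lemma branch_in: "a \<in> \<alpha> \<Longrightarrow> branch a y \<in> a"
 unfolding branch_def using nonempty_\<alpha> by (auto simp: some_in_eq inv_into_into)

lemma T_branch: "y \<in> T ` a \<Longrightarrow> T (branch a y) = y"
 unfolding branch_def by (simp add: f_inv_into_f)

lemma branch_T: "\<lbrakk>a \<in> \<alpha>; x \<in> a\<rbrakk> \<Longrightarrow> branch a (T x) = x"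
 unfolding branch_def using inj by auto

lemma weight_nonneg: "a \<in> \<alpha> \<Longrightarrow> 0 \<le> weight a y"
proof -
 assume "a \<in> \<alpha>"
 then have "0 < J (branch a y)" by (intro J_pos in_space[OF _ branch_in])
 then show ?thesis by (simp add: weight_def)
qed

lemma branch_vimage:
 assumes "a \<in> \<alpha>" "E \<in> sets M"
 shows "{y \<in> T ` a. branch a y \<in> E} = T ` (E \<inter> a)"
proof (intro equalityI subsetI)
 fix y assume "y \<in> {y \<in> T ` a. branch a y \<in> E}"
 then have "y \<in> T ` a" "branch a y \<in> E" by auto
 then show "y \<in> T ` (E \<inter> a)" using branch_in[OF assms(1), of y] T_branch[of y a]
  by (metis IntI imageI)
next
 fix y assume "y \<in> T ` (E \<inter> a)"
 then show "y \<in> {y \<in> T ` a. branch a y \<in> E}" using branch_T[OF assms(1)] by auto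
qed

lemma branch_meas: assumes "a \<in> \<alpha>" shows "branch a \<in> measurable M M"
proof (rule measurableI)
 show "branch a x \<in> space M" for x using branch_in in_space assms by blast
 fix E assume E: "E \<in> sets M"
 have Ta: "T ` a \<in> sets M" using image_sets sets_\<alpha> assms by blast
 have 1: "T ` (E \<inter> a) \<in> sets M" using image_sets[OF assms, of "E \<inter> a"] sets_\<alpha>[OF assms] E by auto
 have "branch a -` E \<inter> space M = T ` (E \<inter> a) \<union> (if (SOME x. x \<in> a) \<in> E then space M - T ` a else {})"
  using branch_vimage[OF assms E] sets.sets_into_space[OF Ta] by (auto simp: branch_def split: if_splits)
 then show "branch a -` E \<inter> space M \<in> sets M" using 1 Ta by auto
qed

lemma weight_meas: assumes "a \<in> \<alpha>" shows "weight a \<in> borel_measurable M"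
proof -
 have [measurable]: "T ` a \<in> sets M" "branch a \<in> measurable M M"
  using image_sets sets_\<alpha> assms branch_meas by blast+
 show ?thesis unfolding weight_def[abs_def] by measurable
qed

text \<open>Change of variables on one branch: \<open>T\<close> carries the measure of density
  \<open>1 / J\<close> on \<open>a\<close> to the restriction of \<open>M\<close> to
  \<open>T a\<close>, and the weight \<open>J\<close> cancels that density.\<close>

lemma nn_integral_branch:
 assumes a: "a \<in> \<alpha>" and [measurable]: "h \<in> borel_measurable M"
 shows "(\<integral>\<^sup>+y. ennreal (weight a y) * h (branch a y) \<partial>M) = (\<integral>\<^sup>+x\<in>a. h x \<partial>M)"
proof -
 have [measurable]: "T ` a \<in> sets M" "a \<in> sets M" "branch a \<in> measurable M M" "weight a \<in> borel_measurable M"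
  using image_sets sets_\<alpha> a branch_meas weight_meas by blast+
 have eq: "distr (density M (\<lambda>x. ennreal (1 / J x) * indicator a x)) M T = density M (indicator (T ` a))"
 proof (rule measure_eqI)
  fix A assume "A \<in> sets (distr (density M (\<lambda>x. ennreal (1 / J x) * indicator a x)) M T)"
  then have A[measurable]: "A \<in> sets M" by simp
  have "emeasure (distr (density M (\<lambda>x. ennreal (1 / J x) * indicator a x)) M T) A
    = emeasure (density M (\<lambda>x. ennreal (1 / J x) * indicator a x)) (T -` A \<inter> space M)"
   by (subst emeasure_distr) auto
  also have "\<dots> = (\<integral>\<^sup>+x. ennreal (1 / J x) * indicator a x * indicator (T -` A \<inter> space M) x \<partial>M)"
   by (subst emeasure_density) auto
  also have "\<dots> = (\<integral>\<^sup>+x\<in>(T -` A \<inter> space M \<inter> a). ennreal (1 / J x) \<partial>M)"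
   by (intro nn_integral_cong) (auto simp: indicator_def)
  also have "\<dots> = emeasure M (T ` (T -` A \<inter> space M \<inter> a))"
   by (rule emeasure_image[OF a, symmetric]) auto
  also have "T ` (T -` A \<inter> space M \<inter> a) = T ` a \<inter> A"
   using in_space[OF a] by auto
  also have "emeasure M (T ` a \<inter> A) = emeasure (density M (indicator (T ` a))) A"
   by (subst emeasure_density)
     (auto simp: nn_integral_indicator[symmetric] indicator_inter_arith simp del: nn_integral_indicator)
  finally show "emeasure (distr (density M (\<lambda>x. ennreal (1 / J x) * indicator a x)) M T) A
   = emeasure (density M (indicator (T ` a))) A" .
 qed simp
 have "(\<integral>\<^sup>+y. ennreal (weight a y) * h (branch a y) \<partial>M)
   = (\<integral>\<^sup>+y. indicator (T ` a) y * (ennreal (weight a y) * h (branch a y)) \<partial>M)"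
  by (intro nn_integral_cong) (auto simp: indicator_def weight_def)
 also have "\<dots> = (\<integral>\<^sup>+y. ennreal (weight a y) * h (branch a y) \<partial>density M (indicator (T ` a)))"
  by (subst nn_integral_density) auto
 also have "\<dots> = (\<integral>\<^sup>+y. ennreal (weight a y) * h (branch a y)
    \<partial>distr (density M (\<lambda>x. ennreal (1 / J x) * indicator a x)) M T)"
  unfolding eq ..
 also have "\<dots> = (\<integral>\<^sup>+x. ennreal (weight a (T x)) * h (branch a (T x))
    \<partial>density M (\<lambda>x. ennreal (1 / J x) * indicator a x))"
  by (rule nn_integral_distr) auto
 also have "\<dots> = (\<integral>\<^sup>+x. ennreal (1 / J x) * indicator a x * (ennreal (weight a (T x)) * h (branch a (T x))) \<partial>M)"
  by (rule nn_integral_density) auto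
 also have "\<dots> = (\<integral>\<^sup>+x\<in>a. h x \<partial>M)"
 proof (intro nn_integral_cong)
  fix x assume x: "x \<in> space M"
  show "ennreal (1 / J x) * indicator a x * (ennreal (weight a (T x)) * h (branch a (T x))) = h x * indicator a x"
  proof (cases "x \<in> a")
   case True
   have "ennreal (1 / J x) * ennreal (J x) = 1"
    using J_pos[OF x] by (simp add: ennreal_mult'[symmetric])
   then show ?thesis using True branch_T[OF a True] by (simp add: weight_def mult.assoc[symmetric])
  qed auto
 qed
 finally show ?thesis .
qed

lemma emeasure_\<alpha>_sum: "E \<in> sets M \<Longrightarrow> emeasure M E = (\<integral>\<^sup>+a. emeasure M (E \<inter> a) \<partial>cs)"
proof -
 assume E: "E \<in> sets M"
 have "E = (\<Union>a\<in>\<alpha>. E \<inter> a)" using sets.sets_into_space[OF E] ex_element by blast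
 then have "emeasure M E = emeasure M (\<Union>a\<in>\<alpha>. E \<inter> a)" by simp
 also have "\<dots> = (\<integral>\<^sup>+a. emeasure M (E \<inter> a) \<partial>cs)"
  using E sets_\<alpha> \<alpha>_countable unique_element
  by (intro emeasure_UN_countable) (auto simp: disjoint_family_on_def)
 finally show ?thesis .
qed

lemma integrable_prob_\<alpha>: "integrable cs (\<lambda>a. measure M a)"
proof (rule integrableI_nonneg)
 have "(\<integral>\<^sup>+a. ennreal (measure M a) \<partial>cs) = (\<integral>\<^sup>+a. emeasure M (space M \<inter> a) \<partial>cs)"
  by (intro nn_integral_cong) (simp add: emeasure_eq_measure sets_\<alpha> Int_absorb1 sets.sets_into_space)
 also have "\<dots> = 1" using emeasure_\<alpha>_sum[of "space M"] emeasure_space_1 by simp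
 finally show "(\<integral>\<^sup>+a. ennreal (measure M a) \<partial>cs) < \<infinity>" by simp
qed auto

sublocale CP: pair_sigma_finite "cs" M
 by (intro pair_sigma_finite.intro sigma_finite_measure_count_space_countable \<alpha>_countable) unfold_locales

lemma pair_meas: "(\<And>a. a \<in> \<alpha> \<Longrightarrow> (\<lambda>y. k a y) \<in> measurable M N) \<Longrightarrow> (\<lambda>p. k (fst p) (snd p)) \<in> measurable (cs \<Otimes>\<^sub>M M) N"
 by (rule measurable_pair_measure_countable1[OF \<alpha>_countable]) auto

text \<open>Mass \<open>weight a y\<close> on the pair of \<open>a\<close> and \<open>y\<close>
  records a point together with one of its preimages. Since \<open>branch\<close> maps this measure
  to \<open>M\<close>, the duality for \<open>\<L>\<close> becomes Fubini on the product.\<close>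

definition lifted :: "('a set \<times> 'a) measure" where
 "lifted = density (cs \<Otimes>\<^sub>M M) (\<lambda>p. ennreal (weight (fst p) (snd p)))"

lemma weight_pair_meas [measurable]: "(\<lambda>p. weight (fst p) (snd p)) \<in> borel_measurable (cs \<Otimes>\<^sub>M M)"
 by (rule pair_meas) (rule weight_meas)

lemma branch_pair_meas [measurable]: "(\<lambda>p. branch (fst p) (snd p)) \<in> measurable (cs \<Otimes>\<^sub>M M) M"
 by (rule pair_meas) (rule branch_meas)

lemma distr_lifted: "distr lifted M (\<lambda>p. branch (fst p) (snd p)) = M"
proof (rule measure_eqI)
 have mb: "(\<lambda>p. branch (fst p) (snd p)) \<in> measurable lifted M"
  unfolding lifted_def by measurable
 fix E assume "E \<in> sets (distr lifted M (\<lambda>p. branch (fst p) (snd p)))"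
 then have E[measurable]: "E \<in> sets M" by simp
 let ?k = "\<lambda>p. ennreal (weight (fst p) (snd p)) * indicator E (branch (fst p) (snd p))"
 have "emeasure (distr lifted M (\<lambda>p. branch (fst p) (snd p))) E
   = (\<integral>\<^sup>+x. indicator E x \<partial>distr lifted M (\<lambda>p. branch (fst p) (snd p)))" by simp
 also have "\<dots> = (\<integral>\<^sup>+p. indicator E (branch (fst p) (snd p)) \<partial>lifted)"
  by (rule nn_integral_distr[OF mb]) auto
 also have "\<dots> = (\<integral>\<^sup>+p. ?k p \<partial>(cs \<Otimes>\<^sub>M M))"
  unfolding lifted_def by (rule nn_integral_density) auto
 also have "\<dots> = (\<integral>\<^sup>+a. \<integral>\<^sup>+y. ?k (a, y) \<partial>M \<partial>cs)"
  by (rule nn_integral_fst[symmetric]) auto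
 also have "\<dots> = (\<integral>\<^sup>+a. emeasure M (E \<inter> a) \<partial>cs)"
 proof (intro nn_integral_cong)
  fix a assume "a \<in> space cs"
  then have a: "a \<in> \<alpha>" by simp
  have "(\<integral>\<^sup>+y. ?k (a, y) \<partial>M) = (\<integral>\<^sup>+x\<in>a. indicator E x \<partial>M)"
   using nn_integral_branch[OF a, of "indicator E"] by simp
  also have "\<dots> = emeasure M (E \<inter> a)"
   using sets_\<alpha>[OF a] by (simp add: indicator_inter_arith[symmetric])
  finally show "(\<integral>\<^sup>+y. ?k (a, y) \<partial>M) = emeasure M (E \<inter> a)" .
 qed
 also have "\<dots> = emeasure M E" using emeasure_\<alpha>_sum[OF E] ..
 finally show "emeasure (distr lifted M (\<lambda>p. branch (fst p) (snd p))) E = emeasure M E" .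
qed simp

lemma
 fixes u g :: "'a \<Rightarrow> real"
 assumes [measurable]: "rv u" "rv g"
  and int: "integrable M (\<lambda>x. g (T x) * u x)"
 shows integrable_transfer: "integrable M (\<lambda>y. g y * \<L> u y)" (is ?Q)
  and integral_transfer: "(LINT y|M. g y * \<L> u y) = (LINT x|M. g (T x) * u x)" (is ?P)
proof -
 let ?b = "\<lambda>p. branch (fst p) (snd p)"
 let ?q = "\<lambda>a y. weight a y * (g y * u (branch a y))"
 have mb: "?b \<in> measurable lifted M"
  unfolding lifted_def by measurable
 let ?A = "cs \<Otimes>\<^sub>M M"
 have mb': "(\<lambda>p. g (T (?b p)) * u (?b p)) \<in> borel_measurable ?A"
  by measurable
 have 1: "integrable lifted (\<lambda>p. g (T (?b p)) * u (?b p))"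
  using integrable_distr[OF mb, of "\<lambda>x. g (T x) * u x"] distr_lifted int by simp
 \<comment> \<open>Where the weight is nonzero, \<open>T (branch a y) = y\<close>, so
   \<open>g \<circ> T\<close> becomes a factor \<open>g y\<close> that does not depend on the
   branch.\<close>
 have e: "weight (fst p) (snd p) *\<^sub>R (g (T (?b p)) * u (?b p)) = ?q (fst p) (snd p)" for p
  by (cases "snd p \<in> T ` fst p") (auto simp: T_branch weight_def)
 have int1: "integrable ?A (\<lambda>p. ?q (fst p) (snd p))"
 proof -
  have "integrable ?A (\<lambda>p. weight (fst p) (snd p) *\<^sub>R (g (T (?b p)) * u (?b p)))"
   using 1 unfolding lifted_def
   by (subst (asm) integrable_density) (auto simp: weight_nonneg space_pair_measure intro!: AE_I2 mb')
  then show ?thesis unfolding e .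
 qed
 have int2: "integrable ?A (case_prod ?q)"
  using int1 by (simp add: case_prod_beta')
 have eq: "(LINT a|cs. ?q a y) = g y * \<L> u y" for y
  unfolding \<L>_def by (subst integral_mult_right_zero[symmetric]) (simp add: ac_simps)
 show ?Q
  using CP.integrable_snd[OF int2] unfolding eq .
 have "(LINT x|M. g (T x) * u x) = (\<integral>x. g (T x) * u x \<partial>distr lifted M ?b)"
  by (simp add: distr_lifted)
 also have "\<dots> = (LINT p|lifted. g (T (?b p)) * u (?b p))"
  by (rule integral_distr[OF mb]) auto
 also have "\<dots> = (\<integral>p. weight (fst p) (snd p) *\<^sub>R (g (T (?b p)) * u (?b p)) \<partial>?A)"
  unfolding lifted_def by (rule integral_density) (auto simp: weight_nonneg space_pair_measure intro!: AE_I2 mb')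
 also have "\<dots> = (LINT y|M. g y * \<L> u y)"
  unfolding e using CP.integral_snd[OF int2] unfolding eq by (simp add: case_prod_beta')
 finally show ?P ..
qed

section \<open>Regular observables\<close>

lemma J_ratio: "\<lbrakk>a \<in> \<alpha>; x \<in> a; x' \<in> a\<rbrakk> \<Longrightarrow> J x \<le> (1 + C0 * d (T x) (T x')) * J x'"
 using distortion[of a x x'] J_pos[OF in_space, of a x'] by (simp add: abs_le_iff field_simps)

lemma J_diff: "\<lbrakk>a \<in> \<alpha>; x \<in> a; x' \<in> a\<rbrakk> \<Longrightarrow> \<bar>J x - J x'\<bar> \<le> C0 * d (T x) (T x') * J x'"
proof -
 assume *: "a \<in> \<alpha>" "x \<in> a" "x' \<in> a"
 have p: "J x' > 0" using J_pos[OF in_space] * by auto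
 have "\<bar>J x - J x'\<bar> = \<bar>1 - J x / J x'\<bar> * J x'" using p by (simp add: abs_if field_simps)
 also have "\<dots> \<le> C0 * d (T x) (T x') * J x'"
  by (intro mult_right_mono distortion[OF *]) (use p in auto)
 finally show ?thesis .
qed

definition Kw :: real where "Kw = (1 + C0 * \<delta>) / \<eta>"

lemma Kw_pos: "0 < Kw"
 unfolding Kw_def using C0_nonneg \<delta>_pos \<eta>_pos by (intro divide_pos_pos add_pos_nonneg) auto

text \<open>By distortion \<open>J\<close> varies on \<open>a\<close> by a factor of at most
  \<open>1 + C0 * \<delta>\<close>, while \<open>1 / J\<close> integrates over \<open>a\<close> to
  the measure of \<open>T a\<close>, which is at least \<open>\<eta>\<close>; hence \<open>J\<close>
  is at most \<open>Kw * prob a\<close> on \<open>a\<close>. This is what makes sums over infinitely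
  many branches converge.\<close>

lemma weight_le:
 assumes a: "a \<in> \<alpha>"
 shows "weight a y \<le> Kw * prob a"
proof (cases "y \<in> T ` a")
 case True
 define x where "x = branch a y"
 have x: "x \<in> a" "x \<in> space M" using branch_in[OF a] in_space[OF a] by (auto simp: x_def)
 have Jx: "0 < J x" using J_pos x by auto
 have pd: "0 < 1 + C0 * \<delta>" using C0_nonneg \<delta>_pos by (intro add_pos_nonneg) auto
 have [measurable]: "a \<in> sets M" by (rule sets_\<alpha>[OF a])
 have "ennreal (measure M (T ` a)) = (\<integral>\<^sup>+x'\<in>a. ennreal (1 / J x') \<partial>M)"
  using emeasure_image[OF a sets_\<alpha>[OF a]] by (simp add: emeasure_eq_measure)
 also have "\<dots> \<le> (\<integral>\<^sup>+x'. ennreal ((1 + C0 * \<delta>) / J x) * indicator a x' \<partial>M)"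
 proof (intro nn_integral_mono)
  fix x' assume x': "x' \<in> space M"
  show "ennreal (1 / J x') * indicator a x' \<le> ennreal ((1 + C0 * \<delta>) / J x) * indicator a x'"
  proof (cases "x' \<in> a")
   case True
   have "J x \<le> (1 + C0 * d (T x) (T x')) * J x'" by (rule J_ratio[OF a x(1) True])
   also have "\<dots> \<le> (1 + C0 * \<delta>) * J x'"
    using J_pos[OF x'] C0_nonneg d_bound[OF T_space[OF x(2)] T_space[OF x']]
    by (intro mult_right_mono add_left_mono mult_left_mono) auto
   finally have "1 / J x' \<le> (1 + C0 * \<delta>) / J x" using Jx J_pos[OF x'] by (simp add: field_simps)
   then show ?thesis using True by (simp add: ennreal_leI)
  qed auto
 qed
 also have "\<dots> = ennreal ((1 + C0 * \<delta>) / J x * prob a)"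
  using Jx pd by (simp add: emeasure_eq_measure ennreal_mult'[symmetric] nn_integral_cmult_indicator)
 finally have "measure M (T ` a) \<le> (1 + C0 * \<delta>) / J x * prob a"
  using Jx pd by (subst (asm) ennreal_le_iff) auto
 with big_image[OF a] have "\<eta> \<le> (1 + C0 * \<delta>) / J x * prob a" by simp
 then have "J x \<le> Kw * prob a" using Jx \<eta>_pos by (simp add: Kw_def field_simps)
 then show ?thesis using True by (simp add: weight_def x_def)
next
 case False
 then show ?thesis using Kw_pos by (simp add: weight_def)
qed

text \<open>The error is relative to the weight at \<open>y'\<close>, so summing it over the
  branches produces an average again and not a divergent series.\<close>

lemma weight_diff:
 assumes "a \<in> \<alpha>" "b \<in> \<alpha>" "y \<in> b" "y' \<in> b"
 shows "\<bar>weight a y - weight a y'\<bar> \<le> C0 * d y y' * weight a y'"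
proof (cases "y \<in> T ` a")
 case True
 then have "y' \<in> T ` a" using image_saturated assms by blast
 then show ?thesis
  using True J_diff[OF assms(1), of "branch a y" "branch a y'"] branch_in[OF assms(1)]
  by (simp add: weight_def T_branch)
next
 case False
 then have "y' \<notin> T ` a" using image_saturated assms by blast
 then show ?thesis using False by (simp add: weight_def)
qed

text \<open>The number \<open>e a\<close> is meant to bound an observable on the element
  \<open>a\<close>. Since \<open>weight a y \<le> Kw * prob a\<close>, \<open>esum e\<close> acts as
  the norm of that observable: it bounds the transfer operator uniformly in the point.\<close>

definition admissible :: "('a set \<Rightarrow> real) \<Rightarrow> bool" where
 "admissible e \<longleftrightarrow> (\<forall>a\<in>\<alpha>. 0 \<le> e a) \<and> integrable cs (\<lambda>a. prob a * e a)"

definition esum :: "('a set \<Rightarrow> real) \<Rightarrow> real" where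
 "esum e = (LINT a|cs. prob a * e a)"

lemma esum_nonneg: "admissible e \<Longrightarrow> 0 \<le> esum e"
 unfolding esum_def admissible_def by (intro integral_nonneg_AE AE_I2) auto

lemma admissible_const: "0 \<le> c \<Longrightarrow> admissible (\<lambda>_. c)"
 unfolding admissible_def using integrable_prob_\<alpha> by auto

lemma esum_1: "esum (\<lambda>_. 1) = 1"
proof -
 have "ennreal (esum (\<lambda>_. 1)) = (\<integral>\<^sup>+a. ennreal (prob a) \<partial>cs)"
  unfolding esum_def using integrable_prob_\<alpha> by (subst nn_integral_eq_integral) auto
 also have "\<dots> = (\<integral>\<^sup>+a. emeasure M (space M \<inter> a) \<partial>cs)"
  by (intro nn_integral_cong) (simp add: emeasure_eq_measure sets_\<alpha> Int_absorb1 sets.sets_into_space)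
 also have "\<dots> = 1" using emeasure_\<alpha>_sum[of "space M"] emeasure_space_1 by simp
 finally show ?thesis by (simp add: ennreal_eq_1)
qed

lemma esum_const: "esum (\<lambda>_. c) = c"
 using esum_1 unfolding esum_def by simp

lemma esum_cmult: "esum (\<lambda>a. c * e a) = c * esum e"
 unfolding esum_def by (simp add: mult.left_commute[of _ c])

lemma admissible_cmult: "\<lbrakk>admissible e; 0 \<le> c\<rbrakk> \<Longrightarrow> admissible (\<lambda>a. c * e a)"
 unfolding admissible_def by (auto simp: mult.left_commute[of _ c])

lemma admissible_add: "\<lbrakk>admissible e; admissible e'\<rbrakk> \<Longrightarrow> admissible (\<lambda>a. e a + e' a)"
 unfolding admissible_def by (auto simp: algebra_simps)

lemma esum_add: "\<lbrakk>admissible e; admissible e'\<rbrakk> \<Longrightarrow> esum (\<lambda>a. e a + e' a) = esum e + esum e'"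
 unfolding admissible_def esum_def by (auto simp: algebra_simps)

lemma
 assumes e: "admissible e" and u: "\<And>a. \<lbrakk>a \<in> \<alpha>; y \<in> T ` a\<rbrakk> \<Longrightarrow> \<bar>u a\<bar> \<le> e a"
 shows integrable_weight: "integrable cs (\<lambda>a. weight a y * u a)" (is ?Q)
  and integral_weight_le: "\<bar>LINT a|cs. weight a y * u a\<bar> \<le> Kw * esum e" (is ?P)
proof -
 have b: "\<bar>weight a y * u a\<bar> \<le> Kw * (prob a * e a)" if a: "a \<in> \<alpha>" for a
 proof (cases "y \<in> T ` a")
  case True
  have "\<bar>weight a y * u a\<bar> \<le> (Kw * prob a) * e a"
   unfolding abs_mult using weight_nonneg[OF a] weight_le[OF a] u[OF a True] Kw_pos
   by (intro mult_mono) auto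
  then show ?thesis by simp
 next
  case False
  then show ?thesis using e a Kw_pos by (auto simp: weight_def admissible_def)
 qed
 have i: "integrable cs (\<lambda>a. Kw * (prob a * e a))"
  using e by (auto simp: admissible_def)
 show 1: ?Q
  by (rule int_dom[OF i])
    (use b e Kw_pos in \<open>auto simp: admissible_def AE_count_space abs_mult\<close>)
 have "\<bar>LINT a|cs. weight a y * u a\<bar> \<le> (LINT a|cs. \<bar>weight a y * u a\<bar>)"
  by (rule integral_abs_bound)
 also have "\<dots> \<le> (LINT a|cs. Kw * (prob a * e a))"
  by (rule integral_mono[OF integrable_abs[OF 1] i]) (use b in auto)
 also have "\<dots> = Kw * esum e" by (simp add: esum_def)
 finally show ?P .
qed

section \<open>The set of full measure on which \<open>\<L> 1 = 1\<close> exactly\<close>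

lemma null_image:
 assumes E: "E \<in> null_sets M"
 shows "T ` E \<in> null_sets M"
proof -
 have "T ` (E \<inter> a) \<in> null_sets M" if a: "a \<in> \<alpha>" for a
 proof -
  have Ea: "E \<inter> a \<in> null_sets M" using E sets_\<alpha>[OF a] by (rule null_set_Int2)
  have "emeasure M (T ` (E \<inter> a)) = (\<integral>\<^sup>+x\<in>E \<inter> a. ennreal (1 / J x) \<partial>M)"
   using Ea by (intro emeasure_image[OF a]) auto
  also have "\<dots> = 0" using Ea by (rule nn_integral_null_set)
  finally show ?thesis using image_sets[OF a, of "E \<inter> a"] Ea by auto
 qed
 then have "(\<Union>a\<in>\<alpha>. T ` (E \<inter> a)) \<in> null_sets M"
  by (intro null_sets_UN' \<alpha>_countable)
 moreover have "(\<Union>a\<in>\<alpha>. T ` (E \<inter> a)) = T ` E"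
  using sets.sets_into_space[OF null_setsD2[OF E]] ex_element by blast
 ultimately show ?thesis by simp
qed

lemma null_image_iter: "E \<in> null_sets M \<Longrightarrow> (T ^^ k) ` E \<in> null_sets M"
proof (induction k)
 case (Suc k)
 have "(T ^^ Suc k) ` E = T ` ((T ^^ k) ` E)" by auto
 then show ?case using null_image Suc by metis
qed auto

lemma transfer_1_meas [measurable]: "\<L> (\<lambda>_. 1) \<in> borel_measurable M"
 using integrable_transfer[of "\<lambda>_. 1" "\<lambda>_. 1"] by simp

text \<open>Testing against the sign \<open>g\<close> of \<open>\<L> 1 - 1\<close> gives
  \<open>\<integral> g \<L> 1 = \<integral> g \<circ> T = \<integral> g\<close> by duality and
  invariance, so \<open>|\<L> 1 - 1|\<close> has integral 0.\<close>

lemma transfer_1: "AE y in M. \<L> (\<lambda>_. 1) y = 1"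
proof -
 let ?g = "\<lambda>y. sgn (\<L> (\<lambda>_. 1) y - 1)"
 have b: "integrable M ?g"
  by (rule integrable_const_bound[where B=1]) (auto simp: sgn_if)
 have b': "integrable M (\<lambda>y. ?g (T y))" using integrable_T[OF b] .
 have i: "integrable M (\<lambda>y. ?g y * \<L> (\<lambda>_. 1) y)"
  using b' by (intro integrable_transfer) auto
 have "(LINT y|M. ?g y * \<L> (\<lambda>_. 1) y) = (LINT y|M. ?g (T y))"
  using b' by (subst integral_transfer) auto
 also have "\<dots> = (LINT y|M. ?g y)" by (rule integral_T) auto
 finally have "(LINT y|M. ?g y * \<L> (\<lambda>_. 1) y - ?g y) = 0"
  using b i by simp
 moreover have "?g y * \<L> (\<lambda>_. 1) y - ?g y = \<bar>\<L> (\<lambda>_. 1) y - 1\<bar>" for y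
  by (auto simp: sgn_if)
 ultimately have z: "(LINT y|M. \<bar>\<L> (\<lambda>_. 1) y - 1\<bar>) = 0" by simp
 have "integrable M (\<lambda>y. \<L> (\<lambda>_. 1) y)"
  using integrable_transfer[of "\<lambda>_. 1" "\<lambda>_. 1"] by simp
 then have "AE y in M. \<bar>\<L> (\<lambda>_. 1) y - 1\<bar> = 0"
  using z by (subst (asm) integral_nonneg_eq_0_iff_AE) auto
 then show ?thesis by auto
qed

text \<open>All forward images of the null set where \<open>\<L> 1\<close> differs from 1; it is
  null because \<open>T\<close> maps null sets to null sets. Saturating forward first makes
  \<open>G\<close>, the points whose orbits avoid \<open>bad\<close>, closed under preimages as well
  as images, so that \<open>\<L> u\<close> on \<open>G\<close> only sees \<open>u\<close> on
  \<open>G\<close>.\<close>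

definition bad :: "'a set" where
 "bad = (\<Union>k. (T ^^ k) ` {y \<in> space M. \<L> (\<lambda>_. 1) y \<noteq> 1})"

definition G :: "'a set" where
 "G = {x \<in> space M. \<forall>k. (T ^^ k) x \<notin> bad}"

lemma bad_null: "bad \<in> null_sets M"
proof -
 have "{y \<in> space M. \<L> (\<lambda>_. 1) y \<noteq> 1} \<in> null_sets M"
  using transfer_1 by (subst (asm) AE_iff_null) auto
 then show ?thesis unfolding bad_def using null_image_iter by (intro null_sets_UN) auto
qed

lemma iter_meas [measurable]: "(T ^^ k) \<in> measurable M M"
 by (rule measurable_compose_n) (rule T_meas)

lemma AE_iter: "AE x in M. Q x \<Longrightarrow> AE x in M. Q ((T ^^ k) x)"
proof (induction k)
 case (Suc k)
 from AE_T[OF Suc.IH[OF Suc.prems]] show ?case by (simp add: funpow_swap1)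
qed auto

lemma G_sets [measurable]: "G \<in> sets M"
proof -
 have [measurable]: "bad \<in> sets M" using bad_null by auto
 show ?thesis unfolding G_def by measurable
qed

lemma AE_G: "AE x in M. x \<in> G"
proof -
 have "AE x in M. x \<notin> bad" by (rule AE_not_in[OF bad_null])
 from AE_iter[OF this] have "AE x in M. \<forall>k. (T ^^ k) x \<notin> bad" by (simp add: AE_all_countable)
 then show ?thesis by (auto simp: G_def)
qed

lemma G_space: "x \<in> G \<Longrightarrow> x \<in> space M" by (auto simp: G_def)

lemma T_G: "x \<in> G \<Longrightarrow> T x \<in> G"
proof -
 assume x: "x \<in> G"
 have "(T ^^ k) (T x) \<notin> bad" for k
  using x by (auto simp: G_def dest: spec[of _ "Suc k"] simp: funpow_swap1)
 then show ?thesis using x T_space by (auto simp: G_def)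
qed

lemma G_back: "\<lbrakk>x \<in> space M; T x \<in> G\<rbrakk> \<Longrightarrow> x \<in> G"
proof -
 assume x: "x \<in> space M" "T x \<in> G"
 have "T z \<in> bad" if "z \<in> bad" for z
 proof -
  from that obtain k y where "z = (T ^^ k) y" "y \<in> space M" "\<L> (\<lambda>_. 1) y \<noteq> 1"
   by (auto simp: bad_def)
  then have "T z = (T ^^ Suc k) y" "y \<in> space M" "\<L> (\<lambda>_. 1) y \<noteq> 1" by auto
  then show ?thesis unfolding bad_def by blast
 qed
 then have 0: "x \<notin> bad" using x by (auto simp: G_def dest: spec[of _ 0])
 have "(T ^^ k) x \<notin> bad" for k
 proof (cases k)
  case (Suc j)
  then show ?thesis using x by (auto simp: G_def funpow_swap1 dest: spec[of _ j])
 qed (use 0 in auto)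
 then show ?thesis using x by (auto simp: G_def)
qed

lemma transfer_1_G: "y \<in> G \<Longrightarrow> \<L> (\<lambda>_. 1) y = 1"
proof (rule ccontr)
 assume y: "y \<in> G" "\<L> (\<lambda>_. 1) y \<noteq> 1"
 then have "y = (T ^^ 0) y" "y \<in> space M" by (auto simp: G_def)
 then have "y \<in> bad" using y(2) unfolding bad_def by blast
 then show False using y(1) unfolding G_def by (auto dest: spec[of _ 0])
qed

lemma branch_G: "\<lbrakk>a \<in> \<alpha>; y \<in> G; y \<in> T ` a\<rbrakk> \<Longrightarrow> branch a y \<in> G"
 using G_back[of "branch a y"] T_branch branch_in in_space by auto

lemma transfer_cong:
 assumes "y \<in> G" "\<And>x. \<lbrakk>x \<in> G; T x = y\<rbrakk> \<Longrightarrow> u x = u' x"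
 shows "\<L> u y = \<L> u' y"
 unfolding \<L>_def
proof (intro int_cong refl)
 fix a assume "a \<in> space cs"
 then have a: "a \<in> \<alpha>" by simp
 show "weight a y * u (branch a y) = weight a y * u' (branch a y)"
 proof (cases "y \<in> T ` a")
  case True
  then show ?thesis using assms(2)[OF branch_G[OF a assms(1) True] T_branch[OF True]] by simp
 qed (simp add: weight_def)
qed

section \<open>Positivity and linearity of \<open>\<L>\<close> on the good set\<close>

definition bdd_on_G :: "('a \<Rightarrow> real) \<Rightarrow> bool" where
 "bdd_on_G u \<longleftrightarrow> (\<exists>c. \<forall>x\<in>G. \<bar>u x\<bar> \<le> c)"

lemma integrable_weight_bdd:
 assumes "bdd_on_G u" "y \<in> G"
 shows "integrable cs (\<lambda>a. weight a y * u (branch a y))"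
proof -
 obtain c where c: "\<forall>x\<in>G. \<bar>u x\<bar> \<le> c" using assms by (auto simp: bdd_on_G_def)
 then have "0 \<le> c" using assms(2) by force
 show ?thesis
  by (rule integrable_weight[OF admissible_const[OF \<open>0 \<le> c\<close>]]) (use c branch_G assms(2) in auto)
qed

lemma integral_weight_1: "y \<in> G \<Longrightarrow> (LINT a|cs. weight a y) = 1"
 using transfer_1_G by (simp add: \<L>_def)

lemma integrable_weight_1: "integrable cs (\<lambda>a. weight a y)"
 using integrable_weight[OF admissible_const[of 1], of y "\<lambda>_. 1"] by simp

lemma transfer_mono:
 assumes "bdd_on_G u" "bdd_on_G v" "y \<in> G" "\<And>x. x \<in> G \<Longrightarrow> T x = y \<Longrightarrow> u x \<le> v x"
 shows "\<L> u y \<le> \<L> v y"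
 unfolding \<L>_def
proof (intro integral_mono integrable_weight_bdd assms)
 fix a assume "a \<in> space cs"
 then have a: "a \<in> \<alpha>" by simp
 show "weight a y * u (branch a y) \<le> weight a y * v (branch a y)"
 proof (cases "y \<in> T ` a")
  case True
  then show ?thesis
   using assms(4)[OF branch_G[OF a assms(3) True] T_branch[OF True]] weight_nonneg[OF a]
   by (intro mult_left_mono)
 qed (simp add: weight_def)
qed

lemma transfer_add: "\<lbrakk>bdd_on_G u; bdd_on_G v; y \<in> G\<rbrakk> \<Longrightarrow> \<L> (\<lambda>x. u x + v x) y = \<L> u y + \<L> v y"
 unfolding \<L>_def using integrable_weight_bdd[of u y] integrable_weight_bdd[of v y]
 by (simp add: distrib_left)

lemma transfer_diff: "\<lbrakk>bdd_on_G u; bdd_on_G v; y \<in> G\<rbrakk> \<Longrightarrow> \<L> (\<lambda>x. u x - v x) y = \<L> u y - \<L> v y"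
 unfolding \<L>_def using integrable_weight_bdd[of u y] integrable_weight_bdd[of v y]
 by (simp add: right_diff_distrib)

lemma transfer_cmult: "\<L> (\<lambda>x. c * u x) y = c * \<L> u y"
 unfolding \<L>_def by (simp add: mult.left_commute[of _ c])

lemma transfer_const: "y \<in> G \<Longrightarrow> \<L> (\<lambda>x. c) y = c"
 using transfer_cmult[of c "\<lambda>_. 1" y] transfer_1_G by simp

lemma transfer_abs_le:
 assumes "y \<in> G" "\<And>x. x \<in> G \<Longrightarrow> \<bar>u x\<bar> \<le> c"
 shows "\<bar>\<L> u y\<bar> \<le> c"
proof -
 have b: "bdd_on_G u" "bdd_on_G (\<lambda>_. c)" "bdd_on_G (\<lambda>_. - c)" using assms(2) by (auto simp: bdd_on_G_def)
 have "\<L> u y \<le> \<L> (\<lambda>_. c) y"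
  by (rule transfer_mono) (use b assms in \<open>auto simp: abs_le_iff\<close>)
 moreover have "\<L> (\<lambda>_. - c) y \<le> \<L> u y"
  by (rule transfer_mono) (use b assms in \<open>auto simp: abs_le_iff minus_le_iff\<close>)
 ultimately show ?thesis using assms(1) by (simp add: transfer_const abs_le_iff)
qed

lemma transfer_abs: "\<lbrakk>bdd_on_G u; y \<in> G\<rbrakk> \<Longrightarrow> \<bar>\<L> u y\<bar> \<le> \<L> (\<lambda>x. \<bar>u x\<bar>) y"
proof -
 assume *: "bdd_on_G u" "y \<in> G"
 have b: "bdd_on_G (\<lambda>x. \<bar>u x\<bar>)" "bdd_on_G (\<lambda>x. - \<bar>u x\<bar>)" using * by (auto simp: bdd_on_G_def)
 have "\<L> u y \<le> \<L> (\<lambda>x. \<bar>u x\<bar>) y" by (rule transfer_mono) (use b * in auto)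
 moreover have "\<L> (\<lambda>x. - \<bar>u x\<bar>) y \<le> \<L> u y" by (rule transfer_mono) (use b * in auto)
 ultimately show ?thesis using transfer_cmult[of "-1" "\<lambda>x. \<bar>u x\<bar>" y] by (auto simp: abs_le_iff)
qed

section \<open>Two function classes: Lipschitz functions on elements, and regular
  observables\<close>

definition lip2 :: "real \<Rightarrow> real \<Rightarrow> ('a \<Rightarrow> real) \<Rightarrow> bool" where
 "lip2 s D v \<longleftrightarrow> rv v \<and> (\<forall>x\<in>G. \<bar>v x\<bar> \<le> s) \<and>
   (\<forall>b\<in>\<alpha>. \<forall>x\<in>b \<inter> G. \<forall>x'\<in>b \<inter> G. \<bar>v x - v x'\<bar> \<le> D * d x x')"

text \<open>The oscillation is measured by \<open>d (T x) (T x')\<close>, and only for images in a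
  common element. This is weaker than being Lipschitz on \<open>a\<close>, and it is stable under
  adding \<open>u - u \<circ> T\<close> with \<open>u\<close> Lipschitz on elements, as the
  martingale decomposition requires.\<close>

definition reg :: "('a set \<Rightarrow> real) \<Rightarrow> ('a \<Rightarrow> real) \<Rightarrow> bool" where
 "reg e \<psi> \<longleftrightarrow> rv \<psi> \<and> (\<forall>a\<in>\<alpha>. \<forall>x\<in>a \<inter> G. \<bar>\<psi> x\<bar> \<le> e a) \<and>
   (\<forall>a\<in>\<alpha>. \<forall>b\<in>\<alpha>. \<forall>x\<in>a \<inter> G. \<forall>x'\<in>a \<inter> G. T x \<in> b \<longrightarrow> T x' \<in> b \<longrightarrow>
    \<bar>\<psi> x - \<psi> x'\<bar> \<le> e a * d (T x) (T x'))"

lemma lip2_meas: "lip2 s D v \<Longrightarrow> rv v" by (simp add: lip2_def)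

lemma lip2_bdd: "lip2 s D v \<Longrightarrow> bdd_on_G v" by (auto simp: lip2_def bdd_on_G_def)

lemma lip2_integrable: "lip2 s D v \<Longrightarrow> integrable M v"
 by (rule integrable_const_bound[where B=s], rule AE_mp[OF AE_G AE_I2]) (auto simp: lip2_def)

lemma nn_integral_\<alpha>:
 assumes [measurable]: "h \<in> borel_measurable M"
 shows "(\<integral>\<^sup>+x. h x \<partial>M) = (\<integral>\<^sup>+a. (\<integral>\<^sup>+x\<in>a. h x \<partial>M) \<partial>cs)"
proof -
 have "(\<integral>\<^sup>+x. h x \<partial>M) = (\<integral>\<^sup>+x. h x * indicator (space M) x \<partial>M)"
  by (intro nn_integral_cong) auto
 also have "\<dots> = emeasure (density M h) (space M)" by (subst emeasure_density) auto
 also have "space M = (\<Union>a\<in>\<alpha>. a)" using ex_element in_space by blast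
 also have "emeasure (density M h) (\<Union>a\<in>\<alpha>. a) = (\<integral>\<^sup>+a. emeasure (density M h) a \<partial>cs)"
  using sets_\<alpha> \<alpha>_countable unique_element
  by (intro emeasure_UN_countable) (auto simp: disjoint_family_on_def)
 also have "\<dots> = (\<integral>\<^sup>+a. (\<integral>\<^sup>+x\<in>a. h x \<partial>M) \<partial>cs)"
  using sets_\<alpha> by (intro nn_integral_cong emeasure_density) auto
 finally show ?thesis .
qed

lemma integrable_majorant:
 assumes [measurable]: "rv \<psi>" and e: "admissible e"
  and b: "\<And>a x. \<lbrakk>a \<in> \<alpha>; x \<in> a; x \<in> G\<rbrakk> \<Longrightarrow> \<bar>\<psi> x\<bar> \<le> e a"
 shows "integrable M \<psi>" "(LINT x|M. \<bar>\<psi> x\<bar>) \<le> esum e" (is ?P)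
proof -
 have "(\<integral>\<^sup>+x. ennreal \<bar>\<psi> x\<bar> \<partial>M) = (\<integral>\<^sup>+a. (\<integral>\<^sup>+x\<in>a. ennreal \<bar>\<psi> x\<bar> \<partial>M) \<partial>cs)"
  by (rule nn_integral_\<alpha>) auto
 also have "\<dots> \<le> (\<integral>\<^sup>+a. ennreal (prob a * e a) \<partial>cs)"
 proof (intro nn_integral_mono)
  fix a assume "a \<in> space cs"
  then have a: "a \<in> \<alpha>" by simp
  have "(\<integral>\<^sup>+x\<in>a. ennreal \<bar>\<psi> x\<bar> \<partial>M) \<le> (\<integral>\<^sup>+x. ennreal (e a) * indicator a x \<partial>M)"
   by (intro nn_integral_mono_AE AE_mp[OF AE_G AE_I2]) (auto simp: indicator_def b[OF a] ennreal_leI)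
  also have "\<dots> = ennreal (prob a * e a)"
   using sets_\<alpha>[OF a] e a
   by (simp add: nn_integral_cmult_indicator emeasure_eq_measure ennreal_mult'[symmetric] admissible_def mult.commute)
  finally show "(\<integral>\<^sup>+x\<in>a. ennreal \<bar>\<psi> x\<bar> \<partial>M) \<le> ennreal (prob a * e a)" .
 qed
 also have "\<dots> = ennreal (esum e)"
  unfolding esum_def using e by (intro nn_integral_eq_integral) (auto simp: admissible_def AE_count_space)
 finally have *: "(\<integral>\<^sup>+x. ennreal \<bar>\<psi> x\<bar> \<partial>M) \<le> ennreal (esum e)" .
 then show i: "integrable M \<psi>"
  by (intro integrableI_bounded) (auto simp: le_less_trans)
 have "ennreal (LINT x|M. \<bar>\<psi> x\<bar>) \<le> ennreal (esum e)"
  using * i by (subst (asm) nn_integral_eq_integral) auto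
 then show ?P using esum_nonneg[OF e] by simp
qed

lemma reg_meas: "reg e \<psi> \<Longrightarrow> rv \<psi>" by (simp add: reg_def)

lemma reg_bound: "\<lbrakk>reg e \<psi>; a \<in> \<alpha>; x \<in> a; x \<in> G\<rbrakk> \<Longrightarrow> \<bar>\<psi> x\<bar> \<le> e a"
 unfolding reg_def by blast

lemma reg_integrable: "\<lbrakk>reg e \<psi>; admissible e\<rbrakk> \<Longrightarrow> integrable M \<psi>"
 by (rule integrable_majorant(1)) (auto simp: reg_def)

lemma reg_integral_abs: "\<lbrakk>reg e \<psi>; admissible e\<rbrakk> \<Longrightarrow> (LINT x|M. \<bar>\<psi> x\<bar>) \<le> esum e"
 by (rule integrable_majorant(2)) (auto simp: reg_def)

lemma integrable_transfer':
 assumes "integrable M u"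
 shows "integrable M (\<L> u)" "(LINT y|M. \<L> u y) = (LINT x|M. u x)"
 using integrable_transfer[of u "\<lambda>_. 1"] integral_transfer[of u "\<lambda>_. 1"] assms by auto

text \<open>Branches at \<open>y\<close> and \<open>y'\<close> are paired by
  \<open>image_saturated\<close>. The difference of two paired terms splits into a change of weight
  times the value of \<open>u\<close>, controlled by \<open>weight_diff\<close>, and a weight times
  the change from \<open>u\<close> to \<open>u'\<close>.\<close>

lemma transfer_Lipschitz:
 assumes b: "b \<in> \<alpha>" "y \<in> b" "y' \<in> b" "y \<in> G" "y' \<in> G"
  and e: "admissible e"
  and u: "\<And>a x. \<lbrakk>a \<in> \<alpha>; x \<in> a; x \<in> G; T x = y\<rbrakk> \<Longrightarrow> \<bar>u x\<bar> \<le> e a"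
  and u': "\<And>a x'. \<lbrakk>a \<in> \<alpha>; x' \<in> a; x' \<in> G; T x' = y'\<rbrakk> \<Longrightarrow> \<bar>u' x'\<bar> \<le> e a"
  and \<Delta>: "admissible \<Delta>"
  and diff: "\<And>a x x'. \<lbrakk>a \<in> \<alpha>; x \<in> a; x' \<in> a; x \<in> G; x' \<in> G; T x = y; T x' = y'\<rbrakk> \<Longrightarrow> \<bar>u x - u' x'\<bar> \<le> \<Delta> a"
 shows "\<bar>\<L> u y - \<L> u' y'\<bar> \<le>
   C0 * d y y' * (LINT a|cs. weight a y' * e a) + (LINT a|cs. weight a y' * \<Delta> a)"
proof -
 have i1: "integrable cs (\<lambda>a. weight a y * u (branch a y))"
  by (rule integrable_weight[OF e]) (use u branch_in branch_G T_branch b in auto)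
 have i2: "integrable cs (\<lambda>a. weight a y' * u' (branch a y'))"
  by (rule integrable_weight[OF e]) (use u' branch_in branch_G T_branch b in auto)
 have i3: "integrable cs (\<lambda>a. weight a y' * e a)"
  by (rule integrable_weight[OF e]) (use e in \<open>auto simp: admissible_def\<close>)
 have i4: "integrable cs (\<lambda>a. weight a y' * \<Delta> a)"
  by (rule integrable_weight[OF \<Delta>]) (use \<Delta> in \<open>auto simp: admissible_def\<close>)
 have eq: "\<L> u y - \<L> u' y' =
   (LINT a|cs. weight a y * u (branch a y) - weight a y' * u' (branch a y'))"
  unfolding \<L>_def using i1 i2 by simp
 have "\<bar>\<L> u y - \<L> u' y'\<bar> \<le> (LINT a|cs. \<bar>weight a y * u (branch a y) - weight a y' * u' (branch a y')\<bar>)"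
  unfolding eq by (rule integral_abs_bound)
 also have "\<dots> \<le> (LINT a|cs. C0 * d y y' * (weight a y' * e a) + weight a y' * \<Delta> a)"
 proof (intro integral_mono)
  fix a assume "a \<in> space cs"
  then have a: "a \<in> \<alpha>" by simp
  show "\<bar>weight a y * u (branch a y) - weight a y' * u' (branch a y')\<bar>
    \<le> C0 * d y y' * (weight a y' * e a) + weight a y' * \<Delta> a"
  proof (cases "y \<in> T ` a")
   case True
   then have y': "y' \<in> T ` a" using image_saturated a b by blast
   have 1: "\<bar>u (branch a y)\<bar> \<le> e a"
    using u[OF a branch_in[OF a] branch_G[OF a b(4) True] T_branch[OF True]] .
   have 2: "\<bar>u (branch a y) - u' (branch a y')\<bar> \<le> \<Delta> a"
    using diff[OF a branch_in[OF a] branch_in[OF a] branch_G[OF a b(4) True]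
     branch_G[OF a b(5) y'] T_branch[OF True] T_branch[OF y']] .
   have "\<bar>weight a y * u (branch a y) - weight a y' * u' (branch a y')\<bar>
     = \<bar>(weight a y - weight a y') * u (branch a y) + weight a y' * (u (branch a y) - u' (branch a y'))\<bar>"
    by (simp add: algebra_simps)
   also have "\<dots> \<le> \<bar>weight a y - weight a y'\<bar> * \<bar>u (branch a y)\<bar> + weight a y' * \<bar>u (branch a y) - u' (branch a y')\<bar>"
    by (rule order_trans[OF abs_triangle_ineq]) (simp add: abs_mult weight_nonneg[OF a])
   also have "\<dots> \<le> (C0 * d y y' * weight a y') * e a + weight a y' * \<Delta> a"
    using weight_diff[OF a b(1-3)] 1 2 weight_nonneg[OF a] C0_nonneg d_nonneg
    by (intro add_mono mult_mono mult_left_mono) auto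
   finally show ?thesis by (simp add: mult.assoc)
  next
   case False
   then have "y' \<notin> T ` a" using image_saturated a b by blast
   then show ?thesis using False by (simp add: weight_def)
  qed
 qed (use i1 i2 i3 i4 in auto)
 also have "\<dots> = C0 * d y y' * (LINT a|cs. weight a y' * e a) + (LINT a|cs. weight a y' * \<Delta> a)"
  using i3 i4 by simp
 finally show ?thesis .
qed

text \<open>One application of \<open>\<L>\<close> smooths: an observable that may be unbounded
  across elements becomes bounded and Lipschitz, because averages of \<open>e\<close> over the
  branches are at most \<open>Kw * esum e\<close>.\<close>

lemma transfer_reg:
 assumes r: "reg e \<psi>" and e: "admissible e"
 shows "lip2 (Kw * esum e) ((1 + C0) * Kw * esum e) (\<L> \<psi>)"
 unfolding lip2_def
proof (intro conjI ballI)
 show "\<L> \<psi> \<in> borel_measurable M" using integrable_transfer'(1)[OF reg_integrable[OF r e]] by auto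
 show "\<bar>\<L> \<psi> y\<bar> \<le> Kw * esum e" if y: "y \<in> G" for y
  unfolding \<L>_def
  by (rule integral_weight_le[OF e]) (rule reg_bound[OF r _ branch_in branch_G[OF _ y]])
 fix b y y' assume b: "b \<in> \<alpha>" and y: "y \<in> b \<inter> G" and y': "y' \<in> b \<inter> G"
 have ad: "admissible (\<lambda>a. d y y' * e a)" by (rule admissible_cmult[OF e d_nonneg])
 have "\<bar>\<L> \<psi> y - \<L> \<psi> y'\<bar> \<le>
   C0 * d y y' * (LINT a|cs. weight a y' * e a) + (LINT a|cs. weight a y' * (d y y' * e a))"
 proof (rule transfer_Lipschitz[OF b _ _ _ _ e _ _ ad])
  fix a x x' assume a: "a \<in> \<alpha>" "x \<in> a" "x' \<in> a" "x \<in> G" "x' \<in> G" "T x = y" "T x' = y'"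
  then have "\<bar>\<psi> x - \<psi> x'\<bar> \<le> e a * d (T x) (T x')"
   using r b y y' unfolding reg_def by blast
  then show "\<bar>\<psi> x - \<psi> x'\<bar> \<le> d y y' * e a" using a by (simp add: mult.commute)
 qed (use reg_bound[OF r] y y' in auto)
 also have "\<dots> = (1 + C0) * d y y' * (LINT a|cs. weight a y' * e a)"
 proof -
  have "(LINT a|cs. weight a y' * (d y y' * e a)) = d y y' * (LINT a|cs. weight a y' * e a)"
   by (subst integral_mult_right_zero[symmetric]) (simp only: mult.left_commute)
  then show ?thesis by (simp add: algebra_simps)
 qed
 also have "\<dots> \<le> (1 + C0) * d y y' * (Kw * esum e)"
  using integral_weight_le[OF e, of y' e] e C0_nonneg d_nonneg
  by (intro mult_left_mono) (auto simp: admissible_def abs_le_iff)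
 finally show "\<bar>\<L> \<psi> y - \<L> \<psi> y'\<bar> \<le> (1 + C0) * Kw * esum e * d y y'"
  by (simp add: ac_simps)
qed

text \<open>A Lasota-Yorke (Doeblin-Fortet) inequality: inverse branches contract by
  \<open>\<kappa>\<close>, and the variation of the weights contributes
  \<open>C0 * s\<close>.\<close>

lemma transfer_lip2:
 assumes v: "lip2 s D v" and s: "s \<ge> 0" "D \<ge> 0"
 shows "lip2 s (D / \<kappa> + C0 * s) (\<L> v)"
 unfolding lip2_def
proof (intro conjI ballI)
 show "\<L> v \<in> borel_measurable M" using integrable_transfer'(1)[OF lip2_integrable[OF v]] by auto
 show "\<bar>\<L> v y\<bar> \<le> s" if y: "y \<in> G" for y
  by (rule transfer_abs_le[OF y]) (use v in \<open>auto simp: lip2_def\<close>)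
 fix b y y' assume b: "b \<in> \<alpha>" and y: "y \<in> b \<inter> G" and y': "y' \<in> b \<inter> G"
 have k: "0 \<le> D * d y y' / \<kappa>" using s d_nonneg \<kappa>_gt_1 by auto
 have "\<bar>\<L> v y - \<L> v y'\<bar> \<le>
   C0 * d y y' * (LINT a|cs. weight a y' * s) + (LINT a|cs. weight a y' * (D * d y y' / \<kappa>))"
 proof (rule transfer_Lipschitz[OF b _ _ _ _ admissible_const _ _ admissible_const])
  fix a x x' assume a: "a \<in> \<alpha>" "x \<in> a" "x' \<in> a" "x \<in> G" "x' \<in> G" "T x = y" "T x' = y'"
  have "\<bar>v x - v x'\<bar> \<le> D * d x x'" using v a by (auto simp: lip2_def)
  also have "\<dots> \<le> D * (d y y' / \<kappa>)"
   using expanding'[OF a(1-3)] a s by (intro mult_left_mono) auto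
  finally show "\<bar>v x - v x'\<bar> \<le> D * d y y' / \<kappa>" by simp
 qed (use v y y' s k in \<open>auto simp: lip2_def\<close>)
 also have "\<dots> = (D / \<kappa> + C0 * s) * d y y'"
  using integral_weight_1[of y'] y' by (simp add: algebra_simps)
 finally show "\<bar>\<L> v y - \<L> v y'\<bar> \<le> (D / \<kappa> + C0 * s) * d y y'" .
qed

section \<open>Iterates and compactness\<close>

lemma bdd_on_GI: "(\<And>x. x \<in> G \<Longrightarrow> \<bar>u x\<bar> \<le> c) \<Longrightarrow> bdd_on_G u"
 by (auto simp: bdd_on_G_def)

lemma bdd_on_G_const: "bdd_on_G (\<lambda>_. c)"
 by (auto simp: bdd_on_G_def)

lemma bdd_on_G_add: "\<lbrakk>bdd_on_G u; bdd_on_G v\<rbrakk> \<Longrightarrow> bdd_on_G (\<lambda>x. u x + v x)"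
proof -
 assume "bdd_on_G u" "bdd_on_G v"
 then obtain c c' where "\<forall>x\<in>G. \<bar>u x\<bar> \<le> c" "\<forall>x\<in>G. \<bar>v x\<bar> \<le> c'" by (auto simp: bdd_on_G_def)
 then show ?thesis by (intro bdd_on_GI[where c="c + c'"]) (meson abs_triangle_ineq add_mono order_trans)
qed

lemma lip2_mono: "\<lbrakk>lip2 s D v; s \<le> s'; D \<le> D'\<rbrakk> \<Longrightarrow> lip2 s' D' v"
 unfolding lip2_def by (meson d_nonneg mult_right_mono order_trans)

lemma transfer_iter_bdd: "bdd_on_G u \<Longrightarrow> bdd_on_G ((\<L> ^^ k) u)"
proof (induction k)
 case (Suc k)
 then obtain c where "\<forall>x\<in>G. \<bar>(\<L> ^^ k) u x\<bar> \<le> c" by (auto simp: bdd_on_G_def)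
 then show ?case by (intro bdd_on_GI[where c=c]) (simp add: transfer_abs_le)
qed auto

lemma transfer_iter_nonneg: "\<lbrakk>bdd_on_G u; \<And>x. x \<in> G \<Longrightarrow> 0 \<le> u x; y \<in> G\<rbrakk> \<Longrightarrow> 0 \<le> (\<L> ^^ k) u y"
proof (induction k arbitrary: y)
 case (Suc k)
 have "\<L> (\<lambda>_. 0) y \<le> \<L> ((\<L> ^^ k) u) y"
  by (rule transfer_mono[OF bdd_on_G_const transfer_iter_bdd]) (use Suc in auto)
 then show ?case using transfer_const[OF \<open>y \<in> G\<close>, of 0] by simp
qed auto

lemma transfer_iter_abs: "\<lbrakk>bdd_on_G u; y \<in> G\<rbrakk> \<Longrightarrow> \<bar>(\<L> ^^ k) u y\<bar> \<le> (\<L> ^^ k) (\<lambda>x. \<bar>u x\<bar>) y"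
proof (induction k arbitrary: y)
 case (Suc k)
 have b: "bdd_on_G (\<lambda>x. \<bar>u x\<bar>)" using Suc.prems by (auto simp: bdd_on_G_def)
 have b2: "bdd_on_G (\<lambda>x. \<bar>(\<L> ^^ k) u x\<bar>)"
  using transfer_iter_bdd[OF Suc.prems(1), of k] by (auto simp: bdd_on_G_def)
 have "\<bar>\<L> ((\<L> ^^ k) u) y\<bar> \<le> \<L> (\<lambda>x. \<bar>(\<L> ^^ k) u x\<bar>) y"
  by (rule transfer_abs[OF transfer_iter_bdd[OF Suc.prems(1)] Suc.prems(2)])
 also have "\<dots> \<le> \<L> ((\<L> ^^ k) (\<lambda>x. \<bar>u x\<bar>)) y"
  by (rule transfer_mono[OF b2 transfer_iter_bdd[OF b] Suc.prems(2)]) (rule Suc.IH[OF Suc.prems(1)])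
 finally show ?case by simp
qed auto

section \<open>Bounds for the iterates of \<open>\<L>\<close> that are uniform in the number of
  steps\<close>

lemma \<kappa>_inv: "0 < 1 / \<kappa>" "1 / \<kappa> < 1" "0 < 1 - 1 / \<kappa>"
 using \<kappa>_gt_1 by auto

lemma transfer_iter_lip2:
 assumes v: "lip2 s D v" and s: "0 \<le> s" and D: "0 \<le> D"
 shows "lip2 s (D + C0 * s / (1 - 1 / \<kappa>)) ((\<L> ^^ k) v)"
proof (induction k)
 case 0
 have "0 \<le> C0 * s / (1 - 1 / \<kappa>)" using \<kappa>_inv C0_nonneg s by (intro divide_nonneg_pos) auto
 then show ?case using lip2_mono[OF v] by simp
next
 case (Suc k)
 have n: "0 \<le> C0 * s / (1 - 1 / \<kappa>)" using \<kappa>_inv C0_nonneg s by (intro divide_nonneg_pos) auto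
 have "lip2 s ((D + C0 * s / (1 - 1 / \<kappa>)) / \<kappa> + C0 * s) (\<L> ((\<L> ^^ k) v))"
  by (rule transfer_lip2[OF Suc.IH s]) (use n D in auto)
 moreover have "(D + C0 * s / (1 - 1 / \<kappa>)) / \<kappa> + C0 * s = D / \<kappa> + C0 * s / (1 - 1 / \<kappa>)"
  using \<kappa>_gt_1 by (simp add: field_simps)
 moreover have "D / \<kappa> \<le> D" using D \<kappa>_gt_1 by (simp add: divide_le_eq mult_le_cancel_left1)
 ultimately have l: "lip2 s (D / \<kappa> + C0 * s / (1 - 1 / \<kappa>)) (\<L> ((\<L> ^^ k) v))"
  and le: "D / \<kappa> + C0 * s / (1 - 1 / \<kappa>) \<le> D + C0 * s / (1 - 1 / \<kappa>)" by simp_all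
 show ?case using lip2_mono[OF l order_refl le] by simp
qed

lemma transfer_iter_integral:
 assumes "integrable M u"
 shows "integrable M ((\<L> ^^ k) u)" "(LINT x|M. (\<L> ^^ k) u x) = (LINT x|M. u x)"
proof (induction k)
 case (Suc k)
 { case 1 show ?case using integrable_transfer'(1)[OF Suc(1)] by simp }
 { case 2 show ?case using integrable_transfer'(2)[OF Suc(1)] Suc(2) by simp }
qed (use assms in auto)

text \<open>The fixed point of \<open>C \<mapsto> C0 + C / \<kappa>\<close>: distances shrink
  geometrically along inverse branches, so the distortion accumulated over any number of steps is
  bounded by this constant.\<close>

definition C1 :: real where "C1 = C0 / (1 - 1 / \<kappa>)"

lemma C1_nonneg: "0 \<le> C1" unfolding C1_def using C0_nonneg \<kappa>_inv by (intro divide_nonneg_pos) auto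

lemma C1_eq: "C0 + C1 / \<kappa> = C1"
 unfolding C1_def using \<kappa>_gt_1 by (simp add: field_simps)

text \<open>For nonnegative \<open>u\<close> the iterates are log-Lipschitz with constant
  \<open>C1\<close>, up to the variation of \<open>u\<close> itself, which is
  \<open>D * d y y' / \<kappa> ^ k\<close> after \<open>k\<close> contractions. In the induction the
  weight contributes \<open>exp (C0 * d y y')\<close> and the hypothesis
  \<open>exp (C1 * d y y' / \<kappa>)\<close>; \<open>C1_eq\<close> closes the product.\<close>

lemma transfer_iter_distortion:
 assumes u: "lip2 s D u" and pos: "\<And>x. x \<in> G \<Longrightarrow> 0 \<le> u x" and D: "0 \<le> D"
  and b: "b \<in> \<alpha>" "y \<in> b" "y' \<in> b" "y \<in> G" "y' \<in> G"
 shows "(\<L> ^^ k) u y \<le> exp (C1 * d y y') * ((\<L> ^^ k) u y' + D * d y y' / \<kappa> ^ k)"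
 using b
proof (induction k arbitrary: b y y')
 case 0
 have "\<bar>u y - u y'\<bar> \<le> D * d y y'" using u 0 unfolding lip2_def by blast
 then have 1: "u y \<le> u y' + D * d y y'" by simp
 have "1 * (u y' + D * d y y') \<le> exp (C1 * d y y') * (u y' + D * d y y')"
  using pos[OF 0(5)] D d_nonneg C1_nonneg by (intro mult_right_mono) auto
 then show ?case using 1 by simp
next
 case (Suc k)
 let ?v = "(\<L> ^^ k) u" and ?q = "D * d y y' / \<kappa> ^ Suc k"
 note bu = lip2_bdd[OF u]
 have bv: "bdd_on_G ?v" by (rule transfer_iter_bdd[OF bu])
 then have bv': "bdd_on_G (\<lambda>x. ?v x + ?q)" by (rule bdd_on_G_add[OF _ bdd_on_G_const])
 have vpos: "0 \<le> ?v x" if "x \<in> G" for x using transfer_iter_nonneg[OF bu pos that] .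
 have q: "0 \<le> ?q" using D d_nonneg \<kappa>_gt_1 by (intro divide_nonneg_pos mult_nonneg_nonneg) auto
 have "\<L> ?v y \<le> (LINT a|cs. exp (C1 * d y y') * (weight a y' * (?v (branch a y') + ?q)))"
  unfolding \<L>_def[of ?v y]
 proof (intro integral_mono)
  fix a assume "a \<in> space cs"
  then have a: "a \<in> \<alpha>" by simp
  show "weight a y * ?v (branch a y) \<le> exp (C1 * d y y') * (weight a y' * (?v (branch a y') + ?q))"
  proof (cases "y \<in> T ` a")
   case True
   then have y': "y' \<in> T ` a" using image_saturated a Suc.prems by blast
   let ?x = "branch a y" and ?x' = "branch a y'"
   have x: "?x \<in> a" "?x' \<in> a" "?x \<in> G" "?x' \<in> G"
    using branch_in[OF a] branch_G[OF a] True y' Suc.prems by auto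
   have dx: "d ?x ?x' \<le> d y y' / \<kappa>"
    using expanding'[OF a x(1,2)] True y' by (simp add: T_branch)
   have w: "weight a y \<le> exp (C0 * d y y') * weight a y'"
   proof -
    have "weight a y \<le> (1 + C0 * d y y') * weight a y'"
     using weight_diff[OF a Suc.prems(1-3)] by (simp add: algebra_simps abs_le_iff)
    also have "\<dots> \<le> exp (C0 * d y y') * weight a y'"
     using weight_nonneg[OF a] by (intro mult_right_mono exp_ge_add_one_self) auto
    finally show ?thesis .
   qed
   let ?A = "d y y' / \<kappa>"
   have "?v ?x \<le> exp (C1 * d ?x ?x') * (?v ?x' + D * d ?x ?x' / \<kappa> ^ k)"
    by (rule Suc.IH[OF a x])
   also have "\<dots> \<le> exp (C1 * ?A) * (?v ?x' + D * ?A / \<kappa> ^ k)"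
   proof (rule mult_mono)
    show "exp (C1 * d ?x ?x') \<le> exp (C1 * ?A)"
     using mult_left_mono[OF dx C1_nonneg] by simp
    show "?v ?x' + D * d ?x ?x' / \<kappa> ^ k \<le> ?v ?x' + D * ?A / \<kappa> ^ k"
     using dx D \<kappa>_gt_1 by (intro add_left_mono divide_right_mono mult_left_mono) auto
    show "0 \<le> ?v ?x' + D * d ?x ?x' / \<kappa> ^ k"
     using vpos[OF x(4)] D d_nonneg \<kappa>_gt_1 by auto
   qed simp
   finally have v: "?v ?x \<le> exp (C1 * ?A) * (?v ?x' + ?q)" by simp
   have "weight a y * ?v ?x \<le> (exp (C0 * d y y') * weight a y') * (exp (C1 * ?A) * (?v ?x' + ?q))"
    using w v weight_nonneg[OF a] vpos[OF x(3)] by (intro mult_mono) auto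
   also have "\<dots> = exp (C0 * d y y' + C1 * ?A) * (weight a y' * (?v ?x' + ?q))"
    by (simp add: exp_add)
   also have "C0 * d y y' + C1 * ?A = (C0 + C1 / \<kappa>) * d y y'"
    by (simp add: algebra_simps)
   finally show ?thesis unfolding C1_eq .
  next
   case False
   then have "y' \<notin> T ` a" using image_saturated a Suc.prems by blast
   then show ?thesis using False by (simp add: weight_def)
  qed
 qed (use integrable_weight_bdd[OF bv] integrable_weight_bdd[OF bv'] Suc.prems in auto)
 also have "\<dots> = exp (C1 * d y y') * \<L> (\<lambda>x. ?v x + ?q) y'"
  unfolding \<L>_def[of "\<lambda>x. ?v x + ?q" y'] by (rule integral_mult_right_zero)
 also have "\<L> (\<lambda>x. ?v x + ?q) y' = \<L> ?v y' + ?q"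
  using transfer_add[OF bv, of "\<lambda>_. ?q" y'] transfer_const Suc.prems by (auto simp: bdd_on_G_def)
 finally show ?case by simp
qed

definition K3 :: real where "K3 = exp (C1 * \<delta>)"

lemma K3_pos: "0 < K3" by (simp add: K3_def)

text \<open>A bound of the supremum by the mean. By distortion the value at
  \<open>branch a y\<close> is at most \<open>K3\<close> times any value on \<open>a\<close>, up to
  the error term, and \<open>weight a y \<le> Kw * prob a\<close> turns this into an integral over
  \<open>a\<close>; the sum over \<open>a\<close> is the integral of \<open>u\<close>. Smallness in
  mean thus becomes uniform smallness.\<close>

lemma transfer_iter_sup:
 assumes u: "lip2 s D u" and pos: "\<And>x. x \<in> G \<Longrightarrow> 0 \<le> u x" and D: "0 \<le> D" and y: "y \<in> G"
 shows "(\<L> ^^ Suc k) u y \<le> Kw * K3 * ((LINT x|M. u x) + D * \<delta> / \<kappa> ^ k)"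
proof -
 let ?v = "(\<L> ^^ k) u" and ?q = "D * \<delta> / \<kappa> ^ k"
 note bu = lip2_bdd[OF u]
 have bv: "bdd_on_G ?v" by (rule transfer_iter_bdd[OF bu])
 have iv: "integrable M ?v" "(LINT x|M. ?v x) = (LINT x|M. u x)"
  using transfer_iter_integral[OF lip2_integrable[OF u]] by auto
 then have mv[measurable]: "?v \<in> borel_measurable M" by auto
 have vpos: "0 \<le> ?v x" if "x \<in> G" for x using transfer_iter_nonneg[OF bu pos that] .
 have q: "0 \<le> ?q" using D \<delta>_pos \<kappa>_gt_1 by (intro divide_nonneg_pos mult_nonneg_nonneg) auto
 have le: "ennreal (weight a y * ?v (branch a y)) \<le> ennreal (Kw * K3) * (\<integral>\<^sup>+x\<in>a. ennreal (?v x + ?q) \<partial>M)" if a: "a \<in> \<alpha>" for a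
 proof (cases "y \<in> T ` a")
  case True
  let ?x = "branch a y"
  have [measurable]: "a \<in> sets M" using sets_\<alpha>[OF a] .
  have x: "?x \<in> a" "?x \<in> G" using branch_in[OF a] branch_G[OF a y True] by auto
  have 1: "?v ?x \<le> K3 * (?v x' + ?q)" if x': "x' \<in> a" "x' \<in> G" for x'
  proof -
   have dle: "d ?x x' \<le> \<delta>" using d_bound G_space x x' by auto
   have "?v ?x \<le> exp (C1 * d ?x x') * (?v x' + D * d ?x x' / \<kappa> ^ k)"
    by (rule transfer_iter_distortion[OF u pos D a x(1) x'(1) x(2) x'(2)])
   also have "\<dots> \<le> exp (C1 * \<delta>) * (?v x' + D * \<delta> / \<kappa> ^ k)"
    using dle C1_nonneg D \<kappa>_gt_1 vpos[OF x'(2)] d_nonneg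
    by (intro mult_mono add_left_mono divide_right_mono mult_left_mono)
      (auto intro!: mult_left_mono add_nonneg_nonneg)
   finally show ?thesis by (simp add: K3_def)
  qed
  have "weight a y * ?v ?x \<le> (Kw * prob a) * ?v ?x"
   by (rule mult_right_mono[OF weight_le[OF a] vpos[OF x(2)]])
  then have "ennreal (weight a y * ?v ?x) \<le> ennreal (Kw * (prob a * ?v ?x))"
   by (simp add: ennreal_leI mult.assoc)
  also have "\<dots> = ennreal Kw * (\<integral>\<^sup>+x'. ennreal (?v ?x) * indicator a x' \<partial>M)"
   using Kw_pos vpos[OF x(2)]
   by (subst nn_integral_cmult_indicator) (auto simp: emeasure_eq_measure ennreal_mult'[symmetric] mult.commute)
  also have "\<dots> \<le> ennreal Kw * (\<integral>\<^sup>+x'. ennreal K3 * (ennreal (?v x' + ?q) * indicator a x') \<partial>M)"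
   using K3_pos by (intro mult_left_mono nn_integral_mono_AE AE_mp[OF AE_G AE_I2])
     (auto simp: indicator_def ennreal_mult'[symmetric] intro!: ennreal_leI 1)
  also have "\<dots> = ennreal (Kw * K3) * (\<integral>\<^sup>+x\<in>a. ennreal (?v x + ?q) \<partial>M)"
   using Kw_pos K3_pos by (simp add: nn_integral_cmult ennreal_mult' mult.assoc)
  finally show ?thesis .
 qed (simp add: weight_def)
 have "ennreal (\<L> ?v y) = (\<integral>\<^sup>+a. ennreal (weight a y * ?v (branch a y)) \<partial>cs)"
  unfolding \<L>_def[of ?v y]
 proof (rule nn_integral_eq_integral[symmetric, OF integrable_weight_bdd[OF bv y]])
  have "0 \<le> weight a y * ?v (branch a y)" if a: "a \<in> \<alpha>" for a
  proof (cases "y \<in> T ` a")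
   case True
   then show ?thesis using weight_nonneg[OF a] vpos[OF branch_G[OF a y True]] by auto
  qed (simp add: weight_def)
  then show "AE a in cs. 0 \<le> weight a y * ?v (branch a y)" by (auto simp: AE_count_space)
 qed
 also have "\<dots> \<le> (\<integral>\<^sup>+a. ennreal (Kw * K3) * (\<integral>\<^sup>+x\<in>a. ennreal (?v x + ?q) \<partial>M) \<partial>cs)"
  using le by (intro nn_integral_mono) auto
 also have "\<dots> = ennreal (Kw * K3) * (\<integral>\<^sup>+x. ennreal (?v x + ?q) \<partial>M)"
  by (subst nn_integral_cmult) (auto simp: nn_integral_\<alpha>[symmetric])
 also have "(\<integral>\<^sup>+x. ennreal (?v x + ?q) \<partial>M) = ennreal (LINT x|M. ?v x + ?q)"
  using iv q by (intro nn_integral_eq_integral AE_mp[OF AE_G AE_I2]) (auto simp: vpos)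
 also have "(LINT x|M. ?v x + ?q) = (LINT x|M. u x) + ?q" using iv prob_space by simp
 also have "ennreal (Kw * K3) * ennreal ((LINT x|M. u x) + ?q) = ennreal (Kw * K3 * ((LINT x|M. u x) + ?q))"
  using Kw_pos K3_pos by (simp add: ennreal_mult'[symmetric])
 finally have "ennreal (\<L> ?v y) \<le> ennreal (Kw * K3 * ((LINT x|M. u x) + ?q))" .
 moreover have "0 \<le> (LINT x|M. u x)"
  by (rule integral_nonneg_AE, rule AE_mp[OF AE_G AE_I2]) (use pos in auto)
 ultimately show ?thesis using Kw_pos K3_pos q by (subst (asm) ennreal_le_iff) auto
qed

section \<open>Cylinders and compactness\<close>

lemma d_iter:
 assumes "x \<in> space M" "x' \<in> space M" "\<And>i. i < k \<Longrightarrow> \<exists>a\<in>\<alpha>. (T ^^ i) x \<in> a \<and> (T ^^ i) x' \<in> a"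
 shows "d x x' \<le> d ((T ^^ k) x) ((T ^^ k) x') / \<kappa> ^ k"
 using assms(3)
proof (induction k)
 case (Suc k)
 then obtain a where a: "a \<in> \<alpha>" "(T ^^ k) x \<in> a" "(T ^^ k) x' \<in> a" by (meson lessI)
 have "d x x' \<le> d ((T ^^ k) x) ((T ^^ k) x') / \<kappa> ^ k" using Suc by auto
 also have "\<dots> \<le> (d ((T ^^ Suc k) x) ((T ^^ Suc k) x') / \<kappa>) / \<kappa> ^ k"
  using expanding'[OF a] \<kappa>_gt_1 by (intro divide_right_mono) auto
 finally show ?case by simp
qed auto

definition elem :: "'a \<Rightarrow> 'a set" where "elem x = (SOME a. a \<in> \<alpha> \<and> x \<in> a)"

lemma elem: "x \<in> space M \<Longrightarrow> elem x \<in> \<alpha> \<and> x \<in> elem x"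
 unfolding elem_def using ex_element by (intro someI_ex[of "\<lambda>a. a \<in> \<alpha> \<and> x \<in> a"]) auto

definition word :: "nat \<Rightarrow> 'a \<Rightarrow> 'a set list" where
 "word k x = map (\<lambda>i. elem ((T ^^ i) x)) [0..<k]"

lemma iter_space: "x \<in> space M \<Longrightarrow> (T ^^ k) x \<in> space M"
 using measurable_space[OF iter_meas] .

lemma word_eq_close:
 assumes "x \<in> space M" "x' \<in> space M" "word k x = word k x'"
 shows "d x x' \<le> \<delta> / \<kappa> ^ k" (is ?P) "0 < k \<Longrightarrow> \<exists>b\<in>\<alpha>. x \<in> b \<and> x' \<in> b"
proof -
 have e: "\<exists>a\<in>\<alpha>. (T ^^ i) x \<in> a \<and> (T ^^ i) x' \<in> a" if "i < k" for i
 proof -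
  have "word k x ! i = word k x' ! i" using assms by simp
  then have "elem ((T ^^ i) x) = elem ((T ^^ i) x')" using that by (simp add: word_def)
  then show ?thesis using elem[OF iter_space[OF assms(1)]] elem[OF iter_space[OF assms(2)]] by metis
 qed
 have "d x x' \<le> d ((T ^^ k) x) ((T ^^ k) x') / \<kappa> ^ k" by (rule d_iter[OF assms(1,2) e])
 also have "\<dots> \<le> \<delta> / \<kappa> ^ k"
  using d_bound[OF iter_space iter_space] assms \<kappa>_gt_1 by (intro divide_right_mono) auto
 finally show ?P .
 show "\<exists>b\<in>\<alpha>. x \<in> b \<and> x' \<in> b" if "0 < k" using e[OF that] by simp
qed

text \<open>
 Functions that are uniformly Lipschitz on the partition elements are determined up to a small
 error by their values on representatives of the countably many cylinders, so that a diagonal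
 argument extracts pointwise convergent subsequences.
\<close>
lemma lip2_compact:
 assumes w: "\<And>n. lip2 s D (w n)" and D: "0 \<le> D"
 obtains r w' where "strict_mono (r :: nat \<Rightarrow> nat)" "lip2 s D w'"
  "\<And>x. x \<in> G \<Longrightarrow> (\<lambda>n. w (r n) x) \<longlonglongrightarrow> w' x"
proof -
 \<comment> \<open>For a word whose cylinder misses \<open>G\<close> the chosen point is arbitrary;
   intersecting with \<open>G\<close> discards it.\<close>
 define S where "S = (\<Union>k::nat. (\<lambda>ws. SOME x. x \<in> G \<and> word k x = ws) ` lists \<alpha>) \<inter> G"
 have cS: "countable S" unfolding S_def using \<alpha>_countable by (intro countable_Int1) auto
 have bS: "norm (w n x) \<le> s" if "x \<in> S" for n x using that w[of n] by (auto simp: S_def lip2_def)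
 obtain r where r: "strict_mono (r :: nat \<Rightarrow> nat)" "\<And>x. x \<in> S \<Longrightarrow> \<exists>l. (\<lambda>n. w (r n) x) \<longlonglongrightarrow> l"
  by (rule function_convergent_subsequence[where f=w, OF cS bS]) auto
 have conv: "convergent (\<lambda>n. w (r n) x)" if x: "x \<in> G" for x
 proof (rule Cauchy_convergent, rule metric_CauchyI)
  fix \<epsilon> :: real assume "0 < \<epsilon>"
  have "(\<lambda>k. D * \<delta> * (1 / \<kappa>) ^ k) \<longlonglongrightarrow> D * \<delta> * 0"
   using \<kappa>_inv by (intro tendsto_intros LIMSEQ_power_zero) auto
  then have "EV k. D * \<delta> * (1 / \<kappa>) ^ k < \<epsilon> / 3"
   using \<open>0 < \<epsilon>\<close> by (intro order_tendstoD) auto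
  then obtain N0 where "\<And>k. k \<ge> N0 \<Longrightarrow> D * \<delta> * (1 / \<kappa>) ^ k < \<epsilon> / 3"
   by (auto simp: eventually_sequentially)
  from this[of "Suc N0"] obtain k where k: "0 < k" "D * (\<delta> / \<kappa> ^ k) < \<epsilon> / 3"
   by (intro that[of "Suc N0"]) (auto simp: power_one_over)
  define x' where "x' = (SOME x'. x' \<in> G \<and> word k x' = word k x)"
  have x': "x' \<in> G" "word k x = word k x'"
   using someI[of "\<lambda>x'. x' \<in> G \<and> word k x' = word k x" x] x unfolding x'_def by metis+
  have "word k x \<in> lists \<alpha>" unfolding word_def using elem[OF iter_space[OF G_space[OF x]]] by auto
  then have "x' \<in> (\<lambda>ws. SOME x. x \<in> G \<and> word k x = ws) ` lists \<alpha>" unfolding x'_def by (rule imageI)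
  then have "x' \<in> S" unfolding S_def using x'(1) by blast
  then have "Cauchy (\<lambda>n. w (r n) x')" using r(2) by (auto intro: LIMSEQ_imp_Cauchy)
  then obtain N where N: "\<And>m n. m \<ge> N \<Longrightarrow> n \<ge> N \<Longrightarrow> dist (w (r m) x') (w (r n) x') < \<epsilon> / 3"
   using \<open>0 < \<epsilon>\<close> by (metis metric_CauchyD divide_pos_pos zero_less_numeral)
  have c: "dist (w n x) (w n x') < \<epsilon> / 3" for n
  proof -
   obtain b where "b \<in> \<alpha>" "x \<in> b" "x' \<in> b"
    using word_eq_close(2)[OF G_space[OF x] G_space[OF x'(1)] x'(2) k(1)] by auto
   then have "\<bar>w n x - w n x'\<bar> \<le> D * d x x'" using w[of n] x x' unfolding lip2_def by blast
   also have "\<dots> \<le> D * (\<delta> / \<kappa> ^ k)"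
    using word_eq_close(1)[OF G_space[OF x] G_space[OF x'(1)] x'(2)] D by (intro mult_left_mono)
   finally show ?thesis using k(2) unfolding dist_real_def by linarith
  qed
  have "dist (w (r m) x) (w (r n) x) < \<epsilon>" if "m \<ge> N" "n \<ge> N" for m n
   using N[OF that] c[of "r m"] c[of "r n"] unfolding dist_real_def by linarith
  then show "\<exists>N. \<forall>m\<ge>N. \<forall>n\<ge>N. dist (w (r m) x) (w (r n) x) < \<epsilon>" by blast
 qed
 define w' where "w' x = (if x \<in> G then lim (\<lambda>n. w (r n) x) else 0)" for x
 have lim: "(\<lambda>n. w (r n) x) \<longlonglongrightarrow> w' x" if "x \<in> G" for x
  using conv[OF that] that by (simp add: w'_def convergent_LIMSEQ_iff)
 have "rv w'"
 proof (rule borel_measurable_LIMSEQ_metric[where f="\<lambda>n x. if x \<in> G then w (r n) x else 0"])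
  have [measurable]: "w n \<in> borel_measurable M" for n using lip2_meas[OF w] .
  show "(\<lambda>x. if x \<in> G then w (r n) x else 0) \<in> borel_measurable M" for n by measurable
  show "(\<lambda>n. if x \<in> G then w (r n) x else 0) \<longlonglongrightarrow> w' x" for x
   using lim[of x] by (cases "x \<in> G") (auto simp: w'_def)
 qed
 moreover have "\<bar>w' x\<bar> \<le> s" if "x \<in> G" for x
  using w that by (intro LIMSEQ_le_const2[OF tendsto_rabs[OF lim[OF that]]]) (auto simp: lip2_def)
 moreover have "\<bar>w' x - w' x'\<bar> \<le> D * d x x'" if "b \<in> \<alpha>" "x \<in> b \<inter> G" "x' \<in> b \<inter> G" for b x x'
  using w that by (intro LIMSEQ_le_const2[OF tendsto_rabs[OF tendsto_diff[OF lim lim]]]) (auto simp: lip2_def)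
 ultimately have "lip2 s D w'" unfolding lip2_def by blast
 with r(1) lim show ?thesis using that by blast
qed

lemma transfer_LIMSEQ:
 assumes "\<And>n x. x \<in> G \<Longrightarrow> \<bar>w n x\<bar> \<le> s" "\<And>x. x \<in> G \<Longrightarrow> (\<lambda>n. w n x) \<longlonglongrightarrow> w' x" "y \<in> G"
 shows "(\<lambda>n. \<L> (w n) y) \<longlonglongrightarrow> \<L> w' y"
 unfolding \<L>_def
proof (rule integral_dominated_convergence[where w="\<lambda>a. s * weight a y"])
 show "integrable cs (\<lambda>a. s * weight a y)" using integrable_weight_1 by simp
 show "AE a in cs. (\<lambda>n. weight a y * w n (branch a y)) \<longlonglongrightarrow> weight a y * w' (branch a y)"
 proof (rule AE_I2)
  fix a assume "a \<in> space cs"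
  then have a: "a \<in> \<alpha>" by simp
  show "(\<lambda>n. weight a y * w n (branch a y)) \<longlonglongrightarrow> weight a y * w' (branch a y)"
  proof (cases "y \<in> T ` a")
   case True
   show ?thesis by (intro tendsto_intros assms(2) branch_G[OF a assms(3) True])
  qed (simp add: weight_def)
 qed
 fix n show "AE a in cs. norm (weight a y * w n (branch a y)) \<le> s * weight a y"
 proof (rule AE_I2)
  fix a assume "a \<in> space cs"
  then have a: "a \<in> \<alpha>" by simp
  show "norm (weight a y * w n (branch a y)) \<le> s * weight a y"
  proof (cases "y \<in> T ` a")
   case True
   then show ?thesis using mult_right_mono[OF assms(1)[OF branch_G[OF a assms(3) True]] weight_nonneg[OF a]]
    weight_nonneg[OF a] by (simp add: abs_mult mult.commute)
  qed (simp add: weight_def)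
 qed
qed auto

text \<open>Write \<open>w = (w - \<L> w) + \<L> w\<close>: a Lipschitz constant \<open>E\<close> of
  \<open>w\<close> may be replaced by \<open>c + C0 * s + E / \<kappa>\<close>. Iterating this
  contraction leads to its fixed point, which no longer depends on the initial constant
  \<open>D\<close>.\<close>

lemma lip2_improve:
 assumes w: "lip2 s D w" and s: "0 \<le> s" and c: "0 \<le> c" and wt: "lip2 c c (\<lambda>x. w x - \<L> w x)"
 shows "lip2 s ((c + C0 * s) / (1 - 1 / \<kappa>)) w"
proof -
 define D0 where "D0 = (c + C0 * s) / (1 - 1 / \<kappa>)"
 define E where "E = max D D0"
 have D0: "0 \<le> D0" unfolding D0_def using c s C0_nonneg \<kappa>_inv by (intro divide_nonneg_pos) auto
 have D0_eq: "c + C0 * s + D0 / \<kappa> = D0" unfolding D0_def using \<kappa>_gt_1 by (simp add: field_simps)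
 have E: "0 \<le> E" "D0 \<le> E" using D0 by (auto simp: E_def)
 have wE: "lip2 s E w" by (rule lip2_mono[OF w]) (auto simp: E_def)
 have k: "lip2 s (D0 + (E - D0) / \<kappa> ^ k) w" for k
 proof (induction k)
  case (Suc k)
  let ?D = "D0 + (E - D0) / \<kappa> ^ k"
  have "0 \<le> ?D" using D0 E \<kappa>_gt_1 by (intro add_nonneg_nonneg divide_nonneg_pos) auto
  from transfer_lip2[OF Suc s this] have t: "lip2 s (?D / \<kappa> + C0 * s) (\<L> w)" .
  have e: "c + (?D / \<kappa> + C0 * s) = D0 + (E - D0) / \<kappa> ^ Suc k"
   using D0_eq by (simp add: add_divide_distrib mult.commute)
  show ?case unfolding lip2_def
  proof (intro conjI ballI)
   fix b x x' assume b: "b \<in> \<alpha>" "x \<in> b \<inter> G" "x' \<in> b \<inter> G"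
   have "\<bar>(w x - \<L> w x) - (w x' - \<L> w x')\<bar> \<le> c * d x x'" using wt b unfolding lip2_def by blast
   moreover have "\<bar>\<L> w x - \<L> w x'\<bar> \<le> (?D / \<kappa> + C0 * s) * d x x'" using t b unfolding lip2_def by blast
   ultimately have "\<bar>w x - w x'\<bar> \<le> c * d x x' + (?D / \<kappa> + C0 * s) * d x x'" by linarith
   then show "\<bar>w x - w x'\<bar> \<le> (D0 + (E - D0) / \<kappa> ^ Suc k) * d x x'"
    unfolding e[symmetric] by (simp only: distrib_right)
  qed (use w in \<open>auto simp: lip2_def\<close>)
 qed (use wE in auto)
 show ?thesis unfolding D0_def[symmetric] lip2_def
 proof (intro conjI ballI)
  fix b x x' assume b: "b \<in> \<alpha>" "x \<in> b \<inter> G" "x' \<in> b \<inter> G"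
  have "(\<lambda>k. (D0 + (E - D0) * (1 / \<kappa>) ^ k) * d x x') \<longlonglongrightarrow> (D0 + (E - D0) * 0) * d x x'"
   using \<kappa>_inv by (intro tendsto_intros LIMSEQ_power_zero) auto
  then have "(\<lambda>k. (D0 + (E - D0) / \<kappa> ^ k) * d x x') \<longlonglongrightarrow> D0 * d x x'" by (simp add: power_one_over)
  then show "\<bar>w x - w x'\<bar> \<le> D0 * d x x'"
   using k b by (intro LIMSEQ_le_const) (auto simp: lip2_def)
 qed (use w in \<open>auto simp: lip2_def\<close>)
qed


section \<open>Algebra of the class \<open>lip2\<close> and duality for iterates\<close>

lemma lip2_add: "\<lbrakk>lip2 s D v; lip2 s' D' v'\<rbrakk> \<Longrightarrow> lip2 (s + s') (D + D') (\<lambda>x. v x + v' x)"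
proof -
 assume v: "lip2 s D v" and v': "lip2 s' D' v'"
 show ?thesis unfolding lip2_def
 proof (intro conjI ballI)
  have [measurable]: "rv v" "rv v'" using v v' lip2_meas by auto
  show "(\<lambda>x. v x + v' x) \<in> borel_measurable M" by measurable
  show "\<bar>v x + v' x\<bar> \<le> s + s'" if "x \<in> G" for x
   using v v' that unfolding lip2_def by (meson abs_triangle_ineq add_mono order_trans)
  fix b x x' assume b: "b \<in> \<alpha>" "x \<in> b \<inter> G" "x' \<in> b \<inter> G"
  have "\<bar>v x - v x'\<bar> \<le> D * d x x'" "\<bar>v' x - v' x'\<bar> \<le> D' * d x x'"
   using v v' b unfolding lip2_def by blast+
  then show "\<bar>v x + v' x - (v x' + v' x')\<bar> \<le> (D + D') * d x x'" unfolding distrib_right by linarith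
 qed
qed

lemma lip2_cmult: "lip2 s D v \<Longrightarrow> lip2 (\<bar>k\<bar> * s) (\<bar>k\<bar> * D) (\<lambda>x. k * v x)"
proof -
 assume v: "lip2 s D v"
 show ?thesis unfolding lip2_def
 proof (intro conjI ballI)
  show "(\<lambda>x. k * v x) \<in> borel_measurable M" using lip2_meas[OF v] by measurable
  show "\<bar>k * v x\<bar> \<le> \<bar>k\<bar> * s" if "x \<in> G" for x
   using v that unfolding lip2_def abs_mult by (intro mult_left_mono) auto
  fix b x x' assume b: "b \<in> \<alpha>" "x \<in> b \<inter> G" "x' \<in> b \<inter> G"
  have "\<bar>v x - v x'\<bar> \<le> D * d x x'" using v b unfolding lip2_def by blast
  then show "\<bar>k * v x - k * v x'\<bar> \<le> \<bar>k\<bar> * D * d x x'"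
   unfolding right_diff_distrib[symmetric] abs_mult mult.assoc by (intro mult_left_mono) auto
 qed
qed

lemma lip2_const: "lip2 \<bar>c\<bar> 0 (\<lambda>_. c)"
 by (simp add: lip2_def)

lemma lip2_diff: "\<lbrakk>lip2 s D v; lip2 s' D' v'\<rbrakk> \<Longrightarrow> lip2 (s + s') (D + D') (\<lambda>x. v x - v' x)"
 using lip2_add[of s D v s' D' "\<lambda>x. (-1) * v' x"] lip2_cmult[of s' D' v' "-1"] by simp

lemma lip2_cong: "\<lbrakk>lip2 s D v; rv v'; \<And>x. x \<in> G \<Longrightarrow> v' x = v x\<rbrakk> \<Longrightarrow> lip2 s D v'"
 unfolding lip2_def by simp

lemma lip2_0: "lip2 0 0 (\<lambda>_. 0)"
 by (simp add: lip2_def)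

lemma lip2_sum:
 assumes "finite I" "\<And>i. i \<in> I \<Longrightarrow> lip2 s D (v i)"
 shows "lip2 (real (card I) * s) (real (card I) * D) (\<lambda>x. \<Sum>i\<in>I. v i x)"
 using assms
proof (induction I rule: finite_induct)
 case (insert i I)
 from lip2_add[OF insert(4)[of i] insert(3)] show ?case using insert
  by (simp add: algebra_simps)
qed (simp add: lip2_0)

lemma bdd_on_G_sum: "\<lbrakk>finite I; \<And>i. i \<in> I \<Longrightarrow> bdd_on_G (v i)\<rbrakk> \<Longrightarrow> bdd_on_G (\<lambda>x. \<Sum>i\<in>I. v i x)"
 by (induction I rule: finite_induct) (auto intro: bdd_on_G_add bdd_on_G_const)

lemma transfer_sum:
 assumes "finite I" "\<And>i. i \<in> I \<Longrightarrow> bdd_on_G (v i)" "y \<in> G"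
 shows "\<L> (\<lambda>x. \<Sum>i\<in>I. v i x) y = (\<Sum>i\<in>I. \<L> (v i) y)"
 using assms(1,2)
proof (induction I rule: finite_induct)
 case (insert i I)
 then have "\<L> (\<lambda>x. v i x + (\<Sum>i\<in>I. v i x)) y = \<L> (v i) y + \<L> (\<lambda>x. \<Sum>i\<in>I. v i x) y"
  using assms(3) by (intro transfer_add bdd_on_G_sum) auto
 then show ?case using insert by simp
qed (use transfer_const[OF assms(3)] in auto)

lemma transfer_iter_diff_le:
 assumes "bdd_on_G u" "bdd_on_G u'" "\<And>x. x \<in> G \<Longrightarrow> \<bar>u x - u' x\<bar> \<le> c" "y \<in> G"
 shows "\<bar>(\<L> ^^ k) u y - (\<L> ^^ k) u' y\<bar> \<le> c"
 using assms(4)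
proof (induction k arbitrary: y)
 case (Suc k)
 have "\<bar>\<L> (\<lambda>x. (\<L> ^^ k) u x - (\<L> ^^ k) u' x) y\<bar> \<le> c"
  by (rule transfer_abs_le[OF Suc.prems]) (rule Suc.IH)
 then show ?case using transfer_diff[OF transfer_iter_bdd[OF assms(1)] transfer_iter_bdd[OF assms(2)] Suc.prems] by simp
qed (use assms in auto)

lemma transfer_iter_cong:
 assumes "y \<in> G" "\<And>x. \<lbrakk>x \<in> G; (T ^^ k) x = y\<rbrakk> \<Longrightarrow> u x = u' x"
 shows "(\<L> ^^ k) u y = (\<L> ^^ k) u' y"
 using assms
proof (induction k arbitrary: y)
 case (Suc k)
 have "\<L> ((\<L> ^^ k) u) y = \<L> ((\<L> ^^ k) u') y"
  by (rule transfer_cong[OF Suc.prems(1)], rule Suc.IH) (use Suc.prems in auto)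
 then show ?case by simp
qed auto

lemma integrable_bounded: "\<lbrakk>rv h; \<And>x. x \<in> space M \<Longrightarrow> \<bar>h x\<bar> \<le> B\<rbrakk> \<Longrightarrow> integrable M h"
 for h :: "'a \<Rightarrow> real"
 by (rule integrable_const_bound[where B=B]) auto

lemma integrable_times_bounded:
 fixes h u :: "'a \<Rightarrow> real"
 assumes "integrable M u" "rv h" "\<And>x. x \<in> space M \<Longrightarrow> \<bar>h x\<bar> \<le> B"
 shows "integrable M (\<lambda>x. h x * u x)"
proof (rule int_dom[where f="\<lambda>x. B * u x"])
 have [measurable]: "rv u" using assms by auto
 show "integrable M (\<lambda>x. B * u x)" using assms by auto
 show "(\<lambda>x. h x * u x) \<in> borel_measurable M" using assms(2) by measurable
 show "AE x in M. norm (h x * u x) \<le> norm (B * u x)"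
 proof (rule AE_I2)
  fix x assume "x \<in> space M"
  then have "\<bar>h x\<bar> \<le> \<bar>B\<bar>" using assms(3)[of x] by auto
  then show "norm (h x * u x) \<le> norm (B * u x)" by (simp add: abs_mult mult_right_mono)
 qed
qed

lemma integral_transfer_iter:
 fixes u H :: "'a \<Rightarrow> real"
 assumes u: "integrable M u" and H: "rv H" "\<And>x. x \<in> space M \<Longrightarrow> \<bar>H x\<bar> \<le> B"
 shows "(LINT x|M. H ((T ^^ k) x) * u x) = (LINT x|M. H x * (\<L> ^^ k) u x)"
 using H
proof (induction k arbitrary: H)
 case (Suc k)
 note [measurable] = Suc.prems(1)
 have iu: "integrable M ((\<L> ^^ k) u)" by (rule transfer_iter_integral(1)[OF u])
 then have [measurable]: "(\<L> ^^ k) u \<in> borel_measurable M" by auto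
 have "(LINT x|M. H ((T ^^ Suc k) x) * u x) = (LINT x|M. H (T ((T ^^ k) x)) * u x)" by simp
 also have "\<dots> = (LINT x|M. H (T x) * (\<L> ^^ k) u x)"
  by (rule Suc.IH[of "\<lambda>x. H (T x)"]) (use Suc.prems T_space in auto)
 also have "\<dots> = (LINT x|M. H x * \<L> ((\<L> ^^ k) u) x)"
  by (rule integral_transfer[symmetric]) (use Suc.prems(2) T_space iu in \<open>auto intro!: integrable_times_bounded\<close>)
 finally show ?case by simp
qed auto

end

section \<open>Ergodicity and decorrelation\<close>

locale gm_ergodic = gm_map +
 assumes erg: "ergodic_map M T"
begin

text \<open>For a fixed point of \<open>\<L>\<close>, duality and invariance give
  \<open>\<integral> (w \<circ> T - w)\<^sup>2 = 0\<close>, so \<open>w\<close> is invariant;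
  ergodicity gives it a constant sign, and the zero mean does the rest.\<close>

lemma transfer_fixed_zero:
 assumes w: "lip2 s D w" and fixed: "\<And>x. x \<in> G \<Longrightarrow> \<L> w x = w x" and int: "(LINT x|M. w x) = 0"
 shows "AE x in M. w x = 0"
proof -
 have [measurable]: "rv w" by (rule lip2_meas[OF w])
 have wb: "AE x in M. \<bar>w x\<bar> \<le> s" by (rule AE_mp[OF AE_G AE_I2]) (use w in \<open>auto simp: lip2_def\<close>)
 have wTb: "AE x in M. \<bar>w (T x)\<bar> \<le> s" using AE_T[OF wb] .
 have s: "0 \<le> s"
 proof (rule ccontr)
  assume "\<not> 0 \<le> s"
  then have "AE x in M. False" by (intro AE_mp[OF wb AE_I2]) auto
  then show False by simp
 qed
 have bound: "\<bar>p * q\<bar> \<le> s * s" if "\<bar>p\<bar> \<le> s" "\<bar>q\<bar> \<le> s" for p q :: real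
  using that s unfolding abs_mult by (intro mult_mono) auto
 have i1: "integrable M (\<lambda>x. w (T x) * w x)"
  by (rule integrable_const_bound[where B="s * s"], use wb wTb in eventually_elim) (auto simp: bound)
 have i2: "integrable M (\<lambda>x. w x * w x)"
  by (rule integrable_const_bound[where B="s * s"], use wb in eventually_elim) (unfold real_norm_def, rule bound, auto)
 have i3: "integrable M (\<lambda>x. w (T x) * w (T x))" using integrable_T[OF i2] .
 have "(LINT x|M. w (T x) * w x) = (LINT x|M. w x * \<L> w x)"
  by (rule integral_transfer[symmetric]) (use i1 in auto)
 also have "\<dots> = (LINT x|M. w x * w x)"
  using integrable_transfer'(1)[OF lip2_integrable[OF w]]
  by (intro integral_cong_AE AE_mp[OF AE_G AE_I2]) (auto simp: fixed)
 finally have e1: "(LINT x|M. w (T x) * w x) = (LINT x|M. w x * w x)" .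
 have e2: "(LINT x|M. w (T x) * w (T x)) = (LINT x|M. w x * w x)"
  by (rule integral_T) auto
 have sq: "(w (T x) - w x)\<^sup>2 = w (T x) * w (T x) - 2 * (w (T x) * w x) + w x * w x" for x
  by (simp add: power2_eq_square algebra_simps)
 have i4: "integrable M (\<lambda>x. (w (T x) - w x)\<^sup>2)" unfolding sq using i1 i2 i3 by auto
 have "(LINT x|M. (w (T x) - w x)\<^sup>2) = 0"
  unfolding sq using i1 i2 i3 e1 e2 by simp
 then have "AE x in M. (w (T x) - w x)\<^sup>2 = 0"
  using i4 by (subst (asm) integral_nonneg_eq_0_iff_AE) auto
 then have "AE x in M. w (T x) = w x" by auto
 then have "AE x in M. \<forall>k. w (T ((T ^^ k) x)) = w ((T ^^ k) x)"
  unfolding AE_all_countable by (intro allI AE_iter[where Q="\<lambda>x. w (T x) = w x"])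
 then have inv: "AE x in M. \<forall>k. w ((T ^^ k) x) = w x"
 proof eventually_elim
  case (elim x)
  have "w ((T ^^ k) x) = w x" for k by (induction k) (use elim in auto)
  then show ?case by auto
 qed
 \<comment> \<open>Ergodicity concerns strictly invariant sets, whereas
   \<open>w \<circ> T = w\<close> holds only almost everywhere. Positivity at all late times of the
   orbit is a strictly invariant condition and agrees with \<open>0 < w x\<close> almost
   everywhere.\<close>
 define A where "A = {x \<in> space M. \<exists>N. \<forall>n\<ge>N. 0 < w ((T ^^ n) x)}"
 have A[measurable]: "A \<in> sets M" unfolding A_def by measurable
 have "T -` A \<inter> space M = A"
 proof (intro set_eqI iffI)
  fix x assume "x \<in> T -` A \<inter> space M"
  then obtain N where x: "x \<in> space M" "\<forall>n\<ge>N. 0 < w ((T ^^ n) (T x))" by (auto simp: A_def)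
  have "\<forall>n\<ge>Suc N. 0 < w ((T ^^ n) x)"
  proof (intro allI impI)
   fix n assume "Suc N \<le> n"
   then obtain m where "n = Suc m" "N \<le> m" by (cases n) auto
   then show "0 < w ((T ^^ n) x)" using x(2) by (simp add: funpow_swap1)
  qed
  then show "x \<in> A" using x by (auto simp: A_def)
 next
  fix x assume "x \<in> A"
  then obtain N where x: "x \<in> space M" "\<forall>n\<ge>N. 0 < w ((T ^^ n) x)" by (auto simp: A_def)
  have "\<forall>n\<ge>N. 0 < w ((T ^^ n) (T x))"
  proof (intro allI impI)
   fix n assume "N \<le> n"
   then have "0 < w ((T ^^ Suc n) x)" using x(2) by (auto simp del: funpow.simps)
   then show "0 < w ((T ^^ n) (T x))" by (simp add: funpow_swap1)
  qed
  then show "x \<in> T -` A \<inter> space M" using x T_space by (auto simp: A_def)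
 qed
 then consider "prob A = 0" | "prob A = 1" using erg A unfolding ergodic_map_def by blast
 then have le: "AE x in M. w x \<le> 0"
 proof cases
  case 1
  then have "AE x in M. x \<notin> A" by (simp add: prob_eq_0)
  then show ?thesis using inv AE_space by eventually_elim (auto simp: A_def not_less[symmetric])
 next
  case 2
  then have "AE x in M. x \<in> A" by (simp add: prob_eq_1)
  then have pos: "AE x in M. 0 < w x" using inv by eventually_elim (auto simp: A_def)
  then have "AE x in M. 0 \<le> w x" by eventually_elim auto
  then have "AE x in M. w x = 0"
   using int lip2_integrable[OF w] by (subst (asm) integral_nonneg_eq_0_iff_AE) auto
  then have "AE x in M. \<not> 0 < w x" by eventually_elim auto
  with pos show ?thesis by (metis AE_contr)
 qed
 then have "AE x in M. 0 \<le> - w x" by eventually_elim auto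
 moreover have "(LINT x|M. - w x) = 0" using int by simp
 ultimately have "AE x in M. - w x = 0"
  using lip2_integrable[OF w] by (subst (asm) integral_nonneg_eq_0_iff_AE) auto
 then show ?thesis by auto
qed

text \<open>\<open>w - (\<L> ^^ j) w\<close> is the sum of the first \<open>j\<close> iterates of
  \<open>w - \<L> w\<close>, and \<open>\<L>\<close> does not increase the supremum on
  \<open>G\<close>.\<close>

lemma telescope_transfer:
 assumes "bdd_on_G w" "\<And>x. x \<in> G \<Longrightarrow> \<bar>w x - \<L> w x\<bar> \<le> c" "y \<in> G"
 shows "\<bar>w y - (\<L> ^^ j) w y\<bar> \<le> real j * c"
 using assms(3)
proof (induction j arbitrary: y)
 case (Suc j)
 have "\<bar>\<L> (\<lambda>x. w x - (\<L> ^^ j) w x) y\<bar> \<le> real j * c"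
  by (rule transfer_abs_le[OF Suc.prems]) (rule Suc.IH)
 then have "\<bar>\<L> w y - \<L> ((\<L> ^^ j) w) y\<bar> \<le> real j * c"
  using transfer_diff[OF assms(1) transfer_iter_bdd[OF assms(1)] Suc.prems] by simp
 moreover have "\<bar>w y - \<L> w y\<bar> \<le> c" by (rule assms(2)[OF Suc.prems])
 ultimately have "\<bar>w y - \<L> ((\<L> ^^ j) w) y\<bar> \<le> real j * c + c" by linarith
 then show ?case by (simp add: algebra_simps)
qed auto

text \<open>By contradiction and compactness. Normalized counterexamples have a common Lipschitz
  constant by \<open>lip2_improve\<close>, so a subsequence converges to a fixed point of
  \<open>\<L>\<close> with zero mean, which vanishes by \<open>transfer_fixed_zero\<close>. The
  convergence to 0 is first in mean, and \<open>transfer_iter_sup\<close> upgrades it to uniform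
  smallness, against the normalization. The constant depends neither on \<open>s\<close> nor on
  \<open>D\<close>, which is what the Poisson equation needs.\<close>

lemma coboundary_bound:
 "\<exists>C>0. \<forall>c w s D. 0 \<le> c \<longrightarrow> lip2 s D w \<longrightarrow> (LINT x|M. w x) = 0 \<longrightarrow>
   lip2 c c (\<lambda>x. w x - \<L> w x) \<longrightarrow> (\<forall>x\<in>G. \<bar>w x\<bar> \<le> C * c)"
proof (rule ccontr)
 assume neg: "\<not> ?thesis"
 let ?i = "\<lambda>n::nat. 1 / real (Suc n)"
 have "\<forall>n. \<exists>W D. lip2 1 D W \<and> (LINT x|M. W x) = 0 \<and> lip2 (?i n) (?i n) (\<lambda>x. W x - \<L> W x)
   \<and> (\<exists>x\<in>G. 1 / 2 < \<bar>W x\<bar>)"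
 proof
  fix n :: nat
  from neg have "\<exists>c w s D. 0 \<le> c \<and> lip2 s D w \<and> (LINT x|M. w x) = 0 \<and>
   lip2 c c (\<lambda>x. w x - \<L> w x) \<and> (\<exists>x\<in>G. \<not> \<bar>w x\<bar> \<le> real (Suc n) * c)"
   by (auto dest!: spec[of _ "real (Suc n)"])
  then obtain c w s D x where c: "0 \<le> c" and w: "lip2 s D w" and iw: "(LINT x|M. w x) = 0"
   and t: "lip2 c c (\<lambda>x. w x - \<L> w x)" and x: "x \<in> G" "real (Suc n) * c < \<bar>w x\<bar>"
   by (metis not_le)
  define S where "S = (SUP x\<in>G. \<bar>w x\<bar>)"
  have bdd: "bdd_above ((\<lambda>x. \<bar>w x\<bar>) ` G)" using w by (auto simp: lip2_def intro!: bdd_aboveI[of _ s])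
  have le: "\<bar>w y\<bar> \<le> S" if "y \<in> G" for y unfolding S_def by (rule cSUP_upper[OF that bdd])
  have Sc: "real (Suc n) * c < S" using le[OF x(1)] x(2) by linarith
  have S: "0 < S" using Sc c by (smt (verit) mult_nonneg_nonneg of_nat_0_le_iff)
  \<comment> \<open>The supremum need not be attained, hence only a value above \<open>1 / 2\<close>
    after normalization.\<close>
  have "\<exists>y\<in>G. S / 2 < \<bar>w y\<bar>"
   using S less_cSUP_iff[of G "\<lambda>x. \<bar>w x\<bar>" "S / 2"] bdd x(1) unfolding S_def[symmetric] by auto
  then obtain y where y: "y \<in> G" "S / 2 < \<bar>w y\<bar>" by auto
  let ?W = "\<lambda>x. (1 / S) * w x"
  have 1: "lip2 1 (D / S) ?W"
   using lip2_cmult[OF w, of "1 / S"] S le unfolding lip2_def by (auto simp: abs_mult)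
  have e: "?W x - \<L> ?W x = (1 / S) * (w x - \<L> w x)" for x
   using transfer_cmult[of "1 / S" w x] by (simp add: right_diff_distrib)
  have "\<bar>1 / S\<bar> * c \<le> ?i n" using Sc S by (simp add: field_simps)
  then have 2: "lip2 (?i n) (?i n) (\<lambda>x. ?W x - \<L> ?W x)"
   unfolding e by (intro lip2_mono[OF lip2_cmult[OF t]])
  have 3: "(LINT x|M. ?W x) = 0" using iw by simp
  have "1 / 2 < \<bar>?W y\<bar>" using y(2) S by (simp add: abs_mult field_simps)
  then show "\<exists>W D. lip2 1 D W \<and> (LINT x|M. W x) = 0 \<and> lip2 (?i n) (?i n) (\<lambda>x. W x - \<L> W x)
   \<and> (\<exists>x\<in>G. 1 / 2 < \<bar>W x\<bar>)" using 1 2 3 y(1) by (intro exI[of _ ?W] exI[of _ "D / S"] conjI bexI[of _ y]) auto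
 qed
 then obtain W Ds where W: "\<And>n. lip2 1 (Ds n) (W n)" "\<And>n. (LINT x|M. W n x) = 0"
  "\<And>n. lip2 (?i n) (?i n) (\<lambda>x. W n x - \<L> (W n) x)" "\<And>n. \<exists>x\<in>G. 1 / 2 < \<bar>W n x\<bar>"
  unfolding choice_iff by blast
 define D0 where "D0 = (1 + C0 * 1) / (1 - 1 / \<kappa>)"
 have D0: "0 \<le> D0" unfolding D0_def using C0_nonneg \<kappa>_inv by (intro divide_nonneg_pos) auto
 have WL: "lip2 1 D0 (W n)" for n unfolding D0_def
  by (rule lip2_improve[OF W(1)], simp, simp, rule lip2_mono[OF W(3)]) auto
 obtain r w where r: "strict_mono (r :: nat \<Rightarrow> nat)" and w: "lip2 1 D0 w"
  and lim: "\<And>x. x \<in> G \<Longrightarrow> (\<lambda>n. W (r n) x) \<longlonglongrightarrow> w x"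
  by (rule lip2_compact[where w=W, OF WL D0]) auto
 have rn: "?i (r n) \<le> ?i n" for n using seq_suble[OF r, of n] by (simp add: frac_le)
 have b1: "\<bar>W n x\<bar> \<le> 1" if "x \<in> G" for n x using WL[of n] that by (auto simp: lip2_def)
 have [measurable]: "W n \<in> borel_measurable M" "rv w" for n
  using lip2_meas WL w by auto
 have fixed: "\<L> w y = w y" if y: "y \<in> G" for y
 proof -
  have 1: "(\<lambda>n. \<L> (W (r n)) y) \<longlonglongrightarrow> \<L> w y"
   by (rule transfer_LIMSEQ[of _ 1]) (use b1 lim y in auto)
  have "(\<lambda>n. W (r n) y - \<L> (W (r n)) y) \<longlonglongrightarrow> 0"
  proof (rule Lim_null_comparison[OF _ LIMSEQ_inverse_real_of_nat], rule always_eventually, rule allI)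
   fix n
   have "\<bar>W (r n) y - \<L> (W (r n)) y\<bar> \<le> ?i (r n)" using W(3)[of "r n"] y by (auto simp: lip2_def)
   then show "norm (W (r n) y - \<L> (W (r n)) y) \<le> inverse (real (Suc n))"
    using rn[of n] by (simp add: inverse_eq_divide)
  qed
  from tendsto_diff[OF lim[OF y] this] have "(\<lambda>n. \<L> (W (r n)) y) \<longlonglongrightarrow> w y" by simp
  with 1 show ?thesis by (rule LIMSEQ_unique)
 qed
 have limAE: "AE x in M. (\<lambda>n. W (r n) x) \<longlonglongrightarrow> w x"
  by (rule AE_mp[OF AE_G AE_I2]) (simp add: lim)
 have bAE: "AE x in M. norm (W (r n) x) \<le> 1" for n
  by (rule AE_mp[OF AE_G AE_I2]) (simp add: b1)
 have "(\<lambda>n. LINT x|M. W (r n) x) \<longlonglongrightarrow> (LINT x|M. w x)"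
  by (rule integral_dominated_convergence[where w="\<lambda>_. 1"]) (use limAE bAE in auto)
 then have "(LINT x|M. w x) = 0" unfolding W(2) by (simp add: LIMSEQ_const_iff)
 from transfer_fixed_zero[OF w fixed this] have w0: "AE x in M. w x = 0" .
 have "(\<lambda>n. LINT x|M. \<bar>W (r n) x\<bar>) \<longlonglongrightarrow> (LINT x|M. \<bar>w x\<bar>)"
 proof (rule integral_dominated_convergence[where w="\<lambda>_. 1"])
  show "AE x in M. (\<lambda>n. \<bar>W (r n) x\<bar>) \<longlonglongrightarrow> \<bar>w x\<bar>" using limAE by eventually_elim (rule tendsto_rabs)
 qed (use bAE in auto)
 moreover have "(LINT x|M. \<bar>w x\<bar>) = 0" using w0 by (intro integral_eq_zero_AE) auto
 ultimately have iW: "(\<lambda>n. LINT x|M. \<bar>W (r n) x\<bar>) \<longlonglongrightarrow> 0" by simp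
 \<comment> \<open>The number of iterates \<open>k\<close> is fixed first, to make the contribution
   of the Lipschitz constant small; only then is \<open>n\<close> chosen, against the
   \<open>Suc k\<close> telescoping errors and the mean.\<close>
 have "(\<lambda>k. Kw * K3 * (D0 * \<delta> * (1 / \<kappa>) ^ k)) \<longlonglongrightarrow> Kw * K3 * (D0 * \<delta> * 0)"
  using \<kappa>_inv by (intro tendsto_intros LIMSEQ_power_zero) auto
 then have "EV k. Kw * K3 * (D0 * \<delta> * (1 / \<kappa>) ^ k) < 1 / 4"
  by (intro order_tendstoD) auto
 then obtain k where k: "Kw * K3 * (D0 * \<delta> * (1 / \<kappa>) ^ k) < 1 / 4" by (auto simp: eventually_sequentially)
 have "(\<lambda>n. real (Suc k) * ?i n + Kw * K3 * (LINT x|M. \<bar>W (r n) x\<bar>)) \<longlonglongrightarrow> real (Suc k) * 0 + Kw * K3 * 0"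
  using LIMSEQ_inverse_real_of_nat unfolding inverse_eq_divide
  by (intro tendsto_intros iW)
 then have "EV n. real (Suc k) * ?i n + Kw * K3 * (LINT x|M. \<bar>W (r n) x\<bar>) < 1 / 4"
  by (intro order_tendstoD) auto
 then obtain n where n: "real (Suc k) * ?i n + Kw * K3 * (LINT x|M. \<bar>W (r n) x\<bar>) < 1 / 4"
  by (auto simp: eventually_sequentially)
 obtain y where y: "y \<in> G" "1 / 2 < \<bar>W (r n) y\<bar>" using W(4) by blast
 have absL: "lip2 1 D0 (\<lambda>x. \<bar>W (r n) x\<bar>)" unfolding lip2_def
 proof (intro conjI ballI)
  fix b x x' assume b: "b \<in> \<alpha>" "x \<in> b \<inter> G" "x' \<in> b \<inter> G"
  have "\<bar>W (r n) x - W (r n) x'\<bar> \<le> D0 * d x x'" using WL[of "r n"] b unfolding lip2_def by blast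
  then show "\<bar>\<bar>W (r n) x\<bar> - \<bar>W (r n) x'\<bar>\<bar> \<le> D0 * d x x'" by linarith
 qed (use b1 in auto)
 have bW: "bdd_on_G (W (r n))" by (rule lip2_bdd[OF WL])
 have "\<bar>W (r n) x - \<L> (W (r n)) x\<bar> \<le> ?i (r n)" if "x \<in> G" for x
  using W(3)[of "r n"] that unfolding lip2_def by blast
 from telescope_transfer[OF bW this y(1), of "Suc k"]
 have "\<bar>W (r n) y\<bar> \<le> real (Suc k) * ?i (r n) + \<bar>(\<L> ^^ Suc k) (W (r n)) y\<bar>"
  by linarith
 also have "real (Suc k) * ?i (r n) \<le> real (Suc k) * ?i n" by (rule mult_left_mono[OF rn]) auto
 also have "\<bar>(\<L> ^^ Suc k) (W (r n)) y\<bar> \<le> (\<L> ^^ Suc k) (\<lambda>x. \<bar>W (r n) x\<bar>) y"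
  by (rule transfer_iter_abs[OF bW y(1)])
 also have "\<dots> \<le> Kw * K3 * ((LINT x|M. \<bar>W (r n) x\<bar>) + D0 * \<delta> / \<kappa> ^ k)"
  by (rule transfer_iter_sup[OF absL _ D0 y(1)]) auto
 also have "\<dots> = Kw * K3 * (LINT x|M. \<bar>W (r n) x\<bar>) + Kw * K3 * (D0 * \<delta> * (1 / \<kappa>) ^ k)"
  by (simp add: algebra_simps power_one_over)
 finally show False using n k y(2) by linarith
qed

text \<open>The partial sums \<open>ws m\<close> of the iterates \<open>(\<L> ^^ k) v\<close> need
  not converge, since \<open>T\<close> may be periodic. They are uniformly bounded by
  \<open>coboundary_bound\<close>, because \<open>ws m - \<L> (ws m) = v - (\<L> ^^ m) v\<close> is.
  Their averages \<open>W N\<close> solve the equation up to \<open>ws (Suc N)\<close> divided by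
  \<open>Suc N\<close>, and a limit point of the averages is a solution.\<close>

lemma poisson_equation:
 "\<exists>C>0. \<forall>c v. 0 \<le> c \<longrightarrow> lip2 c c v \<longrightarrow> (LINT x|M. v x) = 0 \<longrightarrow>
   (\<exists>w. lip2 (C * c) (C * c) w \<and> (\<forall>x\<in>G. v x = w x - \<L> w x))"
proof -
 obtain Cr where Cr: "0 < Cr" and bound: "\<And>c w s D. \<lbrakk>0 \<le> c; lip2 s D w; (LINT x|M. w x) = 0;
   lip2 c c (\<lambda>x. w x - \<L> w x)\<rbrakk> \<Longrightarrow> \<forall>x\<in>G. \<bar>w x\<bar> \<le> Cr * c"
  using coboundary_bound by blast
 define C4 where "C4 = 1 + C0 / (1 - 1 / \<kappa>)"
 have q0: "0 \<le> C0 / (1 - 1 / \<kappa>)" using C0_nonneg \<kappa>_inv by (intro divide_nonneg_pos) auto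
 then have C4: "1 \<le> C4" by (simp add: C4_def)
 define A where "A = Cr * (2 * C4)"
 define B where "B = (2 * C4 + C0 * A) / (1 - 1 / \<kappa>)"
 have A: "0 < A" unfolding A_def using Cr C4 by auto
 have B: "0 \<le> B" unfolding B_def using A C4 C0_nonneg \<kappa>_inv by (intro divide_nonneg_pos add_nonneg_nonneg mult_nonneg_nonneg) auto
 show ?thesis
 proof (intro exI[of _ "A + B"] conjI allI impI)
  show "0 < A + B" using A B by auto
  fix c v assume c: "0 \<le> c" and v: "lip2 c c v" and iv: "(LINT x|M. v x) = 0"
  have Pv: "lip2 c (C4 * c) ((\<L> ^^ m) v)" for m
   using transfer_iter_lip2[OF v c c, of m] by (simp add: C4_def algebra_simps)
  define ws where "ws m x = (\<Sum>k<m. (\<L> ^^ k) v x)" for m x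
  have wsL: "lip2 (real m * c) (real m * (C4 * c)) (ws m)" for m
   using lip2_sum[of "{..<m}" c "C4 * c" "\<lambda>k. (\<L> ^^ k) v"] Pv unfolding ws_def[abs_def] by simp
  have wsI: "(LINT x|M. ws m x) = 0" for m
   unfolding ws_def using transfer_iter_integral[OF lip2_integrable[OF v]] iv by simp
  have wst: "\<L> (ws m) y = (\<Sum>k<m. (\<L> ^^ Suc k) v y)" if "y \<in> G" for m y
   unfolding ws_def[abs_def] using transfer_sum[of "{..<m}" "\<lambda>k. (\<L> ^^ k) v" y] that lip2_bdd[OF Pv] by simp
  have wsd: "ws m y - \<L> (ws m) y = v y - (\<L> ^^ m) v y" if "y \<in> G" for m y
   unfolding wst[OF that] ws_def sum_subtractf[symmetric] using sum_lessThan_telescope'[of "\<lambda>k. (\<L> ^^ k) v y" m] by simp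
  have tm: "\<L> (ws m) \<in> borel_measurable M" for m using integrable_transfer'(1)[OF lip2_integrable[OF wsL]] by auto
  have "lip2 (c + c) (c + C4 * c) (\<lambda>x. ws m x - \<L> (ws m) x)" for m
   by (rule lip2_cong[OF lip2_diff[OF v Pv[of m]]]) (use lip2_meas[OF wsL[of m]] tm wsd in auto)
  then have wsd2: "lip2 (2 * C4 * c) (2 * C4 * c) (\<lambda>x. ws m x - \<L> (ws m) x)" for m
   by (rule lip2_mono) (use C4 c mult_right_mono[OF C4 c] in auto)
  have c2: "0 \<le> 2 * C4 * c" using c C4 by auto
  have wsA: "\<forall>x\<in>G. \<bar>ws m x\<bar> \<le> A * c" for m
   using bound[OF c2 wsL wsI wsd2, of m] by (simp add: A_def mult.assoc)
  have wsL1: "lip2 (A * c) (real m * (C4 * c)) (ws m)" for m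
   using wsL[of m] wsA[of m] by (auto simp: lip2_def)
  have wsAB: "lip2 (A * c) (B * c) (ws m)" for m
  proof -
   have "lip2 (A * c) ((2 * C4 * c + C0 * (A * c)) / (1 - 1 / \<kappa>)) (ws m)"
    by (rule lip2_improve[OF wsL1 _ c2 wsd2]) (use A c in auto)
   moreover have "(2 * C4 * c + C0 * (A * c)) / (1 - 1 / \<kappa>) = B * c"
    by (simp add: B_def algebra_simps)
   ultimately show ?thesis by simp
  qed
  define W where "W N x = (1 / real (Suc N)) * (\<Sum>m\<le>N. ws m x)" for N x
  have WL: "lip2 (A * c) (B * c) (W N)" for N
  proof -
   have "lip2 (real (Suc N) * (A * c)) (real (Suc N) * (B * c)) (\<lambda>x. \<Sum>m\<le>N. ws m x)"
    using lip2_sum[of "{..N}" "A * c" "B * c" ws] wsAB by simp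
   from lip2_cmult[OF this, of "1 / real (Suc N)"] show ?thesis
    unfolding W_def[abs_def] by simp
  qed
  have Wd: "W N y - \<L> (W N) y = v y - ws (Suc N) y / real (Suc N)" if y: "y \<in> G" for N y
  proof -
   have "\<L> (W N) y = (1 / real (Suc N)) * (\<Sum>m\<le>N. \<L> (ws m) y)"
    unfolding W_def[abs_def] transfer_cmult using transfer_sum[of "{..N}" ws y] lip2_bdd[OF wsL] y by simp
   then have "W N y - \<L> (W N) y = (1 / real (Suc N)) * (\<Sum>m\<le>N. ws m y - \<L> (ws m) y)"
    unfolding W_def sum_subtractf by (simp add: right_diff_distrib)
   also have "\<dots> = (1 / real (Suc N)) * (\<Sum>m\<le>N. v y - (\<L> ^^ m) v y)"
    using wsd[OF y] by simp
   also have "\<dots> = v y - ws (Suc N) y / real (Suc N)"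
    unfolding sum_subtractf ws_def lessThan_Suc_atMost by (simp add: field_simps)
   finally show ?thesis .
  qed
  obtain r w where r: "strict_mono (r :: nat \<Rightarrow> nat)" and w: "lip2 (A * c) (B * c) w"
   and lim: "\<And>x. x \<in> G \<Longrightarrow> (\<lambda>n. W (r n) x) \<longlonglongrightarrow> w x"
   by (rule lip2_compact[where w=W, OF WL]) (use B c in auto)
  have eq: "v y = w y - \<L> w y" if y: "y \<in> G" for y
  proof -
   have "(\<lambda>n. W (r n) y - \<L> (W (r n)) y) \<longlonglongrightarrow> w y - \<L> w y"
    by (intro tendsto_diff lim[OF y] transfer_LIMSEQ[of _ "A * c"]) (use WL lim y in \<open>auto simp: lip2_def\<close>)
   moreover have "(\<lambda>n. W (r n) y - \<L> (W (r n)) y) \<longlonglongrightarrow> v y - 0"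
    unfolding Wd[OF y]
   proof (intro tendsto_diff tendsto_const)
    have z: "(\<lambda>n. (A * c) * inverse (real (Suc n))) \<longlonglongrightarrow> (A * c) * 0"
     by (intro tendsto_intros LIMSEQ_inverse_real_of_nat)
    have z2: "(\<lambda>N. ws (Suc N) y / real (Suc N)) \<longlonglongrightarrow> 0"
    proof (rule Lim_null_comparison[OF _ z[unfolded mult_zero_right]], rule always_eventually, rule allI)
     fix N show "norm (ws (Suc N) y / real (Suc N)) \<le> A * c * inverse (real (Suc N))"
      using wsA[of "Suc N"] y by (simp add: divide_inverse abs_mult mult_right_mono)
    qed
    show "(\<lambda>n. ws (Suc (r n)) y / real (Suc (r n))) \<longlonglongrightarrow> 0"
     using LIMSEQ_subseq_LIMSEQ[OF z2 r] by (simp add: o_def)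
   qed
   ultimately show ?thesis using LIMSEQ_unique by fastforce
  qed
  have "lip2 ((A + B) * c) ((A + B) * c) w"
   by (rule lip2_mono[OF w]) (use A B c in \<open>auto intro!: mult_right_mono\<close>)
  then show "\<exists>w. lip2 ((A + B) * c) ((A + B) * c) w \<and> (\<forall>x\<in>G. v x = w x - \<L> w x)"
   using eq by blast
 qed
qed

end

context gm_map begin

lemma birkhoff_meas [measurable]: "rv f \<Longrightarrow> Sn f k \<in> borel_measurable M"
proof -
 assume [measurable]: "rv f"
 show ?thesis unfolding birkhoff_sum_def[abs_def] by measurable
qed

lemma transfer_iter_abs_le: "\<lbrakk>\<And>x. x \<in> G \<Longrightarrow> \<bar>u x\<bar> \<le> c; y \<in> G\<rbrakk> \<Longrightarrow> \<bar>(\<L> ^^ k) u y\<bar> \<le> c"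
proof (induction k arbitrary: y)
 case (Suc k)
 have "\<bar>\<L> ((\<L> ^^ k) u) y\<bar> \<le> c"
  by (rule transfer_abs_le[OF Suc.prems(2)]) (rule Suc.IH[OF Suc.prems(1)])
 then show ?case by simp
qed auto

end

section \<open>Decorrelation and martingale approximation\<close>

context gm_ergodic begin

text \<open>With \<open>m\<close> the mean of \<open>v\<close> and \<open>v - m = w - \<L> w\<close>
  from \<open>poisson_equation\<close>, duality gives
  \<open>\<integral> H (v - m) = \<integral> (H - H \<circ> T) w\<close>. No decay rate enters:
  almost invariance of \<open>H\<close> takes the place of mixing.\<close>

lemma lip2_decorrelation:
 "\<exists>C>0. \<forall>c v H B. 0 \<le> c \<longrightarrow> lip2 c c v \<longrightarrow> rv H \<longrightarrow> (\<forall>x\<in>space M. \<bar>H x\<bar> \<le> B) \<longrightarrow>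
   \<bar>(LINT x|M. H x * v x) - (LINT x|M. H x) * (LINT x|M. v x)\<bar> \<le> C * c * (LINT x|M. \<bar>H x - H (T x)\<bar>)"
proof -
 obtain C where C: "0 < C" and poisson: "\<And>c v. \<lbrakk>0 \<le> c; lip2 c c v; (LINT x|M. v x) = 0\<rbrakk> \<Longrightarrow>
   \<exists>w. lip2 (C * c) (C * c) w \<and> (\<forall>x\<in>G. v x = w x - \<L> w x)"
  using poisson_equation by blast
 show ?thesis
 proof (intro exI[of _ "C * 2"] conjI allI impI)
  show "0 < C * 2" using C by simp
  fix c v B and H :: "'a \<Rightarrow> real"
  assume c: "0 \<le> c" and v: "lip2 c c v" and H[measurable]: "rv H" and HB: "\<forall>x\<in>space M. \<bar>H x\<bar> \<le> B"
  define m where "m = (LINT x|M. v x)"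
  have iv: "integrable M v" by (rule lip2_integrable[OF v])
  have m: "\<bar>m\<bar> \<le> c"
  proof -
   have "\<bar>m\<bar> \<le> (LINT x|M. \<bar>v x\<bar>)" unfolding m_def by (rule integral_abs_bound)
   also have "\<dots> \<le> (LINT x|M. c)"
    using iv by (intro integral_mono_AE AE_mp[OF AE_G AE_I2]) (use v in \<open>auto simp: lip2_def\<close>)
   finally show ?thesis using prob_space by simp
  qed
  have "lip2 (c + \<bar>m\<bar>) (c + 0) (\<lambda>x. v x - m)" by (rule lip2_diff[OF v lip2_const])
  then have vm: "lip2 (2 * c) (2 * c) (\<lambda>x. v x - m)" by (rule lip2_mono) (use m c in auto)
  have "(LINT x|M. v x - m) = 0" using iv prob_space by (simp add: m_def)
  with poisson[OF _ vm] c obtain w where w: "lip2 (C * (2 * c)) (C * (2 * c)) w"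
   and eq: "\<forall>x\<in>G. v x - m = w x - \<L> w x" by auto
  have iw: "integrable M w" by (rule lip2_integrable[OF w])
  have [measurable]: "rv v" "rv w" using iv iw by auto
  have itw: "integrable M (\<L> w)" by (rule integrable_transfer'(1)[OF iw])
  have HB': "\<bar>H x\<bar> \<le> B" "\<bar>H (T x)\<bar> \<le> B" if "x \<in> space M" for x using HB that T_space by auto
  have i1: "integrable M (\<lambda>x. H x * v x)" "integrable M (\<lambda>x. H x * w x)" "integrable M (\<lambda>x. H x * \<L> w x)"
   using integrable_times_bounded[OF _ H HB'(1)] iv iw itw by auto
  have i2: "integrable M (\<lambda>x. H (T x) * w x)"
   by (rule integrable_times_bounded[OF iw _ HB'(2)]) auto
  have iH: "integrable M H" by (rule integrable_bounded[OF H HB'(1)])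
  have iHT: "integrable M (\<lambda>x. H (T x))" by (rule integrable_T[OF iH])
  have "(LINT x|M. H x * v x) - (LINT x|M. H x) * m = (LINT x|M. H x * v x - m * H x)"
   using i1 iH by (simp add: mult.commute)
  also have "\<dots> = (LINT x|M. H x * w x - H x * \<L> w x)"
  proof (intro integral_cong_AE AE_mp[OF AE_G AE_I2] impI)
   fix x assume "x \<in> G"
   then have "v x = m + w x - \<L> w x" using eq by force
   then show "H x * v x - m * H x = H x * w x - H x * \<L> w x"
    by (simp only:) (simp add: algebra_simps)
  qed (use i1 in auto)
  also have "\<dots> = (LINT x|M. H x * w x) - (LINT x|M. H x * \<L> w x)" using i1 by simp
  also have "(LINT x|M. H x * \<L> w x) = (LINT x|M. H (T x) * w x)"
   by (rule integral_transfer) (use i2 in auto)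
  also have "(LINT x|M. H x * w x) - (LINT x|M. H (T x) * w x) = (LINT x|M. (H x - H (T x)) * w x)"
   using i1 i2 by (simp add: left_diff_distrib)
  finally have e: "(LINT x|M. H x * v x) - (LINT x|M. H x) * m = (LINT x|M. (H x - H (T x)) * w x)" .
  have i3: "integrable M (\<lambda>x. (H x - H (T x)) * w x)" using i1 i2 by (simp add: left_diff_distrib)
  have i4: "integrable M (\<lambda>x. \<bar>H x - H (T x)\<bar>)" using iH iHT by auto
  have "\<bar>LINT x|M. (H x - H (T x)) * w x\<bar> \<le> (LINT x|M. \<bar>(H x - H (T x)) * w x\<bar>)" by (rule integral_abs_bound)
  also have "\<dots> \<le> (LINT x|M. (C * 2 * c) * \<bar>H x - H (T x)\<bar>)"
  proof (intro integral_mono_AE AE_mp[OF AE_G AE_I2] impI)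
   fix x assume "x \<in> G"
   then have "\<bar>w x\<bar> \<le> C * 2 * c" using w by (auto simp: lip2_def mult.assoc)
   then show "\<bar>(H x - H (T x)) * w x\<bar> \<le> (C * 2 * c) * \<bar>H x - H (T x)\<bar>"
    unfolding abs_mult by (subst mult.commute) (rule mult_right_mono, auto)
  qed (use i3 i4 in auto)
  finally show "\<bar>(LINT x|M. H x * v x) - (LINT x|M. H x) * (LINT x|M. v x)\<bar> \<le> C * 2 * c * (LINT x|M. \<bar>H x - H (T x)\<bar>)"
   using e unfolding m_def by simp
 qed
qed

definition Creg :: real where "Creg = (1 + C0) * Kw"

lemma Creg_pos: "0 < Creg" unfolding Creg_def using C0_nonneg Kw_pos by auto

lemma transfer_reg': "\<lbrakk>reg e \<psi>; admissible e\<rbrakk> \<Longrightarrow> lip2 (Creg * esum e) (Creg * esum e) (\<L> \<psi>)"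
proof -
 assume *: "reg e \<psi>" "admissible e"
 have "Kw * esum e \<le> Creg * esum e"
  using Kw_pos C0_nonneg esum_nonneg[OF *(2)] by (intro mult_right_mono) (auto simp: Creg_def algebra_simps)
 then show ?thesis using lip2_mono[OF transfer_reg[OF *]] by (simp add: Creg_def)
qed

text \<open>Applying \<open>\<L>\<close> once makes \<open>\<psi>\<close> Lipschitz and moves
  \<open>H \<circ> T\<close> to \<open>H\<close>; this is why the observable is tested against
  \<open>H \<circ> T\<close>.\<close>

lemma reg_decorrelation:
 "\<exists>C>0. \<forall>e \<psi> H B. admissible e \<longrightarrow> reg e \<psi> \<longrightarrow> rv H \<longrightarrow> (\<forall>x\<in>space M. \<bar>H x\<bar> \<le> B) \<longrightarrow>
   \<bar>(LINT x|M. \<psi> x * H (T x)) - (LINT x|M. \<psi> x) * (LINT x|M. H x)\<bar> \<le> C * esum e * (LINT x|M. \<bar>H x - H (T x)\<bar>)"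
proof -
 obtain C where C: "0 < C" and dec: "\<And>c v H B. \<lbrakk>0 \<le> c; lip2 c c v; rv H; \<forall>x\<in>space M. \<bar>H x\<bar> \<le> B\<rbrakk> \<Longrightarrow>
   \<bar>(LINT x|M. H x * v x) - (LINT x|M. H x) * (LINT x|M. v x)\<bar> \<le> C * c * (LINT x|M. \<bar>H x - H (T x)\<bar>)"
  using lip2_decorrelation by blast
 show ?thesis
 proof (intro exI[of _ "C * Creg"] conjI allI impI)
  show "0 < C * Creg" using C Creg_pos by simp
  fix e \<psi> B and H :: "'a \<Rightarrow> real"
  assume e: "admissible e" and r: "reg e \<psi>" and H[measurable]: "rv H" and HB: "\<forall>x\<in>space M. \<bar>H x\<bar> \<le> B"
  have i: "integrable M \<psi>" by (rule reg_integrable[OF r e])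
  have "integrable M (\<lambda>x. H (T x) * \<psi> x)"
   by (rule integrable_times_bounded[OF i, of _ B]) (use HB T_space in auto)
  then have "(LINT x|M. \<psi> x * H (T x)) = (LINT x|M. H x * \<L> \<psi> x)"
   using integral_transfer[of \<psi> H] i by (simp add: mult.commute)
  moreover have "(LINT x|M. \<L> \<psi> x) = (LINT x|M. \<psi> x)" by (rule integrable_transfer'(2)[OF i])
  ultimately show "\<bar>(LINT x|M. \<psi> x * H (T x)) - (LINT x|M. \<psi> x) * (LINT x|M. H x)\<bar> \<le> C * Creg * esum e * (LINT x|M. \<bar>H x - H (T x)\<bar>)"
   using dec[OF _ transfer_reg'[OF r e] H HB] Creg_pos esum_nonneg[OF e] by (simp add: mult.commute mult.left_commute)
 qed
qed

text \<open>Gordin's method: if \<open>\<L> \<psi> = u - \<L> u\<close>, then \<open>\<L>\<close>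
  annihilates \<open>\<psi> + u - u \<circ> T\<close> almost everywhere, because
  \<open>\<L> (u \<circ> T) = u\<close>. By duality this function is orthogonal to every bounded
  \<open>h \<circ> T\<close>, that is, a reversed martingale difference.\<close>

lemma gordin_decomposition:
 "\<exists>C>0. \<forall>e \<psi>. admissible e \<longrightarrow> reg e \<psi> \<longrightarrow> (LINT x|M. \<psi> x) = 0 \<longrightarrow>
   (\<exists>u. rv u \<and> (\<forall>x. \<bar>u x\<bar> \<le> C * esum e) \<and>
    (\<forall>h B. rv h \<longrightarrow> (\<forall>x\<in>space M. \<bar>h x\<bar> \<le> B) \<longrightarrow>
      (LINT x|M. (\<psi> x + u x - u (T x)) * h (T x)) = 0) \<and>
    reg (\<lambda>a. e a + 2 * C * esum e) (\<lambda>x. \<psi> x + u x - u (T x)))"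
proof -
 obtain C where C: "0 < C" and poisson: "\<And>c v. \<lbrakk>0 \<le> c; lip2 c c v; (LINT x|M. v x) = 0\<rbrakk> \<Longrightarrow>
   \<exists>w. lip2 (C * c) (C * c) w \<and> (\<forall>x\<in>G. v x = w x - \<L> w x)"
  using poisson_equation by blast
 show ?thesis
 proof (intro exI[of _ "C * Creg"] conjI allI impI)
  show "0 < C * Creg" using C Creg_pos by simp
  fix e \<psi> assume e: "admissible e" and r: "reg e \<psi>" and z: "(LINT x|M. \<psi> x) = 0"
  have i: "integrable M \<psi>" by (rule reg_integrable[OF r e])
  have [measurable]: "rv \<psi>" using i by auto
  define s where "s = C * Creg * esum e"
  have s: "0 \<le> s" unfolding s_def using C Creg_pos esum_nonneg[OF e] by simp
  have "(LINT x|M. \<L> \<psi> x) = 0" using integrable_transfer'(2)[OF i] z by simp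
  then obtain w where w: "lip2 s s w" and eq: "\<forall>x\<in>G. \<L> \<psi> x = w x - \<L> w x"
   using poisson[OF _ transfer_reg'[OF r e]] Creg_pos esum_nonneg[OF e] by (auto simp: s_def mult.assoc)
  \<comment> \<open>Setting \<open>u\<close> to 0 off \<open>G\<close> makes its bound hold at every
    point, as the pathwise estimates of Birkhoff sums need.\<close>
  define u where "u x = (if x \<in> G then w x else 0)" for x
  have [measurable]: "rv w" using lip2_meas[OF w] .
  have um[measurable]: "rv u" unfolding u_def[abs_def] by measurable
  have uL: "lip2 s s u" by (rule lip2_cong[OF w um]) (simp add: u_def)
  have ub: "\<bar>u x\<bar> \<le> s" for x using w s by (auto simp: u_def lip2_def)
  have iu: "integrable M u" by (rule lip2_integrable[OF uL])
  have itu: "integrable M (\<L> u)" by (rule integrable_transfer'(1)[OF iu])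
  have it\<psi>: "integrable M (\<L> \<psi>)" by (rule integrable_transfer'(1)[OF i])
  have tu: "\<L> u y = \<L> w y" if "y \<in> G" for y
   by (rule transfer_cong[OF that]) (simp add: u_def)
  have mart: "(LINT x|M. (\<psi> x + u x - u (T x)) * h (T x)) = 0"
   if h[measurable]: "rv h" and hB: "\<forall>x\<in>space M. \<bar>h x\<bar> \<le> B" for h B
  proof -
   have hTB: "\<bar>h (T x)\<bar> \<le> B" if "x \<in> space M" for x using hB T_space that by auto
   have i1: "integrable M (\<lambda>x. h (T x) * \<psi> x)" "integrable M (\<lambda>x. h (T x) * u x)" "integrable M (\<lambda>x. h (T x) * u (T x))"
    using integrable_times_bounded[OF i _ hTB] integrable_times_bounded[OF iu _ hTB]
     integrable_times_bounded[OF integrable_T[OF iu] _ hTB] by auto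
   have i2: "integrable M (\<lambda>x. h x * u x)" "integrable M (\<lambda>x. h x * \<L> \<psi> x)" "integrable M (\<lambda>x. h x * \<L> u x)"
    using integrable_times_bounded[OF _ h] hB iu it\<psi> itu by blast+
   have "(LINT x|M. (\<psi> x + u x - u (T x)) * h (T x))
     = (LINT x|M. h (T x) * \<psi> x + h (T x) * u x - h (T x) * u (T x))" by (simp add: algebra_simps)
   also have "\<dots> = (LINT x|M. h (T x) * \<psi> x) + (LINT x|M. h (T x) * u x) - (LINT x|M. h (T x) * u (T x))"
    using i1 by simp
   also have "(LINT x|M. h (T x) * \<psi> x) = (LINT x|M. h x * \<L> \<psi> x)"
    by (rule integral_transfer[symmetric]) (use i1 in auto)
   also have "(LINT x|M. h (T x) * u x) = (LINT x|M. h x * \<L> u x)"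
    by (rule integral_transfer[symmetric]) (use i1 in auto)
   also have "(LINT x|M. h (T x) * u (T x)) = (LINT x|M. h x * u x)"
    by (rule integral_T[of "\<lambda>x. h x * u x"]) auto
   also have "(LINT x|M. h x * \<L> \<psi> x) + (LINT x|M. h x * \<L> u x) - (LINT x|M. h x * u x)
    = (LINT x|M. h x * \<L> \<psi> x + h x * \<L> u x - h x * u x)" using i2 by simp
   also have "\<dots> = 0"
   proof (intro integral_eq_zero_AE AE_mp[OF AE_G AE_I2] impI)
    fix x assume x: "x \<in> G"
    then have "\<L> \<psi> x = u x - \<L> u x" using eq tu by (simp add: u_def)
    then show "h x * \<L> \<psi> x + h x * \<L> u x - h x * u x = 0"
     by (simp only:) (simp add: algebra_simps)
   qed
   finally show ?thesis .
  qed
  have "reg (\<lambda>a. e a + 2 * s) (\<lambda>x. \<psi> x + u x - u (T x))" unfolding reg_def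
  proof (intro conjI ballI impI)
   fix a x assume a: "a \<in> \<alpha>" "x \<in> a \<inter> G"
   have "\<bar>\<psi> x\<bar> \<le> e a" using reg_bound[OF r a(1)] a(2) by auto
   then show "\<bar>\<psi> x + u x - u (T x)\<bar> \<le> e a + 2 * s" using ub[of x] ub[of "T x"] by linarith
  next
   fix a b x x' assume a: "a \<in> \<alpha>" "b \<in> \<alpha>" "x \<in> a \<inter> G" "x' \<in> a \<inter> G" "T x \<in> b" "T x' \<in> b"
   have 1: "\<bar>\<psi> x - \<psi> x'\<bar> \<le> e a * d (T x) (T x')" using r a unfolding reg_def by blast
   have "\<bar>u x - u x'\<bar> \<le> s * d x x'" using uL a unfolding lip2_def by blast
   also have "\<dots> \<le> s * d (T x) (T x')" using expanding_le[OF a(1)] a s by (intro mult_left_mono) auto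
   finally have 2: "\<bar>u x - u x'\<bar> \<le> s * d (T x) (T x')" .
   have 3: "\<bar>u (T x) - u (T x')\<bar> \<le> s * d (T x) (T x')" using uL a T_G unfolding lip2_def by blast
   have "(e a + 2 * s) * d (T x) (T x') = e a * d (T x) (T x') + s * d (T x) (T x') + s * d (T x) (T x')"
    by (simp add: algebra_simps)
   then show "\<bar>\<psi> x + u x - u (T x) - (\<psi> x' + u x' - u (T x'))\<bar> \<le> (e a + 2 * s) * d (T x) (T x')"
    using 1 2 3 by linarith
  qed measurable
  then show "\<exists>u. rv u \<and> (\<forall>x. \<bar>u x\<bar> \<le> C * Creg * esum e) \<and>
    (\<forall>h B. rv h \<longrightarrow> (\<forall>x\<in>space M. \<bar>h x\<bar> \<le> B) \<longrightarrow>
      (LINT x|M. (\<psi> x + u x - u (T x)) * h (T x)) = 0) \<and>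
    reg (\<lambda>a. e a + 2 * (C * Creg) * esum e) (\<lambda>x. \<psi> x + u x - u (T x))"
   using um ub mart by (intro exI[of _ u]) (auto simp: s_def mult.assoc)
 qed
qed

text \<open>The Lipschitz constant does not grow with \<open>k\<close>, because paired preimages
  approach each other geometrically. It is the fixed point of
  \<open>D \<mapsto> C0 + L * \<beta>0 * (Kw * esum e) + D / \<kappa>\<close>, where the middle term
  is the price of one more summand of the Birkhoff sum.\<close>

lemma transfer_iter_birkhoff:
 assumes f: "reg e f" "admissible e" and \<phi>b: "\<And>x. \<bar>\<phi> x\<bar> \<le> 1" and \<phi>L: "\<And>x y. \<bar>\<phi> x - \<phi> y\<bar> \<le> L * \<bar>x - y\<bar>"
  and L: "0 \<le> L" and \<beta>: "0 \<le> \<beta>" "\<beta> \<le> \<beta>0"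
  and \<phi>m: "\<phi> \<in> borel_measurable borel"
 shows "lip2 1 ((C0 + L * \<beta>0 * (Kw * esum e)) / (1 - 1 / \<kappa>)) ((\<L> ^^ k) (\<lambda>x. \<phi> (\<beta> * Sn f k x)))"
proof -
 define D where "D = (C0 + L * \<beta>0 * (Kw * esum e)) / (1 - 1 / \<kappa>)"
 have es: "0 \<le> Kw * esum e" using Kw_pos esum_nonneg[OF f(2)] by simp
 have D: "0 \<le> D" unfolding D_def using mult_nonneg_nonneg[OF mult_nonneg_nonneg[OF L order_trans[OF \<beta>]] es] C0_nonneg \<kappa>_inv
  by (intro divide_nonneg_pos add_nonneg_nonneg) auto
 have D_eq: "C0 + L * \<beta>0 * (Kw * esum e) + D / \<kappa> = D" unfolding D_def using \<kappa>_gt_1 by (simp add: field_simps)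
 have [measurable]: "rv f" using reg_meas[OF f(1)] .
 note [measurable] = \<phi>m
 \<comment> \<open>Splitting off the last summand \<open>f z\<close>, with
   \<open>z = (T ^^ k) x\<close>, leaves the same expression with a shifted argument, so the
   induction runs over all offsets \<open>s\<close> at once.\<close>
 define \<Phi> where "\<Phi> k s = (\<L> ^^ k) (\<lambda>x. \<phi> (s + \<beta> * Sn f k x))" for k and s :: real
 have bu: "bdd_on_G (\<lambda>x. \<phi> (q x))" for q by (rule bdd_on_GI[where c=1]) (rule \<phi>b)
 have \<Phi>b: "\<bar>\<Phi> k s y\<bar> \<le> 1" if "y \<in> G" for k s y
  unfolding \<Phi>_def by (rule transfer_iter_abs_le[OF _ that]) (rule \<phi>b)
 have \<Phi>s: "\<bar>\<Phi> k s y - \<Phi> k s' y\<bar> \<le> L * \<bar>s - s'\<bar>" if "y \<in> G" for k s s' y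
  unfolding \<Phi>_def
 proof (rule transfer_iter_diff_le[OF bu bu _ that])
  fix x assume "x \<in> G"
  show "\<bar>\<phi> (s + \<beta> * Sn f k x) - \<phi> (s' + \<beta> * Sn f k x)\<bar> \<le> L * \<bar>s - s'\<bar>"
   using \<phi>L[of "s + \<beta> * Sn f k x" "s' + \<beta> * Sn f k x"] by simp
 qed
 have rec: "\<Phi> (Suc k) s y = \<L> (\<lambda>z. \<Phi> k (s + \<beta> * f z) z) y" if "y \<in> G" for k s y
 proof -
  have "\<Phi> (Suc k) s y = \<L> ((\<L> ^^ k) (\<lambda>x. \<phi> (s + \<beta> * Sn f (Suc k) x))) y"
   unfolding \<Phi>_def by simp
  also have "\<dots> = \<L> (\<lambda>z. \<Phi> k (s + \<beta> * f z) z) y"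
  proof (rule transfer_cong[OF that])
   fix z assume "z \<in> G"
   then show "(\<L> ^^ k) (\<lambda>x. \<phi> (s + \<beta> * Sn f (Suc k) x)) z = \<Phi> k (s + \<beta> * f z) z"
    unfolding \<Phi>_def by (intro transfer_iter_cong) (auto simp: birkhoff_sum_def algebra_simps)
  qed
  finally show ?thesis .
 qed
 have main: "\<bar>\<Phi> k s y - \<Phi> k s y'\<bar> \<le> D * d y y'" if "b \<in> \<alpha>" "y \<in> b" "y' \<in> b" "y \<in> G" "y' \<in> G" for k s b y y'
  using that
 proof (induction k arbitrary: s b y y')
  case 0
  then show ?case using D d_nonneg by (simp add: \<Phi>_def birkhoff_sum_def)
 next
  case (Suc k)
  note yb = Suc.prems
  define \<Delta> where "\<Delta> a = (L * \<beta> * d y y') * e a + D * d y y' / \<kappa>" for a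
  have dn: "0 \<le> D * d y y' / \<kappa>" "0 \<le> L * \<beta> * d y y'" using D d_nonneg \<kappa>_gt_1 L \<beta> by auto
  have \<Delta>a: "admissible \<Delta>" unfolding \<Delta>_def[abs_def]
   by (intro admissible_add admissible_cmult admissible_const f(2) dn)
  have "\<bar>\<L> (\<lambda>z. \<Phi> k (s + \<beta> * f z) z) y - \<L> (\<lambda>z. \<Phi> k (s + \<beta> * f z) z) y'\<bar> \<le>
   C0 * d y y' * (LINT a|cs. weight a y' * 1) + (LINT a|cs. weight a y' * \<Delta> a)"
  proof (rule transfer_Lipschitz[OF yb admissible_const _ _ \<Delta>a])
   fix a x x' assume a: "a \<in> \<alpha>" "x \<in> a" "x' \<in> a" "x \<in> G" "x' \<in> G" "T x = y" "T x' = y'"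
   have 1: "\<bar>f x - f x'\<bar> \<le> e a * d y y'" using f(1) a yb unfolding reg_def by blast
   have "\<bar>\<Phi> k (s + \<beta> * f x) x - \<Phi> k (s + \<beta> * f x') x\<bar> \<le> L * \<bar>(s + \<beta> * f x) - (s + \<beta> * f x')\<bar>"
    by (rule \<Phi>s[OF a(4)])
   also have "(s + \<beta> * f x) - (s + \<beta> * f x') = \<beta> * (f x - f x')" by (simp add: algebra_simps)
   also have "L * \<bar>\<beta> * (f x - f x')\<bar> \<le> L * (\<beta> * (e a * d y y'))"
    using mult_left_mono[OF 1 \<beta>(1)] L \<beta> unfolding abs_mult by (intro mult_left_mono) auto
   finally have 2: "\<bar>\<Phi> k (s + \<beta> * f x) x - \<Phi> k (s + \<beta> * f x') x\<bar> \<le> (L * \<beta> * d y y') * e a"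
    by (simp add: ac_simps)
   have "\<bar>\<Phi> k (s + \<beta> * f x') x - \<Phi> k (s + \<beta> * f x') x'\<bar> \<le> D * d x x'"
    by (rule Suc.IH[OF a(1-5)])
   also have "\<dots> \<le> D * (d y y' / \<kappa>)" using expanding'[OF a(1-3)] a D by (intro mult_left_mono) auto
   finally show "\<bar>\<Phi> k (s + \<beta> * f x) x - \<Phi> k (s + \<beta> * f x') x'\<bar> \<le> \<Delta> a"
    using 2 unfolding \<Delta>_def by simp
  qed (use \<Phi>b in auto)
  also have "(LINT a|cs. weight a y' * 1) = 1" using integral_weight_1 yb by simp
  also have "(LINT a|cs. weight a y' * \<Delta> a)
   = (LINT a|cs. (L * \<beta> * d y y') * (weight a y' * e a) + (D * d y y' / \<kappa>) * weight a y')"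
   unfolding \<Delta>_def by (simp add: algebra_simps)
  also have "\<dots> = (L * \<beta> * d y y') * (LINT a|cs. weight a y' * e a) + D * d y y' / \<kappa>"
  proof -
   have i3: "integrable cs (\<lambda>a. weight a y' * e a)"
    by (rule integrable_weight[OF f(2)]) (use f(2) in \<open>auto simp: admissible_def\<close>)
   then show ?thesis using integrable_weight_1[of y'] integral_weight_1 yb by simp
  qed
  also have "C0 * d y y' * 1 + ((L * \<beta> * d y y') * (LINT a|cs. weight a y' * e a) + D * d y y' / \<kappa>)
    \<le> C0 * d y y' * 1 + ((L * \<beta>0 * d y y') * (Kw * esum e) + D * d y y' / \<kappa>)"
  proof -
   have "\<bar>LINT a|cs. weight a y' * e a\<bar> \<le> Kw * esum e"
    by (rule integral_weight_le[OF f(2)]) (use f(2) in \<open>auto simp: admissible_def\<close>)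
   then have "(L * \<beta> * d y y') * (LINT a|cs. weight a y' * e a) \<le> (L * \<beta> * d y y') * (Kw * esum e)"
    using dn by (intro mult_left_mono) auto
   also have "\<dots> \<le> (L * \<beta>0 * d y y') * (Kw * esum e)"
    using es L \<beta> d_nonneg by (intro mult_right_mono mult_left_mono) auto
   finally show ?thesis by simp
  qed
  also have "\<dots> = (C0 + L * \<beta>0 * (Kw * esum e) + D / \<kappa>) * d y y'" by (simp add: algebra_simps)
  finally show ?case unfolding D_eq rec[OF yb(4)] rec[OF yb(5)] .
 qed
 have e0: "(\<L> ^^ k) (\<lambda>x. \<phi> (\<beta> * Sn f k x)) = \<Phi> k 0" by (simp add: \<Phi>_def)
 have "integrable M (\<lambda>x. \<phi> (\<beta> * Sn f k x))"
  by (rule integrable_bounded[where B=1]) (auto simp: \<phi>b)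
 from transfer_iter_integral(1)[OF this, of k]
 have "\<Phi> k 0 \<in> borel_measurable M" unfolding e0 by auto
 then show ?thesis unfolding e0 D_def[symmetric] lip2_def using \<Phi>b main by blast
qed

text \<open>Past against future: duality replaces the past by its image under
  \<open>\<L> ^^ k\<close>, which is Lipschitz uniformly in \<open>k\<close>, so
  \<open>lip2_decorrelation\<close> applies with one constant for all \<open>k\<close>. The cap
  \<open>\<beta>0\<close> makes it uniform in \<open>\<beta>\<close> as well.\<close>

lemma birkhoff_decorrelation:
 assumes f: "reg e f" "admissible e" and \<phi>b: "\<And>x. \<bar>\<phi> x\<bar> \<le> 1" and \<phi>L: "\<And>x y. \<bar>\<phi> x - \<phi> y\<bar> \<le> L * \<bar>x - y\<bar>"
  and L: "0 \<le> L" and \<beta>0: "0 \<le> \<beta>0" and \<phi>m: "\<phi> \<in> borel_measurable borel"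
 shows "\<exists>C>0. \<forall>\<beta> k H B. 0 \<le> \<beta> \<longrightarrow> \<beta> \<le> \<beta>0 \<longrightarrow> rv H \<longrightarrow> (\<forall>x\<in>space M. \<bar>H x\<bar> \<le> B) \<longrightarrow>
   \<bar>(LINT x|M. \<phi> (\<beta> * Sn f k x) * H ((T ^^ k) x))
    - (LINT x|M. \<phi> (\<beta> * Sn f k x)) * (LINT x|M. H x)\<bar> \<le> C * (LINT x|M. \<bar>H x - H (T x)\<bar>)"
proof -
 obtain C where C: "0 < C" and dec: "\<And>c v H B. \<lbrakk>0 \<le> c; lip2 c c v; rv H; \<forall>x\<in>space M. \<bar>H x\<bar> \<le> B\<rbrakk> \<Longrightarrow>
   \<bar>(LINT x|M. H x * v x) - (LINT x|M. H x) * (LINT x|M. v x)\<bar> \<le> C * c * (LINT x|M. \<bar>H x - H (T x)\<bar>)"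
  using lip2_decorrelation by blast
 define D where "D = (C0 + L * \<beta>0 * (Kw * esum e)) / (1 - 1 / \<kappa>)"
 define c where "c = max 1 D"
 have [measurable]: "rv f" using reg_meas[OF f(1)] .
 note [measurable] = \<phi>m
 show ?thesis
 proof (intro exI[of _ "C * c"] conjI allI impI)
  show "0 < C * c" using C by (auto simp: c_def max_def)
  fix \<beta> k B and H :: "'a \<Rightarrow> real"
  assume \<beta>: "0 \<le> \<beta>" "\<beta> \<le> \<beta>0" and H: "rv H" and HB: "\<forall>x\<in>space M. \<bar>H x\<bar> \<le> B"
  let ?u = "\<lambda>x. \<phi> (\<beta> * Sn f k x)"
  have iu: "integrable M ?u" by (rule integrable_bounded[where B=1]) (auto simp: \<phi>b)
  have "lip2 1 D ((\<L> ^^ k) ?u)" unfolding D_def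
   by (rule transfer_iter_birkhoff[OF f \<phi>b \<phi>L L \<beta> \<phi>m])
  then have l: "lip2 c c ((\<L> ^^ k) ?u)" by (rule lip2_mono) (auto simp: c_def)
  have "(LINT x|M. ?u x * H ((T ^^ k) x)) = (LINT x|M. H x * (\<L> ^^ k) ?u x)"
   using integral_transfer_iter[OF iu H, of B k] HB by (simp add: mult.commute)
  then show "\<bar>(LINT x|M. ?u x * H ((T ^^ k) x)) - (LINT x|M. ?u x) * (LINT x|M. H x)\<bar>
    \<le> C * c * (LINT x|M. \<bar>H x - H (T x)\<bar>)"
   using dec[OF _ l H HB] transfer_iter_integral(2)[OF iu, of k] by (simp add: c_def mult.commute)
 qed
qed

end

section \<open>Characteristic functions of Birkhoff sums\<close>

text \<open>Compare \<open>\<theta> n\<close> with \<open>exp (\<psi> / n)\<close>: both lie in the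
  closed unit disc, the latter because \<open>Re \<psi> \<le> 0\<close>, and there
  \<open>n\<close>-th powers differ by at most \<open>n\<close> times the difference of the
  bases.\<close>

lemma power_tendsto_exp:
 fixes \<theta> :: "nat \<Rightarrow> complex" and \<psi> :: complex
 assumes lim: "(\<lambda>n. of_nat n * (\<theta> n - 1)) \<longlonglongrightarrow> \<psi>" and le: "\<And>n. norm (\<theta> n) \<le> 1" and re: "Re \<psi> \<le> 0"
 shows "(\<lambda>n. \<theta> n ^ n) \<longlonglongrightarrow> exp \<psi>"
proof -
 have d: "(\<lambda>n. of_nat n * (exp (\<psi> / of_nat n) - 1)) \<longlonglongrightarrow> \<psi>"
 proof (cases "\<psi> = 0")
  case False
  have "((\<lambda>z::complex. (exp z - 1) / z) \<longlongrightarrow> 1) (at 0)"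
   using DERIV_exp[of "0::complex"] by (simp add: has_field_derivative_iff)
  moreover have "filterlim (\<lambda>n. \<psi> / of_nat n) (at 0) sequentially"
   unfolding filterlim_at
  proof
   show "(\<lambda>n. \<psi> / of_nat n) \<longlonglongrightarrow> 0" by (rule lim_const_over_n)
   show "EV n. \<psi> / of_nat n \<in> UNIV \<and> \<psi> / of_nat n \<noteq> 0"
    using eventually_gt_at_top[of 0] by eventually_elim (use False in auto)
  qed
  ultimately have "(\<lambda>n. (exp (\<psi> / of_nat n) - 1) / (\<psi> / of_nat n)) \<longlonglongrightarrow> 1" by (rule filterlim_compose)
  from tendsto_mult[OF this tendsto_const[of \<psi>]]
  have "(\<lambda>n. (exp (\<psi> / of_nat n) - 1) / (\<psi> / of_nat n) * \<psi>) \<longlonglongrightarrow> \<psi>" by simp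
  then show ?thesis
   by (rule Lim_transform_eventually) (use eventually_gt_at_top[of 0] in eventually_elim, use False in auto)
 qed auto
 have diff: "(\<lambda>n. \<theta> n ^ n - exp \<psi>) \<longlonglongrightarrow> 0"
 proof (rule Lim_null_comparison)
  have "(\<lambda>n. of_nat n * (\<theta> n - 1) - of_nat n * (exp (\<psi> / of_nat n) - 1)) \<longlonglongrightarrow> \<psi> - \<psi>"
   by (intro tendsto_diff lim d)
  then show "(\<lambda>n. norm (of_nat n * (\<theta> n - 1) - of_nat n * (exp (\<psi> / of_nat n) - 1))) \<longlonglongrightarrow> 0"
   using tendsto_norm_zero by simp
  show "EV n. norm (\<theta> n ^ n - exp \<psi>) \<le> norm (of_nat n * (\<theta> n - 1) - of_nat n * (exp (\<psi> / of_nat n) - 1))"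
   using eventually_gt_at_top[of 0]
  proof eventually_elim
   case (elim n)
   have "exp \<psi> = exp (\<psi> / of_nat n) ^ n" using elim by (simp add: exp_of_nat_mult[symmetric])
   moreover have "norm (exp (\<psi> / of_nat n)) \<le> 1" using re elim by (simp add: divide_nonpos_pos)
   ultimately have "norm (\<theta> n ^ n - exp \<psi>) \<le> real n * norm (\<theta> n - exp (\<psi> / of_nat n))"
    using norm_power_diff[OF le] by simp
   also have "\<dots> = norm (of_nat n * (\<theta> n - exp (\<psi> / of_nat n)))" by (simp add: norm_mult)
   finally show ?case by (simp add: algebra_simps)
  qed
 qed
 then show ?thesis by (simp add: LIM_zero_iff)
qed

lemma abs_cos_diff_le: "\<bar>cos x - cos y\<bar> \<le> \<bar>x - y\<bar>" for x y :: real
 using field_differentiable_bound[of UNIV cos "\<lambda>x. - sin x" 1 y x] by (auto intro: DERIV_cos)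

lemma abs_sin_diff_le: "\<bar>sin x - sin y\<bar> \<le> \<bar>x - y\<bar>" for x y :: real
 using field_differentiable_bound[of UNIV sin cos 1 y x] by (auto intro: DERIV_sin)

lemma norm_iexp_diff_le: "norm (iexp x - iexp y) \<le> \<bar>x - y\<bar>"
proof -
 have "iexp x - iexp y = iexp y * (iexp (x - y) - 1)"
  by (simp add: algebra_simps exp_diff)
 then have "norm (iexp x - iexp y) = norm (iexp (x - y) - 1)" by (simp add: norm_mult)
 also have "\<dots> \<le> \<bar>x - y\<bar>" using iexp_approx1[of "x - y" 0] by simp
 finally show ?thesis .
qed

context gm_map begin

lemma birkhoff_Suc: "Sn g (Suc k) x = g x + Sn g k (T x)"
 unfolding birkhoff_sum_def sum.lessThan_Suc_shift by (simp add: funpow_swap1)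

lemma birkhoff_Suc': "Sn g (Suc k) x = Sn g k x + g ((T ^^ k) x)"
 unfolding birkhoff_sum_def by simp

text \<open>Composing with \<open>T\<close> changes a Birkhoff sum by two terms only, whatever
  \<open>k\<close>. This is the almost invariance that feeds the decorrelation bounds.\<close>

lemma birkhoff_T: "Sn g k x - Sn g k (T x) = g x - g ((T ^^ k) x)"
 using birkhoff_Suc[of g k x] birkhoff_Suc'[of g k x] by simp

lemma distr_iter: "distr M M (T ^^ k) = M"
proof (induction k)
 case (Suc k)
 have "distr M M (T ^^ Suc k) = distr (distr M M (T ^^ k)) M T"
  by (subst distr_distr) (auto simp: comp_def)
 then show ?case using Suc T_inv by (simp add: comp_def)
qed (simp add: distr_id[unfolded id_def] id_def)

lemma integrable_iter: "integrable M h \<Longrightarrow> integrable M (\<lambda>x. h ((T ^^ k) x))" for h :: "'a \<Rightarrow> real"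
 using integrable_distr[OF iter_meas[of k], of h] distr_iter by simp

lemma integral_iter: "rv h \<Longrightarrow> (LINT x|M. h ((T ^^ k) x)) = (LINT x|M. h x)" for h :: "'a \<Rightarrow> real"
 using integral_distr[OF iter_meas[of k], of h] distr_iter by simp

lemma birkhoff_T_integral:
 assumes g: "integrable M g"
 shows "integrable M (\<lambda>x. \<bar>Sn g k x - Sn g k (T x)\<bar>)" (is ?Q)
  "(LINT x|M. \<bar>Sn g k x - Sn g k (T x)\<bar>) \<le> 2 * (LINT x|M. \<bar>g x\<bar>)" (is ?P)
proof -
 have [measurable]: "rv g" using g by auto
 have i: "integrable M (\<lambda>x. \<bar>g ((T ^^ k) x)\<bar>)" using integrable_iter[of "\<lambda>x. \<bar>g x\<bar>" k] g by auto
 show i2: ?Q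
  unfolding birkhoff_T using g integrable_iter[OF g] by auto
 have "(LINT x|M. \<bar>Sn g k x - Sn g k (T x)\<bar>) \<le> (LINT x|M. \<bar>g x\<bar> + \<bar>g ((T ^^ k) x)\<bar>)"
  using i2 unfolding birkhoff_T by (intro integral_mono) (use i g in auto)
 also have "\<dots> = (LINT x|M. \<bar>g x\<bar>) + (LINT x|M. \<bar>g ((T ^^ k) x)\<bar>)" using i g by simp
 also have "(LINT x|M. \<bar>g ((T ^^ k) x)\<bar>) = (LINT x|M. \<bar>g x\<bar>)" by (rule integral_iter) auto
 finally show ?P by simp
qed

lemma
 assumes [measurable]: "rv g"
 shows integrable_iexp': "integrable M (\<lambda>x. iexp (g x))" (is ?X)
  and Re_integral_iexp: "Re (LINT x|M. iexp (g x)) = (LINT x|M. cos (g x))" (is ?R)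
  and Im_integral_iexp: "Im (LINT x|M. iexp (g x)) = (LINT x|M. sin (g x))" (is ?Q)
  and norm_integral_iexp: "norm (LINT x|M. iexp (g x)) \<le> 1" (is ?P)
proof -
 show i: ?X by (rule integrable_const_bound[where B=1]) auto
 show ?R using i by (simp add: integral_Re[symmetric] Re_exp)
 show ?Q using i by (simp add: integral_Im[symmetric] Im_exp)
 have "norm (LINT x|M. iexp (g x)) \<le> (LINT x|M. norm (iexp (g x)))" by (rule integral_norm_bound)
 then show ?P using prob_space by simp
qed

text \<open>
 Conditioning on the first step, the characteristic functions \<open>a\<^sub>k\<close> of the Birkhoff sums satisfy
 \<open>a\<^sub>k\<^sub>+\<^sub>1 = \<theta> a\<^sub>k\<close> up to an error controlled by the almost invariance of \<open>S\<^sub>k\<close> under \<open>T\<close>.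
\<close>
lemma char_recursion:
 assumes g: "integrable M g" and \<epsilon>: "0 \<le> \<epsilon>"
  and dcos: "\<And>H. \<lbrakk>rv H; \<forall>x\<in>space M. \<bar>H x\<bar> \<le> 1\<rbrakk> \<Longrightarrow>
   \<bar>(LINT x|M. cos (s * g x) * H (T x)) - (LINT x|M. cos (s * g x)) * (LINT x|M. H x)\<bar> \<le> \<epsilon> * (LINT x|M. \<bar>H x - H (T x)\<bar>)"
  and dsin: "\<And>H. \<lbrakk>rv H; \<forall>x\<in>space M. \<bar>H x\<bar> \<le> 1\<rbrakk> \<Longrightarrow>
   \<bar>(LINT x|M. sin (s * g x) * H (T x)) - (LINT x|M. sin (s * g x)) * (LINT x|M. H x)\<bar> \<le> \<epsilon> * (LINT x|M. \<bar>H x - H (T x)\<bar>)"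
 shows "norm ((LINT x|M. iexp (s * Sn g n x)) - (LINT x|M. iexp (s * g x)) ^ n)
  \<le> real n * (8 * \<epsilon> * \<bar>s\<bar> * (LINT x|M. \<bar>g x\<bar>))"
proof (induction n)
 case 0
 show ?case using prob_space by (simp add: birkhoff_sum_def)
next
 case (Suc k)
 have [measurable]: "rv g" using g by auto
 have [measurable]: "Sn g k \<in> borel_measurable M" for k by measurable
 let ?S = "Sn g k" and ?\<theta> = "(LINT x|M. iexp (s * g x))"
 define c c' where "c = (LINT x|M. cos (s * ?S x))" and "c' = (LINT x|M. sin (s * ?S x))"
 define p p' where "p = (LINT x|M. cos (s * g x))" and "p' = (LINT x|M. sin (s * g x))"
 define \<Delta> where "\<Delta> = \<epsilon> * (2 * \<bar>s\<bar> * (LINT x|M. \<bar>g x\<bar>))"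
 have ib: "integrable M (\<lambda>x. q x * q' x)" if [measurable]: "rv q" "rv q'"
  and "\<And>x. \<bar>q x\<bar> \<le> 1" "\<And>x. \<bar>q' x\<bar> \<le> 1" for q q' :: "'a \<Rightarrow> real"
 proof (rule integrable_const_bound[where B=1])
  show "AE x in M. norm (q x * q' x) \<le> 1" using mult_mono[OF that(3,4)] by (intro AE_I2) (auto simp: abs_mult)
 qed measurable
 \<comment> \<open>For 1-Lipschitz \<open>h\<close> the defect of invariance of
   \<open>h (s * S\<^sub>k)\<close> is at most \<open>|s|\<close> times that of
   \<open>S\<^sub>k\<close>, hence bounded independently of \<open>k\<close>.\<close>
 have lip: "\<epsilon> * (LINT x|M. \<bar>h (s * ?S x) - h (s * ?S (T x))\<bar>) \<le> \<Delta>"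
  if h: "\<And>x y::real. \<bar>h x - h y\<bar> \<le> \<bar>x - y\<bar>" and [measurable]: "h \<in> borel_measurable borel" and hb: "\<And>x. \<bar>h x\<bar> \<le> 1" for h :: "real \<Rightarrow> real"
 proof -
  have "(LINT x|M. \<bar>h (s * ?S x) - h (s * ?S (T x))\<bar>) \<le> (LINT x|M. \<bar>s\<bar> * \<bar>?S x - ?S (T x)\<bar>)"
  proof (rule integral_mono)
   show "integrable M (\<lambda>x. \<bar>h (s * ?S x) - h (s * ?S (T x))\<bar>)"
    by (rule integrable_const_bound[where B=2])
      (auto intro!: AE_I2 order_trans[OF abs_triangle_ineq4] add_mono[OF hb hb, simplified])
   show "integrable M (\<lambda>x. \<bar>s\<bar> * \<bar>?S x - ?S (T x)\<bar>)" using birkhoff_T_integral(1)[OF g] by simp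
   show "\<bar>h (s * ?S x) - h (s * ?S (T x))\<bar> \<le> \<bar>s\<bar> * \<bar>?S x - ?S (T x)\<bar>" for x
    using h[of "s * ?S x" "s * ?S (T x)"] by (simp add: right_diff_distrib[symmetric] abs_mult)
  qed
  also have "\<dots> \<le> \<bar>s\<bar> * (2 * (LINT x|M. \<bar>g x\<bar>))"
   using birkhoff_T_integral(2)[OF g, of k] by (simp add: mult_left_mono)
  finally show ?thesis unfolding \<Delta>_def using \<epsilon> by (auto intro!: mult_left_mono)
 qed
 note lc = lip[of cos, OF abs_cos_diff_le _ abs_cos_le_one, simplified]
 note ls = lip[of sin, OF abs_sin_diff_le _ abs_sin_le_one, simplified]
 have 1: "\<bar>(LINT x|M. cos (s * g x) * cos (s * ?S (T x))) - p * c\<bar> \<le> \<Delta>"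
  using order_trans[OF dcos[of "\<lambda>x. cos (s * ?S x)"] lc] by (simp add: p_def c_def)
 have 2: "\<bar>(LINT x|M. sin (s * g x) * sin (s * ?S (T x))) - p' * c'\<bar> \<le> \<Delta>"
  using order_trans[OF dsin[of "\<lambda>x. sin (s * ?S x)"] ls] by (simp add: p'_def c'_def)
 have 3: "\<bar>(LINT x|M. sin (s * g x) * cos (s * ?S (T x))) - p' * c\<bar> \<le> \<Delta>"
  using order_trans[OF dsin[of "\<lambda>x. cos (s * ?S x)"] lc] by (simp add: p'_def c_def)
 have 4: "\<bar>(LINT x|M. cos (s * g x) * sin (s * ?S (T x))) - p * c'\<bar> \<le> \<Delta>"
  using order_trans[OF dcos[of "\<lambda>x. sin (s * ?S x)"] ls] by (simp add: p_def c'_def)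
 have ar: "s * Sn g (Suc k) x = s * g x + s * ?S (T x)" for x
  by (simp add: birkhoff_Suc distrib_left)
 have re: "(LINT x|M. cos (s * Sn g (Suc k) x))
   = (LINT x|M. cos (s * g x) * cos (s * ?S (T x))) - (LINT x|M. sin (s * g x) * sin (s * ?S (T x)))"
  unfolding ar cos_add by (rule lint_diff) (intro ib, auto)+
 have im: "(LINT x|M. sin (s * Sn g (Suc k) x))
   = (LINT x|M. sin (s * g x) * cos (s * ?S (T x))) + (LINT x|M. cos (s * g x) * sin (s * ?S (T x)))"
  unfolding ar sin_add by (rule lint_add) (intro ib, auto)+
 let ?a = "\<lambda>k. (LINT x|M. iexp (s * Sn g k x))"
 have pth: "Re ?\<theta> = p" "Im ?\<theta> = p'" "Re (?a k) = c" "Im (?a k) = c'"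
  unfolding p_def p'_def c_def c'_def by (rule Re_integral_iexp Im_integral_iexp; measurable)+
 have reS: "Re (?a (Suc k)) = (LINT x|M. cos (s * Sn g (Suc k) x))"
  "Im (?a (Suc k)) = (LINT x|M. sin (s * Sn g (Suc k) x))"
  by (rule Re_integral_iexp Im_integral_iexp; measurable)+
 have "\<bar>Re (?a (Suc k) - ?\<theta> * ?a k)\<bar> \<le> 2 * \<Delta>"
  unfolding minus_complex.simps times_complex.simps pth reS re using 1 2 by linarith
 moreover have "\<bar>Im (?a (Suc k) - ?\<theta> * ?a k)\<bar> \<le> 2 * \<Delta>"
  unfolding minus_complex.simps times_complex.simps pth reS im using 3 4 by linarith
 ultimately have err: "norm (?a (Suc k) - ?\<theta> * ?a k) \<le> 4 * \<Delta>"
  using cmod_le[of "?a (Suc k) - ?\<theta> * ?a k"] by linarith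
 have th1: "norm ?\<theta> \<le> 1" by (rule norm_integral_iexp) measurable
 \<comment> \<open>Since \<open>?\<theta>\<close> has norm at most 1, the errors of successive steps
   add up without being amplified.\<close>
 have eq: "?a (Suc k) - ?\<theta> ^ Suc k = (?a (Suc k) - ?\<theta> * ?a k) + ?\<theta> * (?a k - ?\<theta> ^ k)"
  by (simp add: algebra_simps)
 have n1: "norm (?a (Suc k) - ?\<theta> ^ Suc k) \<le> norm (?a (Suc k) - ?\<theta> * ?a k) + norm (?\<theta> * (?a k - ?\<theta> ^ k))"
  unfolding eq by (rule norm_triangle_ineq)
 have n2: "norm (?\<theta> * (?a k - ?\<theta> ^ k)) \<le> 1 * (real k * (8 * \<epsilon> * \<bar>s\<bar> * (LINT x|M. \<bar>g x\<bar>)))"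
  unfolding norm_mult using Suc.IH th1 by (intro mult_mono) auto
 have "4 * \<Delta> + 1 * (real k * (8 * \<epsilon> * \<bar>s\<bar> * (LINT x|M. \<bar>g x\<bar>)))
   = real (Suc k) * (8 * \<epsilon> * \<bar>s\<bar> * (LINT x|M. \<bar>g x\<bar>))"
  by (simp add: \<Delta>_def algebra_simps)
 with n1 n2 err show ?case by linarith
qed


section \<open>Doob's inequality for reversed martingales\<close>

lemma integral_le_sqrt:
 assumes [measurable]: "rv X" and X: "integrable M (\<lambda>x. (X x)\<^sup>2)"
 shows "integrable M X" "(LINT x|M. X x) \<le> sqrt (LINT x|M. (X x)\<^sup>2)" (is ?P)
proof -
 show i: "integrable M X" by (rule square_integrable_imp_integrable[OF _ X]) measurable
 define \<mu> where "\<mu> = (LINT x|M. X x)"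
 have "0 \<le> (LINT x|M. (X x - \<mu>)\<^sup>2)" by simp
 also have "(\<lambda>x. (X x - \<mu>)\<^sup>2) = (\<lambda>x. (X x)\<^sup>2 - 2 * \<mu> * X x + \<mu>\<^sup>2)" by (simp add: power2_eq_square algebra_simps)
 also have "(LINT x|M. (X x)\<^sup>2 - 2 * \<mu> * X x + \<mu>\<^sup>2) = (LINT x|M. (X x)\<^sup>2) - \<mu>\<^sup>2"
  using i X prob_space by (simp add: \<mu>_def power2_eq_square algebra_simps)
 finally show ?P
  unfolding \<mu>_def[symmetric] by (intro real_le_rsqrt) simp
qed

text \<open>By recursion this is the maximum of \<open>S\<^sub>n - S\<^sub>k\<close> over
  \<open>k \<le> n\<close>: the term \<open>k = 0\<close> is the new one, the others come from
  \<open>T x\<close>.\<close>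

fun revmax :: "('a \<Rightarrow> real) \<Rightarrow> nat \<Rightarrow> 'a \<Rightarrow> real" where
 "revmax F 0 x = 0"
| "revmax F (Suc n) x = max (revmax F n (T x)) (Sn F (Suc n) x)"

text \<open>The martingale transform of \<open>F\<close> by the running maximum: each increment is
  \<open>F\<close> times a function of \<open>T x\<close>, so it integrates to 0.\<close>

fun revmart :: "('a \<Rightarrow> real) \<Rightarrow> nat \<Rightarrow> 'a \<Rightarrow> real" where
 "revmart F 0 x = 0"
| "revmart F (Suc n) x = revmart F n (T x) + revmax F n (T x) * F x"

lemma revmax_nonneg: "0 \<le> revmax F n x"
 by (induction n arbitrary: x) (auto intro: order_trans[OF _ max.cobounded1])

lemma birkhoff_0 [simp]: "Sn F 0 x = 0"
 by (simp add: birkhoff_sum_def)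

lemma revmax_ge: "k \<le> n \<Longrightarrow> Sn F n x - Sn F k x \<le> revmax F n x"
proof (induction n arbitrary: x k)
 case (Suc n)
 show ?case
 proof (cases k)
  case (Suc j)
  then have "Sn F (Suc n) x - Sn F k x = Sn F n (T x) - Sn F j (T x)"
   by (simp add: birkhoff_Suc)
  also have "\<dots> \<le> revmax F n (T x)" using Suc.IH[of j "T x"] Suc Suc.prems by simp
  finally show ?thesis by simp
 qed auto
qed auto

text \<open>Doob's \<open>L2\<close> inequality as a deterministic statement, by induction along the
  orbit. When the maximum is renewed, the step reduces to the nonnegativity of
  \<open>(f + S - R)\<^sup>2\<close>. Integration removes \<open>revmart\<close>, so filtrations and
  stopping times are avoided.\<close>

lemma revmax_pathwise: "(revmax F n x)\<^sup>2 / 2 \<le> revmax F n x * Sn F n x - revmart F n x"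
proof (induction n arbitrary: x)
 case (Suc n)
 define R S Q f where "R = revmax F n (T x)" and "S = Sn F n (T x)" and "Q = revmart F n (T x)" and "f = F x"
 have IH: "R\<^sup>2 / 2 \<le> R * S - Q" unfolding R_def S_def Q_def by (rule Suc.IH)
 have "(max R (f + S))\<^sup>2 / 2 \<le> max R (f + S) * (f + S) - (Q + R * f)"
 proof (cases "f + S \<le> R")
  case True
  then show ?thesis using IH by (simp add: max_def algebra_simps)
 next
  case False
  have "0 \<le> (f + S - R)\<^sup>2 / 2" by simp
  also have "\<dots> = (f + S)\<^sup>2 / 2 - R * f - R * S + R\<^sup>2 / 2" by (simp add: power2_eq_square field_simps)
  finally have "0 \<le> (f + S)\<^sup>2 / 2 - R * f - Q" using IH by linarith
  moreover have "max R (f + S) = f + S" using False by simp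
  moreover have "(f + S) * (f + S) = (f + S)\<^sup>2" by (simp add: power2_eq_square)
  ultimately show ?thesis by simp
 qed
 then show ?case by (simp add: birkhoff_Suc R_def S_def Q_def f_def)
qed simp

lemma revmax_meas [measurable]: assumes [measurable]: "rv F" shows "revmax F n \<in> borel_measurable M"
proof (induction n)
 case (Suc n)
 note [measurable] = Suc.IH
 have [measurable]: "Sn F k \<in> borel_measurable M" for k by measurable
 have "(\<lambda>x. max (revmax F n (T x)) (Sn F (Suc n) x)) \<in> borel_measurable M" by measurable
 then show ?case by (simp add: fun_eq_iff[symmetric] cong: measurable_cong)
qed (simp cong: measurable_cong)

lemma revmart_meas [measurable]: assumes [measurable]: "rv F" shows "revmart F n \<in> borel_measurable M"
proof (induction n)
 case (Suc n)
 note [measurable] = Suc.IH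
 have "(\<lambda>x. revmart F n (T x) + revmax F n (T x) * F x) \<in> borel_measurable M" by measurable
 then show ?case by (simp cong: measurable_cong)
qed (simp cong: measurable_cong)

lemma birkhoff_bound: "(\<And>x. \<bar>F x\<bar> \<le> b) \<Longrightarrow> \<bar>Sn F n x\<bar> \<le> real n * b"
proof -
 assume "\<And>x. \<bar>F x\<bar> \<le> b"
 then have "(\<Sum>i<n. \<bar>F ((T ^^ i) x)\<bar>) \<le> of_nat (card {..<n}) * b" by (intro sum_bounded_above) auto
 then show ?thesis unfolding birkhoff_sum_def by (intro order_trans[OF sum_abs]) simp
qed

lemma revmax_bound: "(\<And>x. \<bar>F x\<bar> \<le> b) \<Longrightarrow> \<bar>revmax F n x\<bar> \<le> real n * b"
proof (induction n arbitrary: x)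
 case (Suc n)
 have b: "0 \<le> b" using Suc.prems[of undefined] by linarith
 have "\<bar>revmax F n (T x)\<bar> \<le> real n * b" by (rule Suc.IH[OF Suc.prems])
 also have "\<dots> \<le> real (Suc n) * b" using b by (intro mult_right_mono) auto
 finally have "revmax F n (T x) \<le> real (Suc n) * b" by linarith
 moreover have "Sn F (Suc n) x \<le> real (Suc n) * b" using birkhoff_bound[where F=F and b=b and n="Suc n" and x=x, OF Suc.prems] by linarith
 ultimately show ?case using revmax_nonneg[of F "Suc n" x] by simp
qed auto

lemma revmart_bound: "(\<And>x. \<bar>F x\<bar> \<le> b) \<Longrightarrow> \<exists>c. \<forall>x. \<bar>revmart F n x\<bar> \<le> c"
proof (induction n)
 case (Suc n)
 then obtain c where c: "\<And>x. \<bar>revmart F n x\<bar> \<le> c" by blast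
 have b: "0 \<le> b" using Suc.prems[of undefined] by linarith
 have "\<bar>revmart F (Suc n) x\<bar> \<le> c + (real n * b) * b" for x
 proof -
  have "\<bar>revmax F n (T x) * F x\<bar> \<le> (real n * b) * b"
   unfolding abs_mult by (rule mult_mono[OF revmax_bound[where F=F and b=b, OF Suc.prems] Suc.prems]) (use b in auto)
  then show ?thesis using c[of "T x"] by simp
 qed
 then show ?case by blast
qed auto

lemma martingale_maximal:
 assumes Fm[measurable]: "rv F" and Fb: "\<And>x. \<bar>F x\<bar> \<le> b"
  and mart: "\<And>h c. \<lbrakk>rv h; \<forall>x\<in>space M. \<bar>h x\<bar> \<le> c\<rbrakk> \<Longrightarrow> (LINT x|M. F x * h (T x)) = 0"
 shows martingale_variance: "(LINT x|M. (Sn F n x)\<^sup>2) = real n * (LINT x|M. (F x)\<^sup>2)"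
  and revmax_integral: "(LINT x|M. (revmax F n x)\<^sup>2) \<le> 4 * (real n * (LINT x|M. (F x)\<^sup>2))" (is ?P)
proof -
 have b: "0 \<le> b" using Fb[of undefined] by linarith
 have Sm[measurable]: "Sn F k \<in> borel_measurable M" for k by measurable
 note Sb = birkhoff_bound[where F=F and b=b, OF Fb]
 have ib: "integrable M (\<lambda>x. q x * q' x)" if [measurable]: "rv q" "rv q'"
  and "\<And>x. \<bar>q x\<bar> \<le> c" "\<And>x. \<bar>q' x\<bar> \<le> c'" for q q' :: "'a \<Rightarrow> real" and c c'
 proof (rule integrable_const_bound[where B="c * c'"])
  have "0 \<le> c" using that(3)[of undefined] by linarith
  then show "AE x in M. norm (q x * q' x) \<le> c * c'" using mult_mono[OF that(3,4)] by (intro AE_I2) (auto simp: abs_mult)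
 qed measurable
 show var: "(LINT x|M. (Sn F n x)\<^sup>2) = real n * (LINT x|M. (F x)\<^sup>2)" for n
 proof (induction n)
  case (Suc n)
  let ?S = "Sn F n"
  have i1: "integrable M (\<lambda>x. F x * F x)" "integrable M (\<lambda>x. F x * ?S (T x))" "integrable M (\<lambda>x. ?S (T x) * ?S (T x))"
   by (rule ib[OF _ _ Fb Fb] ib[OF _ _ Fb Sb] ib[OF _ _ Sb Sb]; measurable)+
  have "(LINT x|M. (Sn F (Suc n) x)\<^sup>2) = (LINT x|M. F x * F x + 2 * (F x * ?S (T x)) + ?S (T x) * ?S (T x))"
   by (intro int_cong) (auto simp: birkhoff_Suc power2_eq_square algebra_simps)
  also have "\<dots> = (LINT x|M. F x * F x) + 2 * (LINT x|M. F x * ?S (T x)) + (LINT x|M. ?S (T x) * ?S (T x))"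
   using i1 by simp
  also have "(LINT x|M. F x * ?S (T x)) = 0" by (rule mart[of _ "real n * b"]) (use Sb in auto)
  also have "(LINT x|M. ?S (T x) * ?S (T x)) = (LINT x|M. ?S x * ?S x)" by (rule integral_T[of "\<lambda>x. ?S x * ?S x"]) measurable
  finally show ?case using Suc.IH by (simp add: power2_eq_square algebra_simps)
 qed simp
 have Q: "(LINT x|M. revmart F n x) = 0" for n
 proof (induction n)
  case (Suc n)
  obtain c where c: "\<And>x. \<bar>revmart F n x\<bar> \<le> c" using revmart_bound[where F=F and b=b, OF Fb] by blast
  have "integrable M (revmart F n)" by (rule integrable_bounded[where B=c]) (auto simp: c)
  then have i1: "integrable M (\<lambda>x. revmart F n (T x))" by (rule integrable_T)
  have i2: "integrable M (\<lambda>x. revmax F n (T x) * F x)"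
   by (rule ib[OF _ _ revmax_bound[where F=F and b=b, OF Fb] Fb]) measurable
  have "(LINT x|M. revmart F (Suc n) x) = (LINT x|M. revmart F n (T x)) + (LINT x|M. revmax F n (T x) * F x)"
   using i1 i2 by simp
  also have "(LINT x|M. revmart F n (T x)) = 0" using integral_T[of "revmart F n"] Suc by simp
  also have "(LINT x|M. revmax F n (T x) * F x) = 0"
   using mart[of "revmax F n" "real n * b"] revmax_bound[where F=F and b=b, OF Fb] by (simp add: mult.commute)
  finally show ?case by simp
 qed simp
 obtain c where c: "\<And>x. \<bar>revmart F n x\<bar> \<le> c" using revmart_bound[where F=F and b=b, OF Fb] by blast
 have iQ: "integrable M (revmart F n)" by (rule integrable_bounded[where B=c]) (auto simp: c)
 note Rb = revmax_bound[where F=F and b=b and n=n, OF Fb]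
 have i1: "integrable M (\<lambda>x. (revmax F n x)\<^sup>2)" "integrable M (\<lambda>x. (Sn F n x)\<^sup>2)"
  unfolding power2_eq_square by (rule ib[OF _ _ Rb Rb] ib[OF _ _ Sb Sb]; measurable)+
 have "(LINT x|M. (revmax F n x)\<^sup>2) \<le> (LINT x|M. 4 * (Sn F n x)\<^sup>2 - 4 * revmart F n x)"
 proof (rule integral_mono)
  fix x
  \<comment> \<open>Young's inequality in the form
    \<open>R S \<le> R\<^sup>2 / 4 + S\<^sup>2\<close> absorbs half of the left-hand side of
    \<open>revmax_pathwise\<close>.\<close>
  have "0 \<le> (revmax F n x / 2 - Sn F n x)\<^sup>2" by simp
  then have "revmax F n x * Sn F n x \<le> (revmax F n x)\<^sup>2 / 4 + (Sn F n x)\<^sup>2"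
   by (simp add: power2_eq_square field_simps)
  then show "(revmax F n x)\<^sup>2 \<le> 4 * (Sn F n x)\<^sup>2 - 4 * revmart F n x"
   using revmax_pathwise[of F n x] by linarith
 qed (use i1 iQ in auto)
 also have "\<dots> = 4 * (real n * (LINT x|M. (F x)\<^sup>2))" using i1 iQ var Q by simp
 finally show ?P .
qed

lemma birkhoff_uminus: "Sn (\<lambda>x. - F x) n x = - Sn F n x"
 by (simp add: birkhoff_sum_def sum_negf)

text \<open>
 The sums \<open>S\<^sub>n - S\<^sub>k\<close>, read backwards in \<open>k\<close>, form a martingale, so Doob's inequality controls
 their maximum.
\<close>
lemma martingale_max_bound:
 assumes Fm[measurable]: "rv F" and Fb: "\<And>x. \<bar>F x\<bar> \<le> b"
  and mart: "\<And>h c. \<lbrakk>rv h; \<forall>x\<in>space M. \<bar>h x\<bar> \<le> c\<rbrakk> \<Longrightarrow> (LINT x|M. F x * h (T x)) = 0"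
 shows "\<exists>W. integrable M W \<and> (\<forall>x. \<forall>k\<le>n. \<bar>Sn F k x\<bar> \<le> W x) \<and>
   (LINT x|M. W x) \<le> 8 * sqrt (real n * (LINT x|M. (F x)\<^sup>2))"
proof -
 let ?F = "\<lambda>x. - F x"
 let ?v = "real n * (LINT x|M. (F x)\<^sup>2)"
 have Fb': "\<And>x. \<bar>?F x\<bar> \<le> b" using Fb by simp
 have mart': "(LINT x|M. ?F x * h (T x)) = 0" if "rv h" "\<forall>x\<in>space M. \<bar>h x\<bar> \<le> c" for h c
  using mart[OF that] by simp
 have b: "integrable M (\<lambda>x. (revmax q n x)\<^sup>2)" if [measurable]: "rv q" and q: "\<And>x. \<bar>q x\<bar> \<le> b" for q
 proof (rule integrable_const_bound[where B="(real n * b)\<^sup>2"])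
  show "AE x in M. norm ((revmax q n x)\<^sup>2) \<le> (real n * b)\<^sup>2"
  proof (rule AE_I2)
   fix x
   have "\<bar>revmax q n x\<bar> \<le> \<bar>real n * b\<bar>" using revmax_bound[where F=q and b=b and n=n and x=x, OF q] by linarith
   then show "norm ((revmax q n x)\<^sup>2) \<le> (real n * b)\<^sup>2" by (simp only: real_norm_def abs_power2 abs_le_square_iff[symmetric])
  qed
 qed measurable
 have s4: "sqrt (4 * ?v) = 2 * sqrt ?v" by (simp add: real_sqrt_mult)
 have 1: "integrable M (revmax F n)" by (rule integral_le_sqrt(1)[OF _ b[OF Fm Fb]]) measurable
 have int1: "(LINT x|M. revmax F n x) \<le> 2 * sqrt ?v"
 proof -
  have "(LINT x|M. revmax F n x) \<le> sqrt (LINT x|M. (revmax F n x)\<^sup>2)"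
   by (rule integral_le_sqrt(2)[OF _ b[OF Fm Fb]]) measurable
  also have "\<dots> \<le> sqrt (4 * ?v)" by (rule real_sqrt_le_mono, rule revmax_integral[OF Fm Fb]) (rule mart)
  finally show ?thesis unfolding s4 .
 qed
 have Fm': "?F \<in> borel_measurable M" by measurable
 have 2: "integrable M (revmax ?F n)" by (rule integral_le_sqrt(1)[OF _ b[OF Fm' Fb']]) measurable
 have int2: "(LINT x|M. revmax ?F n x) \<le> 2 * sqrt ?v"
 proof -
  have "(LINT x|M. revmax ?F n x) \<le> sqrt (LINT x|M. (revmax ?F n x)\<^sup>2)"
   by (rule integral_le_sqrt(2)[OF _ b[OF Fm' Fb']]) measurable
  also have "\<dots> \<le> sqrt (4 * (real n * (LINT x|M. (?F x)\<^sup>2)))"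
   by (rule real_sqrt_le_mono, rule revmax_integral[OF Fm' Fb']) (rule mart')
  finally show ?thesis unfolding s4[symmetric] by simp
 qed
 let ?W = "\<lambda>x. 2 * revmax F n x + 2 * revmax ?F n x"
 \<comment> \<open>The sum \<open>S\<^sub>k\<close> is
   \<open>(S\<^sub>n - S\<^sub>0) - (S\<^sub>n - S\<^sub>k)\<close>; each difference is bounded
   above by \<open>revmax\<close> of \<open>F\<close> and below by minus \<open>revmax\<close> of
   \<open>- F\<close>.\<close>
 have "\<bar>Sn F k x\<bar> \<le> ?W x" if k: "k \<le> n" for x k
  using revmax_ge[OF k, of F x] revmax_ge[OF k, of ?F x] revmax_ge[of 0 n F x] revmax_ge[of 0 n ?F x]
   revmax_nonneg[of F n x] revmax_nonneg[of ?F n x] unfolding birkhoff_uminus by simp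
 then show ?thesis using 1 2 int1 int2 by (intro exI[of _ ?W]) simp
qed

end

section \<open>Maximal inequality\<close>

locale gm_obs = gm_ergodic +
 fixes f :: "'a \<Rightarrow> real" and e :: "'a set \<Rightarrow> real"
 assumes f_reg: "reg e f" and e_adm: "admissible e" and f_mean: "(LINT x|M. f x) = 0"
begin

lemma f_meas [measurable]: "rv f" by (rule reg_meas[OF f_reg])
lemma f_int: "integrable M f" by (rule reg_integrable[OF f_reg e_adm])

text \<open>The condition \<open>h 0 = 0\<close> carries the bound \<open>e\<close> over from
  \<open>f\<close> to \<open>h \<circ> f\<close>; it is the reason why \<open>cos - 1\<close> will
  stand in for \<open>cos\<close>.\<close>

lemma reg_compose:
 assumes h: "\<And>x y. \<bar>h x - h y\<bar> \<le> L * \<bar>x - y\<bar>" "h 0 = 0" "0 \<le> L" and [measurable]: "h \<in> borel_measurable borel"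
 shows "reg (\<lambda>a. L * e a) (\<lambda>x. h (f x))"
 unfolding reg_def
proof (intro conjI ballI impI)
 fix a x assume a: "a \<in> \<alpha>" "x \<in> a \<inter> G"
 have "\<bar>h (f x)\<bar> \<le> L * \<bar>f x\<bar>" using h(1)[of "f x" 0] h(2) by simp
 also have "\<dots> \<le> L * e a" using reg_bound[OF f_reg a(1)] a(2) h(3) by (intro mult_left_mono) auto
 finally show "\<bar>h (f x)\<bar> \<le> L * e a" .
next
 fix a b x x' assume a: "a \<in> \<alpha>" "b \<in> \<alpha>" "x \<in> a \<inter> G" "x' \<in> a \<inter> G" "T x \<in> b" "T x' \<in> b"
 have "\<bar>f x - f x'\<bar> \<le> e a * d (T x) (T x')" using f_reg a unfolding reg_def by blast
 then have "L * \<bar>f x - f x'\<bar> \<le> L * (e a * d (T x) (T x'))" using h(3) by (intro mult_left_mono) auto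
 then show "\<bar>h (f x) - h (f x')\<bar> \<le> L * e a * d (T x) (T x')" using h(1)[of "f x" "f x'"] by simp
qed measurable

text \<open>Both \<open>cos (s f) - 1\<close> and \<open>sin (s f)\<close> have norm at most
  \<open>|s| * esum e\<close>, and the almost invariance of \<open>exp (i s S\<^sub>k)\<close> gives
  a second factor \<open>|s|\<close>. Subtracting 1 from the cosine is harmless, since a constant
  has no covariance with anything.\<close>

lemma char_approx:
 "\<exists>K\<ge>0. \<forall>s n. norm ((LINT x|M. iexp (s * Sn f n x)) - (LINT x|M. iexp (s * f x)) ^ n) \<le> K * s\<^sup>2 * real n"
proof -
 obtain C where C: "0 < C" and dec: "\<And>e \<psi> H B. \<lbrakk>admissible e; reg e \<psi>; rv H; \<forall>x\<in>space M. \<bar>H x\<bar> \<le> B\<rbrakk> \<Longrightarrow>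
   \<bar>(LINT x|M. \<psi> x * H (T x)) - (LINT x|M. \<psi> x) * (LINT x|M. H x)\<bar> \<le> C * esum e * (LINT x|M. \<bar>H x - H (T x)\<bar>)"
  using reg_decorrelation by blast
 have E: "0 \<le> esum e" by (rule esum_nonneg[OF e_adm])
 show ?thesis
 proof (intro exI[of _ "8 * (C * esum e) * (LINT x|M. \<bar>f x\<bar>)"] conjI allI)
  show "0 \<le> 8 * (C * esum e) * (LINT x|M. \<bar>f x\<bar>)" using C E by (intro mult_nonneg_nonneg) auto
  fix s n
  have ad: "admissible (\<lambda>a. \<bar>s\<bar> * e a)" by (rule admissible_cmult[OF e_adm]) simp
  have es: "esum (\<lambda>a. \<bar>s\<bar> * e a) = \<bar>s\<bar> * esum e" by (rule esum_cmult)
  have lipc: "\<bar>(cos (s * x) - 1) - (cos (s * y) - 1)\<bar> \<le> \<bar>s\<bar> * \<bar>x - y\<bar>" for x y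
   using abs_cos_diff_le[of "s * x" "s * y"] by (simp add: right_diff_distrib[symmetric] abs_mult)
  have lips: "\<bar>sin (s * x) - sin (s * y)\<bar> \<le> \<bar>s\<bar> * \<bar>x - y\<bar>" for x y
   using abs_sin_diff_le[of "s * x" "s * y"] by (simp add: right_diff_distrib[symmetric] abs_mult)
  have rc: "reg (\<lambda>a. \<bar>s\<bar> * e a) (\<lambda>x. cos (s * f x) - 1)"
   by (rule reg_compose[of "\<lambda>x. cos (s * x) - 1"]) (use lipc in auto)
  have rs: "reg (\<lambda>a. \<bar>s\<bar> * e a) (\<lambda>x. sin (s * f x))"
   by (rule reg_compose[of "\<lambda>x. sin (s * x)"]) (use lips in auto)
  have "norm ((LINT x|M. iexp (s * Sn f n x)) - (LINT x|M. iexp (s * f x)) ^ n)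
    \<le> real n * (8 * (C * (\<bar>s\<bar> * esum e)) * \<bar>s\<bar> * (LINT x|M. \<bar>f x\<bar>))"
  proof (rule char_recursion[OF f_int])
   show "0 \<le> C * (\<bar>s\<bar> * esum e)" using C E by simp
   fix H :: "'a \<Rightarrow> real" assume H[measurable]: "rv H" and Hb: "\<forall>x\<in>space M. \<bar>H x\<bar> \<le> 1"
   show "\<bar>(LINT x|M. sin (s * f x) * H (T x)) - (LINT x|M. sin (s * f x)) * (LINT x|M. H x)\<bar>
     \<le> C * (\<bar>s\<bar> * esum e) * (LINT x|M. \<bar>H x - H (T x)\<bar>)"
    using dec[OF ad rs H Hb] by (simp add: es)
   have iH: "integrable M H" by (rule integrable_bounded[OF H]) (use Hb in auto)
   have iHT: "integrable M (\<lambda>x. H (T x))" by (rule integrable_T[OF iH])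
   have ic: "integrable M (\<lambda>x. cos (s * f x))" by (rule integrable_bounded[where B=1]) auto
   have icH: "integrable M (\<lambda>x. cos (s * f x) * H (T x))"
    by (rule integrable_times_bounded[OF iHT, where B=1]) auto
   have "(LINT x|M. (cos (s * f x) - 1) * H (T x)) = (LINT x|M. cos (s * f x) * H (T x)) - (LINT x|M. H x)"
    using icH iHT integral_T[OF H] by (simp add: left_diff_distrib)
   moreover have "(LINT x|M. cos (s * f x) - 1) = (LINT x|M. cos (s * f x)) - 1" using ic prob_space by simp
   ultimately show "\<bar>(LINT x|M. cos (s * f x) * H (T x)) - (LINT x|M. cos (s * f x)) * (LINT x|M. H x)\<bar>
     \<le> C * (\<bar>s\<bar> * esum e) * (LINT x|M. \<bar>H x - H (T x)\<bar>)"
    using dec[OF ad rc H Hb] by (simp add: es left_diff_distrib)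
  qed
  also have "\<dots> = 8 * (C * esum e) * (LINT x|M. \<bar>f x\<bar>) * s\<^sup>2 * real n"
  proof -
   have "\<bar>s\<bar> * \<bar>s\<bar> = s\<^sup>2" by (simp add: power2_eq_square)
   from this[symmetric] show ?thesis by (simp only: mult.assoc mult.commute mult.left_commute)
  qed
  finally show "norm ((LINT x|M. iexp (s * Sn f n x)) - (LINT x|M. iexp (s * f x)) ^ n)
    \<le> 8 * (C * esum e) * (LINT x|M. \<bar>f x\<bar>) * s\<^sup>2 * real n" .
 qed
qed

text \<open>Truncation at height \<open>b\<close> is 1-Lipschitz, so the coboundary of the truncated
  and centered observable is bounded by a constant \<open>U\<close> that does not depend on
  \<open>b\<close>. Doob's inequality handles the martingale part, and the excess over
  \<open>b\<close> is summed in absolute value. The excess counts twice because it also bounds the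
  mean \<open>\<mu>\<close> of the truncation, \<open>f\<close> being centered.\<close>

lemma truncated_max_bound:
 "\<exists>K\<ge>0. \<forall>n b. 1 \<le> n \<longrightarrow> 0 < b \<longrightarrow> (\<exists>W. integrable M W \<and> (\<forall>x. \<forall>k\<le>n. \<bar>Sn f k x\<bar> \<le> W x) \<and>
   (LINT x|M. W x) \<le> K * (sqrt (real n * (LINT x|M. min ((f x)\<^sup>2) (b\<^sup>2))) + sqrt (real n))
    + 2 * (real n * (LINT x|M. max (\<bar>f x\<bar> - b) 0)))"
proof -
 obtain C where C: "0 < C" and gordin: "\<And>e \<psi>. \<lbrakk>admissible e; reg e \<psi>; (LINT x|M. \<psi> x) = 0\<rbrakk> \<Longrightarrow>
   (\<exists>u. rv u \<and> (\<forall>x. \<bar>u x\<bar> \<le> C * esum e) \<and>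
    (\<forall>h B. rv h \<longrightarrow> (\<forall>x\<in>space M. \<bar>h x\<bar> \<le> B) \<longrightarrow>
      (LINT x|M. (\<psi> x + u x - u (T x)) * h (T x)) = 0) \<and>
    reg (\<lambda>a. e a + 2 * C * esum e) (\<lambda>x. \<psi> x + u x - u (T x)))"
  using gordin_decomposition by blast
 define E where "E = esum e"
 have E: "0 \<le> E" unfolding E_def by (rule esum_nonneg[OF e_adm])
 have fE: "(LINT x|M. \<bar>f x\<bar>) \<le> E" unfolding E_def by (rule reg_integral_abs[OF f_reg e_adm])
 define U where "U = C * (2 * E)"
 have U: "0 \<le> U" unfolding U_def using C E by simp
 show ?thesis
 \<comment> \<open>Collected from \<open>8 * (2 * sqrt (n V) + 3 * U * sqrt n)\<close> for the
   martingale and \<open>2 * U \<le> 2 * U * sqrt n\<close> for the coboundary.\<close>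
 proof (intro exI[of _ "16 + 26 * U"] conjI allI impI)
  show "0 \<le> 16 + 26 * U" using U by simp
  fix n :: nat and b :: real assume n: "1 \<le> n" and b: "0 < b"
  define g where "g x = max (- b) (min b (f x))" for x
  define ex where "ex x = max (\<bar>f x\<bar> - b) 0" for x
  define \<mu> where "\<mu> = (LINT x|M. g x)"
  have gm[measurable]: "rv g" unfolding g_def[abs_def] by measurable
  have exm[measurable]: "rv ex" unfolding ex_def[abs_def] by measurable
  have gb: "\<bar>g x\<bar> \<le> b" for x using b by (auto simp: g_def)
  have ig: "integrable M g" by (rule integrable_bounded[where B=b]) (auto simp: gb)
  have fg: "\<bar>f x - g x\<bar> = ex x" for x using b by (auto simp: g_def ex_def max_def min_def abs_if)
  have ex0: "0 \<le> ex x" for x by (simp add: ex_def)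
  have iex: "integrable M ex" using integrable_abs[OF int_diff[OF f_int ig]] by (simp add: fg)
  have \<mu>: "\<bar>\<mu>\<bar> \<le> (LINT x|M. ex x)"
  proof -
   have "\<mu> = - (LINT x|M. f x - g x)" using f_int ig f_mean by (simp add: \<mu>_def)
   also have "\<bar>\<dots>\<bar> \<le> (LINT x|M. \<bar>f x - g x\<bar>)" using integral_abs_bound[of M "\<lambda>x. f x - g x"] by simp
   finally show ?thesis by (simp add: fg)
  qed
  have \<mu>E: "\<bar>\<mu>\<bar> \<le> E"
  proof -
   have "\<bar>\<mu>\<bar> \<le> (LINT x|M. \<bar>g x\<bar>)" unfolding \<mu>_def by (rule integral_abs_bound)
   also have "\<dots> \<le> (LINT x|M. \<bar>f x\<bar>)" using ig f_int b by (intro integral_mono) (auto simp: g_def)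
   finally show ?thesis using fE by simp
  qed
  have rg: "reg e g"
   using reg_compose[of "\<lambda>x. max (- b) (min b x)" 1] b by (auto simp: g_def[abs_def] max_def min_def abs_if)
  have ad: "admissible (\<lambda>a. e a + E)" by (intro admissible_add e_adm admissible_const E)
  have es: "esum (\<lambda>a. e a + E) = 2 * E"
   using esum_add[OF e_adm admissible_const[OF E]] by (simp add: esum_const E_def)
  have r\<psi>: "reg (\<lambda>a. e a + E) (\<lambda>x. g x - \<mu>)" unfolding reg_def
  proof (intro conjI ballI impI)
   fix a x assume a: "a \<in> \<alpha>" "x \<in> a \<inter> G"
   show "\<bar>g x - \<mu>\<bar> \<le> e a + E" using reg_bound[OF rg a(1), of x] a(2) \<mu>E by auto
  next
   fix a c x x' assume a: "a \<in> \<alpha>" "c \<in> \<alpha>" "x \<in> a \<inter> G" "x' \<in> a \<inter> G" "T x \<in> c" "T x' \<in> c"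
   have "\<bar>g x - g x'\<bar> \<le> e a * d (T x) (T x')" using rg a unfolding reg_def by blast
   moreover have "0 \<le> E * d (T x) (T x')" using E d_nonneg by simp
   ultimately show "\<bar>g x - \<mu> - (g x' - \<mu>)\<bar> \<le> (e a + E) * d (T x) (T x')" by (simp add: distrib_right)
  qed measurable
  have "(LINT x|M. g x - \<mu>) = 0" using ig prob_space by (simp add: \<mu>_def)
  from gordin[OF ad r\<psi> this] obtain u where um[measurable]: "rv u" and ub: "\<And>x. \<bar>u x\<bar> \<le> U"
   and mart: "\<And>h B. rv h \<Longrightarrow> \<forall>x\<in>space M. \<bar>h x\<bar> \<le> B \<Longrightarrow> (LINT x|M. (g x - \<mu> + u x - u (T x)) * h (T x)) = 0"
   unfolding es U_def[symmetric] by blast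
  define F where "F x = g x - \<mu> + u x - u (T x)" for x
  have Fm[measurable]: "rv F" unfolding F_def[abs_def] by measurable
  have Fb: "\<bar>F x\<bar> \<le> b + E + 2 * U" for x using gb[of x] \<mu>E ub[of x] ub[of "T x"] unfolding F_def by linarith
  have mart': "(LINT x|M. F x * h (T x)) = 0" if "rv h" "\<forall>x\<in>space M. \<bar>h x\<bar> \<le> c" for h c
   unfolding F_def by (rule mart[OF that])
  have "\<exists>W. integrable M W \<and> (\<forall>x. \<forall>k\<le>n. \<bar>Sn F k x\<bar> \<le> W x) \<and>
    (LINT x|M. W x) \<le> 8 * sqrt (real n * (LINT x|M. (F x)\<^sup>2))"
   by (rule martingale_max_bound[OF Fm Fb]) (rule mart')
  then obtain W where W1: "integrable M W" and W2: "\<forall>x. \<forall>k\<le>n. \<bar>Sn F k x\<bar> \<le> W x"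
   and iW: "(LINT x|M. W x) \<le> 8 * sqrt (real n * (LINT x|M. (F x)\<^sup>2))"
   by (elim exE conjE)
  have W: "integrable M W" "\<And>x k. k \<le> n \<Longrightarrow> \<bar>Sn F k x\<bar> \<le> W x"
   using W1 W2 by auto
  define V where "V = (LINT x|M. min ((f x)\<^sup>2) (b\<^sup>2))"
  have V: "0 \<le> V" unfolding V_def by simp
  have g2: "(g x)\<^sup>2 = min ((f x)\<^sup>2) (b\<^sup>2)" for x
  proof (cases "\<bar>f x\<bar> \<le> b")
   case True
   then have "(f x)\<^sup>2 \<le> b\<^sup>2" using b by (simp add: abs_le_square_iff[symmetric])
   then show ?thesis using True by (auto simp: g_def min_def max_def abs_le_iff)
  next
   case False
   then have "b\<^sup>2 \<le> (f x)\<^sup>2" using b by (simp add: abs_le_square_iff[symmetric])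
   moreover have "g x = b \<or> g x = - b" using False by (auto simp: g_def min_def max_def)
   ultimately show ?thesis by auto
  qed
  have ig2: "integrable M (\<lambda>x. (g x)\<^sup>2)"
  proof (rule integrable_const_bound[where B="b\<^sup>2"])
   show "AE x in M. norm ((g x)\<^sup>2) \<le> b\<^sup>2" by (intro AE_I2) (simp add: g2)
  qed measurable
  \<comment> \<open>The square of a sum of three terms is at most three times the sum of the
    squares, and centering by \<open>\<mu>\<close> only lowers the second moment.\<close>
  have F2: "(LINT x|M. (F x)\<^sup>2) \<le> 3 * V + 6 * U\<^sup>2"
  proof -
   have "(LINT x|M. (F x)\<^sup>2) \<le> (LINT x|M. 3 * ((g x)\<^sup>2 - 2 * \<mu> * g x + \<mu>\<^sup>2) + 6 * U\<^sup>2)"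
   proof (rule integral_mono)
    show "integrable M (\<lambda>x. (F x)\<^sup>2)"
    proof (rule integrable_const_bound[where B="(b + E + 2 * U)\<^sup>2"])
     have "\<bar>F x\<bar> \<le> \<bar>b + E + 2 * U\<bar>" for x using Fb[of x] by linarith
     then show "AE x in M. norm ((F x)\<^sup>2) \<le> (b + E + 2 * U)\<^sup>2"
      by (intro AE_I2) (simp only: real_norm_def abs_power2 abs_le_square_iff[symmetric])
    qed measurable
    show "integrable M (\<lambda>x. 3 * ((g x)\<^sup>2 - 2 * \<mu> * g x + \<mu>\<^sup>2) + 6 * U\<^sup>2)" using ig ig2 by auto
    fix x
    have u2: "(u y)\<^sup>2 \<le> U\<^sup>2" for y using ub[of y] U by (simp add: abs_le_square_iff[symmetric])
    define p where "p = g x - \<mu>"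
    have "(p + u x - u (T x))\<^sup>2 \<le> 3 * (p\<^sup>2 + (u x)\<^sup>2 + (u (T x))\<^sup>2)"
    proof -
     have "0 \<le> (p - u x)\<^sup>2 + (p + u (T x))\<^sup>2 + (u x + u (T x))\<^sup>2" by simp
     then show ?thesis by (simp add: power2_eq_square algebra_simps)
    qed
    also have "\<dots> \<le> 3 * p\<^sup>2 + 6 * U\<^sup>2" using u2[of x] u2[of "T x"] by simp
    also have "p\<^sup>2 = (g x)\<^sup>2 - 2 * \<mu> * g x + \<mu>\<^sup>2" by (simp add: p_def power2_eq_square algebra_simps)
    finally show "(F x)\<^sup>2 \<le> 3 * ((g x)\<^sup>2 - 2 * \<mu> * g x + \<mu>\<^sup>2) + 6 * U\<^sup>2" by (simp add: F_def p_def)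
   qed
   also have "\<dots> = (LINT x|M. 3 * (g x)\<^sup>2 + (- 6 * \<mu>) * g x + (3 * \<mu>\<^sup>2 + 6 * U\<^sup>2))"
    by (intro int_cong) (simp_all add: algebra_simps)
   also have "\<dots> = 3 * (LINT x|M. (g x)\<^sup>2) + (- 6 * \<mu>) * \<mu> + (3 * \<mu>\<^sup>2 + 6 * U\<^sup>2)"
    using ig ig2 prob_space by (simp add: \<mu>_def[symmetric])
   also have "\<dots> = 3 * (LINT x|M. (g x)\<^sup>2) - 3 * \<mu>\<^sup>2 + 6 * U\<^sup>2" by (simp add: power2_eq_square)
   also have "(LINT x|M. (g x)\<^sup>2) = V" by (simp add: g2 V_def)
   finally show ?thesis using zero_le_power2[of \<mu>] by linarith
  qed
  have sq: "sqrt (real n * (LINT x|M. (F x)\<^sup>2)) \<le> 2 * sqrt (real n * V) + 3 * U * sqrt (real n)"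
  proof (rule real_le_lsqrt)
   show "0 \<le> 2 * sqrt (real n * V) + 3 * U * sqrt (real n)" using V U by simp
   have "real n * (LINT x|M. (F x)\<^sup>2) \<le> real n * (3 * V + 6 * U\<^sup>2)" by (rule mult_left_mono[OF F2]) simp
   also have "\<dots> \<le> (2 * sqrt (real n * V))\<^sup>2 + (3 * U * sqrt (real n))\<^sup>2"
    using V by (simp add: power_mult_distrib algebra_simps)
   also have "\<dots> \<le> (2 * sqrt (real n * V) + 3 * U * sqrt (real n))\<^sup>2"
    using V U by (simp add: power2_sum)
   finally show "real n * (LINT x|M. (F x)\<^sup>2) \<le> (2 * sqrt (real n * V) + 3 * U * sqrt (real n))\<^sup>2" .
  qed
  define Y where "Y x = (\<Sum>j<n. ex ((T ^^ j) x))" for x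
  have iY: "integrable M Y" unfolding Y_def[abs_def] using integrable_iter[OF iex] by auto
  have intY: "(LINT x|M. Y x) = real n * (LINT x|M. ex x)"
   unfolding Y_def using integrable_iter[OF iex] integral_iter[OF exm] by simp
  have tel: "Sn F k x = Sn g k x - real k * \<mu> + u x - u ((T ^^ k) x)" for k x
  proof (induction k)
   case (Suc k)
   then show ?case unfolding birkhoff_Suc' F_def by (simp add: algebra_simps)
  qed simp
  have main: "\<bar>Sn f k x\<bar> \<le> W x + 2 * U + Y x + real n * \<bar>\<mu>\<bar>" if k: "k \<le> n" for k x
  proof -
   have "\<bar>Sn f k x - Sn g k x\<bar> = \<bar>\<Sum>j<k. f ((T ^^ j) x) - g ((T ^^ j) x)\<bar>"
    by (simp add: birkhoff_sum_def sum_subtractf)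
   also have "\<dots> \<le> (\<Sum>j<k. ex ((T ^^ j) x))" unfolding fg[symmetric] by (rule sum_abs)
   also have "\<dots> \<le> Y x" unfolding Y_def using k ex0 by (intro sum_mono2) auto
   finally have 1: "\<bar>Sn f k x - Sn g k x\<bar> \<le> Y x" .
   have 2: "\<bar>real k * \<mu>\<bar> \<le> real n * \<bar>\<mu>\<bar>" using k by (simp add: abs_mult mult_right_mono)
   show ?thesis using 1 2 W(2)[OF k, of x] ub[of x] ub[of "(T ^^ k) x"] tel[of k x] by linarith
  qed
  have iW2: "integrable M (\<lambda>x. W x + 2 * U + Y x + real n * \<bar>\<mu>\<bar>)" using W(1) iY by auto
  have "(LINT x|M. W x + 2 * U + Y x + real n * \<bar>\<mu>\<bar>) = (LINT x|M. W x) + 2 * U + real n * (LINT x|M. ex x) + real n * \<bar>\<mu>\<bar>"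
   using W(1) iY intY prob_space by simp
  also have "\<dots> \<le> 8 * (2 * sqrt (real n * V) + 3 * U * sqrt (real n)) + 2 * U * sqrt (real n)
    + 2 * (real n * (LINT x|M. ex x))"
  proof -
   have "real n * \<bar>\<mu>\<bar> \<le> real n * (LINT x|M. ex x)" by (rule mult_left_mono[OF \<mu>]) simp
   moreover have "2 * U * 1 \<le> 2 * U * sqrt (real n)" using n U by (intro mult_left_mono) auto
   moreover have "8 * sqrt (real n * (LINT x|M. (F x)\<^sup>2)) \<le> 8 * (2 * sqrt (real n * V) + 3 * U * sqrt (real n))"
    by (rule mult_left_mono[OF sq]) simp
   ultimately show ?thesis using iW by simp
  qed
  also have "\<dots> \<le> (16 + 26 * U) * (sqrt (real n * V) + sqrt (real n)) + 2 * (real n * (LINT x|M. ex x))"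
   using U V by (simp add: algebra_simps)
  finally show "\<exists>W. integrable M W \<and> (\<forall>x. \<forall>k\<le>n. \<bar>Sn f k x\<bar> \<le> W x) \<and>
   (LINT x|M. W x) \<le> (16 + 26 * U) * (sqrt (real n * (LINT x|M. min ((f x)\<^sup>2) (b\<^sup>2))) + sqrt (real n))
    + 2 * (real n * (LINT x|M. max (\<bar>f x\<bar> - b) 0))"
   using iW2 main unfolding V_def ex_def
   by (intro exI[of _ "\<lambda>x. W x + 2 * U + Y x + real n * \<bar>\<mu>\<bar>"] conjI allI impI)
 qed
qed

end

section \<open>The central limit theorem for square integrable observables\<close>

text \<open>Made for \<open>cos z - 1\<close> and \<open>sin z - z\<close>, which vanish to second
  order or better at 0 but grow at most linearly; \<open>min 2 R\<close> interpolates between the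
  two regimes.\<close>

lemma second_order_lip:
 fixes \<phi> \<phi>' :: "real \<Rightarrow> real"
 assumes "\<And>z. (\<phi> has_real_derivative \<phi>' z) (at z)" "\<And>z. \<bar>\<phi>' z\<bar> \<le> min 2 \<bar>z\<bar>" "\<bar>x\<bar> \<le> R" "\<bar>y\<bar> \<le> R"
 shows "\<bar>\<phi> x - \<phi> y\<bar> \<le> min 2 R * \<bar>x - y\<bar>"
proof -
 have "norm (\<phi> x - \<phi> y) \<le> min 2 R * norm (x - y)"
 proof (rule field_differentiable_bound[of "{-R..R}" \<phi> \<phi>'])
  fix z assume "z \<in> {-R..R}"
  then show "norm (\<phi>' z) \<le> min 2 R" using assms(2)[of z] by auto
 qed (use assms in \<open>auto intro: has_field_derivative_at_within\<close>)
 then show ?thesis by simp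
qed

lemma norm_iexp_second_order: "norm (iexp z - 1 - \<i> * of_real z) \<le> z\<^sup>2 / 2"
 using iexp_approx1[of z 1] by (simp add: diff_diff_eq power2_eq_square)

lemma norm_iexp_third_order: "norm (iexp z - 1 - \<i> * of_real z + of_real (z\<^sup>2 / 2)) \<le> \<bar>z\<bar> ^ 3 / 6"
proof -
 have "(\<Sum>k\<le>2. (\<i> * complex_of_real z)^k / fact k) = 1 + \<i> * of_real z - of_real (z\<^sup>2 / 2)"
  by (simp add: numeral_2_eq_2 power_mult_distrib)
 then show ?thesis using iexp_approx1[of z 2] by (simp add: eval_nat_numeral algebra_simps)
qed

context gm_ergodic begin

text \<open>The new bound is \<open>|s| e\<close> times a factor \<open>min 2 (|s| e)\<close> that
  tends to 0 with \<open>s\<close>. The cap at 2 is essential: \<open>e\<close> is summable against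
  \<open>prob\<close>, but its square may fail to be.\<close>

lemma reg_second_order:
 assumes F: "reg e F" and e: "admissible e"
  and \<phi>: "\<And>z. (\<phi> has_real_derivative \<phi>' z) (at z)" "\<And>z. \<bar>\<phi>' z\<bar> \<le> min 2 \<bar>z\<bar>" "\<phi> 0 = 0"
 shows "reg (\<lambda>a. (\<bar>s\<bar> * e a) * min 2 (\<bar>s\<bar> * e a)) (\<lambda>x. \<phi> (s * F x))"
 unfolding reg_def
proof (intro conjI ballI impI)
 have [measurable]: "\<phi> \<in> borel_measurable borel"
  by (intro borel_measurable_continuous_onI continuous_at_imp_continuous_on) (use \<phi>(1) DERIV_isCont in blast)
 have [measurable]: "rv F" by (rule reg_meas[OF F])
 show "(\<lambda>x. \<phi> (s * F x)) \<in> borel_measurable M" by measurable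
 fix a x assume a: "a \<in> \<alpha>" "x \<in> a \<inter> G"
 have ea: "0 \<le> e a" using e a by (auto simp: admissible_def)
 have b: "\<bar>s * F x\<bar> \<le> \<bar>s\<bar> * e a" if "x \<in> a \<inter> G" for x
  unfolding abs_mult using reg_bound[OF F a(1), of x] that by (intro mult_left_mono) auto
 have z: "\<bar>0\<bar> \<le> \<bar>s\<bar> * e a" using ea by simp
 have "\<bar>\<phi> (s * F x) - \<phi> 0\<bar> \<le> min 2 (\<bar>s\<bar> * e a) * \<bar>s * F x - 0\<bar>"
  by (rule second_order_lip[OF \<phi>(1,2) b[OF a(2)] z])
 also have "\<dots> \<le> min 2 (\<bar>s\<bar> * e a) * (\<bar>s\<bar> * e a)"
  using b[OF a(2)] z by (intro mult_left_mono) auto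
 finally show "\<bar>\<phi> (s * F x)\<bar> \<le> (\<bar>s\<bar> * e a) * min 2 (\<bar>s\<bar> * e a)" using \<phi>(3) by (simp add: mult.commute)
next
 fix a b x x' assume a: "a \<in> \<alpha>" "b \<in> \<alpha>" "x \<in> a \<inter> G" "x' \<in> a \<inter> G" "T x \<in> b" "T x' \<in> b"
 have ea: "0 \<le> e a" using e a by (auto simp: admissible_def)
 have b: "\<bar>s * F x\<bar> \<le> \<bar>s\<bar> * e a" if "x \<in> a \<inter> G" for x
  unfolding abs_mult using reg_bound[OF F a(1), of x] that by (intro mult_left_mono) auto
 have "\<bar>F x - F x'\<bar> \<le> e a * d (T x) (T x')" using F a unfolding reg_def by blast
 then have 1: "\<bar>s * F x - s * F x'\<bar> \<le> \<bar>s\<bar> * (e a * d (T x) (T x'))"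
  unfolding right_diff_distrib[symmetric] abs_mult by (intro mult_left_mono) auto
 have "\<bar>\<phi> (s * F x) - \<phi> (s * F x')\<bar> \<le> min 2 (\<bar>s\<bar> * e a) * \<bar>s * F x - s * F x'\<bar>"
  by (rule second_order_lip[OF \<phi>(1,2) b[OF a(3)] b[OF a(4)]])
 also have "\<dots> \<le> min 2 (\<bar>s\<bar> * e a) * (\<bar>s\<bar> * (e a * d (T x) (T x')))"
  using 1 ea by (intro mult_left_mono) auto
 finally show "\<bar>\<phi> (s * F x) - \<phi> (s * F x')\<bar> \<le> (\<bar>s\<bar> * e a) * min 2 (\<bar>s\<bar> * e a) * d (T x) (T x')"
  by (simp add: ac_simps)
qed

text \<open>Taylor expansion under the integral: the linear term has mean 0, and \<open>n\<close>
  times the remainder is dominated by \<open>t\<^sup>2 / 2 * (F x)\<^sup>2\<close>.\<close>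

lemma iexp_second_order_limit:
 assumes Fm[measurable]: "rv F" and F2: "integrable M (\<lambda>x. (F x)\<^sup>2)" and F0: "(LINT x|M. F x) = 0"
 shows "(\<lambda>n. of_nat n * ((LINT x|M. iexp (t / sqrt (real n) * F x)) - 1))
   \<longlonglongrightarrow> complex_of_real (- (t\<^sup>2 / 2 * (LINT x|M. (F x)\<^sup>2)))"
proof -
 have F1: "integrable M F" by (rule integral_le_sqrt(1)[OF Fm F2])
 let ?s = "\<lambda>n. t / sqrt (real n)"
 let ?q = "\<lambda>n x. of_nat n * (iexp (?s n * F x) - 1 - \<i> * of_real (?s n * F x))"
 have i1: "integrable M (\<lambda>x. iexp (?s n * F x))" for n by (rule integrable_iexp') measurable
 have eq: "of_nat n * ((LINT x|M. iexp (?s n * F x)) - 1) = (LINT x|M. ?q n x)" for n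
 proof -
  have "(LINT x|M. complex_of_real (?s n * F x)) = 0" using F1 F0 by (simp add: integral_complex_of_real del: of_real_mult)
  then show ?thesis using i1[of n] F1 prob_space by (simp del: of_real_mult)
 qed
 have bound: "norm (?q n x) \<le> t\<^sup>2 / 2 * (F x)\<^sup>2" for n x
 proof (cases "n = 0")
  case False
  have 1: "norm (iexp (?s n * F x) - 1 - \<i> * of_real (?s n * F x)) \<le> (?s n * F x)\<^sup>2 / 2"
   by (rule norm_iexp_second_order)
  have "norm (?q n x) \<le> real n * ((?s n * F x)\<^sup>2 / 2)"
   unfolding norm_mult norm_of_nat by (rule mult_left_mono[OF 1]) simp
  also have "\<dots> = t\<^sup>2 / 2 * (F x)\<^sup>2" using False by (simp add: power_mult_distrib power_divide)
  finally show ?thesis .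
 qed auto
 let ?A = "\<lambda>x. t\<^sup>2 / 2 * (F x)\<^sup>2"
 have lim: "(\<lambda>n. ?q n x) \<longlonglongrightarrow> complex_of_real (- (?A x))" for x
 proof (rule LIM_zero_cancel, rule Lim_null_comparison)
  show "EV n. norm (?q n x - complex_of_real (- (?A x))) \<le> \<bar>t * F x\<bar>^3 / 6 * (1 / sqrt (real n))"
   using eventually_gt_at_top[of 0]
  proof eventually_elim
   case (elim n)
   let ?z = "?s n * F x"
   have sq: "real n * ?z\<^sup>2 = t\<^sup>2 * (F x)\<^sup>2" using elim by (simp add: power_mult_distrib power_divide)
   have 1: "norm (iexp ?z - 1 - \<i> * of_real ?z + of_real (?z\<^sup>2 / 2)) \<le> \<bar>?z\<bar>^3 / 6"
    by (rule norm_iexp_third_order)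
   have "?q n x - complex_of_real (- (?A x)) = of_nat n * (iexp ?z - 1 - \<i> * of_real ?z + of_real (?z\<^sup>2 / 2))"
   proof -
    have "complex_of_real (?A x) = complex_of_real (real n * ?z\<^sup>2 / 2)" unfolding sq by simp
    also have "\<dots> = of_nat n * of_real (?z\<^sup>2 / 2)" by simp
    finally show ?thesis by (simp add: algebra_simps)
   qed
   then have "norm (?q n x - complex_of_real (- (?A x))) \<le> real n * (\<bar>?z\<bar>^3 / 6)"
    using mult_left_mono[OF 1, of "real n"] by (simp add: norm_mult)
   also have "real n * (\<bar>?z\<bar>^3 / 6) = (real n * ?z\<^sup>2) * \<bar>?z\<bar> / 6"
   proof -
    have "\<bar>z\<bar>^3 = z\<^sup>2 * \<bar>z\<bar>" for z :: real by (simp add: power3_eq_cube power2_eq_square)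
    from this[of ?z] show ?thesis by (simp only: mult.assoc times_divide_eq_right)
   qed
   also have "\<dots> = \<bar>t * F x\<bar>^3 / 6 * (1 / sqrt (real n))"
   proof -
    have "t\<^sup>2 * (F x)\<^sup>2 * \<bar>t * F x\<bar> = \<bar>t * F x\<bar> ^ 3"
    proof -
     have "t\<^sup>2 * (F x)\<^sup>2 = \<bar>t * F x\<bar> * \<bar>t * F x\<bar>" by (simp add: power2_eq_square)
     then show ?thesis by (simp only: power3_eq_cube)
    qed
    then show ?thesis unfolding sq using elim by simp
   qed
   finally show ?case .
  qed
  have "(\<lambda>n. 1 / sqrt (real n)) \<longlonglongrightarrow> 0"
   by (intro tendsto_divide_0[OF tendsto_const] filterlim_at_top_imp_at_infinity
     filterlim_compose[OF sqrt_at_top] filterlim_real_sequentially)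
  then have "(\<lambda>n. \<bar>t * F x\<bar>^3 / 6 * (1 / sqrt (real n))) \<longlonglongrightarrow> \<bar>t * F x\<bar>^3 / 6 * 0" by (intro tendsto_intros)
  then show "(\<lambda>n. \<bar>t * F x\<bar>^3 / 6 * (1 / sqrt (real n))) \<longlonglongrightarrow> 0" by simp
 qed
 have "(\<lambda>n. LINT x|M. ?q n x) \<longlonglongrightarrow> (LINT x|M. complex_of_real (- (?A x)))"
  by (rule integral_dominated_convergence[where w="\<lambda>x. t\<^sup>2 / 2 * (F x)\<^sup>2"])
    (use F2 bound lim in \<open>auto simp del: of_real_mult of_real_minus of_real_divide of_real_power\<close>)
 also have "(LINT x|M. complex_of_real (- (?A x))) = complex_of_real (- (t\<^sup>2 / 2 * (LINT x|M. (F x)\<^sup>2)))"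
  by (simp only: integral_complex_of_real) simp
 finally show ?thesis unfolding eq .
qed

end

context gm_obs begin

text \<open>At the scale \<open>s = t / sqrt n\<close> the error \<open>K * s\<^sup>2 * n\<close> of
  \<open>char_approx\<close> stays of order 1. For the martingale difference \<open>F\<close> the
  linear part of the sine integrates to 0 against \<open>H \<circ> T\<close>, so only second order
  functions have to be decorrelated; their norm is \<open>|s| * E n\<close> with \<open>E n\<close>
  tending to 0. The variance of the limit is the integral of \<open>F\<^sup>2\<close>.\<close>

lemma clt_square_integrable:
 assumes f2: "integrable M (\<lambda>x. (f x)\<^sup>2)"
 shows "\<exists>v\<ge>0. \<forall>t. (\<lambda>n. LINT x|M. iexp (t / sqrt (real n) * Sn f n x)) \<longlonglongrightarrow> exp (complex_of_real (- (v * t\<^sup>2 / 2)))"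
proof -
 obtain C where C: "0 < C" and dec: "\<And>e \<psi> H B. \<lbrakk>admissible e; reg e \<psi>; rv H; \<forall>x\<in>space M. \<bar>H x\<bar> \<le> B\<rbrakk> \<Longrightarrow>
   \<bar>(LINT x|M. \<psi> x * H (T x)) - (LINT x|M. \<psi> x) * (LINT x|M. H x)\<bar> \<le> C * esum e * (LINT x|M. \<bar>H x - H (T x)\<bar>)"
  using reg_decorrelation by blast
 obtain Cg where Cg: "0 < Cg" and gordin: "\<And>e \<psi>. \<lbrakk>admissible e; reg e \<psi>; (LINT x|M. \<psi> x) = 0\<rbrakk> \<Longrightarrow>
   (\<exists>u. rv u \<and> (\<forall>x. \<bar>u x\<bar> \<le> Cg * esum e) \<and>
    (\<forall>h B. rv h \<longrightarrow> (\<forall>x\<in>space M. \<bar>h x\<bar> \<le> B) \<longrightarrow>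
      (LINT x|M. (\<psi> x + u x - u (T x)) * h (T x)) = 0) \<and>
    reg (\<lambda>a. e a + 2 * Cg * esum e) (\<lambda>x. \<psi> x + u x - u (T x)))"
  using gordin_decomposition by blast
 define U where "U = Cg * esum e"
 have U: "0 \<le> U" unfolding U_def using Cg esum_nonneg[OF e_adm] by simp
 from gordin[OF e_adm f_reg f_mean] obtain u where um[measurable]: "rv u" and ub: "\<forall>x. \<bar>u x\<bar> \<le> U"
   and mart0: "\<forall>h B. rv h \<longrightarrow> (\<forall>x\<in>space M. \<bar>h x\<bar> \<le> B) \<longrightarrow> (LINT x|M. (f x + u x - u (T x)) * h (T x)) = 0"
   and rF0: "reg (\<lambda>a. e a + 2 * U) (\<lambda>x. f x + u x - u (T x))"
  unfolding U_def mult.assoc by (elim exE conjE)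
 define F where "F x = f x + u x - u (T x)" for x
 define e' where "e' a = e a + 2 * U" for a
 have Fm[measurable]: "rv F" unfolding F_def[abs_def] by measurable
 have rF: "reg e' F" using rF0 by (simp add: F_def[abs_def] e'_def[abs_def])
 have ae: "admissible e'" unfolding e'_def[abs_def] using U by (intro admissible_add e_adm admissible_const) simp
 have mart: "(LINT x|M. F x * h (T x)) = 0" if "rv h" "\<forall>x\<in>space M. \<bar>h x\<bar> \<le> B" for h B
  unfolding F_def using mart0 that by blast
 have F1: "integrable M F" by (rule reg_integrable[OF rF ae])
 have F0: "(LINT x|M. F x) = 0" using mart[of "\<lambda>_. 1" 1] by simp
 have F2: "integrable M (\<lambda>x. (F x)\<^sup>2)"
 proof (rule int_dom[where f="\<lambda>x. 2 * (f x)\<^sup>2 + 8 * U\<^sup>2"])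
  show "AE x in M. norm ((F x)\<^sup>2) \<le> norm (2 * (f x)\<^sup>2 + 8 * U\<^sup>2)"
  proof (rule AE_I2)
   fix x
   define p where "p = u x - u (T x)"
   have "\<bar>p\<bar> \<le> \<bar>2 * U\<bar>" unfolding p_def using ub[rule_format, of x] ub[rule_format, of "T x"] by linarith
   then have "p\<^sup>2 \<le> (2 * U)\<^sup>2" by (simp only: abs_le_square_iff)
   moreover have "(f x + p)\<^sup>2 \<le> 2 * (f x)\<^sup>2 + 2 * p\<^sup>2"
   proof -
    have "0 \<le> (f x - p)\<^sup>2" by simp
    then show ?thesis by (simp add: power2_eq_square algebra_simps)
   qed
   ultimately have "(f x + p)\<^sup>2 \<le> 2 * (f x)\<^sup>2 + 8 * U\<^sup>2" by (simp add: power_mult_distrib)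
   then show "norm ((F x)\<^sup>2) \<le> norm (2 * (f x)\<^sup>2 + 8 * U\<^sup>2)" by (simp add: F_def p_def add_diff_eq)
  qed
 qed (use f2 in auto)
 define v where "v = (LINT x|M. (F x)\<^sup>2)"
 have v: "0 \<le> v" by (simp add: v_def)
 have "(\<lambda>n. LINT x|M. iexp (t / sqrt (real n) * Sn f n x)) \<longlonglongrightarrow> exp (complex_of_real (- (v * t\<^sup>2 / 2)))" for t
 proof -
  let ?s = "\<lambda>n. t / sqrt (real n)"
  have "(\<lambda>n. (LINT x|M. iexp (?s n * F x)) ^ n) \<longlonglongrightarrow> exp (complex_of_real (- (t\<^sup>2 / 2 * v)))"
  proof (rule power_tendsto_exp)
   show "(\<lambda>n. of_nat n * ((LINT x|M. iexp (?s n * F x)) - 1)) \<longlonglongrightarrow> complex_of_real (- (t\<^sup>2 / 2 * v))"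
    unfolding v_def by (rule iexp_second_order_limit[OF Fm F2 F0])
   show "norm (LINT x|M. iexp (?s n * F x)) \<le> 1" for n by (rule norm_integral_iexp) measurable
  qed (use v in simp)
  then have pow: "(\<lambda>n. (LINT x|M. iexp (?s n * F x)) ^ n) \<longlonglongrightarrow> exp (complex_of_real (- (v * t\<^sup>2 / 2)))"
   by (simp add: mult.commute)
  define I where "I = (LINT x|M. \<bar>F x\<bar>)"
  let ?A = "\<lambda>n a. \<bar>?s n\<bar> * e' a"
  \<comment> \<open>The bound of \<open>reg_second_order\<close> divided by \<open>|s|\<close>. It
    tends to 0 by dominated convergence: the factor \<open>min 2 (|s| e')\<close> vanishes in the
    limit, and \<open>2 * e'\<close> is summable against \<open>prob\<close>.\<close>
  define E where "E n = esum (\<lambda>a. e' a * min 2 (?A n a))" for n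
  have e'0: "0 \<le> e' a" if "a \<in> \<alpha>" for a using ae that by (auto simp: admissible_def)
  have ie: "integrable cs (\<lambda>a. prob a * (2 * e' a))"
   using admissible_cmult[OF ae, of 2] by (simp add: admissible_def)
  have s0: "(\<lambda>n. \<bar>?s n\<bar>) \<longlonglongrightarrow> 0"
  proof -
   have "(\<lambda>n. ?s n) \<longlonglongrightarrow> 0"
    by (intro tendsto_divide_0[OF tendsto_const] filterlim_at_top_imp_at_infinity
     filterlim_compose[OF sqrt_at_top] filterlim_real_sequentially)
   then show ?thesis by (rule tendsto_rabs_zero)
  qed
  have E0: "E \<longlonglongrightarrow> (LINT a|cs. 0)" unfolding E_def esum_def
  proof (rule integral_dominated_convergence[where w="\<lambda>a. prob a * (2 * e' a)"])
   show "AE a in cs. (\<lambda>n. prob a * (e' a * min 2 (?A n a))) \<longlonglongrightarrow> 0"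
   proof (rule AE_I2)
    fix a
    have "(\<lambda>n. prob a * (e' a * min 2 (?A n a))) \<longlonglongrightarrow> prob a * (e' a * min 2 (0 * e' a))"
     by (intro tendsto_intros s0)
    then show "(\<lambda>n. prob a * (e' a * min 2 (?A n a))) \<longlonglongrightarrow> 0" by simp
   qed
   show "AE a in cs. norm (prob a * (e' a * min 2 (?A n a))) \<le> prob a * (2 * e' a)" for n
   proof (rule AE_I2)
    fix a assume "a \<in> space cs"
    then have a: "0 \<le> e' a" using e'0 by simp
    then have m: "0 \<le> min 2 (?A n a)" by simp
    have "e' a * min 2 (?A n a) \<le> e' a * 2" using a by (intro mult_left_mono) auto
    then have "prob a * (e' a * min 2 (?A n a)) \<le> prob a * (2 * e' a)" by (intro mult_left_mono) (auto simp: mult.commute)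
    then show "norm (prob a * (e' a * min 2 (?A n a))) \<le> prob a * (2 * e' a)" using a m by (simp add: abs_mult)
   qed
  qed (use ie in auto)
  have adE: "admissible (\<lambda>a. (?A n a) * min 2 (?A n a))" for n
   unfolding admissible_def
  proof
   show "\<forall>a\<in>\<alpha>. 0 \<le> (?A n a) * min 2 (?A n a)" using e'0 by auto
   show "integrable cs (\<lambda>a. prob a * ((?A n a) * min 2 (?A n a)))"
   proof (rule int_dom[where f="\<lambda>a. \<bar>?s n\<bar> * (prob a * (2 * e' a))"])
    show "AE a in cs. norm (prob a * ((?A n a) * min 2 (?A n a))) \<le> norm (\<bar>?s n\<bar> * (prob a * (2 * e' a)))"
    proof (rule AE_I2)
     fix a assume "a \<in> space cs"
     then have a: "0 \<le> \<bar>?s n\<bar> * e' a" using e'0 by simp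
     then have "(?A n a) * min 2 (?A n a) \<le> (?A n a) * 2" by (rule mult_left_mono[OF min.cobounded1])
     then have "prob a * ((?A n a) * min 2 (?A n a)) \<le> prob a * ((?A n a) * 2)" by (rule mult_left_mono) simp
     moreover have "0 \<le> prob a * ((?A n a) * min 2 (?A n a))"
      by (rule mult_nonneg_nonneg[OF measure_nonneg mult_nonneg_nonneg[OF a]]) (use a in simp)
     moreover have "prob a * ((?A n a) * 2) = \<bar>?s n\<bar> * (prob a * (2 * e' a))" by (simp only: ac_simps)
     moreover have "\<bar>p\<bar> \<le> \<bar>r\<bar>" if "p \<le> q" "0 \<le> p" "q = r" for p q r :: real using that by auto
     ultimately show "norm (prob a * ((?A n a) * min 2 (?A n a))) \<le> norm (\<bar>?s n\<bar> * (prob a * (2 * e' a)))"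
      unfolding real_norm_def by blast
    qed
   qed (use ie in auto)
  qed
  have esE: "esum (\<lambda>a. (?A n a) * min 2 (?A n a)) = \<bar>?s n\<bar> * E n" for n
   unfolding E_def using esum_cmult[of "\<bar>?s n\<bar>" "\<lambda>a. e' a * min 2 (?A n a)"] by (simp only: mult.assoc)
  have En0: "0 \<le> \<bar>?s n\<bar> * E n" for n using esum_nonneg[OF adE[of n]] unfolding esE .
  have err: "norm ((LINT x|M. iexp (?s n * Sn F n x)) - (LINT x|M. iexp (?s n * F x)) ^ n)
    \<le> real n * (8 * (C * (\<bar>?s n\<bar> * E n)) * \<bar>?s n\<bar> * I)" for n
   unfolding I_def
  proof (rule char_recursion[OF F1])
   show "0 \<le> C * (\<bar>?s n\<bar> * E n)" by (rule mult_nonneg_nonneg[OF less_imp_le[OF C] En0])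
   fix H :: "'a \<Rightarrow> real" assume H[measurable]: "rv H" and Hb: "\<forall>x\<in>space M. \<bar>H x\<bar> \<le> 1"
   have iH: "integrable M H" by (rule integrable_bounded[OF H]) (use Hb in auto)
   have iHT: "integrable M (\<lambda>x. H (T x))" by (rule integrable_T[OF iH])
   have ic: "integrable M (\<lambda>x. cos (?s n * F x))" by (rule integrable_bounded[where B=1]) auto
   have isn: "integrable M (\<lambda>x. sin (?s n * F x))" by (rule integrable_bounded[where B=1]) auto
   have icH: "integrable M (\<lambda>x. cos (?s n * F x) * H (T x))" by (rule integrable_times_bounded[OF iHT, where B=1]) auto
   have isH: "integrable M (\<lambda>x. sin (?s n * F x) * H (T x))" by (rule integrable_times_bounded[OF iHT, where B=1]) auto
   have iFH: "integrable M (\<lambda>x. F x * H (T x))"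
    using integrable_times_bounded[OF F1, of "\<lambda>x. H (T x)" 1] Hb T_space by (simp add: mult.commute)
   have rc: "reg (\<lambda>a. (?A n a) * min 2 (?A n a)) (\<lambda>x. cos (?s n * F x) - 1)"
   proof (rule reg_second_order[OF rF ae, of "\<lambda>z. cos z - 1" "\<lambda>z. - sin z"])
    show "((\<lambda>z. cos z - 1) has_real_derivative - sin z) (at z)" for z by (auto intro!: derivative_eq_intros)
    show "\<bar>- sin z\<bar> \<le> min 2 \<bar>z\<bar>" for z :: real using abs_sin_x_le_abs_x[of z] order_trans[OF abs_sin_le_one[of z], of 2] by simp
   qed simp
   have rs: "reg (\<lambda>a. (?A n a) * min 2 (?A n a)) (\<lambda>x. sin (?s n * F x) - ?s n * F x)"
   proof (rule reg_second_order[OF rF ae, of "\<lambda>z. sin z - z" "\<lambda>z. cos z - 1"])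
    show "((\<lambda>z. sin z - z) has_real_derivative cos z - 1) (at z)" for z by (auto intro!: derivative_eq_intros)
    show "\<bar>cos z - 1\<bar> \<le> min 2 \<bar>z\<bar>" for z :: real
     using abs_cos_diff_le[of z 0] cos_le_one[of z] cos_ge_minus_one[of z] by (simp add: abs_le_iff)
   qed simp
   have "(LINT x|M. (cos (?s n * F x) - 1) * H (T x)) = (LINT x|M. cos (?s n * F x) * H (T x)) - (LINT x|M. H x)"
    using icH iHT integral_T[OF H] by (simp add: left_diff_distrib)
   moreover have "(LINT x|M. cos (?s n * F x) - 1) = (LINT x|M. cos (?s n * F x)) - 1" using ic prob_space by simp
   ultimately show "\<bar>(LINT x|M. cos (?s n * F x) * H (T x)) - (LINT x|M. cos (?s n * F x)) * (LINT x|M. H x)\<bar>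
     \<le> C * (\<bar>?s n\<bar> * E n) * (LINT x|M. \<bar>H x - H (T x)\<bar>)"
    using dec[OF adE rc H Hb] unfolding esE by (simp add: left_diff_distrib)
   have "(LINT x|M. (sin (?s n * F x) - ?s n * F x) * H (T x))
     = (LINT x|M. sin (?s n * F x) * H (T x) - ?s n * (F x * H (T x)))"
    by (simp only: left_diff_distrib mult.assoc)
   also have "\<dots> = (LINT x|M. sin (?s n * F x) * H (T x)) - ?s n * (LINT x|M. F x * H (T x))"
    using isH iFH by simp
   also have "(LINT x|M. F x * H (T x)) = 0" by (rule mart[OF H Hb])
   finally have "(LINT x|M. (sin (?s n * F x) - ?s n * F x) * H (T x)) = (LINT x|M. sin (?s n * F x) * H (T x))" by simp
   moreover have "(LINT x|M. sin (?s n * F x) - ?s n * F x) = (LINT x|M. sin (?s n * F x))" using isn F1 F0 by simp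
   ultimately show "\<bar>(LINT x|M. sin (?s n * F x) * H (T x)) - (LINT x|M. sin (?s n * F x)) * (LINT x|M. H x)\<bar>
     \<le> C * (\<bar>?s n\<bar> * E n) * (LINT x|M. \<bar>H x - H (T x)\<bar>)"
    using dec[OF adE rs H Hb] unfolding esE by simp
  qed
  have err0: "(\<lambda>n. real n * (8 * (C * (\<bar>?s n\<bar> * E n)) * \<bar>?s n\<bar> * I)) \<longlonglongrightarrow> 0"
  proof (rule Lim_transform_eventually)
   have "(\<lambda>n. 8 * C * I * t\<^sup>2 * E n) \<longlonglongrightarrow> 8 * C * I * t\<^sup>2 * 0" using E0 by (intro tendsto_intros) simp
   then show "(\<lambda>n. 8 * C * I * t\<^sup>2 * E n) \<longlonglongrightarrow> 0" by simp
   show "EV n. 8 * C * I * t\<^sup>2 * E n = real n * (8 * (C * (\<bar>?s n\<bar> * E n)) * \<bar>?s n\<bar> * I)"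
    using eventually_gt_at_top[of 0]
   proof eventually_elim
    case (elim n)
    have "real n * (\<bar>?s n\<bar> * \<bar>?s n\<bar>) = t\<^sup>2" using elim by (simp add: power2_eq_square)
    from this[symmetric] show ?case by (simp only: mult.assoc mult.commute mult.left_commute)
   qed
  qed
  have d1: "(\<lambda>n. (LINT x|M. iexp (?s n * Sn F n x)) - (LINT x|M. iexp (?s n * F x)) ^ n) \<longlonglongrightarrow> 0"
   by (rule Lim_null_comparison[OF _ err0]) (use err in auto)
  have tel: "Sn F k x = Sn f k x + u x - u ((T ^^ k) x)" for k x
   by (induction k) (auto simp: birkhoff_Suc' F_def)
  \<comment> \<open>The Birkhoff sums of \<open>F\<close> and \<open>f\<close> differ by the bounded
    function \<open>u - u \<circ> T\<^sup>n\<close>, which disappears after division by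
    \<open>sqrt n\<close>.\<close>
  have d2: "(\<lambda>n. (LINT x|M. iexp (?s n * Sn f n x)) - (LINT x|M. iexp (?s n * Sn F n x))) \<longlonglongrightarrow> 0"
  proof (rule Lim_null_comparison[OF always_eventually], rule allI)
   fix n
   have i: "integrable M (\<lambda>x. iexp (?s n * Sn f n x))" "integrable M (\<lambda>x. iexp (?s n * Sn F n x))"
    by (rule integrable_iexp'; measurable)+
   have "norm ((LINT x|M. iexp (?s n * Sn f n x)) - (LINT x|M. iexp (?s n * Sn F n x)))
     = norm (LINT x|M. iexp (?s n * Sn f n x) - iexp (?s n * Sn F n x))"
    using i by simp
   also have "\<dots> \<le> (LINT x|M. norm (iexp (?s n * Sn f n x) - iexp (?s n * Sn F n x)))"
    by (rule integral_norm_bound)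
   also have "\<dots> \<le> (LINT x|M. \<bar>?s n\<bar> * (2 * U))"
   proof (rule integral_mono)
    show "integrable M (\<lambda>x. norm (iexp (?s n * Sn f n x) - iexp (?s n * Sn F n x)))"
     by (rule integrable_norm[OF int_diff[OF i]])
    fix x
    have "norm (iexp (?s n * Sn f n x) - iexp (?s n * Sn F n x))
     \<le> \<bar>?s n * Sn f n x - ?s n * Sn F n x\<bar>" by (rule norm_iexp_diff_le)
    also have "\<dots> = \<bar>?s n\<bar> * \<bar>Sn f n x - Sn F n x\<bar>"
     by (simp only: right_diff_distrib[symmetric] abs_mult)
    also have "\<dots> \<le> \<bar>?s n\<bar> * (2 * U)"
     using ub[rule_format, of x] ub[rule_format, of "(T ^^ n) x"] tel[of n x] by (intro mult_left_mono) linarith+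
    finally show "norm (iexp (?s n * Sn f n x) - iexp (?s n * Sn F n x)) \<le> \<bar>?s n\<bar> * (2 * U)" .
   qed simp
   finally show "norm ((LINT x|M. iexp (?s n * Sn f n x)) - (LINT x|M. iexp (?s n * Sn F n x))) \<le> \<bar>?s n\<bar> * (2 * U)"
    using prob_space by simp
  next
   show "(\<lambda>n. \<bar>?s n\<bar> * (2 * U)) \<longlonglongrightarrow> 0" using tendsto_mult[OF s0 tendsto_const[of "2 * U"]] by simp
  qed
  from tendsto_add[OF tendsto_add[OF d2 d1] pow] show ?thesis by simp
 qed
 then show ?thesis using v by blast
qed

end

section \<open>Logarithmic averages\<close>

lemma sum_inverse_le_ln_diff:
 assumes "1 \<le> m" "m \<le> N"
 shows "(\<Sum>k\<in>{m<..N}. 1 / real k) \<le> ln (real N) - ln (real m)"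
 using assms(2)
proof (induction N rule: dec_induct)
 case (step n)
 then have n: "1 \<le> n" using assms(1) by simp
 have "ln (real n / real (Suc n)) \<le> real n / real (Suc n) - 1" using n by (intro ln_le_minus_one) simp
 also have "real n / real (Suc n) - 1 = - (1 / real (Suc n))" by (simp add: field_simps)
 finally have "1 / real (Suc n) \<le> ln (real (Suc n)) - ln (real n)" using n by (simp add: ln_div)
 moreover have "{m<..Suc n} = insert (Suc n) {m<..n}" using step by auto
 ultimately show ?case using step.IH by simp
qed simp

lemma harm_le_ln: "1 \<le> n \<Longrightarrow> harm n \<le> 1 + ln (real n)"
proof -
 assume n: "1 \<le> n"
 then have "{1..n} = insert 1 {1<..n}" by auto
 then have "harm n = 1 + (\<Sum>k\<in>{1<..n}. 1 / real k)" by (simp add: harm_def inverse_eq_divide)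
 then show ?thesis using sum_inverse_le_ln_diff[of 1 n] n by simp
qed

text \<open>The logarithms of \<open>2 ^ (j\<^sup>2)\<close> and
  \<open>2 ^ ((j + 1)\<^sup>2)\<close> differ by \<open>(2 j + 1) ln 2\<close>, negligible against
  \<open>j\<^sup>2 ln 2\<close>; bounded terms cannot move the average between two such
  times.\<close>

lemma log_average_interpolate:
 fixes a :: "nat \<Rightarrow> real"
 assumes a: "\<And>k. \<bar>a k\<bar> \<le> c"
  and lim: "(\<lambda>j. (\<Sum>k\<in>{1..2 ^ (j^2)}. a k / real k) / (real (j^2) * ln 2)) \<longlonglongrightarrow> 0"
 shows "(\<lambda>N. (\<Sum>k\<in>{1..N}. a k / real k) / ln (real N)) \<longlonglongrightarrow> 0"
proof (rule LIMSEQ_I)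
 fix \<epsilon> :: real assume \<epsilon>: "0 < \<epsilon>"
 define A where "A N = (\<Sum>k\<in>{1..N}. a k / real k)" for N
 have c: "0 \<le> c" using a[of 0] by linarith
 have "(\<lambda>j. c * (2 * inverse (real j) + inverse (real j) * inverse (real j))) \<longlonglongrightarrow> c * (2 * 0 + 0 * 0)"
  by (intro tendsto_intros lim_inverse_n)
 then have "EV j. c * (2 * inverse (real j) + inverse (real j) * inverse (real j)) < \<epsilon> / 2"
  using \<epsilon> by (intro order_tendstoD) auto
 moreover have "EV j. \<bar>A (2 ^ (j^2)) / (real (j^2) * ln 2)\<bar> < \<epsilon> / 2"
  using order_tendstoD(2)[OF tendsto_rabs_zero[OF lim], of "\<epsilon> / 2"] \<epsilon> by (simp add: A_def)
 ultimately have "EV j. c * (2 * inverse (real j) + inverse (real j) * inverse (real j)) < \<epsilon> / 2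
   \<and> \<bar>A (2 ^ (j^2)) / (real (j^2) * ln 2)\<bar> < \<epsilon> / 2" by (rule eventually_conj)
 then obtain J where J: "\<And>j. j \<ge> J \<Longrightarrow> c * (2 * inverse (real j) + inverse (real j) * inverse (real j)) < \<epsilon> / 2
   \<and> \<bar>A (2 ^ (j^2)) / (real (j^2) * ln 2)\<bar> < \<epsilon> / 2" unfolding eventually_sequentially by blast
 have "\<bar>A N / ln (real N)\<bar> < \<epsilon>" if N: "2 ^ ((Suc J)^2) \<le> N" for N
 proof -
  define k where "k = (LEAST k. N < 2 ^ (k^2))"
  have "N < 2 ^ N" by simp
  also have "(2::nat) ^ N \<le> 2 ^ (N^2)" by (intro power_increasing) (auto simp: power2_eq_square)
  finally have k: "N < 2 ^ (k^2)" unfolding k_def by (rule LeastI)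
  have kJ: "Suc J < k"
  proof (rule ccontr)
   assume "\<not> Suc J < k"
   then have "k^2 \<le> (Suc J)^2" by (intro power_mono) auto
   then have "(2::nat) ^ (k^2) \<le> 2 ^ ((Suc J)^2)" by (intro power_increasing) auto
   with k N show False by linarith
  qed
  then obtain j where j: "k = Suc j" "J < j" by (cases k) auto
  have jN: "2 ^ (j^2) \<le> N" using not_less_Least[of j "\<lambda>k. N < 2 ^ (k^2)"] j unfolding k_def[symmetric] by simp
  have j1: "1 \<le> j" using j by simp
  have lnj: "ln (real (2 ^ (j^2))) = real (j^2) * ln 2" by (simp add: ln_realpow)
  have lnk: "ln (real (2 ^ (k^2))) = real (k^2) * ln 2" by (simp add: ln_realpow)
  have N0: "0 < N" using jN by (meson less_le_trans zero_less_numeral zero_less_power)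
  have le1: "real (j^2) * ln 2 \<le> ln (real N)" unfolding lnj[symmetric] using jN N0 by (subst ln_le_cancel_iff) (auto simp del: of_nat_power)
  have le2: "ln (real N) \<le> real (k^2) * ln 2" unfolding lnk[symmetric] using k N0 by (subst ln_le_cancel_iff) (auto simp del: of_nat_power)
  have pos: "0 < real (j^2) * ln 2" using j1 by simp
  let ?A = "\<Sum>k\<in>{2 ^ (j^2)<..N}. 1 / real k"
  have "{1..N} = {1..2 ^ (j^2)} \<union> {2 ^ (j^2)<..N}" using jN by auto
  then have "A N = A (2 ^ (j^2)) + (\<Sum>k\<in>{2 ^ (j^2)<..N}. a k / real k)"
   unfolding A_def by (simp add: sum.union_disjoint ivl_disj_int)
  moreover have "\<bar>\<Sum>k\<in>{2 ^ (j^2)<..N}. a k / real k\<bar> \<le> c * ?A"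
   unfolding sum_distrib_left by (rule order_trans[OF sum_abs]) (auto intro!: sum_mono simp: a divide_right_mono abs_divide)
  moreover have "c * ?A \<le> c * ((real (k^2) - real (j^2)) * ln 2)"
  proof (rule mult_left_mono[OF _ c])
   have "?A \<le> ln (real N) - ln (real (2 ^ (j^2)))"
    by (rule sum_inverse_le_ln_diff) (use jN in auto)
   then show "?A \<le> (real (k^2) - real (j^2)) * ln 2"
    unfolding lnj using le2 by (simp add: left_diff_distrib)
  qed
  ultimately have AN: "\<bar>A N\<bar> \<le> \<bar>A (2 ^ (j^2))\<bar> + c * ((real (k^2) - real (j^2)) * ln 2)" by linarith
  have "\<bar>A N / ln (real N)\<bar> \<le> \<bar>A N\<bar> / (real (j^2) * ln 2)"
   using le1 pos by (simp add: abs_divide frac_le)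
  also have "\<dots> \<le> (\<bar>A (2 ^ (j^2))\<bar> + c * ((real (k^2) - real (j^2)) * ln 2)) / (real (j^2) * ln 2)"
   by (rule divide_right_mono[OF AN]) (use pos in simp)
  also have "\<dots> = \<bar>A (2 ^ (j^2)) / (real (j^2) * ln 2)\<bar> + c * (2 * inverse (real j) + inverse (real j) * inverse (real j))"
  proof -
   have "real (k^2) - real (j^2) = 2 * real j + 1" using j by (simp add: power2_eq_square algebra_simps)
   moreover have "c * ((2 * real j + 1) * ln 2) / (real (j^2) * ln 2) = c * (2 * inverse (real j) + inverse (real j) * inverse (real j))"
    using j1 by (simp add: field_simps power2_eq_square)
   moreover have "\<bar>A (2 ^ (j^2))\<bar> / (real (j^2) * ln 2) = \<bar>A (2 ^ (j^2)) / (real (j^2) * ln 2)\<bar>"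
    using pos by (simp only: abs_divide abs_of_pos)
   ultimately show ?thesis by (simp only: add_divide_distrib)
  qed
  also have "\<dots> < \<epsilon>" using conjunct1[OF J[of j]] conjunct2[OF J[of j]] j by linarith
  finally show ?thesis .
 qed
 then show "\<exists>no. \<forall>n\<ge>no. norm ((\<Sum>k\<in>{1..n}. a k / real k) / ln (real n) - 0) < \<epsilon>"
  unfolding A_def by (intro exI[of _ "2 ^ ((Suc J)^2)"]) simp
qed

lemma sum_powr_le:
 assumes \<rho>: "0 < \<rho>" "\<rho> \<le> 1"
 shows "1 \<le> n \<Longrightarrow> (\<Sum>k\<in>{1..n}. real k powr (\<rho> - 1)) \<le> real n powr \<rho> / \<rho>"
proof (induction n rule: dec_induct)
 case base
 show ?case using \<rho> by simp
next
 case (step n)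
 have "\<exists>z. real n < z \<and> z < real (Suc n) \<and> real (Suc n) powr \<rho> - real n powr \<rho> = (real (Suc n) - real n) * (\<rho> * z powr (\<rho> - 1))"
  by (rule MVT2) (use step in \<open>auto intro!: derivative_eq_intros\<close>)
 then obtain z where z: "real n < z" "z < real (Suc n)" "real (Suc n) powr \<rho> - real n powr \<rho> = \<rho> * z powr (\<rho> - 1)"
  by auto
 have "real (Suc n) powr (\<rho> - 1) \<le> z powr (\<rho> - 1)" using z \<rho> step by (intro powr_mono2') auto
 then have "real (Suc n) powr (\<rho> - 1) \<le> (real (Suc n) powr \<rho> - real n powr \<rho>) / \<rho>" using z(3) \<rho> by simp
 then show ?case using step.IH step.hyps by (simp add: atLeastAtMostSuc_conv diff_divide_distrib)
qed

text \<open>A strong law for weakly correlated variables. For each \<open>n\<close> the sum over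
  \<open>k \<le> n\<close> of \<open>(k / n) powr \<rho> / k\<close> is bounded, so the second
  moment of the weighted sum is \<open>O(ln N)\<close>. Along \<open>N = 2 ^ (j\<^sup>2)\<close> the
  normalized second moments are \<open>O(1 / j\<^sup>2)\<close>, hence summable, and
  \<open>log_average_interpolate\<close> fills the gaps.\<close>

lemma (in prob_space) log_average_law:
 fixes \<xi> :: "nat \<Rightarrow> 'a \<Rightarrow> real"
 assumes m[measurable]: "\<And>k. \<xi> k \<in> borel_measurable M" and b: "\<And>k x. \<bar>\<xi> k x\<bar> \<le> c"
  and C: "0 \<le> C" and \<rho>: "0 < \<rho>" "\<rho> \<le> 1"
  and cov: "\<And>k n. 1 \<le> k \<Longrightarrow> k \<le> n \<Longrightarrow> \<bar>LINT x|M. \<xi> k x * \<xi> n x\<bar> \<le> C * (real k / real n) powr \<rho>"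
 shows "AE x in M. (\<lambda>N. (\<Sum>k\<in>{1..N}. \<xi> k x / real k) / ln (real N)) \<longlonglongrightarrow> 0"
proof -
 define A where "A N x = (\<Sum>k\<in>{1..N}. \<xi> k x / real k)" for N x
 have Am[measurable]: "A N \<in> borel_measurable M" for N unfolding A_def by measurable
 have i\<xi>: "integrable M (\<lambda>x. \<xi> k x * \<xi> n x)" for k n
 proof (rule integrable_const_bound[where B="c * c"])
  have "0 \<le> c" using b[of 0 undefined] by linarith
  then show "AE x in M. norm (\<xi> k x * \<xi> n x) \<le> c * c" using mult_mono[OF b b] by (intro AE_I2) (auto simp: abs_mult)
 qed measurable
 have iA\<xi>: "integrable M (\<lambda>x. A N x * \<xi> n x)" for N n
  unfolding A_def sum_distrib_right using i\<xi> by (auto intro!: Bochner_Integration.integrable_sum)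
 have iA2: "integrable M (\<lambda>x. A N x * A N x)" for N
 proof -
  have "(\<lambda>x. A N x * A N x) = (\<lambda>x. \<Sum>k\<in>{1..N}. A N x * \<xi> k x / real k)"
   by (subst (2) A_def) (simp add: sum_distrib_left)
  then show ?thesis using iA\<xi> by (auto intro!: Bochner_Integration.integrable_sum)
 qed
 define D where "D = 2 * C / \<rho>"
 have D: "0 \<le> D" unfolding D_def using C \<rho> by simp
 have var: "(LINT x|M. A N x * A N x) \<le> D * harm N" for N
 proof (induction N)
  case 0
  show ?case by (simp add: A_def harm_def)
 next
  case (Suc N)
  let ?n = "Suc N"
  have AS: "A ?n x = A N x + \<xi> ?n x / real ?n" for x by (simp add: A_def)
  have "(LINT x|M. A ?n x * A ?n x)
    = (LINT x|M. A N x * A N x + (2 / real ?n) * (A N x * \<xi> ?n x) + (1 / real ?n)\<^sup>2 * (\<xi> ?n x * \<xi> ?n x))"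
  proof -
   have "(p + q / r) * (p + q / r) = p * p + (2 / r) * (p * q) + (1 / r)\<^sup>2 * (q * q)" for p q r :: real
    unfolding divide_inverse by (simp add: power2_eq_square algebra_simps)
   then show ?thesis unfolding AS by (simp only:)
  qed
  also have "\<dots> = (LINT x|M. A N x * A N x) + (2 / real ?n) * (LINT x|M. A N x * \<xi> ?n x) + (1 / real ?n)\<^sup>2 * (LINT x|M. \<xi> ?n x * \<xi> ?n x)"
   using i\<xi> iA\<xi> iA2 by simp
  finally have eq: "(LINT x|M. A ?n x * A ?n x) = (LINT x|M. A N x * A N x) + (2 / real ?n) * (LINT x|M. A N x * \<xi> ?n x) + (1 / real ?n)\<^sup>2 * (LINT x|M. \<xi> ?n x * \<xi> ?n x)" .
  have kp: "(real k / real ?n) powr \<rho> / real k = real k powr (\<rho> - 1) * real ?n powr (- \<rho>)" if "1 \<le> k" for k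
   using that by (simp add: powr_divide powr_diff powr_minus field_simps)
  have "(LINT x|M. A N x * \<xi> ?n x) = (\<Sum>k\<in>{1..N}. (LINT x|M. \<xi> k x * \<xi> ?n x) / real k)"
   unfolding A_def sum_distrib_right using i\<xi> by (subst Bochner_Integration.integral_sum) auto
  also have "\<dots> \<le> (\<Sum>k\<in>{1..N}. C * (real k powr (\<rho> - 1) * real ?n powr (- \<rho>)))"
  proof (rule sum_mono)
   fix k assume k: "k \<in> {1..N}"
   have "(LINT x|M. \<xi> k x * \<xi> ?n x) \<le> C * (real k / real ?n) powr \<rho>" using cov[of k ?n] k by (simp add: abs_le_iff)
   then have "(LINT x|M. \<xi> k x * \<xi> ?n x) / real k \<le> C * (real k / real ?n) powr \<rho> / real k" by (rule divide_right_mono) simp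
   also have "\<dots> = C * (real k powr (\<rho> - 1) * real ?n powr (- \<rho>))"
    using kp[of k] k unfolding times_divide_eq_right[symmetric] by (simp only: atLeastAtMost_iff)
   finally show "(LINT x|M. \<xi> k x * \<xi> ?n x) / real k \<le> C * (real k powr (\<rho> - 1) * real ?n powr (- \<rho>))" .
  qed
  finally have s1: "(LINT x|M. A N x * \<xi> ?n x) \<le> (\<Sum>k\<in>{1..N}. C * (real k powr (\<rho> - 1) * real ?n powr (- \<rho>)))" .
  have s2: "(1 / real ?n) * (LINT x|M. \<xi> ?n x * \<xi> ?n x) \<le> C * (real ?n powr (\<rho> - 1) * real ?n powr (- \<rho>))"
  proof -
   have "(LINT x|M. \<xi> ?n x * \<xi> ?n x) \<le> C" using cov[of ?n ?n] by (simp add: abs_le_iff)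
   then have "(1 / real ?n) * (LINT x|M. \<xi> ?n x * \<xi> ?n x) \<le> (1 / real ?n) * C" by (rule mult_left_mono) simp
   moreover have "real ?n powr (\<rho> - 1) * real ?n powr (- \<rho>) = 1 / real ?n"
    unfolding powr_add[symmetric] by (simp add: powr_minus_divide)
   ultimately show ?thesis by simp
  qed
  have pos2: "0 \<le> (LINT x|M. \<xi> ?n x * \<xi> ?n x)" by simp
  \<comment> \<open>The diagonal term is doubled so that it becomes the term \<open>k = n\<close> of
    a single sum over \<open>k \<le> n\<close>.\<close>
  have "(2 / real ?n) * (LINT x|M. A N x * \<xi> ?n x) + (1 / real ?n)\<^sup>2 * (LINT x|M. \<xi> ?n x * \<xi> ?n x)
    \<le> (2 / real ?n) * ((LINT x|M. A N x * \<xi> ?n x) + (1 / real ?n) * (LINT x|M. \<xi> ?n x * \<xi> ?n x))"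
  proof -
   have "(2 / r) * a + (1 / r)\<^sup>2 * p \<le> (2 / r) * (a + (1 / r) * p)" if "0 \<le> p" for r a p :: real
   proof -
    have "(2 / r) * (a + (1 / r) * p) = (2 / r) * a + 2 * ((1 / r)\<^sup>2 * p)"
     by (simp add: power2_eq_square distrib_left)
    moreover have "0 \<le> (1 / r)\<^sup>2 * p" using that by simp
    ultimately show ?thesis by linarith
   qed
   then show ?thesis using pos2 by blast
  qed
  also have "\<dots> \<le> (2 / real ?n) * (\<Sum>k\<in>{1..?n}. C * (real k powr (\<rho> - 1) * real ?n powr (- \<rho>)))"
   using s1 s2 by (intro mult_left_mono) auto
  also have "(\<Sum>k\<in>{1..?n}. C * (real k powr (\<rho> - 1) * real ?n powr (- \<rho>))) = C * real ?n powr (- \<rho>) * (\<Sum>k\<in>{1..?n}. real k powr (\<rho> - 1))"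
   unfolding sum_distrib_left by (intro sum.cong) auto
  also have "(2 / real ?n) * (C * real ?n powr (- \<rho>) * (\<Sum>k\<in>{1..?n}. real k powr (\<rho> - 1)))
    \<le> (2 / real ?n) * (C * real ?n powr (- \<rho>) * (real ?n powr \<rho> / \<rho>))"
   using sum_powr_le[OF \<rho>, of ?n] C by (intro mult_left_mono) auto
  also have "\<dots> = D * inverse (real ?n)"
  proof -
   have "real ?n powr (- \<rho>) * real ?n powr \<rho> = 1" by (simp add: powr_add[symmetric])
   then have "C * real ?n powr (- \<rho>) * (real ?n powr \<rho> / \<rho>) = C / \<rho>" by (simp add: field_simps)
   then show ?thesis by (simp only: D_def) (simp add: field_simps)
  qed
  finally show ?case using Suc.IH eq by (simp add: harm_Suc distrib_left)
 qed
 define Y where "Y j x = (A (2 ^ (Suc j)^2) x / (real ((Suc j)^2) * ln 2))\<^sup>2" for j x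
 have Ym[measurable]: "Y j \<in> borel_measurable M" for j unfolding Y_def by measurable
 have iY: "integrable M (Y j)" for j
  unfolding Y_def power_divide using iA2 by (simp add: power2_eq_square)
 define D' where "D' = D * (1 + ln 2) / (ln 2)\<^sup>2"
 have Yb: "(LINT x|M. Y j x) \<le> D' * inverse (real (Suc j) ^ 2)" for j
 proof -
  let ?q = "real ((Suc j)^2)"
  have q: "1 \<le> ?q" by (simp only: of_nat_power) (rule one_le_power, simp)
  have l2: "0 < ln (2::real)" by simp
  have "(LINT x|M. Y j x) = (LINT x|M. A (2 ^ (Suc j)^2) x * A (2 ^ (Suc j)^2) x) / (?q * ln 2)\<^sup>2"
   unfolding Y_def power_divide by (simp add: power2_eq_square[of "A _ _"])
  also have "\<dots> \<le> D * harm (2 ^ (Suc j)^2) / (?q * ln 2)\<^sup>2" by (rule divide_right_mono[OF var]) simp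
  also have "\<dots> \<le> D * (?q * (1 + ln 2)) / (?q * ln 2)\<^sup>2"
  proof (intro divide_right_mono mult_left_mono D)
   have "harm (2 ^ (Suc j)^2) \<le> 1 + ln (real (2 ^ (Suc j)^2))" by (rule harm_le_ln) simp
   also have "ln (real (2 ^ (Suc j)^2)) = ?q * ln 2" by (simp add: ln_realpow)
   also have "1 + ?q * ln 2 \<le> ?q * (1 + ln 2)" using q by (simp add: distrib_left)
   finally show "harm (2 ^ (Suc j)^2) \<le> ?q * (1 + ln 2)" .
  qed simp
  also have "\<dots> = D' * inverse ?q"
  proof -
   have "D * (q * (1 + l)) / (q * l)\<^sup>2 = D * (1 + l) / l\<^sup>2 * inverse q" if "q \<noteq> 0" "l \<noteq> 0" for q l :: real
    using that by (simp add: power2_eq_square field_simps)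
   then show ?thesis using q l2 unfolding D'_def by force
  qed
  finally show ?thesis by simp
 qed
 have "summable (\<lambda>j. inverse (real (Suc j) ^ 2))"
  using inverse_power_summable[of 2, where 'a=real] by (subst summable_Suc_iff) auto
 then have sm: "summable (\<lambda>j. D' * inverse (real (Suc j) ^ 2))" by (rule summable_mult)
 have Y0: "0 \<le> Y j x" for j x by (simp add: Y_def)
 \<comment> \<open>Borel-Cantelli in expectation: the sum of the \<open>Y j\<close> has finite
   integral, so it is finite almost everywhere and \<open>Y j\<close> tends to 0.\<close>
 have "(\<integral>\<^sup>+x. (\<Sum>j. ennreal (Y j x)) \<partial>M) = (\<Sum>j. \<integral>\<^sup>+x. ennreal (Y j x) \<partial>M)"
  by (rule nn_integral_suminf) measurable
 also have "\<dots> \<le> (\<Sum>j. ennreal (D' * inverse (real (Suc j) ^ 2)))"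
 proof (intro suminf_le allI)
  show "(\<integral>\<^sup>+x. ennreal (Y j x) \<partial>M) \<le> ennreal (D' * inverse (real (Suc j) ^ 2))" for j
   using iY Yb[of j] by (subst nn_integral_eq_integral) (auto simp: Y0 intro!: ennreal_leI)
 qed auto
 also have "\<dots> < \<infinity>"
 proof -
  have "0 \<le> D' * inverse (real (Suc j) ^ 2)" for j unfolding D'_def using D by (intro mult_nonneg_nonneg divide_nonneg_nonneg) auto
  then show ?thesis using sm by (simp add: suminf_ennreal2 less_top[symmetric])
 qed
 finally have "AE x in M. (\<Sum>j. ennreal (Y j x)) \<noteq> \<infinity>" by (intro nn_integral_PInf_AE) auto
 then show ?thesis
 proof (rule AE_mp, intro AE_I2 impI)
  fix x assume "(\<Sum>j. ennreal (Y j x)) \<noteq> \<infinity>"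
  then have "summable (\<lambda>j. Y j x)" using Y0 by (intro summable_suminf_not_top) auto
  then have "(\<lambda>j. Y j x) \<longlonglongrightarrow> 0" by (rule summable_LIMSEQ_zero)
  then have "(\<lambda>j. sqrt (Y j x)) \<longlonglongrightarrow> sqrt 0" by (rule tendsto_real_sqrt)
  then have "(\<lambda>j. \<bar>A (2 ^ (Suc j)^2) x / (real ((Suc j)^2) * ln 2)\<bar>) \<longlonglongrightarrow> 0"
   unfolding Y_def real_sqrt_abs by simp
  then have "(\<lambda>j. A (2 ^ (Suc j)^2) x / (real ((Suc j)^2) * ln 2)) \<longlonglongrightarrow> 0" by (rule tendsto_rabs_zero_cancel)
  then have "(\<lambda>j. A (2 ^ j^2) x / (real (j^2) * ln 2)) \<longlonglongrightarrow> 0"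
   by (rule LIMSEQ_imp_Suc)
  then show "(\<lambda>N. (\<Sum>k\<in>{1..N}. \<xi> k x / real k) / ln (real N)) \<longlonglongrightarrow> 0"
   unfolding A_def by (rule log_average_interpolate[OF b])
 qed
qed

section \<open>From logarithmic averages of test functions to weak convergence; tightness
  criteria\<close>

lemma harm_over_ln: "(\<lambda>N. harm N / ln (real N)) \<longlonglongrightarrow> 1"
proof -
 have ln: "filterlim (\<lambda>N. ln (real N)) at_top sequentially"
  by (rule filterlim_compose[OF ln_at_top filterlim_real_sequentially])
 have "(\<lambda>N. (harm N - ln (real N)) / ln (real N)) \<longlonglongrightarrow> 0"
  by (rule tendsto_divide_0[OF euler_mascheroni_LIMSEQ filterlim_at_top_imp_at_infinity[OF ln]])
 from tendsto_add[OF this tendsto_const[of 1]]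
 have "(\<lambda>N. (harm N - ln (real N)) / ln (real N) + 1) \<longlonglongrightarrow> 1" by simp
 then show ?thesis
 proof (rule Lim_transform_eventually)
  show "\<forall>\<^sub>F N in sequentially. (harm N - ln (real N)) / ln (real N) + 1 = harm N / ln (real N)"
   using eventually_gt_at_top[of 1] by eventually_elim (simp add: field_simps)
 qed
qed

lemma log_average_tendsto:
 fixes m :: "nat \<Rightarrow> real"
 assumes m: "m \<longlonglongrightarrow> l"
 shows "(\<lambda>N. (\<Sum>k\<in>{1..N}. m k / real k) / ln (real N)) \<longlonglongrightarrow> l"
proof -
 have z: "(\<lambda>N. (\<Sum>k\<in>{1..N}. (m k - l) / real k) / ln (real N)) \<longlonglongrightarrow> 0"
 proof (rule LIMSEQ_I)
  fix \<epsilon> :: real assume \<epsilon>: "0 < \<epsilon>"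
  from LIMSEQ_D[OF m, of "\<epsilon> / 4"] \<epsilon> obtain K where K: "\<And>k. k \<ge> K \<Longrightarrow> \<bar>m k - l\<bar> < \<epsilon> / 4" by auto
  define S where "S = (\<Sum>k\<in>{1..K}. \<bar>m k - l\<bar> / real k)"
  have ln: "filterlim (\<lambda>N. ln (real N)) at_top sequentially"
   by (rule filterlim_compose[OF ln_at_top filterlim_real_sequentially])
  have "(\<lambda>N. S / ln (real N)) \<longlonglongrightarrow> 0"
   by (rule tendsto_divide_0[OF tendsto_const filterlim_at_top_imp_at_infinity[OF ln]])
  then have "\<forall>\<^sub>F N in sequentially. S / ln (real N) < \<epsilon> / 4" using \<epsilon> by (intro order_tendstoD) auto
  moreover have "\<forall>\<^sub>F N in sequentially. harm N / ln (real N) < (2::real)" by (rule order_tendstoD(2)[OF harm_over_ln]) simp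
  moreover have "\<forall>\<^sub>F N in sequentially. K + 2 \<le> N" by (rule eventually_ge_at_top)
  ultimately have "\<forall>\<^sub>F N in sequentially. \<bar>(\<Sum>k\<in>{1..N}. (m k - l) / real k) / ln (real N)\<bar> < \<epsilon>"
  proof eventually_elim
   case (elim N)
   have lnN: "0 < ln (real N)" using elim by simp
   have "\<bar>\<Sum>k\<in>{1..N}. (m k - l) / real k\<bar> \<le> (\<Sum>k\<in>{1..N}. \<bar>m k - l\<bar> / real k)"
    by (rule order_trans[OF sum_abs]) (simp add: abs_divide)
   also have "(\<Sum>k\<in>{1..N}. \<bar>m k - l\<bar> / real k) = S + (\<Sum>k\<in>{K<..N}. \<bar>m k - l\<bar> / real k)"
   proof -
    have "{1..N} = {1..K} \<union> {K<..N}" using elim by auto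
    then show ?thesis unfolding S_def by (simp only:) (rule sum.union_disjoint, auto)
   qed
   also have "(\<Sum>k\<in>{K<..N}. \<bar>m k - l\<bar> / real k) \<le> (\<Sum>k\<in>{K<..N}. \<epsilon> / 4 * inverse (real k))"
   proof (rule sum_mono)
    fix k assume "k \<in> {K<..N}"
    then have "\<bar>m k - l\<bar> \<le> \<epsilon> / 4" by (intro less_imp_le K) simp
    then show "\<bar>m k - l\<bar> / real k \<le> \<epsilon> / 4 * inverse (real k)"
     unfolding divide_inverse[of "\<bar>m k - l\<bar>"] by (rule mult_right_mono) simp
   qed
   also have "\<dots> \<le> \<epsilon> / 4 * harm N"
    unfolding sum_distrib_left[symmetric] harm_def using \<epsilon> by (intro mult_left_mono sum_mono2) auto
   finally have "\<bar>\<Sum>k\<in>{1..N}. (m k - l) / real k\<bar> / ln (real N) \<le> (S + \<epsilon> / 4 * harm N) / ln (real N)"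
    using lnN by (intro divide_right_mono) auto
   also have "\<dots> = S / ln (real N) + \<epsilon> / 4 * (harm N / ln (real N))" by (simp add: add_divide_distrib)
   also have "\<dots> < \<epsilon> / 4 + \<epsilon> / 4 * 2" using elim \<epsilon> by (intro add_strict_mono mult_strict_left_mono) auto
   finally have "\<bar>\<Sum>k\<in>{1..N}. (m k - l) / real k\<bar> / ln (real N) < \<epsilon>" using \<epsilon> by linarith
   then show ?case using lnN by (simp add: abs_divide)
  qed
  then show "\<exists>no. \<forall>n\<ge>no. norm ((\<Sum>k\<in>{1..n}. (m k - l) / real k) / ln (real n) - 0) < \<epsilon>"
   by (simp add: eventually_sequentially)
 qed
 have "(\<Sum>k\<in>{1..N}. (m k - l) / real k) / ln (real N) + l * (harm N / ln (real N)) = (\<Sum>k\<in>{1..N}. m k / real k) / ln (real N)" for N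
 proof -
  have "(\<Sum>k\<in>{1..N}. (m k - l) / real k) = (\<Sum>k\<in>{1..N}. m k / real k) - l * harm N"
   unfolding harm_def sum_distrib_left sum_subtractf[symmetric]
   by (intro sum.cong) (simp_all add: divide_inverse left_diff_distrib)
  then show ?thesis by (simp add: diff_divide_distrib)
 qed
 moreover have "(\<lambda>N. (\<Sum>k\<in>{1..N}. (m k - l) / real k) / ln (real N) + l * (harm N / ln (real N))) \<longlonglongrightarrow> 0 + l * 1"
  by (intro tendsto_intros z harm_over_ln)
 ultimately show ?thesis by simp
qed

text \<open>Continuous steps with rational break points squeeze the distribution function at its
  continuity points. As they are countably many, an almost sure statement about each of them yields
  one exceptional null set for all.\<close>

lemma weak_conv_of_rational_steps:
 assumes \<nu>: "\<And>n. real_distribution (\<nu> n)" and W: "real_distribution W"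
  and lim: "\<And>a b. \<lbrakk>a \<in> \<rat>; b \<in> \<rat>; a < b\<rbrakk> \<Longrightarrow> (\<lambda>n. integral\<^sup>L (\<nu> n) (cts_step a b)) \<longlonglongrightarrow> integral\<^sup>L W (cts_step a b)"
 shows "weak_conv_m \<nu> W"
 unfolding weak_conv_m_def weak_conv_def
proof (intro allI impI)
 interpret W: real_distribution W by (rule W)
 interpret N: real_distribution "\<nu> n" for n by (rule \<nu>)
 fix z assume z: "isCont (cdf W) z"
 show "(\<lambda>n. cdf (\<nu> n) z) \<longlonglongrightarrow> cdf W z"
 proof (rule LIMSEQ_I)
  fix \<epsilon> :: real assume \<epsilon>: "0 < \<epsilon>"
  from LIM_D[OF z[unfolded isCont_def], of "\<epsilon> / 2"] \<epsilon>
  obtain \<delta> where \<delta>: "0 < \<delta>" "\<And>w. w \<noteq> z \<Longrightarrow> \<bar>w - z\<bar> < \<delta> \<Longrightarrow> \<bar>cdf W w - cdf W z\<bar> < \<epsilon> / 2" by auto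
  obtain a1 where a1: "a1 \<in> \<rat>" "z - \<delta> < a1" "a1 < z" using Rats_dense_in_real[of "z - \<delta>" z] \<delta> by auto
  obtain b1 where b1: "b1 \<in> \<rat>" "a1 < b1" "b1 < z" using Rats_dense_in_real[of a1 z] a1 by auto
  obtain b2 where b2: "b2 \<in> \<rat>" "z < b2" "b2 < z + \<delta>" using Rats_dense_in_real[of z "z + \<delta>"] \<delta> by auto
  obtain a2 where a2: "a2 \<in> \<rat>" "z < a2" "a2 < b2" using Rats_dense_in_real[of z b2] b2 by auto
  have "EV n. integral\<^sup>L (\<nu> n) (cts_step a2 b2) < integral\<^sup>L W (cts_step a2 b2) + \<epsilon> / 2"
   using order_tendstoD(2)[OF lim[OF a2(1) b2(1) a2(3)]] \<epsilon> by simp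
  moreover have "EV n. integral\<^sup>L W (cts_step a1 b1) - \<epsilon> / 2 < integral\<^sup>L (\<nu> n) (cts_step a1 b1)"
   using order_tendstoD(1)[OF lim[OF a1(1) b1(1) b1(2)]] \<epsilon> by simp
  ultimately have "EV n. \<bar>cdf (\<nu> n) z - cdf W z\<bar> < \<epsilon>"
  proof eventually_elim
   case (elim n)
   have "cdf (\<nu> n) z \<le> cdf (\<nu> n) a2" using a2 by (intro N.cdf_nondecreasing) simp
   also have "\<dots> \<le> integral\<^sup>L (\<nu> n) (cts_step a2 b2)" by (rule N.cdf_cts_step(1)[OF a2(3)])
   finally have u: "cdf (\<nu> n) z < cdf W b2 + \<epsilon> / 2" using elim(1) W.cdf_cts_step(2)[OF a2(3)] by linarith
   have "integral\<^sup>L (\<nu> n) (cts_step a1 b1) \<le> cdf (\<nu> n) b1" by (rule N.cdf_cts_step(2)[OF b1(2)])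
   also have "\<dots> \<le> cdf (\<nu> n) z" using b1 by (intro N.cdf_nondecreasing) simp
   finally have l: "cdf W a1 - \<epsilon> / 2 < cdf (\<nu> n) z" using elim(2) W.cdf_cts_step(1)[OF b1(2)] by linarith
   have "\<bar>cdf W b2 - cdf W z\<bar> < \<epsilon> / 2" "\<bar>cdf W a1 - cdf W z\<bar> < \<epsilon> / 2"
    using \<delta>(2)[of b2] \<delta>(2)[of a1] a1 b2 by auto
   with u l show ?case by linarith
  qed
  then show "\<exists>no. \<forall>n\<ge>no. norm (cdf (\<nu> n) z - cdf W z) < \<epsilon>" by (simp add: eventually_sequentially)
 qed
qed

text \<open>The logarithmic empirical measures have total mass \<open>harm N / ln N\<close>, not 1.
  Dividing by \<open>harm\<close> gives probability measures, to which the theory of weak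
  convergence applies, and the two normalizations are equivalent by
  \<open>harm_over_ln\<close>.\<close>

lemma weakly_converges_log_empirical:
 fixes y :: "nat \<Rightarrow> real"
 assumes W: "real_distribution W"
  and lim: "\<And>a b. \<lbrakk>a \<in> \<rat>; b \<in> \<rat>; a < b\<rbrakk> \<Longrightarrow>
   (\<lambda>N. (\<Sum>k\<in>{1..N}. cts_step a b (y k) / real k) / ln (real N)) \<longlonglongrightarrow> integral\<^sup>L W (cts_step a b)"
 shows "weakly_converges (log_empirical_measure y) W"
proof -
 \<comment> \<open>The shift to \<open>Suc N\<close> keeps \<open>harm\<close> positive from the
   first index on.\<close>
 define p where "p N k = 1 / harm (Suc N) * (1 / real k)" for N k
 define \<nu> where "\<nu> N = distr (point_measure {1..Suc N} (\<lambda>k. ennreal (p N k))) borel y" for N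
 have h: "0 < (harm (Suc N) :: real)" for N by (rule harm_pos) simp
 have p0: "0 \<le> p N k" for N k unfolding p_def using less_imp_le[OF h[of N]] by (intro mult_nonneg_nonneg divide_nonneg_nonneg) auto
 have psum: "(\<Sum>k\<in>{1..Suc N}. p N k) = 1" for N
  unfolding p_def sum_distrib_left[symmetric] using h[of N] by (simp add: harm_def inverse_eq_divide)
 have \<nu>: "real_distribution (\<nu> N)" for N unfolding \<nu>_def
 proof (intro prob_space.real_distribution_distr prob_spaceI)
  show "emeasure (point_measure {1..Suc N} (\<lambda>k. ennreal (p N k))) (space (point_measure {1..Suc N} (\<lambda>k. ennreal (p N k)))) = 1"
   using psum[of N] p0 by (simp add: space_point_measure emeasure_point_measure_finite sum_ennreal del: sum.cl_ivl_Suc)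
 qed simp
 have int: "integral\<^sup>L (\<nu> N) \<phi> = (\<Sum>k\<in>{1..Suc N}. \<phi> (y k) / real k) / harm (Suc N)"
  if [measurable]: "\<phi> \<in> borel_measurable borel" for N and \<phi> :: "real \<Rightarrow> real"
 proof -
  have "integral\<^sup>L (\<nu> N) \<phi> = integral\<^sup>L (point_measure {1..Suc N} (\<lambda>k. ennreal (p N k))) (\<lambda>k. \<phi> (y k))"
   unfolding \<nu>_def by (rule integral_distr) auto
  also have "\<dots> = (\<Sum>k\<in>{1..Suc N}. p N k *\<^sub>R \<phi> (y k))"
   by (rule lebesgue_integral_point_measure_finite) (auto simp: p0)
  finally show ?thesis by (simp add: p_def sum_divide_distrib del: sum.cl_ivl_Suc) (simp add: ac_simps)
 qed
 have int2: "integral\<^sup>L (log_empirical_measure y N) \<phi> = (\<Sum>k\<in>{1..N}. \<phi> (y k) / real k) / ln (real N)"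
  if [measurable]: "\<phi> \<in> borel_measurable borel" and N: "1 < N" for N and \<phi> :: "real \<Rightarrow> real"
 proof -
  have "integral\<^sup>L (log_empirical_measure y N) \<phi> = integral\<^sup>L (point_measure {1..N} (\<lambda>k. ennreal (1 / ln (real N) * (1 / real k)))) (\<lambda>k. \<phi> (y k))"
   unfolding log_empirical_measure_def by (rule integral_distr) auto
  also have "\<dots> = (\<Sum>k\<in>{1..N}. (1 / ln (real N) * (1 / real k)) *\<^sub>R \<phi> (y k))"
   by (rule lebesgue_integral_point_measure_finite) (use N in auto)
  finally show ?thesis by (simp add: sum_divide_distrib) (simp add: ac_simps)
 qed
 have ratio: "(\<lambda>N. ln (real (Suc N)) / harm (Suc N)) \<longlonglongrightarrow> 1"
  using tendsto_inverse[OF LIMSEQ_Suc[OF harm_over_ln]] by simp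
 have "weak_conv_m \<nu> W"
 proof (rule weak_conv_of_rational_steps[OF \<nu> W])
  fix a b :: real assume ab: "a \<in> \<rat>" "b \<in> \<rat>" "a < b"
  have m: "cts_step a b \<in> borel_measurable borel"
   using ab(3) by (intro borel_measurable_continuous_onI uniformly_continuous_imp_continuous cts_step_uniformly_continuous)
  have "(\<lambda>N. (\<Sum>k\<in>{1..Suc N}. cts_step a b (y k) / real k) / ln (real (Suc N)) * (ln (real (Suc N)) / harm (Suc N)))
    \<longlonglongrightarrow> integral\<^sup>L W (cts_step a b) * 1"
   by (intro tendsto_mult ratio LIMSEQ_Suc[OF lim[OF ab]])
  then show "(\<lambda>n. integral\<^sup>L (\<nu> n) (cts_step a b)) \<longlonglongrightarrow> integral\<^sup>L W (cts_step a b)"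
   unfolding int[OF m] mult_1_right
  proof (rule Lim_transform_eventually)
   show "\<forall>\<^sub>F N in sequentially. (\<Sum>k\<in>{1..Suc N}. cts_step a b (y k) / real k) / ln (real (Suc N)) * (ln (real (Suc N)) / harm (Suc N))
     = (\<Sum>k\<in>{1..Suc N}. cts_step a b (y k) / real k) / harm (Suc N)"
    using eventually_gt_at_top[of 0] by eventually_elim (simp del: sum.cl_ivl_Suc)
  qed
 qed
 note wc = this
 show ?thesis unfolding weakly_converges_def
 proof (intro allI impI)
  fix \<phi> :: "real \<Rightarrow> real" assume c: "continuous_on UNIV \<phi>" and b: "bounded (range \<phi>)"
  have m: "\<phi> \<in> borel_measurable borel" by (rule borel_measurable_continuous_onI[OF c])
  from b obtain B where B: "\<And>x. norm (\<phi> x) \<le> B" unfolding bounded_iff by auto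
  have "(\<lambda>N. integral\<^sup>L (\<nu> N) \<phi>) \<longlonglongrightarrow> integral\<^sup>L W \<phi>"
   using \<nu> W wc by (rule weak_conv_imp_integral_bdd_continuous_conv) (use c B in \<open>auto simp: continuous_on_eq_continuous_at\<close>)
  then have "(\<lambda>N. (\<Sum>k\<in>{1..Suc N}. \<phi> (y k) / real k) / harm (Suc N) * (harm (Suc N) / ln (real (Suc N)))) \<longlonglongrightarrow> integral\<^sup>L W \<phi> * 1"
   unfolding int[OF m] by (intro tendsto_mult LIMSEQ_Suc[OF harm_over_ln])
  then have "(\<lambda>N. (\<Sum>k\<in>{1..Suc N}. \<phi> (y k) / real k) / ln (real (Suc N))) \<longlonglongrightarrow> integral\<^sup>L W \<phi>"
   using h by (simp add: less_imp_neq[OF h, symmetric] del: sum.cl_ivl_Suc)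
  then have "(\<lambda>N. (\<Sum>k\<in>{1..N}. \<phi> (y k) / real k) / ln (real N)) \<longlonglongrightarrow> integral\<^sup>L W \<phi>" by (rule LIMSEQ_imp_Suc)
  then show "(\<lambda>N. integral\<^sup>L (log_empirical_measure y N) \<phi>) \<longlonglongrightarrow> integral\<^sup>L W \<phi>"
  proof (rule Lim_transform_eventually)
   show "\<forall>\<^sub>F N in sequentially. (\<Sum>k\<in>{1..N}. \<phi> (y k) / real k) / ln (real N) = integral\<^sup>L (log_empirical_measure y N) \<phi>"
    using eventually_gt_at_top[of 1] by eventually_elim (simp add: int2[OF m])
  qed
 qed
qed

lemma (in prob_space) tight_of_moments:
 assumes m[measurable]: "\<And>n. X n \<in> borel_measurable M"
  and W: "\<And>n. \<exists>W. integrable M W \<and> (\<forall>x\<in>space M. \<bar>X n x\<bar> \<le> W x) \<and> (LINT x|M. W x) \<le> K"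
 shows "tight (\<lambda>n. distr M borel (X n))"
 unfolding tight_def
proof (intro conjI allI impI)
 show "real_distribution (distr M borel (X n))" for n by (rule real_distribution_distr) measurable
 fix \<epsilon> :: real assume \<epsilon>: "0 < \<epsilon>"
 define b where "b = (\<bar>K\<bar> + 1) / \<epsilon>"
 have b: "0 < b" unfolding b_def using \<epsilon> by (intro divide_pos_pos) auto
 have "1 - \<epsilon> < measure (distr M borel (X n)) {- b - 1<..b}" for n
 proof -
  from W[of n] obtain W where W: "integrable M W" "\<And>x. x \<in> space M \<Longrightarrow> \<bar>X n x\<bar> \<le> W x" "(LINT x|M. W x) \<le> K" by blast
  have [measurable]: "W \<in> borel_measurable M" using W(1) by auto
  have W0: "0 \<le> W x" if "x \<in> space M" for x using W(2)[OF that] by linarith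
  have "prob {x \<in> space M. b \<le> W x} \<le> (LINT x|M. W x) / b"
   by (rule integral_Markov_inequality_measure[OF W(1)]) (use W0 b in auto)
  also have "\<dots> \<le> K / b" using W(3) b by (simp add: divide_right_mono)
  also have "\<dots> < \<epsilon>"
  proof -
   have "K < \<epsilon> * b" unfolding b_def using \<epsilon> by simp
   then show ?thesis using b by (simp add: pos_divide_less_eq)
  qed
  finally have 1: "prob {x \<in> space M. b \<le> W x} < \<epsilon>" .
  have "1 - prob {x \<in> space M. b \<le> W x} = prob (space M - {x \<in> space M. b \<le> W x})"
   by (rule prob_compl[symmetric]) measurable
  also have "\<dots> \<le> prob (X n -` {- b - 1<..b} \<inter> space M)"
   by (rule finite_measure_mono) (use W(2) in \<open>force+\<close>)
  also have "\<dots> = measure (distr M borel (X n)) {- b - 1<..b}" by (rule measure_distr[symmetric]) auto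
  finally show ?thesis using 1 by linarith
 qed
 then show "\<exists>a b. a < b \<and> (\<forall>n. 1 - \<epsilon> < measure (distr M borel (X n)) {a<..b})"
  using b by (intro exI[of _ "- b - 1"] exI[of _ b]) auto
qed

text \<open>Tightness supplies a limit point, whose characteristic function can only be
  \<open>ch\<close>. This produces the limit law without knowing beforehand that \<open>ch\<close>
  is a characteristic function; the stable laws are obtained in this way.\<close>

lemma tight_char_limit:
 assumes t: "tight \<mu>" and lim: "\<And>t. (\<lambda>n. char (\<mu> n) t) \<longlonglongrightarrow> ch t"
 shows "\<exists>W. real_distribution W \<and> (\<forall>t. char W t = ch t)"
proof -
 have \<mu>: "real_distribution (\<mu> n)" for n using t by (simp add: tight_def)
 obtain r W where r: "strict_mono (r :: nat \<Rightarrow> nat)" and W: "real_distribution W" "weak_conv_m (\<mu> \<circ> id \<circ> r) W"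
  using tight_imp_convergent_subsubsequence[OF t strict_mono_id] by blast
 have "char W t = ch t" for t
 proof -
  have "(\<lambda>n. char ((\<mu> \<circ> id \<circ> r) n) t) \<longlonglongrightarrow> char W t"
   by (rule levy_continuity1[OF _ W]) (simp add: \<mu>)
  moreover have "(\<lambda>n. char ((\<mu> \<circ> id \<circ> r) n) t) \<longlonglongrightarrow> ch t"
   using LIMSEQ_subseq_LIMSEQ[OF lim r] by (simp add: o_def)
  ultimately show ?thesis by (rule LIMSEQ_unique)
 qed
 then show ?thesis using W by blast
qed

lemma (in prob_space) char_distr:
 "X \<in> borel_measurable M \<Longrightarrow> char (distr M borel X) t = (LINT x|M. iexp (t * X x))"
 unfolding char_def by (subst integral_distr) auto

lemma cts_step_eq: "a < b \<Longrightarrow> cts_step a b x = max 0 (min 1 ((b - x) / (b - a)))"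
 by (auto simp: cts_step_def max_def min_def field_simps)

lemma cts_step_lipschitz: "a < b \<Longrightarrow> \<bar>cts_step a b x - cts_step a b y\<bar> \<le> 1 / (b - a) * \<bar>x - y\<bar>"
proof -
 assume ab: "a < b"
 have "\<bar>max 0 (min 1 p) - max 0 (min 1 q)\<bar> \<le> \<bar>p - q\<bar>" for p q :: real by (auto simp: max_def min_def)
 then have "\<bar>cts_step a b x - cts_step a b y\<bar> \<le> \<bar>(b - x) / (b - a) - (b - y) / (b - a)\<bar>"
  unfolding cts_step_eq[OF ab] .
 also have "(b - x) / (b - a) - (b - y) / (b - a) = (y - x) / (b - a)" by (simp add: diff_divide_distrib)
 also have "\<bar>(y - x) / (b - a)\<bar> = 1 / (b - a) * \<bar>x - y\<bar>" using ab by (simp add: abs_divide abs_minus_commute)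
 finally show ?thesis .
qed

lemma cts_step_bounds: "a < b \<Longrightarrow> \<bar>cts_step a b x\<bar> \<le> 1"
 unfolding cts_step_eq by (auto simp: max_def min_def)

lemma cts_step_meas: "a < b \<Longrightarrow> cts_step a b \<in> borel_measurable borel"
 by (intro borel_measurable_continuous_onI uniformly_continuous_imp_continuous cts_step_uniformly_continuous)

section \<open>Tight maxima and the almost sure limit theorem\<close>

context gm_obs begin

lemma birkhoff_add: "Sn g (k + j) x = Sn g k x + Sn g j ((T ^^ k) x)"
 by (induction j) (auto simp: birkhoff_Suc' funpow_add[symmetric, unfolded o_def] funpow_add add.commute)

text \<open>What makes the bound of \<open>truncated_max_bound\<close> at height
  \<open>b = B n\<close> a multiple of \<open>B n\<close>: one condition for the second moment of
  the truncation, one for the excess, one for the \<open>sqrt n\<close> of the coboundary.\<close>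

definition normalizing :: "(nat \<Rightarrow> real) \<Rightarrow> real \<Rightarrow> bool" where
 "normalizing B K \<longleftrightarrow> (\<forall>n\<ge>1. 0 < B n \<and> real n * (LINT x|M. min ((f x)\<^sup>2) ((B n)\<^sup>2)) \<le> K * (B n)\<^sup>2 \<and>
   real n * (LINT x|M. max (\<bar>f x\<bar> - B n) 0) \<le> K * B n \<and> real n \<le> K * (B n)\<^sup>2)"

lemma max_moment:
 assumes B: "normalizing B K"
 shows "\<exists>K'\<ge>0. \<forall>n\<ge>1. \<exists>W. integrable M W \<and> (\<forall>x. \<forall>k\<le>n. \<bar>Sn f k x\<bar> \<le> W x) \<and> (LINT x|M. W x) \<le> K' * B n"
proof -
 obtain Kt where Kt: "0 \<le> Kt" and tr: "\<forall>n b. 1 \<le> n \<longrightarrow> 0 < b \<longrightarrow> (\<exists>W. integrable M W \<and> (\<forall>x. \<forall>k\<le>n. \<bar>Sn f k x\<bar> \<le> W x) \<and>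
   (LINT x|M. W x) \<le> Kt * (sqrt (real n * (LINT x|M. min ((f x)\<^sup>2) (b\<^sup>2))) + sqrt (real n))
    + 2 * (real n * (LINT x|M. max (\<bar>f x\<bar> - b) 0)))"
  using truncated_max_bound by (elim exE conjE)
 have K: "0 \<le> K"
 proof (rule ccontr)
  assume "\<not> 0 \<le> K"
  then have "K * (B 1)\<^sup>2 \<le> 0" by (simp add: mult_nonpos_nonneg)
  then show False using B unfolding normalizing_def by force
 qed
 show ?thesis
 proof (intro exI[of _ "2 * Kt * sqrt K + 2 * K"] conjI allI impI)
  show "0 \<le> 2 * Kt * sqrt K + 2 * K" using K Kt by simp
  fix n :: nat assume n: "1 \<le> n"
  have b: "0 < B n" and b1: "real n * (LINT x|M. min ((f x)\<^sup>2) ((B n)\<^sup>2)) \<le> K * (B n)\<^sup>2"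
   and b2: "real n * (LINT x|M. max (\<bar>f x\<bar> - B n) 0) \<le> K * B n" and b3: "real n \<le> K * (B n)\<^sup>2"
   using B n unfolding normalizing_def by blast+
  from tr[rule_format, OF n b] obtain W where W: "integrable M W" "\<forall>x. \<forall>k\<le>n. \<bar>Sn f k x\<bar> \<le> W x"
   and iW: "(LINT x|M. W x) \<le> Kt * (sqrt (real n * (LINT x|M. min ((f x)\<^sup>2) ((B n)\<^sup>2))) + sqrt (real n))
    + 2 * (real n * (LINT x|M. max (\<bar>f x\<bar> - B n) 0))" by (elim exE conjE)
  have sK: "sqrt (K * (B n)\<^sup>2) = sqrt K * B n" using b by (simp add: real_sqrt_mult)
  have s1: "sqrt (real n * (LINT x|M. min ((f x)\<^sup>2) ((B n)\<^sup>2))) \<le> sqrt K * B n"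
   using real_sqrt_le_mono[OF b1] unfolding sK .
  have s2: "sqrt (real n) \<le> sqrt K * B n" using real_sqrt_le_mono[OF b3] unfolding sK .
  have "(LINT x|M. W x) \<le> Kt * (sqrt K * B n + sqrt K * B n) + 2 * (K * B n)"
   by (rule order_trans[OF iW]) (intro add_mono mult_left_mono s1 s2 b2 Kt, simp)
  also have "\<dots> = (2 * Kt * sqrt K + 2 * K) * B n" by (simp add: algebra_simps)
  finally show "\<exists>W. integrable M W \<and> (\<forall>x. \<forall>k\<le>n. \<bar>Sn f k x\<bar> \<le> W x) \<and> (LINT x|M. W x) \<le> (2 * Kt * sqrt K + 2 * K) * B n"
   using W by blast
 qed
qed

lemma tight_maxima:
 assumes B: "normalizing B K"
 shows "tight (\<lambda>n. distr M borel (\<lambda>x. (MAX k\<in>{1..Suc n}. \<bar>Sn f k x\<bar>) / B (Suc n)))"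
proof -
 obtain K' where K': "0 \<le> K'" and mm: "\<forall>n\<ge>1. \<exists>W. integrable M W \<and> (\<forall>x. \<forall>k\<le>n. \<bar>Sn f k x\<bar> \<le> W x) \<and> (LINT x|M. W x) \<le> K' * B n"
  using max_moment[OF B] by (elim exE conjE)
 show ?thesis
 proof (rule tight_of_moments[where K=K'])
  fix n
  have [measurable]: "Sn f k \<in> borel_measurable M" for k by measurable
  show "(\<lambda>x. (MAX k\<in>{1..Suc n}. \<bar>Sn f k x\<bar>) / B (Suc n)) \<in> borel_measurable M"
   by measurable
  have b: "0 < B (Suc n)" using B by (simp add: normalizing_def)
  from mm[rule_format, of "Suc n"] obtain W where W: "integrable M W" "\<forall>x. \<forall>k\<le>Suc n. \<bar>Sn f k x\<bar> \<le> W x"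
   "(LINT x|M. W x) \<le> K' * B (Suc n)" by auto
  show "\<exists>W. integrable M W \<and> (\<forall>x\<in>space M. \<bar>(MAX k\<in>{1..Suc n}. \<bar>Sn f k x\<bar>) / B (Suc n)\<bar> \<le> W x) \<and> (LINT x|M. W x) \<le> K'"
  proof (intro exI[of _ "\<lambda>x. W x / B (Suc n)"] conjI ballI)
   show "integrable M (\<lambda>x. W x / B (Suc n))" using W(1) by simp
   show "(LINT x|M. W x / B (Suc n)) \<le> K'" using W(3) b by (simp add: pos_divide_le_eq)
   fix x
   let ?m = "MAX k\<in>{1..Suc n}. \<bar>Sn f k x\<bar>"
   have 1: "?m \<le> W x" by (rule Max.boundedI) (use W(2) in auto)
   have "\<bar>Sn f 1 x\<bar> \<le> ?m" by (rule Max_ge) auto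
   then have "0 \<le> ?m" by linarith
   then show "\<bar>?m / B (Suc n)\<bar> \<le> W x / B (Suc n)" using 1 b by (simp add: abs_divide divide_right_mono)
  qed
 qed
qed

lemma tight_sums:
 assumes B: "normalizing B K"
 shows "tight (\<lambda>n. distr M borel (\<lambda>x. Sn f n x / B n))"
proof -
 obtain K' where K': "0 \<le> K'" and mm: "\<forall>n\<ge>1. \<exists>W. integrable M W \<and> (\<forall>x. \<forall>k\<le>n. \<bar>Sn f k x\<bar> \<le> W x) \<and> (LINT x|M. W x) \<le> K' * B n"
  using max_moment[OF B] by (elim exE conjE)
 show ?thesis
 proof (rule tight_of_moments[where K=K'])
  fix n
  show "(\<lambda>x. Sn f n x / B n) \<in> borel_measurable M" by measurable
  show "\<exists>W. integrable M W \<and> (\<forall>x\<in>space M. \<bar>Sn f n x / B n\<bar> \<le> W x) \<and> (LINT x|M. W x) \<le> K'"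
  proof (cases "n = 0")
   case True
   then show ?thesis using K' by (intro exI[of _ "\<lambda>_. 0"]) simp
  next
   case False
   then have b: "0 < B n" using B by (simp add: normalizing_def)
   from mm[rule_format, of n] False obtain W where W: "integrable M W" "\<forall>x. \<forall>k\<le>n. \<bar>Sn f k x\<bar> \<le> W x"
    "(LINT x|M. W x) \<le> K' * B n" by auto
   show ?thesis
   proof (intro exI[of _ "\<lambda>x. W x / B n"] conjI ballI)
    show "integrable M (\<lambda>x. W x / B n)" using W(1) by simp
    show "(LINT x|M. W x / B n) \<le> K'" using W(3) b by (simp add: pos_divide_le_eq)
    show "\<bar>Sn f n x / B n\<bar> \<le> W x / B n" for x using W(2) b by (simp add: abs_divide divide_right_mono)
   qed
  qed
 qed
qed

text \<open>In the covariance of \<open>\<phi> (S\<^sub>k / B\<^sub>k)\<close> and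
  \<open>\<phi> (S\<^sub>n / B\<^sub>n)\<close>, the sum \<open>S\<^sub>n\<close> is replaced by
  \<open>S\<^sub>n\<^sub>-\<^sub>k \<circ> T\<^sup>k\<close>, at a cost of order
  \<open>E|S\<^sub>k| / B\<^sub>n\<close>, and the resulting pair is decorrelated at a cost of order
  \<open>1 / B\<^sub>n\<close>. Both are \<open>O(B\<^sub>k / B\<^sub>n)\<close>, hence bounded by a
  power of \<open>k / n\<close> as \<open>log_average_law\<close> requires.\<close>

lemma almost_sure_limit:
 assumes B: "normalizing B K" and CB: "0 \<le> CB" and \<rho>: "0 < \<rho>" "\<rho> \<le> 1"
  and ratio: "\<And>k n. 1 \<le> k \<Longrightarrow> k \<le> n \<Longrightarrow> B k / B n \<le> CB * (real k / real n) powr \<rho>"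
  and W: "real_distribution W" and wc: "weak_conv_m (\<lambda>n. distr M borel (\<lambda>x. Sn f n x / B n)) W"
 shows "almost_sure_limit_theorem M (Sn f) B W"
proof -
 let ?S = "Sn f"
 have Sm[measurable]: "?S k \<in> borel_measurable M" for k by measurable
 obtain K' where K': "0 \<le> K'" and mm: "\<forall>n\<ge>1. \<exists>W. integrable M W \<and> (\<forall>x. \<forall>k\<le>n. \<bar>?S k x\<bar> \<le> W x) \<and> (LINT x|M. W x) \<le> K' * B n"
  using max_moment[OF B] by (elim exE conjE)
 have iS: "integrable M (\<lambda>x. \<bar>?S k x\<bar>)" for k
  unfolding birkhoff_sum_def using integrable_iter[OF f_int] by auto
 have ES: "(LINT x|M. \<bar>?S k x\<bar>) \<le> K' * B k" if "1 \<le> k" for k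
 proof -
  from mm[rule_format, OF that] obtain W where W: "integrable M W" "\<forall>x. \<forall>j\<le>k. \<bar>?S j x\<bar> \<le> W x"
    "(LINT x|M. W x) \<le> K' * B k" by auto
  have "(LINT x|M. \<bar>?S k x\<bar>) \<le> (LINT x|M. W x)" by (rule integral_mono[OF iS W(1)]) (use W(2) in auto)
  then show ?thesis using W(3) by simp
 qed
 have Bpos: "0 < B n" if "1 \<le> n" for n using B that by (simp add: normalizing_def)
 have K1: "1 \<le> K * (B n)\<^sup>2" if "1 \<le> n" for n
 proof -
  have "real n \<le> K * (B n)\<^sup>2" using B that unfolding normalizing_def by blast
  then show ?thesis using that by linarith
 qed
 have Kp: "0 < K"
 proof (rule ccontr)
  assume "\<not> 0 < K"
  then have "K * (B 1)\<^sup>2 \<le> 0" by (simp add: mult_nonpos_nonneg)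
  then show False using K1[of 1] by simp
 qed
 \<comment> \<open>The condition \<open>n \<le> K * (B n)\<^sup>2\<close> bounds every
   \<open>1 / B n\<close> by \<open>sqrt K\<close>, the range of \<open>\<beta>\<close> over which
   \<open>birkhoff_decorrelation\<close> is uniform. It also gives
   \<open>1 / B n \<le> \<beta>0 * (B k / B n)\<close>.\<close>
 define \<beta>0 where "\<beta>0 = sqrt K"
 have \<beta>0: "0 \<le> \<beta>0" unfolding \<beta>0_def using Kp by simp
 have \<beta>: "1 / B n \<le> \<beta>0" if "1 \<le> n" for n
 proof -
  have "sqrt 1 \<le> sqrt (K * (B n)\<^sup>2)" by (rule real_sqrt_le_mono[OF K1[OF that]])
  then have "1 \<le> \<beta>0 * B n" using Bpos[OF that] by (simp add: real_sqrt_mult \<beta>0_def)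
  then show ?thesis using Bpos[OF that] by (simp add: pos_divide_le_eq)
 qed
 have key: "AE x in M. (\<lambda>N. (\<Sum>k\<in>{1..N}. cts_step a b (?S k x / B k) / real k) / ln (real N)) \<longlonglongrightarrow> integral\<^sup>L W (cts_step a b)"
  if ab: "a < b" for a b
 proof -
  define \<phi> where "\<phi> = cts_step a b"
  define L where "L = 1 / (b - a)"
  have L: "0 \<le> L" using ab by (simp add: L_def)
  have \<phi>L: "\<bar>\<phi> x - \<phi> y\<bar> \<le> L * \<bar>x - y\<bar>" for x y unfolding \<phi>_def L_def by (rule cts_step_lipschitz[OF ab])
  have \<phi>b: "\<bar>\<phi> x\<bar> \<le> 1" for x unfolding \<phi>_def by (rule cts_step_bounds[OF ab])
  have \<phi>m[measurable]: "\<phi> \<in> borel_measurable borel" unfolding \<phi>_def by (rule cts_step_meas[OF ab])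
  have ib: "integrable M (\<lambda>x. q x)" if [measurable]: "rv q" and "\<And>x. \<bar>q x\<bar> \<le> 1" for q :: "'a \<Rightarrow> real"
   by (rule integrable_bounded[where B=1]) (use that in auto)
  have prod1: "\<bar>p * q\<bar> \<le> 1" if "\<bar>p\<bar> \<le> 1" "\<bar>q\<bar> \<le> 1" for p q :: real
   using mult_mono[OF that] by (simp add: abs_mult)
  obtain C where C: "0 < C" and dec: "\<forall>\<beta> k H B. 0 \<le> \<beta> \<longrightarrow> \<beta> \<le> \<beta>0 \<longrightarrow> rv H \<longrightarrow> (\<forall>x\<in>space M. \<bar>H x\<bar> \<le> B) \<longrightarrow>
   \<bar>(LINT x|M. \<phi> (\<beta> * ?S k x) * H ((T ^^ k) x)) - (LINT x|M. \<phi> (\<beta> * ?S k x)) * (LINT x|M. H x)\<bar> \<le> C * (LINT x|M. \<bar>H x - H (T x)\<bar>)"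
   using birkhoff_decorrelation[OF f_reg e_adm \<phi>b \<phi>L L \<beta>0 \<phi>m] by (elim exE conjE)
  define m where "m k = (LINT x|M. \<phi> (?S k x / B k))" for k
  define If where "If = (LINT x|M. \<bar>f x\<bar>)"
  define \<xi> where "\<xi> k x = (if k = 0 then 0 else \<phi> (?S k x / B k) - m k)" for k x
  have i\<phi>: "integrable M (\<lambda>x. \<phi> (?S k x / B n))" for k n by (rule ib) (auto simp: \<phi>b)
  have m1: "\<bar>m k\<bar> \<le> 1" for k
  proof -
   have "\<bar>m k\<bar> \<le> (LINT x|M. \<bar>\<phi> (?S k x / B k)\<bar>)" unfolding m_def by (rule integral_abs_bound)
   also have "\<dots> \<le> (LINT x|M. 1)" using i\<phi> by (intro integral_mono) (auto simp: \<phi>b)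
   finally show ?thesis using prob_space by simp
  qed
  \<comment> \<open>Twice \<open>L * K'\<close> for replacing \<open>S\<^sub>n\<close>, once in the
    joint integral and once in its mean; the other term is the cost of decorrelation.\<close>
  define R where "R = 2 * (L * K') + C * (L * (2 * If)) * \<beta>0"
  have If0: "0 \<le> If" by (simp add: If_def)
  have R0: "0 \<le> R" unfolding R_def using L K' C If0 \<beta>0 by (intro add_nonneg_nonneg mult_nonneg_nonneg) auto
  have \<xi>m: "\<xi> k \<in> borel_measurable M" for k unfolding \<xi>_def[abs_def] by measurable
  have \<xi>b: "\<bar>\<xi> k x\<bar> \<le> 2" for k x using \<phi>b[of "?S k x / B k"] m1[of k] by (auto simp: \<xi>_def)
  have cov: "\<bar>LINT x|M. \<xi> k x * \<xi> n x\<bar> \<le> (R * CB) * (real k / real n) powr \<rho>"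
   if k: "1 \<le> k" "k \<le> n" for k n
  proof -
   have n: "1 \<le> n" using k by simp
   note Bk = Bpos[OF k(1)] and Bn = Bpos[OF n]
   define H where "H x = \<phi> (?S (n - k) x / B n)" for x
   have Hm[measurable]: "rv H" unfolding H_def[abs_def] by measurable
   have Hb: "\<bar>H x\<bar> \<le> 1" for x by (simp add: H_def \<phi>b)
   define I1 where "I1 = (LINT x|M. \<phi> (?S k x / B k) * \<phi> (?S n x / B n))"
   define I2 where "I2 = (LINT x|M. \<phi> (?S k x / B k) * H ((T ^^ k) x))"
   have i1: "integrable M (\<lambda>x. \<phi> (?S k x / B k) * \<phi> (?S n x / B n))"
    by (rule ib) (measurable, auto intro!: prod1 \<phi>b)
   have i2: "integrable M (\<lambda>x. \<phi> (?S k x / B k) * H ((T ^^ k) x))"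
    by (rule ib) (measurable, auto intro!: prod1 \<phi>b Hb)
   have iH: "integrable M H" by (rule ib) (auto simp: Hb)
   have iHk: "integrable M (\<lambda>x. H ((T ^^ k) x))" by (rule integrable_iter[OF iH])
   have dH: "\<bar>\<phi> (?S n x / B n) - H ((T ^^ k) x)\<bar> \<le> (L / B n) * \<bar>?S k x\<bar>" for x
   proof -
    have "?S n x = ?S k x + ?S (n - k) ((T ^^ k) x)" using birkhoff_add[of f k "n - k" x] k by simp
    then have "?S n x / B n - ?S (n - k) ((T ^^ k) x) / B n = ?S k x / B n" by (simp add: add_divide_distrib)
    then have "\<bar>\<phi> (?S n x / B n) - H ((T ^^ k) x)\<bar> \<le> L * \<bar>?S k x / B n\<bar>"
     using \<phi>L[of "?S n x / B n" "?S (n - k) ((T ^^ k) x) / B n"] by (simp add: H_def)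
    then show ?thesis using Bn by (simp add: abs_divide)
   qed
   have dI: "(LINT x|M. \<bar>\<phi> (?S n x / B n) - H ((T ^^ k) x)\<bar>) \<le> (L * K') * (B k / B n)"
   proof -
    have "(LINT x|M. \<bar>\<phi> (?S n x / B n) - H ((T ^^ k) x)\<bar>) \<le> (LINT x|M. (L / B n) * \<bar>?S k x\<bar>)"
     by (rule integral_mono) (use i\<phi> iHk iS dH in auto)
    also have "\<dots> = (L / B n) * (LINT x|M. \<bar>?S k x\<bar>)" by simp
    also have "\<dots> \<le> (L / B n) * (K' * B k)" using ES[OF k(1)] L Bn by (intro mult_left_mono) auto
    finally show ?thesis by simp
   qed
   have e1: "\<bar>I1 - I2\<bar> \<le> (L * K') * (B k / B n)"
   proof -
    have "I1 - I2 = (LINT x|M. \<phi> (?S k x / B k) * (\<phi> (?S n x / B n) - H ((T ^^ k) x)))"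
     unfolding I1_def I2_def using i1 i2 by (simp add: right_diff_distrib)
    then have "\<bar>I1 - I2\<bar> \<le> (LINT x|M. \<bar>\<phi> (?S k x / B k) * (\<phi> (?S n x / B n) - H ((T ^^ k) x))\<bar>)"
     by (simp only:) (rule integral_abs_bound)
    also have "\<dots> \<le> (LINT x|M. \<bar>\<phi> (?S n x / B n) - H ((T ^^ k) x)\<bar>)"
    proof (rule integral_mono)
     show "integrable M (\<lambda>x. \<bar>\<phi> (?S k x / B k) * (\<phi> (?S n x / B n) - H ((T ^^ k) x))\<bar>)"
      using i1 i2 by (simp add: right_diff_distrib)
     show "integrable M (\<lambda>x. \<bar>\<phi> (?S n x / B n) - H ((T ^^ k) x)\<bar>)" using i\<phi> iHk by simp
     show "\<bar>\<phi> (?S k x / B k) * (\<phi> (?S n x / B n) - H ((T ^^ k) x))\<bar> \<le> \<bar>\<phi> (?S n x / B n) - H ((T ^^ k) x)\<bar>" for x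
      unfolding abs_mult by (rule mult_left_le_one_le) (auto simp: \<phi>b)
    qed
    finally show ?thesis using dI by linarith
   qed
   have e2: "\<bar>I2 - m k * (LINT x|M. H x)\<bar> \<le> C * (L * (2 * If)) * \<beta>0 * (B k / B n)"
   proof -
    have "\<bar>(LINT x|M. \<phi> (1 / B k * ?S k x) * H ((T ^^ k) x)) - (LINT x|M. \<phi> (1 / B k * ?S k x)) * (LINT x|M. H x)\<bar>
      \<le> C * (LINT x|M. \<bar>H x - H (T x)\<bar>)"
     by (rule dec[rule_format, of "1 / B k" H 1 k]) (use \<beta>[OF k(1)] Bk Hb Hm in auto)
    then have "\<bar>I2 - m k * (LINT x|M. H x)\<bar> \<le> C * (LINT x|M. \<bar>H x - H (T x)\<bar>)"
     by (simp add: I2_def m_def)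
    also have "(LINT x|M. \<bar>H x - H (T x)\<bar>) \<le> (LINT x|M. (L / B n) * \<bar>?S (n - k) x - ?S (n - k) (T x)\<bar>)"
    proof (rule integral_mono)
     show "integrable M (\<lambda>x. \<bar>H x - H (T x)\<bar>)" using iH integrable_T[OF iH] by simp
     show "integrable M (\<lambda>x. (L / B n) * \<bar>?S (n - k) x - ?S (n - k) (T x)\<bar>)"
      using birkhoff_T_integral(1)[OF f_int] by simp
     fix x
     have "\<bar>H x - H (T x)\<bar> \<le> L * \<bar>?S (n - k) x / B n - ?S (n - k) (T x) / B n\<bar>" unfolding H_def by (rule \<phi>L)
     also have "?S (n - k) x / B n - ?S (n - k) (T x) / B n = (?S (n - k) x - ?S (n - k) (T x)) / B n"
      by (simp add: diff_divide_distrib)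
     finally show "\<bar>H x - H (T x)\<bar> \<le> (L / B n) * \<bar>?S (n - k) x - ?S (n - k) (T x)\<bar>" using Bn by (simp add: abs_divide)
    qed
    also have "\<dots> = (L / B n) * (LINT x|M. \<bar>?S (n - k) x - ?S (n - k) (T x)\<bar>)" by simp
    also have "\<dots> \<le> (L / B n) * (2 * If)"
     using birkhoff_T_integral(2)[OF f_int, of "n - k"] L Bn unfolding If_def by (intro mult_left_mono) auto
    also have "\<dots> = (L * (2 * If)) * (1 / B n)" by simp
    also have "\<dots> \<le> (L * (2 * If)) * (\<beta>0 * (B k / B n))"
    proof (rule mult_left_mono)
     have "1 \<le> \<beta>0 * B k" using \<beta>[OF k(1)] Bk by (simp add: pos_divide_le_eq)
     then have "1 / B n \<le> (\<beta>0 * B k) / B n" using Bn by (intro divide_right_mono) auto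
     then show "1 / B n \<le> \<beta>0 * (B k / B n)" by simp
    qed (use L If0 in simp)
    finally have "\<bar>I2 - m k * (LINT x|M. H x)\<bar> \<le> C * ((L * (2 * If)) * (\<beta>0 * (B k / B n)))" using C by simp
    then show ?thesis by (simp only: mult.assoc)
   qed
   have e3: "\<bar>m k * (LINT x|M. H x) - m k * m n\<bar> \<le> (L * K') * (B k / B n)"
   proof -
    have "(LINT x|M. H x) - m n = (LINT x|M. H ((T ^^ k) x) - \<phi> (?S n x / B n))"
     using integral_iter[OF Hm, of k] iHk i\<phi> by (simp add: m_def)
    then have "\<bar>(LINT x|M. H x) - m n\<bar> \<le> (LINT x|M. \<bar>H ((T ^^ k) x) - \<phi> (?S n x / B n)\<bar>)"
     by (simp only:) (rule integral_abs_bound)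
    also have "\<dots> = (LINT x|M. \<bar>\<phi> (?S n x / B n) - H ((T ^^ k) x)\<bar>)" by (simp only: abs_minus_commute)
    finally have "\<bar>(LINT x|M. H x) - m n\<bar> \<le> (L * K') * (B k / B n)" using dI by linarith
    moreover have "\<bar>m k * (LINT x|M. H x) - m k * m n\<bar> \<le> \<bar>(LINT x|M. H x) - m n\<bar>"
     unfolding right_diff_distrib[symmetric] abs_mult by (rule mult_left_le_one_le) (auto simp: m1)
    ultimately show ?thesis by linarith
   qed
   have "(LINT x|M. \<xi> k x * \<xi> n x) = (LINT x|M. \<phi> (?S k x / B k) * \<phi> (?S n x / B n) - m n * \<phi> (?S k x / B k) - m k * \<phi> (?S n x / B n) + m k * m n)"
    using k by (intro int_cong) (auto simp: \<xi>_def algebra_simps)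
   also have "\<dots> = I1 - m n * m k - m k * m n + m k * m n"
    unfolding I1_def using i1 i\<phi> prob_space by (simp add: m_def[symmetric])
   finally have eq: "(LINT x|M. \<xi> k x * \<xi> n x) = I1 - m k * m n" by simp
   have tri: "\<bar>i - q\<bar> \<le> a + b + c" if "\<bar>i - j\<bar> \<le> a" "\<bar>j - p\<bar> \<le> b" "\<bar>p - q\<bar> \<le> c" for i j p q a b c :: real
    using that by linarith
   have "\<bar>LINT x|M. \<xi> k x * \<xi> n x\<bar> \<le> (L * K') * (B k / B n) + C * (L * (2 * If)) * \<beta>0 * (B k / B n) + (L * K') * (B k / B n)"
    unfolding eq by (rule tri[OF e1 e2 e3])
   also have "\<dots> = R * (B k / B n)" unfolding R_def by (simp only: distrib_right) simp
   also have "\<dots> \<le> R * (CB * (real k / real n) powr \<rho>)" by (rule mult_left_mono[OF ratio[OF k] R0])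
   finally show ?thesis by (simp only: mult.assoc)
  qed
  have z: "AE x in M. (\<lambda>N. (\<Sum>k\<in>{1..N}. \<xi> k x / real k) / ln (real N)) \<longlonglongrightarrow> 0"
   by (rule log_average_law[OF \<xi>m \<xi>b _ \<rho> cov]) (use R0 CB in auto)
  have mlim: "m \<longlonglongrightarrow> integral\<^sup>L W \<phi>"
  proof -
   have "(\<lambda>n. integral\<^sup>L (distr M borel (\<lambda>x. ?S n x / B n)) \<phi>) \<longlonglongrightarrow> integral\<^sup>L W \<phi>"
    using _ W wc
   proof (rule weak_conv_imp_integral_bdd_continuous_conv)
    show "real_distribution (distr M borel (\<lambda>x. ?S n x / B n))" for n by (rule real_distribution_distr) measurable
    show "isCont \<phi> x" for x using uniformly_continuous_imp_continuous[OF cts_step_uniformly_continuous[OF ab]]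
     by (simp add: \<phi>_def continuous_on_eq_continuous_at)
    show "norm (\<phi> x) \<le> 1" for x using \<phi>b by simp
   qed
   moreover have "integral\<^sup>L (distr M borel (\<lambda>x. ?S n x / B n)) \<phi> = m n" for n
    unfolding m_def by (rule integral_distr) measurable
   ultimately show ?thesis by simp
  qed
  from z show ?thesis unfolding \<phi>_def[symmetric]
  proof (rule AE_mp, intro AE_I2 impI)
   fix x assume "(\<lambda>N. (\<Sum>k\<in>{1..N}. \<xi> k x / real k) / ln (real N)) \<longlonglongrightarrow> 0"
   from tendsto_add[OF this log_average_tendsto[OF mlim]]
   have "(\<lambda>N. (\<Sum>k\<in>{1..N}. \<xi> k x / real k) / ln (real N) + (\<Sum>k\<in>{1..N}. m k / real k) / ln (real N)) \<longlonglongrightarrow> integral\<^sup>L W \<phi>" by simp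
   moreover have "(\<Sum>k\<in>{1..N}. \<xi> k x / real k) / ln (real N) + (\<Sum>k\<in>{1..N}. m k / real k) / ln (real N)
     = (\<Sum>k\<in>{1..N}. \<phi> (?S k x / B k) / real k) / ln (real N)" for N
   proof -
    have "(\<Sum>k\<in>{1..N}. \<xi> k x / real k) + (\<Sum>k\<in>{1..N}. m k / real k) = (\<Sum>k\<in>{1..N}. \<phi> (?S k x / B k) / real k)"
     unfolding sum.distrib[symmetric] by (intro sum.cong) (auto simp: \<xi>_def add_divide_distrib[symmetric])
    then show ?thesis by (simp add: add_divide_distrib[symmetric])
   qed
   ultimately show "(\<lambda>N. (\<Sum>k\<in>{1..N}. \<phi> (?S k x / B k) / real k) / ln (real N)) \<longlonglongrightarrow> integral\<^sup>L W \<phi>" by simp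
  qed
 qed
 have "AE x in M. \<forall>a\<in>\<rat>. \<forall>b\<in>\<rat>. a < b \<longrightarrow> (\<lambda>N. (\<Sum>k\<in>{1..N}. cts_step a b (?S k x / B k) / real k) / ln (real N)) \<longlonglongrightarrow> integral\<^sup>L W (cts_step a b)"
  unfolding AE_ball_countable[OF countable_rat] using key by (auto intro: AE_I2)
 then show ?thesis unfolding almost_sure_limit_theorem_def
  by (rule AE_mp) (intro AE_I2 impI weakly_converges_log_empirical[OF W], blast)
qed

end

section \<open>Renormalizing sequences\<close>

lemma eventually_bounded_imp:
 fixes X :: "nat \<Rightarrow> real"
 assumes "EV n. X n \<le> K0"
 shows "\<exists>K. \<forall>n. X n \<le> K"
proof -
 obtain N where N: "\<And>n. n \<ge> N \<Longrightarrow> X n \<le> K0" using assms by (auto simp: eventually_sequentially)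
 have "X n \<le> max K0 (Max (X ` {..N}))" for n
 proof (cases "n \<ge> N")
  case True
  then show ?thesis using N[OF True] by simp
 next
  case False
  then have "X n \<le> Max (X ` {..N})" by (intro Max_ge) auto
  then show ?thesis by simp
 qed
 then show ?thesis by blast
qed

lemma char_centered_normal:
 assumes v: "0 \<le> v"
 shows "real_distribution (centered_normal v)" (is ?P) "char (centered_normal v) t = exp (complex_of_real (- (v * t\<^sup>2 / 2)))"
proof -
 have "real_distribution (centered_normal v) \<and> char (centered_normal v) t = exp (complex_of_real (- (v * t\<^sup>2 / 2)))"
 proof (cases "v = 0")
  case True
  interpret R: prob_space "return borel (0::real)" by (rule prob_space_return) simp
  have "real_distribution (return borel (0::real))" by (auto simp: real_distribution_def real_distribution_axioms_def R.prob_space_axioms)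
  moreover have "char (return borel (0::real)) t = 1" unfolding char_def by (subst integral_return) auto
  ultimately show ?thesis using True by (simp add: centered_normal_def)
 next
  case False
  define \<sigma> where "\<sigma> = sqrt v"
  have \<sigma>: "0 < \<sigma>" using v False by (simp add: \<sigma>_def)
  interpret S: real_distribution std_normal_distribution by (rule real_dist_normal_dist)
  have "distributed std_normal_distribution lborel (\<lambda>x. x) std_normal_density"
   unfolding distributed_def by (auto simp: distr_id2[OF sets_density[symmetric, of lborel]] intro: distr_id2)
  from S.normal_density_affine[OF this, of \<sigma> 0] \<sigma>
  have d: "distributed std_normal_distribution lborel (\<lambda>x. \<sigma> * x) (normal_density 0 \<sigma>)" by simp
  have eq: "centered_normal v = distr std_normal_distribution borel (\<lambda>x. \<sigma> * x)"
  proof -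
   have "distr std_normal_distribution borel (\<lambda>x. \<sigma> * x) = distr std_normal_distribution lborel (\<lambda>x. \<sigma> * x)"
    by (intro distr_cong) auto
   then show ?thesis using distributed_distr_eq_density[OF d] False by (simp add: centered_normal_def \<sigma>_def)
  qed
  have "real_distribution (centered_normal v)" unfolding eq by (rule S.real_distribution_distr) simp
  moreover have "char (centered_normal v) t = exp (complex_of_real (- (v * t\<^sup>2 / 2)))"
  proof -
   have "char (centered_normal v) t = char std_normal_distribution (t * \<sigma>)"
    unfolding eq by (subst S.char_distr) (auto simp: char_def mult.assoc)
   also have "\<dots> = exp (complex_of_real (- ((t * \<sigma>)\<^sup>2 / 2)))"
    by (simp add: char_std_normal_distribution exp_of_real[symmetric])
   also have "(t * \<sigma>)\<^sup>2 = v * t\<^sup>2" using v by (simp add: \<sigma>_def power_mult_distrib)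
   finally show ?thesis .
  qed
  ultimately show ?thesis by simp
 qed
 then show ?P "char (centered_normal v) t = exp (complex_of_real (- (v * t\<^sup>2 / 2)))" by auto
qed

text \<open>Normalized slow variation makes the derivative of \<open>L0\<close> negligible against
  \<open>L0 x / x\<close>, so \<open>x powr (r - \<rho>) * L0 x\<close> has nonnegative derivative
  for large \<open>x\<close>. Thus \<open>h n\<close>, which is \<open>B n\<close> divided by
  \<open>n powr \<rho>\<close>, is eventually nondecreasing; the ratio bound and the growth of
  \<open>B\<close> follow.\<close>

lemma renormalizing_growth:
 assumes "renormalizing_sequence B"
 shows "\<And>n. 1 \<le> n \<Longrightarrow> 0 < B n" "filterlim B at_top sequentially" (is ?Q)
  "\<exists>CB \<rho>. 0 \<le> CB \<and> 0 < \<rho> \<and> \<rho> \<le> 1 \<and> (\<forall>k n. 1 \<le> k \<longrightarrow> k \<le> n \<longrightarrow> B k / B n \<le> CB * (real k / real n) powr \<rho>)" (is ?P)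
proof -
 obtain r L0 L' where r: "0 < r" and sv: "slowly_varying L0" and B: "\<And>n. 1 \<le> n \<Longrightarrow> B n = real n powr r * L0 (real n)"
  and L': "\<And>x. 0 < x \<Longrightarrow> (L0 has_real_derivative L' x) (at x)" and o: "L' \<in> o[at_top](\<lambda>x. L0 x / x)"
  using assms unfolding renormalizing_sequence_def normalized_slowly_varying_def by blast
 have L0: "0 < L0 x" if "0 < x" for x using sv that by (simp add: slowly_varying_def)
 have Bpos: "0 < B n" if "1 \<le> n" for n using B[OF that] L0[of "real n"] that by simp
 then show "\<And>n. 1 \<le> n \<Longrightarrow> 0 < B n" .
 \<comment> \<open>At most \<open>r / 2\<close>, to leave room for the error term in the derivative,
   and at most 1, as \<open>log_average_law\<close> demands.\<close>
 define \<rho> where "\<rho> = min (r / 2) 1"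
 have \<rho>: "0 < \<rho>" "\<rho> \<le> 1" "r / 2 \<le> r - \<rho>" using r by (auto simp: \<rho>_def min_def)
 define h where "h n = real n powr (- \<rho>) * B n" for n
 have hpos: "0 < h n" if "1 \<le> n" for n using Bpos[OF that] that by (simp add: h_def)
 have "\<forall>\<^sub>F x in at_top. norm (L' x) \<le> (r / 2) * norm (L0 x / x)"
  using landau_o.smallD[OF o, of "r / 2"] r by simp
 then obtain X where X: "\<And>x. x \<ge> X \<Longrightarrow> norm (L' x) \<le> (r / 2) * norm (L0 x / x)"
  by (auto simp: eventually_at_top_linorder)
 define N where "N = nat \<lceil>max X 1\<rceil> + 1"
 have N: "real N \<ge> X" "1 \<le> N" unfolding N_def by linarith+
 have mono: "h k \<le> h n" if "N \<le> k" "k \<le> n" for k n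
 proof -
  let ?g = "\<lambda>x. x powr (r - \<rho>) * L0 x"
  have "?g (real k) \<le> ?g (real n)"
  proof (rule DERIV_nonneg_imp_nondecreasing[of "real k" "real n" ?g])
   show "real k \<le> real n" using that by simp
   fix x assume x: "real k \<le> x" "x \<le> real n"
   then have x0: "0 < x" "X \<le> x" using N that by linarith+
   have "((\<lambda>x. x powr (r - \<rho>) * L0 x) has_real_derivative (r - \<rho>) * x powr (r - \<rho> - 1) * L0 x + L' x * x powr (r - \<rho>)) (at x)"
    by (rule DERIV_mult[OF has_real_derivative_powr[OF x0(1)] L'[OF x0(1)]])
   moreover have "0 \<le> (r - \<rho>) * x powr (r - \<rho> - 1) * L0 x + L' x * x powr (r - \<rho>)"
   proof -
    have "- L' x \<le> (r - \<rho>) * (L0 x / x)"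
    proof -
     have "- L' x \<le> (r / 2) * (L0 x / x)" using X[OF x0(2)] L0[OF x0(1)] x0 by simp
     also have "\<dots> \<le> (r - \<rho>) * (L0 x / x)" using \<rho>(3) L0[OF x0(1)] x0 by (intro mult_right_mono) auto
     finally show ?thesis .
    qed
    then have "- L' x * x powr (r - \<rho>) \<le> (r - \<rho>) * (L0 x / x) * x powr (r - \<rho>)" by (rule mult_right_mono) simp
    also have "\<dots> = (r - \<rho>) * x powr (r - \<rho> - 1) * L0 x" using x0 by (simp add: powr_diff ac_simps)
    finally show ?thesis by simp
   qed
   ultimately show "\<exists>y. ((\<lambda>x. x powr (r - \<rho>) * L0 x) has_real_derivative y) (at x) \<and> 0 \<le> y" by blast
  qed
  moreover have "h j = ?g (real j)" if "1 \<le> j" for j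
   using that by (simp add: h_def B powr_diff powr_minus divide_inverse)
  ultimately show ?thesis using that N by simp
 qed
 \<comment> \<open>A crude constant that covers all ratios among the finitely many indices before
   monotonicity sets in; the pair \<open>N\<close>, \<open>N\<close> makes it at least 1.\<close>
 define CB where "CB = (\<Sum>k\<in>{1..N}. \<Sum>n\<in>{1..N}. h k / h n)"
 have CBge: "h k / h n \<le> CB" if "k \<in> {1..N}" "n \<in> {1..N}" for k n
 proof -
  have "h k / h n \<le> (\<Sum>n\<in>{1..N}. h k / h n)" using that hpos by (intro member_le_sum) (auto intro!: divide_nonneg_nonneg simp: less_imp_le)
  also have "\<dots> \<le> CB" unfolding CB_def using that hpos
   by (intro member_le_sum[where f="\<lambda>k. \<Sum>n\<in>{1..N}. h k / h n"]) (auto intro!: sum_nonneg divide_nonneg_nonneg simp: less_imp_le)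
  finally show ?thesis .
 qed
 have CB1: "1 \<le> CB" using CBge[of N N] hpos[OF N(2)] N by simp
 have hk: "h k \<le> CB * h n" if k: "1 \<le> k" "k \<le> n" for k n
 proof -
  have n: "0 < h n" using hpos k by simp
  consider "N \<le> k" | "k < N" "N \<le> n" | "n < N" using k by linarith
  then show ?thesis
  proof cases
   case 1
   then have "h k \<le> 1 * h n" using mono[OF 1 k(2)] by simp
   also have "\<dots> \<le> CB * h n" using CB1 n by (intro mult_right_mono) auto
   finally show ?thesis .
  next
   case 2
   have "h k \<le> CB * h N" using CBge[of k N] k 2 hpos[OF N(2)] N by (simp add: pos_divide_le_eq)
   also have "\<dots> \<le> CB * h n" using mono[of N n] 2 CB1 by (intro mult_left_mono) auto
   finally show ?thesis .
  next
   case 3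
   then show ?thesis using CBge[of k n] k n by (simp add: pos_divide_le_eq)
  qed
 qed
 have Bh: "B n = real n powr \<rho> * h n" if "1 \<le> n" for n
  using that by (simp add: h_def powr_minus field_simps)
 have ratio: "B k / B n \<le> CB * (real k / real n) powr \<rho>" if k: "1 \<le> k" "k \<le> n" for k n
 proof -
  have n: "0 < h n" "1 \<le> n" using hpos k by auto
  have "B k / B n = (real k / real n) powr \<rho> * (h k / h n)"
   using k n by (simp add: Bh powr_divide)
  also have "\<dots> \<le> (real k / real n) powr \<rho> * CB"
   using hk[OF k] n by (intro mult_left_mono) (auto simp: pos_divide_le_eq)
  finally show ?thesis by (simp add: mult.commute)
 qed
 show ?P
  using CB1 \<rho> ratio by (intro exI[of _ CB] exI[of _ \<rho>]) auto
 have "filterlim (\<lambda>n. (h 1 / CB) * real n powr \<rho>) at_top sequentially"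
 proof (rule filterlim_tendsto_pos_mult_at_top[OF tendsto_const])
  show "0 < h 1 / CB" using hpos[of 1] CB1 by simp
  show "filterlim (\<lambda>n. real n powr \<rho>) at_top sequentially"
   by (rule filterlim_compose[OF _ filterlim_real_sequentially]) (use \<rho> in real_asymp)
 qed
 then show ?Q
 proof (rule filterlim_at_top_mono)
  show "EV n. (h 1 / CB) * real n powr \<rho> \<le> B n"
   using eventually_ge_at_top[of 1]
  proof eventually_elim
   case (elim n)
   have "h 1 / CB \<le> h n" using hk[of 1 n] elim CB1 by (simp add: pos_divide_le_eq mult.commute)
   then have "(h 1 / CB) * real n powr \<rho> \<le> h n * real n powr \<rho>" by (rule mult_right_mono) simp
   then show ?case using Bh[OF elim] by (simp add: mult.commute)
  qed
 qed
qed

context gm_obs begin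

abbreviation limits_to :: "(nat \<Rightarrow> real) \<Rightarrow> real measure \<Rightarrow> bool" where
 "limits_to B W \<equiv> converges_with_tight_maxima M (Sn f) B W \<and> almost_sure_limit_theorem M (Sn f) B W"

lemma conclude_limit:
 assumes B: "normalizing B K" and CB: "0 \<le> CB" and \<rho>: "0 < \<rho>" "\<rho> \<le> 1"
  and ratio: "\<And>k n. 1 \<le> k \<Longrightarrow> k \<le> n \<Longrightarrow> B k / B n \<le> CB * (real k / real n) powr \<rho>"
  and W: "real_distribution W"
  and ch: "\<And>t. (\<lambda>n. LINT x|M. iexp (t / B n * Sn f n x)) \<longlonglongrightarrow> char W t"
 shows "limits_to B W"
proof -
 have m: "(\<lambda>x. Sn f n x / B n) \<in> borel_measurable M" for n by measurable
 have wc: "weak_conv_m (\<lambda>n. distr M borel (\<lambda>x. Sn f n x / B n)) W"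
 proof (rule levy_continuity[OF _ W])
  show "real_distribution (distr M borel (\<lambda>x. Sn f n x / B n))" for n
   by (rule real_distribution_distr) measurable
  show "(\<lambda>n. char (distr M borel (\<lambda>x. Sn f n x / B n)) t) \<longlonglongrightarrow> char W t" for t
   using ch[of t] by (simp add: char_distr[OF m])
 qed
 then show ?thesis
  unfolding converges_with_tight_maxima_def
  using tight_maxima[OF B] almost_sure_limit[OF B CB \<rho> ratio W wc] by blast
qed

lemma case_I:
 assumes f2: "integrable M (\<lambda>x. (f x)\<^sup>2)"
 shows "\<exists>v\<ge>0. limits_to (\<lambda>n. sqrt (real n)) (centered_normal v)"
proof -
 obtain v where v: "0 \<le> v" and ch: "\<And>t. (\<lambda>n. LINT x|M. iexp (t / sqrt (real n) * Sn f n x)) \<longlonglongrightarrow> exp (complex_of_real (- (v * t\<^sup>2 / 2)))"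
  using clt_square_integrable[OF f2] by blast
 define V where "V = (LINT x|M. (f x)\<^sup>2)"
 have V: "0 \<le> V" by (simp add: V_def)
 \<comment> \<open>The summand 1 in \<open>V + 1\<close> serves the condition
   \<open>n \<le> K * (B n)\<^sup>2\<close>.\<close>
 have nrm: "normalizing (\<lambda>n. sqrt (real n)) (V + 1)" unfolding normalizing_def
 proof (intro allI impI conjI)
  fix n :: nat assume n: "1 \<le> n"
  show "0 < sqrt (real n)" using n by simp
  have sq: "(sqrt (real n))\<^sup>2 = real n" by simp
  have imin: "integrable M (\<lambda>x. min ((f x)\<^sup>2) ((sqrt (real n))\<^sup>2))"
   by (rule integrable_bounded[where B="real n"]) auto
  have "(LINT x|M. min ((f x)\<^sup>2) ((sqrt (real n))\<^sup>2)) \<le> V"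
   unfolding V_def by (rule integral_mono[OF imin f2]) simp
  then have "real n * (LINT x|M. min ((f x)\<^sup>2) ((sqrt (real n))\<^sup>2)) \<le> real n * (V + 1)" by (intro mult_left_mono) auto
  then show "real n * (LINT x|M. min ((f x)\<^sup>2) ((sqrt (real n))\<^sup>2)) \<le> (V + 1) * (sqrt (real n))\<^sup>2"
   unfolding sq by (simp only: mult.commute)
  show "real n \<le> (V + 1) * (sqrt (real n))\<^sup>2" unfolding sq using V by (simp add: distrib_right)
  have s: "0 < sqrt (real n)" using n by simp
  have "(LINT x|M. max (\<bar>f x\<bar> - sqrt (real n)) 0) \<le> (LINT x|M. (1 / sqrt (real n)) * (f x)\<^sup>2)"
  proof (rule integral_mono)
   show "integrable M (\<lambda>x. max (\<bar>f x\<bar> - sqrt (real n)) 0)" using f_int by auto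
   show "integrable M (\<lambda>x. (1 / sqrt (real n)) * (f x)\<^sup>2)" using f2 by simp
   fix x
   have "\<bar>f x\<bar> * sqrt (real n) - sqrt (real n) * sqrt (real n) \<le> (f x)\<^sup>2"
   proof -
    have "0 \<le> (\<bar>f x\<bar> - sqrt (real n) / 2)\<^sup>2 + 3 / 4 * (sqrt (real n))\<^sup>2" by simp
    also have "\<dots> = (f x)\<^sup>2 - \<bar>f x\<bar> * sqrt (real n) + sqrt (real n) * sqrt (real n)"
     by (simp add: power2_diff power2_eq_square[of "sqrt _"] field_simps power_divide)
    finally show ?thesis by linarith
   qed
   then have "(\<bar>f x\<bar> - sqrt (real n)) * sqrt (real n) \<le> (f x)\<^sup>2" by (simp add: left_diff_distrib)
   then have "\<bar>f x\<bar> - sqrt (real n) \<le> (f x)\<^sup>2 / sqrt (real n)" using s by (simp only: pos_le_divide_eq)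
   then show "max (\<bar>f x\<bar> - sqrt (real n)) 0 \<le> (1 / sqrt (real n)) * (f x)\<^sup>2" using s by simp
  qed
  also have "\<dots> = V / sqrt (real n)" by (simp add: V_def)
  finally have "real n * (LINT x|M. max (\<bar>f x\<bar> - sqrt (real n)) 0) \<le> real n * (V / sqrt (real n))"
   by (rule mult_left_mono) simp
  also have "\<dots> = V * sqrt (real n)" by (simp add: real_div_sqrt mult.commute[of "real n"] times_divide_eq_right[symmetric] del: times_divide_eq_right)
  also have "\<dots> \<le> (V + 1) * sqrt (real n)" by (intro mult_right_mono) auto
  finally show "real n * (LINT x|M. max (\<bar>f x\<bar> - sqrt (real n)) 0) \<le> (V + 1) * sqrt (real n)" .
 qed
 have "limits_to (\<lambda>n. sqrt (real n)) (centered_normal v)"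
 proof (rule conclude_limit[OF nrm, of 1 "1/2"])
  show "sqrt (real k) / sqrt (real n) \<le> 1 * (real k / real n) powr (1 / 2)" for k n :: nat
   by (simp add: powr_half_sqrt real_sqrt_divide)
  show "real_distribution (centered_normal v)" by (rule char_centered_normal(1)[OF v])
  show "(\<lambda>n. LINT x|M. iexp (t / sqrt (real n) * Sn f n x)) \<longlonglongrightarrow> char (centered_normal v) t" for t
   unfolding char_centered_normal(2)[OF v] by (rule ch)
 qed auto
 then show ?thesis using v by blast
qed

end

section \<open>Regularly varying tails\<close>

lemma powr_integrable_0_1:
 assumes "- 1 < a"
 shows "integrable lborel (\<lambda>u. indicator {0<..1} u * u powr (a::real))"
proof -
 have "(\<lambda>u::real. u powr a) absolutely_integrable_on {0..1}"
  by (rule nonnegative_absolutely_integrable_1[OF integrable_on_powr_from_0[OF assms]]) auto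
 then have "integrable lebesgue (\<lambda>u::real. indicator {0..1} u *\<^sub>R u powr a)" by (simp add: set_integrable_def)
 then have "integrable lborel (\<lambda>u::real. indicator {0..1} u *\<^sub>R u powr a)" by (subst (asm) integrable_completion) auto
 moreover have "(\<lambda>u::real. indicator {0..1} u *\<^sub>R u powr a) = (\<lambda>u. indicator {0<..1} u * u powr a)"
  by (auto simp: indicator_def fun_eq_iff)
 ultimately show ?thesis by simp
qed

lemma powr_integrable_1_inf:
 assumes "a < - 1"
 shows "integrable lborel (\<lambda>u. indicator {1..} u * u powr (a::real))"
proof -
 have "(\<lambda>u::real. u powr a) integrable_on {1..}" using has_integral_powr_to_inf[OF assms, of 1] by (auto simp: integrable_on_def)
 then have "(\<lambda>u::real. u powr a) absolutely_integrable_on {1..}"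
  by (rule nonnegative_absolutely_integrable_1) auto
 then have "integrable lebesgue (\<lambda>u::real. indicator {1..} u *\<^sub>R u powr a)" by (simp add: set_integrable_def)
 then show ?thesis by (subst (asm) integrable_completion) auto
qed

abbreviation step :: "real \<Rightarrow> real" where "step u \<equiv> indicator {0<..} u"

text \<open>The Potter majorant, up to a constant, of \<open>G (z u) / G z\<close> for a tail of
  index \<open>- p\<close> with \<open>q2 < p < q1\<close>. Integrability against
  \<open>min 1 u\<close> asks for \<open>q1 < 2\<close> and \<open>1 < q2\<close>; such exponents
  exist because \<open>1 < p < 2\<close>.\<close>

definition envelope :: "real \<Rightarrow> real \<Rightarrow> real \<Rightarrow> real" where
 "envelope q1 q2 u = (if u \<le> 1 then u powr (- q1) else u powr (- q2))"

lemma envelope_meas [measurable]: "envelope q1 q2 \<in> borel_measurable borel"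
 unfolding envelope_def[abs_def] by measurable

lemma envelope_nonneg: "0 \<le> envelope q1 q2 u" by (simp add: envelope_def)

lemma envelope_integrable:
 assumes "q1 < 2" "1 < q2"
 shows "integrable lborel (\<lambda>u. step u * (min 1 u * envelope q1 q2 u))"
proof (rule int_dom)
 show "integrable lborel (\<lambda>u. indicator {0<..1} u * u powr (1 - q1) + indicator {1..} u * u powr (- q2))"
  by (intro int_add powr_integrable_0_1 powr_integrable_1_inf) (use assms in auto)
 show "AE u in lborel. norm (step u * (min 1 u * envelope q1 q2 u)) \<le> norm (indicator {0<..1} u * u powr (1 - q1) + indicator {1..} u * u powr (- q2))"
  by (intro AE_I2) (auto simp: indicator_def envelope_def powr_diff powr_minus divide_inverse min_def)
qed measurable

section \<open>Integrals of the sine and of \<open>1 - cos\<close> against powers\<close>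

lemma half_line_FTC:
 fixes F g :: "real \<Rightarrow> real"
 assumes F: "\<And>u. 0 < u \<Longrightarrow> (F has_real_derivative g u) (at u)" and g: "\<And>u. 0 < u \<Longrightarrow> isCont g u"
  and i: "integrable lborel (\<lambda>u. step u * g u)" and F0: "isCont F 0" and lim: "(F \<longlongrightarrow> 0) at_top"
 shows "(LBINT u. step u * g u) = - F 0"
proof -
 have e: "einterval 0 \<infinity> = {0<..}" by (auto simp: einterval_def)
 have "(LBINT u=0..\<infinity>. g u) = 0 - F 0"
 proof (rule interval_integral_FTC_integrable)
  show "(F has_vector_derivative g u) (at u)" if "0 < ereal u" for u
   using F[of u] that by (simp add: has_real_derivative_iff_has_vector_derivative)
  show "isCont g u" if "0 < ereal u" for u using g that by simp
  show "set_integrable lborel (einterval 0 \<infinity>) g" unfolding e set_integrable_def using i by simp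
  have "(F \<longlongrightarrow> F 0) (at_right 0)" using F0 by (simp add: continuous_within filterlim_at_split isCont_def)
  then show "((F \<circ> real_of_ereal) \<longlongrightarrow> F 0) (at_right 0)" by (simp add: zero_ereal_def ereal_tendsto_simps)
  show "((F \<circ> real_of_ereal) \<longlongrightarrow> 0) (at_left \<infinity>)" unfolding ereal_tendsto_simps using lim .
 qed simp
 then show ?thesis by (simp add: interval_lebesgue_integral_0_infty set_lebesgue_integral_def)
qed

lemma exp_times_bounded:
 fixes h :: "real \<Rightarrow> real"
 assumes s: "0 < s" and [measurable]: "h \<in> borel_measurable borel" and h: "\<And>u. \<bar>h u\<bar> \<le> c"
 shows "integrable lborel (\<lambda>u. step u * (h u * exp (- (s * u))))" (is ?Q)
  "((\<lambda>u. h u * exp (- (s * u))) \<longlongrightarrow> 0) at_top" (is ?P)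
proof -
 have "integrable lborel (\<lambda>u. c * (step u * exp (- (u * s))))"
  using integrable_I0i_exp_mscale[OF s] by (simp add: set_integrable_def)
 then show ?Q
 proof (rule int_dom)
  have "\<bar>h u\<bar> \<le> \<bar>c\<bar>" for u using h[of u] by linarith
  then show "AE u in lborel. norm (step u * (h u * exp (- (s * u)))) \<le> norm (c * (step u * exp (- (u * s))))"
   by (intro AE_I2) (auto simp: indicator_def abs_mult mult.commute[of s] intro!: mult_right_mono)
 qed measurable
 have z: "((\<lambda>u. c * exp (- (s * u))) \<longlongrightarrow> 0) at_top" using s by real_asymp
 show ?P
  by (rule Lim_null_comparison[OF always_eventually z]) (auto simp: abs_mult h intro!: mult_right_mono)
qed

lemma abs_sin_cos_comb: "\<bar>s * sin u + r * cos u\<bar> \<le> \<bar>s\<bar> + \<bar>r\<bar>" for s r u :: real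
proof -
 have "\<bar>s * sin u\<bar> \<le> \<bar>s\<bar>" "\<bar>r * cos u\<bar> \<le> \<bar>r\<bar>"
  using mult_left_mono[OF abs_sin_le_one, of "\<bar>s\<bar>" u] mult_left_mono[OF abs_cos_le_one, of "\<bar>r\<bar>" u] by (auto simp: abs_mult)
 then show ?thesis by linarith
qed

lemma laplace_sin:
 fixes s :: real
 assumes s: "0 < s"
 shows "(LBINT u. step u * (sin u * exp (- (s * u)))) = 1 / (1 + s\<^sup>2)"
proof -
 have p: "1 + s\<^sup>2 \<noteq> 0" using zero_le_power2[of s] by linarith
 let ?F = "\<lambda>u. (- 1 / (1 + s\<^sup>2)) * ((s * sin u + 1 * cos u) * exp (- (s * u)))"
 have "(LBINT u. step u * (sin u * exp (- (s * u)))) = - ?F 0"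
 proof (rule half_line_FTC)
  show "(?F has_real_derivative sin u * exp (- (s * u))) (at u)" for u
  proof -
   have "(?F has_real_derivative (- 1 / (1 + s\<^sup>2)) * ((s * cos u - sin u) * exp (- (s * u)) + (s * sin u + cos u) * (- s * exp (- (s * u))))) (at u)"
    using assms p by (auto intro!: derivative_eq_intros)
   also have "(- 1 / (1 + s\<^sup>2)) * ((s * cos u - sin u) * exp (- (s * u)) + (s * sin u + cos u) * (- s * exp (- (s * u))))
     = (1 / (1 + s\<^sup>2)) * ((1 + s\<^sup>2) * (sin u * exp (- (s * u))))"
    by (simp add: algebra_simps power2_eq_square)
   also have "\<dots> = sin u * exp (- (s * u))" using p by simp
   finally show ?thesis .
  qed
  show "integrable lborel (\<lambda>u. step u * (sin u * exp (- (s * u))))"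
   by (rule exp_times_bounded[OF s, where c=1]) auto
  have "((\<lambda>u. (s * sin u + 1 * cos u) * exp (- (s * u))) \<longlongrightarrow> 0) at_top"
   by (rule exp_times_bounded(2)[OF s _ abs_sin_cos_comb]) measurable
  from tendsto_mult[OF tendsto_const[of "- 1 / (1 + s\<^sup>2)"] this] show "(?F \<longlongrightarrow> 0) at_top" by simp
 qed (use p in \<open>auto intro!: continuous_intros\<close>)
 then show ?thesis by simp
qed

lemma laplace_one_minus_cos:
 fixes s :: real
 assumes s: "0 < s"
 shows "(LBINT u. step u * ((1 - cos u) * exp (- (s * u)))) = 1 / (s * (1 + s\<^sup>2))"
proof -
 have p: "1 + s\<^sup>2 \<noteq> 0" using zero_le_power2[of s] by linarith
 let ?F = "\<lambda>u. (- 1 / s) * (1 * exp (- (s * u))) + (- 1 / (1 + s\<^sup>2)) * ((1 * sin u + (- s) * cos u) * exp (- (s * u)))"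
 have "(LBINT u. step u * ((1 - cos u) * exp (- (s * u)))) = - ?F 0"
 proof (rule half_line_FTC)
  show "(?F has_real_derivative (1 - cos u) * exp (- (s * u))) (at u)" for u
  proof -
   have "(?F has_real_derivative (- 1 / s) * (- s * exp (- (s * u))) + (- 1 / (1 + s\<^sup>2)) * ((cos u + s * sin u) * exp (- (s * u)) + (sin u - s * cos u) * (- s * exp (- (s * u))))) (at u)"
    using assms p by (auto intro!: derivative_eq_intros)
   also have "(- 1 / s) * (- s * exp (- (s * u))) + (- 1 / (1 + s\<^sup>2)) * ((cos u + s * sin u) * exp (- (s * u)) + (sin u - s * cos u) * (- s * exp (- (s * u))))
     = exp (- (s * u)) + (- 1 / (1 + s\<^sup>2)) * ((1 + s\<^sup>2) * (cos u * exp (- (s * u))))"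
    using s by (simp add: algebra_simps power2_eq_square)
   also have "(- 1 / (1 + s\<^sup>2)) * ((1 + s\<^sup>2) * (cos u * exp (- (s * u)))) = - (cos u * exp (- (s * u)))" using p by simp
   also have "exp (- (s * u)) + - (cos u * exp (- (s * u))) = (1 - cos u) * exp (- (s * u))" by (simp add: algebra_simps)
   finally show ?thesis .
  qed
  show "integrable lborel (\<lambda>u. step u * ((1 - cos u) * exp (- (s * u))))"
  proof (rule exp_times_bounded[OF s, where c=2])
   show "\<bar>1 - cos u\<bar> \<le> 2" for u :: real using cos_ge_minus_one[of u] cos_le_one[of u] by linarith
  qed measurable
  have 1: "((\<lambda>u. (1 * sin u + (- s) * cos u) * exp (- (s * u))) \<longlongrightarrow> 0) at_top"
   by (rule exp_times_bounded(2)[OF s _ abs_sin_cos_comb]) measurable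
  have 2: "((\<lambda>u. 1 * exp (- (s * u))) \<longlongrightarrow> 0) at_top"
   by (rule exp_times_bounded(2)[OF s, where c=1]) auto
  from tendsto_add[OF tendsto_mult[OF tendsto_const[of "- 1 / s"] 2] tendsto_mult[OF tendsto_const[of "- 1 / (1 + s\<^sup>2)"] 1]] show "(?F \<longlongrightarrow> 0) at_top" by simp
 qed (use s p in \<open>auto intro!: continuous_intros\<close>)
 also have "- ?F 0 = 1 / s - s / (1 + s\<^sup>2)" by simp
 also have "\<dots> = 1 / (s * (1 + s\<^sup>2))" using s p by (simp add: field_simps power2_eq_square)
 finally show ?thesis .
qed

lemma gamma_scaled:
 fixes p u :: real
 assumes p: "0 < p" and u: "0 < u"
 shows "integrable lborel (\<lambda>s. step s * (s powr (p - 1) * exp (- (s * u))))"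
  "(LBINT s. step s * (s powr (p - 1) * exp (- (s * u)))) = Gamma p * u powr (- p)"
proof -
 let ?k = "\<lambda>s. step s * (s powr (p - 1) * exp (- (s * u)))"
 have G: "0 < Gamma p" using p by simp
 let ?A = "\<integral>\<^sup>+s. ennreal (?k s) \<partial>lborel"
 have "ennreal (Gamma p) = (\<integral>\<^sup>+t. ennreal (indicator {0..} t * t powr (p - 1) / exp t) \<partial>lborel)"
  by (rule Gamma_conv_nn_integral_real[OF p])
 also have "\<dots> = ennreal u * (\<integral>\<^sup>+s. ennreal (indicator {0..} (0 + u * s) * (0 + u * s) powr (p - 1) / exp (0 + u * s)) \<partial>lborel)"
  using u by (subst nn_integral_real_affine[of _ u 0]) auto
 also have "(\<integral>\<^sup>+s. ennreal (indicator {0..} (0 + u * s) * (0 + u * s) powr (p - 1) / exp (0 + u * s)) \<partial>lborel)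
   = (\<integral>\<^sup>+s. ennreal (u powr (p - 1)) * ennreal (?k s) \<partial>lborel)"
 proof (rule nn_integral_cong_AE, rule AE_mp[OF AE_lborel_singleton[of 0]], intro AE_I2 impI)
  fix s :: real assume "s \<noteq> 0"
  then show "ennreal (indicator {0..} (0 + u * s) * (0 + u * s) powr (p - 1) / exp (0 + u * s)) = ennreal (u powr (p - 1)) * ennreal (?k s)"
   using u by (cases "0 < s") (auto simp: indicator_def zero_le_mult_iff ennreal_mult'[symmetric] powr_mult exp_minus field_simps)
 qed
 also have "\<dots> = ennreal (u powr (p - 1)) * ?A" by (rule nn_integral_cmult) measurable
 also have "ennreal u * (ennreal (u powr (p - 1)) * ?A) = ennreal (u powr p) * (\<integral>\<^sup>+s. ennreal (?k s) \<partial>lborel)"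
  using u by (simp add: mult.assoc[symmetric] ennreal_mult'[symmetric] powr_diff)
 finally have eq: "ennreal (Gamma p) = ennreal (u powr p) * ?A" .
 have "ennreal (u powr (- p)) * ennreal (Gamma p) = ennreal (u powr (- p)) * ennreal (u powr p) * ?A"
  by (simp add: eq mult.assoc)
 also have "ennreal (u powr (- p)) * ennreal (u powr p) = 1" using u by (simp add: ennreal_mult'[symmetric] powr_add[symmetric])
 finally have nn: "?A = ennreal (Gamma p * u powr (- p))"
  using G by (simp add: ennreal_mult'[symmetric] mult.commute)
 have "has_bochner_integral lborel ?k (Gamma p * u powr (- p))"
  by (rule has_bochner_integral_nn_integral) (use nn G in auto)
 then show "integrable lborel ?k" "(LBINT s. ?k s) = Gamma p * u powr (- p)"
  by (auto simp: has_bochner_integral_iff)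
qed

lemma Gamma_reflection_real: "Gamma (p::real) * Gamma (1 - p) = pi / sin (pi * p)"
proof -
 have "complex_of_real (Gamma p * Gamma (1 - p)) = complex_of_real (pi / sin (pi * p))"
  using Gamma_reflection_complex[of "complex_of_real p"]
  by (simp add: Gamma_complex_of_real[symmetric] sin_of_real[symmetric])
 then show ?thesis by (simp only: of_real_eq_iff)
qed

text \<open>The substitution \<open>v = s\<^sup>2 / (1 + s\<^sup>2)\<close> turns the integral into
  half of \<open>Beta (q / 2) (1 - q / 2)\<close>, which the reflection formula evaluates.\<close>

lemma beta_half_line:
 fixes q :: real
 assumes q: "0 < q" "q < 2"
 shows "(LBINT s. step s * (s powr (q - 1) / (1 + s\<^sup>2))) = pi / (2 * sin (pi * q / 2))"
proof -
 define a where "a = q / 2"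
 have a: "0 < a" "a < 1" using q by (auto simp: a_def)
 let ?f = "\<lambda>v::real. v powr (a - 1) * (1 - v) powr ((1 - a) - 1)"
 let ?g = "\<lambda>s::real. s\<^sup>2 / (1 + s\<^sup>2)"
 let ?g' = "\<lambda>s::real. 2 * s / (1 + s\<^sup>2)\<^sup>2"
 have pos: "0 < 1 + s\<^sup>2" for s :: real by (simp add: add_pos_nonneg)
 have Bi: "(?f has_integral Beta a (1 - a)) {0<..<1}"
  using has_integral_Beta_real[of a "1 - a"] a by (simp add: has_integral_Icc_iff_Ioo)
 have img: "?g ` {0<..} = {0<..<1}"
 proof (intro equalityI subsetI)
  fix v :: real assume "v \<in> ?g ` {0<..}"
  then obtain s :: real where "0 < s" "v = ?g s" by auto
  then show "v \<in> {0<..<1}" using divide_pos_pos[of "s\<^sup>2" "1 + s\<^sup>2"] divide_less_eq_1_pos[of "1 + s\<^sup>2" "s\<^sup>2"] pos[of s] by simp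
 next
  fix v :: real assume v: "v \<in> {0<..<1}"
  have "v = ?g (sqrt (v / (1 - v)))" using v by (simp add: field_simps)
  moreover have "0 < sqrt (v / (1 - v))" using v by simp
  ultimately show "v \<in> ?g ` {0<..}" by blast
 qed
 have inj: "inj_on ?g {0<..}"
 proof (rule inj_onI)
  fix s t :: real assume st: "s \<in> {0<..}" "t \<in> {0<..}" "?g s = ?g t"
  then have "s\<^sup>2 * (1 + t\<^sup>2) = t\<^sup>2 * (1 + s\<^sup>2)" using pos[of s] pos[of t] by (simp add: frac_eq_eq)
  then have "s\<^sup>2 = t\<^sup>2" by (simp add: algebra_simps)
  then show "s = t" using st by (simp add: power2_eq_iff_nonneg)
 qed
 have der: "(?g has_field_derivative ?g' s) (at s within {0<..})" for s :: real
 proof -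
  have "(?g has_field_derivative (2 * s * (1 + s\<^sup>2) - s\<^sup>2 * (2 * s)) / ((1 + s\<^sup>2) * (1 + s\<^sup>2))) (at s within {0<..})"
   using pos[of s] by (auto intro!: derivative_eq_intros)
  also have "(2 * s * (1 + s\<^sup>2) - s\<^sup>2 * (2 * s)) / ((1 + s\<^sup>2) * (1 + s\<^sup>2)) = ?g' s"
   by (simp add: power2_eq_square algebra_simps)
  finally show ?thesis .
 qed
 have fa: "?f absolutely_integrable_on {0<..<1}"
  by (rule nonnegative_absolutely_integrable_1) (use Bi in \<open>auto simp: integrable_on_def\<close>)
 have cv: "(\<lambda>s. \<bar>?g' s\<bar> * ?f (?g s)) absolutely_integrable_on {0<..} \<and> integral {0<..} (\<lambda>s. \<bar>?g' s\<bar> * ?f (?g s)) = Beta a (1 - a)"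
  using has_absolute_integral_change_of_variables_1'[of "{0<..}" ?g ?g' ?f "Beta a (1 - a)"] der inj fa Bi
  unfolding img by (auto simp: integral_unique)
 have val: "\<bar>?g' s\<bar> * ?f (?g s) = 2 * (s powr (q - 1) / (1 + s\<^sup>2))" if s: "0 < s" for s
 proof -
  let ?m = "1 + s\<^sup>2"
  have m: "0 < ?m" by (rule pos)
  have "1 - ?g s = 1 / ?m" using m by (simp add: field_simps)
  moreover have "(1 / ?m) powr ((1 - a) - 1) = ?m powr a" using m by (simp add: powr_divide powr_minus_divide)
  moreover have "(?g s) powr (a - 1) = (s\<^sup>2) powr (a - 1) / ?m powr (a - 1)" using m s by (simp add: powr_divide)
  moreover have "(s\<^sup>2) powr (a - 1) = s powr (q - 2)"
  proof -
   have "s\<^sup>2 = s powr 2" using s by simp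
   moreover have "2 * (a - 1) = q - 2" by (simp add: a_def)
   ultimately show ?thesis by (simp only: powr_powr)
  qed
  ultimately have "?f (?g s) = s powr (q - 2) / ?m powr (a - 1) * ?m powr a" by (simp only:)
  also have "\<dots> = s powr (q - 2) * ?m" using m by (simp add: powr_diff)
  finally have e1: "?f (?g s) = s powr (q - 2) * ?m" .
  have e2: "\<bar>?g' s\<bar> = 2 * s / ?m\<^sup>2" using s by simp
  have e3: "s powr (q - 1) = s * s powr (q - 2)" using s by (simp add: powr_mult_base)
  have gen: "2 * s / y\<^sup>2 * (z * y) = 2 * (s * z / y)" if "0 < y" for y z :: real
   using that by (simp add: power2_eq_square)
  show ?thesis unfolding e1 e2 e3 by (rule gen[OF m])
 qed
 let ?h = "\<lambda>s::real. 2 * (s powr (q - 1) / (1 + s\<^sup>2))"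
 have "set_integrable lebesgue {0<..} ?h"
  using cv set_integrable_cong[of lebesgue lebesgue "{0<..}" "{0<..}" "\<lambda>s. \<bar>?g' s\<bar> * ?f (?g s)" ?h] val by auto
 then have h1: "set_integrable lborel {0<..} ?h"
  unfolding set_integrable_def by (subst (asm) integrable_completion) auto
 have "integral {0<..} ?h = integral {0<..} (\<lambda>s. \<bar>?g' s\<bar> * ?f (?g s))"
  by (rule integral_cong) (use val in auto)
 then have "(LINT s:{0<..}|lborel. ?h s) = Beta a (1 - a)"
  using set_borel_integral_eq_integral(2)[OF h1] cv by simp
 then have "2 * (LBINT s. step s * (s powr (q - 1) / (1 + s\<^sup>2))) = Beta a (1 - a)"
  unfolding set_lebesgue_integral_def by (subst integral_mult_right_zero[symmetric]) (simp add: ac_simps)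
 also have "Beta a (1 - a) = Gamma a * Gamma (1 - a)" by (simp add: Beta_def)
 also have "\<dots> = pi / sin (pi * a)" by (rule Gamma_reflection_real)
 finally show ?thesis by (simp add: a_def)
qed

text \<open>Write \<open>Gamma p * u powr (- p)\<close> as the integral of
  \<open>s powr (p - 1) * exp (- (s * u))\<close> over \<open>s\<close> and exchange the order of
  integration: an oscillating integral is traded for the Laplace transform \<open>L\<close> of
  \<open>g\<close>.\<close>

lemma mellin_laplace:
 fixes g L :: "real \<Rightarrow> real"
 assumes p: "0 < p" and gm[measurable]: "g \<in> borel_measurable borel"
  and gi: "integrable lborel (\<lambda>u. step u * (\<bar>g u\<bar> * u powr (- p)))"
  and L: "\<And>s. 0 < s \<Longrightarrow> (LBINT u. step u * (g u * exp (- (s * u)))) = L s"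
 shows "Gamma p * (LBINT u. step u * (g u * u powr (- p))) = (LBINT s. step s * (s powr (p - 1) * L s))"
proof -
 define k where "k u s = (step u * g u) * (step s * (s powr (p - 1) * exp (- (s * u))))" for u s :: real
 have km[measurable]: "case_prod k \<in> borel_measurable (lborel \<Otimes>\<^sub>M lborel)"
  unfolding k_def by measurable
 have inner: "(LBINT s. k u s) = Gamma p * (step u * (g u * u powr (- p)))" for u
  using gamma_scaled(2)[OF p, of u] by (cases "0 < u") (auto simp: k_def)
 have innerN: "(LBINT s. norm (k u s)) = Gamma p * (step u * (\<bar>g u\<bar> * u powr (- p)))" for u
 proof (cases "0 < u")
  case True
  have "norm (k u s) = \<bar>g u\<bar> * (step s * (s powr (p - 1) * exp (- (s * u))))" for s
   using True by (simp add: k_def abs_mult)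
  then show ?thesis using gamma_scaled(2)[OF p True] True by simp
 qed (simp add: k_def)
 have ki: "integrable lborel (k u)" for u
  using gamma_scaled(1)[OF p, of u] by (cases "0 < u") (auto simp: k_def[abs_def])
 have int: "integrable (lborel \<Otimes>\<^sub>M lborel) (case_prod k)"
 proof (rule lborel_pair.Fubini_integrable[OF km])
  show "integrable lborel (\<lambda>u. LBINT s. norm (case_prod k (u, s)))"
   unfolding prod.case innerN using gi by simp
  show "AE u in lborel. integrable lborel (\<lambda>s. case_prod k (u, s))" using ki by simp
 qed
 have "Gamma p * (LBINT u. step u * (g u * u powr (- p))) = (LBINT u. (LBINT s. k u s))"
  unfolding inner by simp
 also have "\<dots> = (LBINT s. (LBINT u. k u s))" by (rule lborel_pair.Fubini_integral[OF int, symmetric])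
 also have "\<dots> = (LBINT s. step s * (s powr (p - 1) * L s))"
 proof (rule int_cong[OF refl])
  fix s
  show "(LBINT u. k u s) = step s * (s powr (p - 1) * L s)"
  proof (cases "0 < s")
   case True
   have "(LBINT u. k u s) = (LBINT u. s powr (p - 1) * (step u * (g u * exp (- (s * u)))))"
    using True by (intro int_cong) (auto simp: k_def)
   then show ?thesis using L[OF True] True by simp
  qed (simp add: k_def)
 qed
 finally show ?thesis .
qed

text \<open>The source of the constants of the stable law. The Laplace transforms
  \<open>1 / (1 + s\<^sup>2)\<close> and \<open>1 / (s * (1 + s\<^sup>2))\<close> lead to
  \<open>beta_half_line\<close> at \<open>q = p\<close> and \<open>q = p - 1\<close>, and the
  reflection formula trades \<open>Gamma p\<close> for \<open>Gamma (1 - p)\<close>.\<close>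

lemma
 fixes p :: real
 assumes p: "1 < p" "p < 2"
 shows sin_powr_integral: "(LBINT u. step u * (sin u * u powr (- p))) = Gamma (1 - p) * cos (p * pi / 2)" (is ?Q)
  and cos_powr_integral: "(LBINT u. step u * ((1 - cos u) * u powr (- p))) = - (Gamma (1 - p) * sin (p * pi / 2))" (is ?P)
proof -
 have env: "envelope p p u = u powr (- p)" for u by (simp add: envelope_def)
 have bnd: "integrable lborel (\<lambda>u. step u * (\<bar>g u\<bar> * u powr (- p)))"
  if [measurable]: "g \<in> borel_measurable borel" and g: "\<And>u. 0 < u \<Longrightarrow> \<bar>g u\<bar> \<le> 2 * min 1 u" for g :: "real \<Rightarrow> real"
 proof (rule int_dom)
  show "integrable lborel (\<lambda>u. 2 * (step u * (min 1 u * envelope p p u)))"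
   using envelope_integrable[of p p] p by simp
  show "AE u in lborel. norm (step u * (\<bar>g u\<bar> * u powr (- p))) \<le> norm (2 * (step u * (min 1 u * envelope p p u)))"
  proof (rule AE_I2)
   fix u :: real
   show "norm (step u * (\<bar>g u\<bar> * u powr (- p))) \<le> norm (2 * (step u * (min 1 u * envelope p p u)))"
   proof (cases "0 < u")
    case True
    then have "\<bar>g u\<bar> * u powr (- p) \<le> 2 * min 1 u * u powr (- p)" by (intro mult_right_mono g) auto
    then show ?thesis using True by (simp add: env abs_mult)
   qed simp
  qed
 qed measurable
 have s: "\<bar>sin u\<bar> \<le> 2 * min 1 u" if "0 < u" for u :: real
  using abs_sin_x_le_abs_x[of u] abs_sin_le_one[of u] that unfolding min_def by (simp del: abs_sin_le_one split: if_split)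
 have c: "\<bar>1 - cos u\<bar> \<le> 2 * min 1 u" if "0 < u" for u :: real
  using abs_cos_diff_le[of 0 u] cos_ge_minus_one[of u] cos_le_one[of u] that unfolding min_def by (simp del: cos_ge_minus_one cos_le_one split: if_split)
 have S: "Gamma p * (LBINT u. step u * (sin u * u powr (- p))) = pi / (2 * sin (pi * p / 2))"
 proof -
  have "Gamma p * (LBINT u. step u * (sin u * u powr (- p))) = (LBINT s. step s * (s powr (p - 1) * (1 / (1 + s\<^sup>2))))"
   by (rule mellin_laplace[OF _ _ bnd laplace_sin]) (use p s in auto)
  also have "\<dots> = pi / (2 * sin (pi * p / 2))" using beta_half_line[of p] p by simp
  finally show ?thesis .
 qed
 have C: "Gamma p * (LBINT u. step u * ((1 - cos u) * u powr (- p))) = pi / (2 * sin (pi * (p - 1) / 2))"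
 proof -
  have "Gamma p * (LBINT u. step u * ((1 - cos u) * u powr (- p))) = (LBINT s. step s * (s powr (p - 1) * (1 / (s * (1 + s\<^sup>2)))))"
   by (rule mellin_laplace[OF _ _ bnd laplace_one_minus_cos]) (use p c in auto)
  also have "\<dots> = (LBINT s. step s * (s powr ((p - 1) - 1) / (1 + s\<^sup>2)))"
   by (intro int_cong) (auto simp: indicator_def powr_diff power2_eq_square)
  also have "\<dots> = pi / (2 * sin (pi * (p - 1) / 2))" using beta_half_line[of "p - 1"] p by simp
  finally show ?thesis .
 qed
 define \<theta> where "\<theta> = p * pi / 2"
 have th: "pi / 2 < \<theta>" "\<theta> < pi" using p by (auto simp: \<theta>_def)
 have sn: "0 < sin \<theta>" using th by (intro sin_gt_zero) auto
 have cn: "cos \<theta> < 0" using th by (intro cos_lt_zero_pi) auto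
 have G: "0 < Gamma p" using p by simp
 have rfl: "Gamma p * Gamma (1 - p) = pi / (2 * sin \<theta> * cos \<theta>)"
  using Gamma_reflection_real[of p] sin_double[of \<theta>] by (simp add: \<theta>_def mult.commute)
 have e1: "pi * p / 2 = \<theta>" by (simp add: \<theta>_def)
 have e2: "sin (pi * (p - 1) / 2) = - cos \<theta>"
 proof -
  have "pi * (p - 1) / 2 = \<theta> - pi / 2" by (simp add: \<theta>_def field_simps)
  then show ?thesis by (simp only: sin_diff) simp
 qed
 have "Gamma p * (LBINT u. step u * (sin u * u powr (- p))) = Gamma p * (Gamma (1 - p) * cos \<theta>)"
 proof -
  have "Gamma p * (Gamma (1 - p) * cos \<theta>) = pi / (2 * sin \<theta>)"
   unfolding mult.assoc[symmetric] rfl using sn cn by simp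
  then show ?thesis unfolding S e1 by simp
 qed
 then show ?Q
  using G by (simp add: \<theta>_def)
 have "Gamma p * (LBINT u. step u * ((1 - cos u) * u powr (- p))) = Gamma p * (- (Gamma (1 - p) * sin \<theta>))"
 proof -
  have "Gamma p * (- (Gamma (1 - p) * sin \<theta>)) = pi / (2 * - cos \<theta>)"
   unfolding mult_minus_right mult.assoc[symmetric] rfl using sn cn by simp
  then show ?thesis unfolding C e2 by simp
 qed
 then show ?P
  using mult_cancel_left[of "Gamma p" _ "- (Gamma (1 - p) * sin \<theta>)"] G unfolding \<theta>_def by (metis less_irrefl)
qed

section \<open>From tails to expectations\<close>

lemma (in prob_space) layer_cake:
 assumes Y[measurable]: "Y \<in> borel_measurable M" and B: "0 < (B::real)"
  and H: "\<And>u. (H has_real_derivative h u) (at u)" and h: "\<And>u. isCont h u" and H0: "H 0 = 0"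
  and i: "integrable lborel (\<lambda>u. step u * (h u * prob {x\<in>space M. B * u < Y x}))"
 shows "integrable M (\<lambda>x. H (max (Y x / B) 0))" (is ?Q)
  "(LINT x|M. H (max (Y x / B) 0)) = (LBINT u. step u * (h u * prob {x\<in>space M. B * u < Y x}))" (is ?P)
proof -
 interpret P: pair_sigma_finite lborel M ..
 have hm[measurable]: "h \<in> borel_measurable borel"
  using h by (intro borel_measurable_continuous_onI) (simp add: continuous_on_eq_continuous_at)
 define k where "k u x = step u * h u * (if B * u < Y x then 1 else 0)" for u x
 have km[measurable]: "case_prod k \<in> borel_measurable (lborel \<Otimes>\<^sub>M M)"
  unfolding k_def by measurable
 have kalt: "k u x = step u * h u * indicator {x\<in>space M. B * u < Y x} x" if "x \<in> space M" for u x
  using that by (auto simp: k_def indicator_def)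
 have inner: "(LINT x|M. k u x) = step u * (h u * prob {x\<in>space M. B * u < Y x})" for u
 proof -
  have "(LINT x|M. k u x) = (LINT x|M. step u * h u * indicator {x\<in>space M. B * u < Y x} x)"
   by (rule int_cong) (auto simp: kalt)
  then show ?thesis by simp
 qed
 have innerN: "(LINT x|M. norm (k u x)) = norm (step u * (h u * prob {x\<in>space M. B * u < Y x}))" for u
 proof -
  have "(LINT x|M. norm (k u x)) = (LINT x|M. step u * \<bar>h u\<bar> * indicator {x\<in>space M. B * u < Y x} x)"
   by (rule int_cong) (auto simp: kalt abs_mult)
  then show ?thesis by (simp add: abs_mult)
 qed
 have ki: "integrable M (k u)" for u
  by (rule integrable_const_bound[where B="\<bar>h u\<bar>"]) (auto simp: k_def indicator_def)
 have int: "integrable (lborel \<Otimes>\<^sub>M M) (case_prod k)"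
 proof (rule P.Fubini_integrable[OF km])
  show "integrable lborel (\<lambda>u. LINT x|M. norm (case_prod k (u, x)))"
   unfolding prod.case innerN by (rule integrable_norm[OF i])
  show "AE u in lborel. integrable M (\<lambda>x. case_prod k (u, x))" using ki by simp
 qed
 have outer: "(LBINT u. k u x) = H (max (Y x / B) 0)" for x
 proof (cases "0 < Y x")
  case True
  then have y: "0 \<le> Y x / B" using B by simp
  have "(LBINT u. k u x) = (LBINT u. h u * indicator {0..Y x / B} u)"
  proof (rule integral_cong_AE)
   show "AE u in lborel. k u x = h u * indicator {0..Y x / B} u"
    using AE_lborel_singleton[of 0] AE_lborel_singleton[of "Y x / B"]
    by eventually_elim (use B in \<open>auto simp: k_def indicator_def field_simps\<close>)
  qed (auto simp: k_def)
  also have "\<dots> = H (Y x / B) - H 0" by (rule integral_FTC_Icc_real[OF y H h])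
  finally show ?thesis using H0 y by (simp add: max_def)
 next
  case False
  have "k u x = 0" for u
  proof (cases "0 < u")
   case True
   then have "0 < B * u" using B by simp
   then show ?thesis using False by (simp add: k_def)
  qed (simp add: k_def)
  moreover have "Y x / B \<le> 0" using False B by (simp add: divide_nonpos_pos)
  ultimately show ?thesis using H0 by (simp add: max_absorb2)
 qed
 show ?Q using P.integrable_snd[OF int] by (simp add: outer)
 show ?P
  using P.Fubini_integral[OF int] by (simp add: outer inner)
qed

lemma dyadic_bracket:
 assumes "1 \<le> (v::real)"
 obtains k :: nat where "2 ^ k \<le> v" "v < 2 ^ Suc k"
proof -
 define n where "n = (LEAST n. v < 2 ^ n)"
 have n: "v < 2 ^ n" unfolding n_def by (rule LeastI_ex) (rule real_arch_pow, simp)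
 then have "n \<noteq> 0" using assms by (cases n) auto
 then obtain k where k: "n = Suc k" by (cases n) auto
 have "\<not> v < 2 ^ k" using not_less_Least[of k "\<lambda>n. v < 2 ^ n"] k unfolding n_def by simp
 then show ?thesis using n k that[of k] by simp
qed

lemma powr_two_power: "((2::real) ^ k) powr q = (2 powr q) ^ k"
 by (simp add: powr_realpow[symmetric] powr_powr mult.commute)

text \<open>Only doublings are compared: for large \<open>x\<close> the quotient
  \<open>G (2 x) / G x\<close> lies between \<open>2 powr (- q1)\<close> and
  \<open>2 powr (- q2)\<close>. Iteration relates \<open>G (2 ^ k z)\<close> to \<open>G z\<close>,
  and monotonicity fills in between powers of 2 at the cost of a constant factor.\<close>

lemma potter_bound:
 fixes G :: "real \<Rightarrow> real"
 assumes mono: "\<And>x y. x \<le> y \<Longrightarrow> G y \<le> G x" and pos: "\<And>x. 0 < G x" and le1: "\<And>x. G x \<le> 1"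
  and lim: "((\<lambda>x. G (2 * x) / G x) \<longlongrightarrow> 2 powr (- p)) at_top" and q: "0 < q2" "q2 < p" "p < q1"
 shows "\<exists>K x0. 0 < K \<and> 0 < x0 \<and> (\<forall>z\<ge>x0. \<forall>u>0. G (z * u) \<le> K * G z * envelope q1 q2 u)"
proof -
 have "\<forall>\<^sub>F x in at_top. G (2 * x) / G x < 2 powr (- q2)" by (rule order_tendstoD(2)[OF lim]) (use q in simp)
 moreover have "\<forall>\<^sub>F x in at_top. 2 powr (- q1) < G (2 * x) / G x" by (rule order_tendstoD(1)[OF lim]) (use q in simp)
 ultimately have "\<forall>\<^sub>F x in at_top. G (2 * x) / G x < 2 powr (- q2) \<and> 2 powr (- q1) < G (2 * x) / G x" by eventually_elim simp
 then obtain X where X: "\<And>x. x \<ge> X \<Longrightarrow> G (2 * x) / G x < 2 powr (- q2)" "\<And>x. x \<ge> X \<Longrightarrow> 2 powr (- q1) < G (2 * x) / G x"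
  by (auto simp: eventually_at_top_linorder)
 define x0 where "x0 = max X 1"
 have x0: "0 < x0" by (simp add: x0_def)
 have up: "G (2 ^ k * z) \<le> (2 powr (- q2)) ^ k * G z" if z: "x0 \<le> z" for k z
 proof (induction k)
  case (Suc k)
  have "1 * z \<le> 2 ^ k * z" using z x0 by (intro mult_right_mono) auto
  moreover have "X \<le> z" using z by (simp add: x0_def)
  ultimately have "X \<le> 2 ^ k * z" by linarith
  from X(1)[OF this] have "G (2 ^ Suc k * z) \<le> 2 powr (- q2) * G (2 ^ k * z)"
   using pos[of "2 ^ k * z"] by (simp add: pos_divide_less_eq mult.assoc less_imp_le)
  also have "\<dots> \<le> 2 powr (- q2) * ((2 powr (- q2)) ^ k * G z)" by (intro mult_left_mono Suc) simp
  finally show ?case by (simp add: mult.assoc)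
 qed simp
 have dn: "G z \<le> (2 powr q1) ^ k * G (2 ^ k * z)" if z: "x0 \<le> z" for k z
 proof (induction k)
  case (Suc k)
  have "1 * z \<le> 2 ^ k * z" using z x0 by (intro mult_right_mono) auto
  moreover have "X \<le> z" using z by (simp add: x0_def)
  ultimately have "X \<le> 2 ^ k * z" by linarith
  from X(2)[OF this] have "2 powr (- q1) * G (2 ^ k * z) \<le> G (2 * (2 ^ k * z))"
   using pos[of "2 ^ k * z"] by (simp add: pos_less_divide_eq less_imp_le)
  then have "2 powr q1 * (2 powr (- q1) * G (2 ^ k * z)) \<le> 2 powr q1 * G (2 * (2 ^ k * z))" by (rule mult_left_mono) simp
  moreover have "2 powr q1 * (2 powr (- q1) * G (2 ^ k * z)) = G (2 ^ k * z)"
   by (simp add: mult.assoc[symmetric] powr_add[symmetric])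
  ultimately have "G (2 ^ k * z) \<le> 2 powr q1 * G (2 ^ Suc k * z)" by (simp add: mult.assoc)
  then have "(2 powr q1) ^ k * G (2 ^ k * z) \<le> (2 powr q1) ^ k * (2 powr q1 * G (2 ^ Suc k * z))" by (intro mult_left_mono) auto
  with Suc have "G z \<le> (2 powr q1) ^ k * (2 powr q1 * G (2 ^ Suc k * z))" by (rule order_trans)
  then show ?case by (simp add: ac_simps)
 qed simp
 have big: "G (z * u) \<le> 2 powr q2 * (G z * u powr (- q2))" if z: "x0 \<le> z" and u: "1 \<le> u" for z u
 proof -
  obtain k :: nat where k: "2 ^ k \<le> u" "u < 2 ^ Suc k" by (rule dyadic_bracket[OF u])
  have "2 ^ k * z \<le> z * u" using mult_right_mono[OF k(1), of z] z x0 by (simp add: mult.commute)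
  then have "G (z * u) \<le> G (2 ^ k * z)" by (rule mono)
  also have "\<dots> \<le> (2 powr (- q2)) ^ k * G z" by (rule up[OF z])
  also have "\<dots> \<le> (2 powr q2 * u powr (- q2)) * G z"
  proof (intro mult_right_mono)
   have "(2 ^ Suc k) powr (- q2) \<le> u powr (- q2)" by (rule powr_mono2') (use k u q in auto)
   then have "2 powr q2 * (2 ^ Suc k) powr (- q2) \<le> 2 powr q2 * u powr (- q2)" by (intro mult_left_mono) auto
   moreover have "2 powr q2 * (2 ^ Suc k) powr (- q2) = (2 powr (- q2)) ^ k"
    unfolding powr_two_power by (simp add: mult.assoc[symmetric] powr_add[symmetric])
   ultimately show "(2 powr (- q2)) ^ k \<le> 2 powr q2 * u powr (- q2)" by (simp only:)
  qed (use pos in \<open>simp add: less_imp_le\<close>)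
  finally show ?thesis by (simp add: ac_simps)
 qed
 have small: "G w \<le> 2 powr q1 * (G z * (w / z) powr (- q1))" if w: "x0 \<le> w" "w \<le> z" for w z
 proof -
  have w0: "0 < w" "0 < z" using w x0 by auto
  have v: "1 \<le> z / w" using w w0 by simp
  obtain k :: nat where k: "2 ^ k \<le> z / w" "z / w < 2 ^ Suc k" by (rule dyadic_bracket[OF v])
  have "z \<le> 2 ^ Suc k * w" using k(2) w0 by (simp only: pos_divide_less_eq less_imp_le)
  then have G: "G (2 ^ Suc k * w) \<le> G z" by (rule mono)
  have "G w \<le> (2 powr q1) ^ Suc k * G (2 ^ Suc k * w)" by (rule dn[OF w(1)])
  also have "\<dots> \<le> (2 powr q1) ^ Suc k * G z" by (intro mult_left_mono G) simp
  also have "\<dots> \<le> (2 powr q1 * (w / z) powr (- q1)) * G z"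
  proof (intro mult_right_mono)
   have "(2 ^ k) powr q1 \<le> (z / w) powr q1" by (rule powr_mono2) (use k q in auto)
   moreover have "(z / w) powr q1 = (w / z) powr (- q1)" using w0 by (simp add: powr_divide powr_minus field_simps)
   ultimately show "(2 powr q1) ^ Suc k \<le> 2 powr q1 * (w / z) powr (- q1)"
    by (simp only: powr_two_power power_Suc) (intro mult_left_mono, auto)
  qed (use pos in \<open>simp add: less_imp_le\<close>)
  finally show ?thesis by (simp add: ac_simps)
 qed
 \<comment> \<open>The term with \<open>G x0\<close> serves the range \<open>z * u < x0\<close>, out
   of reach of the doubling argument: there \<open>G (z * u) \<le> 1\<close>, and 1 is compared with
   the positive number \<open>G x0\<close>.\<close>
 define K where "K = 2 powr q2 + 2 powr q1 / G x0"
 have g0: "1 \<le> 1 / G x0" using le1[of x0] pos[of x0] by simp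
 have K1: "2 powr q2 \<le> K" "2 powr q1 / G x0 \<le> K" using pos[of x0] by (auto simp: K_def less_imp_le)
 have K2: "2 powr q1 \<le> K" using order_trans[OF mult_left_mono[OF g0, of "2 powr q1"] ] K1(2) by simp
 have "G (z * u) \<le> K * G z * envelope q1 q2 u" if z: "x0 \<le> z" and u: "0 < u" for z u
 proof -
  have z0: "0 < z" using z x0 by simp
  have sc: "c * (G z * y) \<le> K * G z * y" if "c \<le> K" "0 \<le> y" for c y
   using mult_right_mono[OF that(1), of "G z * y"] pos[of z] that(2) by (simp add: mult.assoc)
  consider "1 < u" | "u \<le> 1" "x0 \<le> z * u" | "u \<le> 1" "z * u < x0" by linarith
  then show ?thesis
  proof cases
   case 1
   have "G (z * u) \<le> 2 powr q2 * (G z * u powr (- q2))" by (rule big[OF z]) (use 1 in simp)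
   also have "\<dots> \<le> K * G z * u powr (- q2)" by (rule sc[OF K1(1)]) simp
   finally show ?thesis using 1 by (simp add: envelope_def)
  next
   case 2
   have "z * u \<le> z" using mult_left_mono[OF 2(1), of z] z0 by simp
   from small[OF 2(2) this] have "G (z * u) \<le> 2 powr q1 * (G z * u powr (- q1))" using z0 by simp
   also have "\<dots> \<le> K * G z * u powr (- q1)" by (rule sc[OF K2]) simp
   finally show ?thesis using 2 by (simp add: envelope_def)
  next
   case 3
   have ux: "u \<le> x0 / z" using 3 z0 by (simp add: pos_le_divide_eq mult.commute less_imp_le)
   have "G x0 \<le> 2 powr q1 * (G z * (x0 / z) powr (- q1))" by (rule small) (use z in auto)
   also have "\<dots> \<le> 2 powr q1 * (G z * u powr (- q1))"
    by (intro mult_left_mono powr_mono2') (use ux u q pos[of z] in auto)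
   finally have "1 \<le> 2 powr q1 * (G z * u powr (- q1)) / G x0" using pos[of x0] by (simp add: pos_le_divide_eq)
   with le1[of "z * u"] have "G (z * u) \<le> 2 powr q1 / G x0 * (G z * u powr (- q1))" by simp
   also have "\<dots> \<le> K * G z * u powr (- q1)" by (rule sc[OF K1(2)]) simp
   finally show ?thesis using 3 by (simp add: envelope_def)
  qed
 qed
 moreover have "0 < K" using K2 by (rule less_le_trans[rotated]) simp
 ultimately show ?thesis using x0 by blast
qed

text \<open>
 By the layer cake formula, the expectation of \<open>H(|f| / B)\<close> is the integral of \<open>h = H'\<close> against the tail of
 \<open>|f| / B\<close>. These \<open>h\<close> are integrable against \<open>u\<^sup>-\<^sup>p\<close> for \<open>1 < p < 2\<close>; they include the kernels of
 \<open>cos (t u) - 1\<close> and \<open>sin (t u) - t u\<close>, and of smooth majorants of \<open>min 1 u\<^sup>2\<close> and \<open>max (u - 1) 0\<close>.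
\<close>
definition kernel :: "real \<Rightarrow> (real \<Rightarrow> real) \<Rightarrow> (real \<Rightarrow> real) \<Rightarrow> bool" where
 "kernel c H h \<longleftrightarrow> (\<forall>u. (H has_real_derivative h u) (at u)) \<and> (\<forall>u. isCont h u) \<and> H 0 = 0 \<and> (\<forall>u>0. \<bar>h u\<bar> \<le> c * min 1 u) \<and>
  h 0 = 0 \<and> h field_differentiable (at 0)"

text \<open>Dominated convergence in the layer cake formula; the dominating function is a multiple
  of \<open>min 1 u * envelope q1 q2 u\<close>, the first factor coming from \<open>h\<close> and
  the second from the tail.\<close>

lemma (in prob_space) tail_limit:
 fixes h :: "real \<Rightarrow> real" and B :: "nat \<Rightarrow> real"
 assumes Y[measurable]: "Y \<in> borel_measurable M" and B: "\<And>n. 1 \<le> n \<Longrightarrow> 0 < B n"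
  and k: "kernel c H h" and q: "q1 < 2" "1 < q2"
  and ev: "EV n. \<forall>u>0. real n * prob {x\<in>space M. B n * u < Y x} \<le> K * envelope q1 q2 u"
  and lim: "\<And>u. 0 < u \<Longrightarrow> (\<lambda>n. real n * prob {x\<in>space M. B n * u < Y x}) \<longlonglongrightarrow> cc * u powr (- p)"
 shows "EV n. integrable M (\<lambda>x. H (max (Y x / B n) 0))" (is ?Q)
  "(\<lambda>n. real n * (LINT x|M. H (max (Y x / B n) 0))) \<longlonglongrightarrow> cc * (LBINT u. step u * (h u * u powr (- p)))" (is ?P)
proof -
 have H: "\<And>u. (H has_real_derivative h u) (at u)" and h: "\<And>u. isCont h u" and H0: "H 0 = 0"
  and hb: "\<And>u. 0 < u \<Longrightarrow> \<bar>h u\<bar> \<le> c * min 1 u" using k by (auto simp: kernel_def)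
 obtain N where N: "\<And>n u. n \<ge> N \<Longrightarrow> 0 < u \<Longrightarrow> real n * prob {x\<in>space M. B n * u < Y x} \<le> K * envelope q1 q2 u"
  using ev by (auto simp: eventually_sequentially)
 define N' where "N' = max N 1"
 have hm[measurable]: "h \<in> borel_measurable borel"
  using h by (intro borel_measurable_continuous_onI) (simp add: continuous_on_eq_continuous_at)
 have c: "0 \<le> c" using hb[of 1] by simp
 have gm: "(\<lambda>u. prob {x\<in>space M. B n * u < Y x}) \<in> borel_measurable borel" if "1 \<le> n" for n
 proof -
  have "mono (\<lambda>u. - prob {x\<in>space M. B n * u < Y x})"
  proof (rule monoI)
   fix u v :: real assume uv: "u \<le> v"
   have "{x\<in>space M. B n * v < Y x} \<subseteq> {x\<in>space M. B n * u < Y x}"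
    using le_less_trans[OF mult_left_mono[OF uv]] B[OF that] by (auto simp: less_imp_le)
   then show "- prob {x\<in>space M. B n * u < Y x} \<le> - prob {x\<in>space M. B n * v < Y x}" by (simp add: finite_measure_mono)
  qed
  then have "(\<lambda>u. - (- prob {x\<in>space M. B n * u < Y x})) \<in> borel_measurable borel"
   by (intro borel_measurable_uminus borel_measurable_mono)
  then show ?thesis by simp
 qed
 let ?g = "\<lambda>n u. step u * (h u * (real n * prob {x\<in>space M. B n * u < Y x}))"
 let ?w = "\<lambda>u. (c * K) * (step u * (min 1 u * envelope q1 q2 u))"
 have wi: "integrable lborel ?w" using envelope_integrable[OF q] by simp
 have gm': "?g n \<in> borel_measurable lborel" if "1 \<le> n" for n using gm[OF that] by measurable
 have dom: "norm (?g n u) \<le> ?w u" if n: "N' \<le> n" for n u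
 proof (cases "0 < u")
  case True
  have "\<bar>h u\<bar> * (real n * prob {x\<in>space M. B n * u < Y x}) \<le> (c * min 1 u) * (K * envelope q1 q2 u)"
   by (rule mult_mono[OF hb[OF True] N]) (use n True c in \<open>auto simp: N'_def\<close>)
  then show ?thesis using True by (simp add: abs_mult ac_simps)
 qed simp
 have gi: "integrable lborel (?g n)" if n: "N' \<le> n" for n
 proof (rule int_dom[OF wi gm'])
  show "1 \<le> n" using n by (simp add: N'_def)
  show "AE u in lborel. norm (?g n u) \<le> norm (?w u)"
   using dom[OF n] abs_ge_self unfolding real_norm_def by (intro AE_I2) (rule order_trans)
 qed
 have lc: "integrable M (\<lambda>x. H (max (Y x / B n) 0)) \<and> real n * (LINT x|M. H (max (Y x / B n) 0)) = (LBINT u. ?g n u)" if n: "N' \<le> n" for n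
 proof -
  have n1: "1 \<le> n" using n by (simp add: N'_def)
  have "integrable lborel (\<lambda>u. (1 / real n) * ?g n u)" by (rule integrable_mult_right[OF gi[OF n]])
  moreover have eq: "(1 / real n) * ?g n u = step u * (h u * prob {x\<in>space M. B n * u < Y x})" for u
   using n1 by simp
  ultimately have i: "integrable lborel (\<lambda>u. step u * (h u * prob {x\<in>space M. B n * u < Y x}))" by (simp only:)
  note L = layer_cake[OF Y B[OF n1] H h H0 i]
  have "real n * (LBINT u. step u * (h u * prob {x\<in>space M. B n * u < Y x})) = (LBINT u. ?g n u)"
   by (subst integral_mult_right_zero[symmetric]) (simp add: ac_simps)
  then show ?thesis using L by simp
 qed
 then show ?Q
  unfolding eventually_sequentially by blast
 have "(\<lambda>n. LBINT u. ?g (n + N') u) \<longlonglongrightarrow> (LBINT u. step u * (h u * (cc * u powr (- p))))"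
 proof (rule integral_dominated_convergence[where w="?w"])
  show "AE u in lborel. (\<lambda>n. ?g (n + N') u) \<longlonglongrightarrow> step u * (h u * (cc * u powr (- p)))"
  proof (rule AE_I2)
   fix u :: real
   show "(\<lambda>n. ?g (n + N') u) \<longlonglongrightarrow> step u * (h u * (cc * u powr (- p)))"
   proof (cases "0 < u")
    case True
    show ?thesis
     by (intro tendsto_mult[OF tendsto_const] LIMSEQ_ignore_initial_segment[OF lim[OF True], of N'])
   qed simp
  qed
  show "?g (n + N') \<in> borel_measurable lborel" for n by (rule gm') (simp add: N'_def)
  show "AE u in lborel. norm (?g (n + N') u) \<le> ?w u" for n by (intro AE_I2 dom) simp
 qed (use wi in auto)
 moreover have "(LBINT u. step u * (h u * (cc * u powr (- p)))) = cc * (LBINT u. step u * (h u * u powr (- p)))"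
  by (subst integral_mult_right_zero[symmetric]) (simp add: ac_simps)
 ultimately have "(\<lambda>n. real (n + N') * (LINT x|M. H (max (Y x / B (n + N')) 0))) \<longlonglongrightarrow> cc * (LBINT u. step u * (h u * u powr (- p)))"
  by (simp only: conjunct2[OF lc] le_add2)
 then show ?P
  by (rule LIMSEQ_offset[where k=N'])
qed

lemma divide_ge_one_le: "1 \<le> y \<Longrightarrow> 0 \<le> x \<Longrightarrow> x / y \<le> (x::real)"
 using mult_left_mono[of 1 y x] by (simp add: pos_divide_le_eq)

section \<open>The four kernels, and the limit law they determine\<close>

lemma kernel_cos: "kernel (2 * \<bar>t\<bar> + t\<^sup>2) (\<lambda>u. cos (t * u) - 1) (\<lambda>u. - (t * sin (t * u)))"
 unfolding kernel_def
proof (intro conjI allI impI)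
 show "(\<lambda>u. - (t * sin (t * u))) field_differentiable at 0"
  unfolding field_differentiable_def by (intro exI) (auto intro!: derivative_eq_intros)
 fix u :: real
 show "((\<lambda>u. cos (t * u) - 1) has_real_derivative - (t * sin (t * u))) (at u)"
  by (auto intro!: derivative_eq_intros)
 show "isCont (\<lambda>u. - (t * sin (t * u))) u" by (intro continuous_intros)
 assume u: "0 < u"
 have "\<bar>t\<bar> * \<bar>sin (t * u)\<bar> \<le> \<bar>t\<bar> * 2" by (intro mult_left_mono order_trans[OF abs_sin_le_one]) auto
 moreover have "\<bar>t\<bar> * \<bar>sin (t * u)\<bar> \<le> \<bar>t\<bar> * (\<bar>t\<bar> * u)"
  by (intro mult_left_mono order_trans[OF abs_sin_x_le_abs_x]) (use u in \<open>auto simp: abs_mult\<close>)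
 moreover have "\<bar>t\<bar> * (\<bar>t\<bar> * u) = t\<^sup>2 * u" by (simp add: mult.assoc[symmetric] power2_eq_square)
 moreover have "0 \<le> \<bar>t\<bar> * u" using u by simp
 ultimately show "\<bar>- (t * sin (t * u))\<bar> \<le> (2 * \<bar>t\<bar> + t\<^sup>2) * min 1 u"
  unfolding abs_minus_cancel abs_mult min_def by (auto simp: distrib_right add_increasing2)
qed simp_all

lemma kernel_sin: "kernel (2 * \<bar>t\<bar> + t\<^sup>2) (\<lambda>u. sin (t * u) - t * u) (\<lambda>u. t * (cos (t * u) - 1))"
 unfolding kernel_def
proof (intro conjI allI impI)
 show "(\<lambda>u. t * (cos (t * u) - 1)) field_differentiable at 0"
  unfolding field_differentiable_def by (intro exI) (auto intro!: derivative_eq_intros)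
 fix u :: real
 show "((\<lambda>u. sin (t * u) - t * u) has_real_derivative t * (cos (t * u) - 1)) (at u)"
  by (auto intro!: derivative_eq_intros simp: algebra_simps)
 show "isCont (\<lambda>u. t * (cos (t * u) - 1)) u" by (intro continuous_intros)
 assume u: "0 < u"
 have "\<bar>cos (t * u) - 1\<bar> \<le> 2" using cos_ge_minus_one[of "t * u"] cos_le_one[of "t * u"] by linarith
 then have "\<bar>t\<bar> * \<bar>cos (t * u) - 1\<bar> \<le> \<bar>t\<bar> * 2" by (intro mult_left_mono) auto
 moreover have "\<bar>t\<bar> * \<bar>cos (t * u) - 1\<bar> \<le> \<bar>t\<bar> * (\<bar>t\<bar> * u)"
  using abs_cos_diff_le[of "t * u" 0] u by (intro mult_left_mono) (auto simp: abs_mult)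
 moreover have "\<bar>t\<bar> * (\<bar>t\<bar> * u) = t\<^sup>2 * u" by (simp add: mult.assoc[symmetric] power2_eq_square)
 moreover have "0 \<le> \<bar>t\<bar> * u" using u by simp
 ultimately show "\<bar>t * (cos (t * u) - 1)\<bar> \<le> (2 * \<bar>t\<bar> + t\<^sup>2) * min 1 u"
  unfolding abs_mult min_def by (auto simp: distrib_right add_increasing2)
qed simp_all

lemma kernel_square: "kernel 4 (\<lambda>u. 2 * u\<^sup>2 / (1 + u\<^sup>2)) (\<lambda>u. 4 * u / (1 + u\<^sup>2)\<^sup>2)"
 unfolding kernel_def
proof (intro conjI allI impI)
 show "(\<lambda>u. 4 * u / (1 + u\<^sup>2)\<^sup>2) field_differentiable at 0"
  by (intro derivative_intros) auto
 fix u :: real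
 have p: "0 < 1 + u\<^sup>2" using zero_le_power2[of u] by linarith
 then have p': "1 + u\<^sup>2 \<noteq> 0" by simp
 have "((\<lambda>u. 2 * u\<^sup>2 / (1 + u\<^sup>2)) has_real_derivative (4 * u * (1 + u\<^sup>2) - 2 * u\<^sup>2 * (2 * u)) / ((1 + u\<^sup>2) * (1 + u\<^sup>2))) (at u)"
  using p' by (auto intro!: derivative_eq_intros)
 also have "(4 * u * (1 + u\<^sup>2) - 2 * u\<^sup>2 * (2 * u)) / ((1 + u\<^sup>2) * (1 + u\<^sup>2)) = 4 * u / (1 + u\<^sup>2)\<^sup>2"
  by (simp add: power2_eq_square algebra_simps)
 finally show "((\<lambda>u. 2 * u\<^sup>2 / (1 + u\<^sup>2)) has_real_derivative 4 * u / (1 + u\<^sup>2)\<^sup>2) (at u)" .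
 show "isCont (\<lambda>u. 4 * u / (1 + u\<^sup>2)\<^sup>2) u" using p' by (intro continuous_intros) auto
 assume u: "0 < u"
 have a: "1 \<le> (1 + u\<^sup>2)\<^sup>2" by (rule one_le_power) simp
 have b: "u \<le> (1 + u\<^sup>2)\<^sup>2"
 proof -
  have "0 \<le> (u - 1)\<^sup>2" by simp
  then have "u \<le> 1 + u\<^sup>2" using u by (simp add: power2_diff)
  also have "\<dots> \<le> (1 + u\<^sup>2)\<^sup>2" using self_le_power[of "1 + u\<^sup>2" 2] by simp
  finally show ?thesis .
 qed
 have "4 * u / (1 + u\<^sup>2)\<^sup>2 \<le> 4 * u" by (rule divide_ge_one_le[OF a]) (use u in simp)
 moreover have "4 * u / (1 + u\<^sup>2)\<^sup>2 \<le> 4" unfolding pos_divide_le_eq[OF less_le_trans[OF zero_less_one a]] using b by simp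
 moreover have "0 \<le> 4 * u / (1 + u\<^sup>2)\<^sup>2" using u by simp
 ultimately show "\<bar>4 * u / (1 + u\<^sup>2)\<^sup>2\<bar> \<le> 4 * min 1 u" unfolding min_def by (auto simp del: zero_le_divide_iff)
qed simp_all

lemma kernel_sqrt: "kernel 1 (\<lambda>u. sqrt (1 + u\<^sup>2) - 1) (\<lambda>u. u / sqrt (1 + u\<^sup>2))"
 unfolding kernel_def
proof (intro conjI allI impI)
 show "(\<lambda>u. u / sqrt (1 + u\<^sup>2)) field_differentiable at 0"
  unfolding field_differentiable_def by (intro exI, rule DERIV_divide) (auto intro!: derivative_eq_intros)
 fix u :: real
 have p: "0 < 1 + u\<^sup>2" using zero_le_power2[of u] by linarith
 have p': "sqrt (1 + u\<^sup>2) \<noteq> 0" using p by simp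
 show "((\<lambda>u. sqrt (1 + u\<^sup>2) - 1) has_real_derivative u / sqrt (1 + u\<^sup>2)) (at u)"
  using p by (auto intro!: derivative_eq_intros simp: field_simps)
 show "isCont (\<lambda>u. u / sqrt (1 + u\<^sup>2)) u" using p' by (intro continuous_intros) auto
 assume u: "0 < u"
 have a: "1 \<le> sqrt (1 + u\<^sup>2)" by simp
 have b: "u \<le> sqrt (1 + u\<^sup>2)" by (rule real_le_rsqrt) simp
 have "u / sqrt (1 + u\<^sup>2) \<le> u" by (rule divide_ge_one_le[OF a]) (use u in simp)
 moreover have "u / sqrt (1 + u\<^sup>2) \<le> 1" unfolding pos_divide_le_eq[OF less_le_trans[OF zero_less_one a]] using b by simp
 ultimately show "\<bar>u / sqrt (1 + u\<^sup>2)\<bar> \<le> 1 * min 1 u" using u a by simp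
qed simp_all

text \<open>The common end of conditions II and III, which differ only in the functional
  \<open>\<Lambda>\<close> and in the odd part \<open>im\<close>. The real part of
  \<open>n (\<theta> - 1)\<close> is even in \<open>f\<close>, so a kernel at \<open>|f|\<close>
  computes it. The square and square root kernels yield \<open>normalizing\<close>, hence tightness,
  hence a law having the limit as its characteristic function.\<close>

lemma (in gm_obs) limit_law:
 assumes R: "renormalizing_sequence B" and n0: "(\<lambda>n. real n / (B n)\<^sup>2) \<longlonglongrightarrow> 0"
  and even: "\<And>c H h. kernel c H h \<Longrightarrow> (EV n. integrable M (\<lambda>x. H (max (\<bar>f x\<bar> / B n) 0)))"
   "\<And>c H h. kernel c H h \<Longrightarrow> (\<lambda>n. real n * (LINT x|M. H (max (\<bar>f x\<bar> / B n) 0))) \<longlonglongrightarrow> \<Lambda> h"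
  and odd: "\<And>t. (\<lambda>n. real n * (LINT x|M. sin (t / B n * f x))) \<longlonglongrightarrow> im t"
 shows "\<exists>W. real_distribution W \<and> (\<forall>t. char W t = exp (Complex (\<Lambda> (\<lambda>u. - (t * sin (t * u)))) (im t))) \<and>
  limits_to B W"
proof -
 have Bpos: "0 < B n" if "1 \<le> n" for n using renormalizing_growth(1)[OF R that] .
 have mx: "max (\<bar>f x\<bar> / B n) 0 = \<bar>f x\<bar> / B n" if "1 \<le> n" for n x using Bpos[OF that] by simp
 have fm[measurable]: "rv f" by (rule f_meas)
 define ch where "ch t = exp (Complex (\<Lambda> (\<lambda>u. - (t * sin (t * u)))) (im t))" for t
 have lim: "(\<lambda>n. LINT x|M. iexp (t / B n * Sn f n x)) \<longlonglongrightarrow> ch t" for t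
 proof -
  let ?\<theta> = "\<lambda>n. (LINT x|M. iexp (t / B n * f x))"
  have ii: "integrable M (\<lambda>x. cos (t / B n * f x))" for n
   by (rule integrable_const_bound[where B=1]) auto
  have re: "(\<lambda>n. real n * (LINT x|M. cos (t / B n * f x) - 1)) \<longlonglongrightarrow> \<Lambda> (\<lambda>u. - (t * sin (t * u)))"
  proof (rule Lim_transform_eventually[OF even(2)[OF kernel_cos]])
   show "EV n. real n * (LINT x|M. cos (t * max (\<bar>f x\<bar> / B n) 0) - 1) = real n * (LINT x|M. cos (t / B n * f x) - 1)"
    using eventually_ge_at_top[of 1]
   proof eventually_elim
    case (elim n)
    have "cos (t * max (\<bar>f x\<bar> / B n) 0) = cos (t / B n * f x)" for x
     unfolding mx[OF elim] using cos_abs_real[of "t / B n * f x"] cos_minus[of "t / B n * f x"]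
     by (cases "0 \<le> f x") (auto simp: abs_if)
    then show ?case by simp
   qed
  qed
  have eq: "of_nat n * (?\<theta> n - 1) = Complex (real n * (LINT x|M. cos (t / B n * f x) - 1)) (real n * (LINT x|M. sin (t / B n * f x)))" for n
  proof (rule complex_eqI)
   have m: "(\<lambda>x. t / B n * f x) \<in> borel_measurable M" by measurable
   show "Re (of_nat n * (?\<theta> n - 1)) = Re (Complex (real n * (LINT x|M. cos (t / B n * f x) - 1)) (real n * (LINT x|M. sin (t / B n * f x))))"
    using Re_integral_iexp[OF m] ii[of n] by (simp add: prob_space)
   show "Im (of_nat n * (?\<theta> n - 1)) = Im (Complex (real n * (LINT x|M. cos (t / B n * f x) - 1)) (real n * (LINT x|M. sin (t / B n * f x))))"
    using Im_integral_iexp[OF m] by simp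
  qed
  have conv: "(\<lambda>n. of_nat n * (?\<theta> n - 1)) \<longlonglongrightarrow> Complex (\<Lambda> (\<lambda>u. - (t * sin (t * u)))) (im t)"
   unfolding eq by (rule tendsto_Complex[OF re odd])
  have pw: "(\<lambda>n. ?\<theta> n ^ n) \<longlonglongrightarrow> ch t" unfolding ch_def
  proof (rule power_tendsto_exp[OF conv])
   show "norm (?\<theta> n) \<le> 1" for n by (rule norm_integral_iexp) measurable
   have "real n * (LINT x|M. cos (t / B n * f x) - 1) \<le> 0" for n
   proof -
    have "(LINT x|M. cos (t / B n * f x) - 1) \<le> (LINT x|M. 0)" by (rule integral_mono) (use ii[of n] in auto)
    then show ?thesis by (intro mult_nonneg_nonpos) auto
   qed
   then show "Re (Complex (\<Lambda> (\<lambda>u. - (t * sin (t * u)))) (im t)) \<le> 0"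
    using LIMSEQ_le_const2[OF re, of 0] by simp
  qed
  obtain K where K: "\<And>s n. norm ((LINT x|M. iexp (s * Sn f n x)) - (LINT x|M. iexp (s * f x)) ^ n) \<le> K * s\<^sup>2 * real n"
   using char_approx by (elim exE conjE) blast
  have "(\<lambda>n. (LINT x|M. iexp (t / B n * Sn f n x)) - ?\<theta> n ^ n) \<longlonglongrightarrow> 0"
  proof (rule Lim_null_comparison)
   show "EV n. norm ((LINT x|M. iexp (t / B n * Sn f n x)) - ?\<theta> n ^ n) \<le> K * t\<^sup>2 * (real n / (B n)\<^sup>2)"
   proof (rule always_eventually, rule allI)
    fix n
    have "K * (t / B n)\<^sup>2 * real n = K * t\<^sup>2 * (real n / (B n)\<^sup>2)" by (simp add: power_divide)
    then show "norm ((LINT x|M. iexp (t / B n * Sn f n x)) - ?\<theta> n ^ n) \<le> K * t\<^sup>2 * (real n / (B n)\<^sup>2)"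
     using K[of "t / B n" n] by simp
   qed
   show "(\<lambda>n. K * t\<^sup>2 * (real n / (B n)\<^sup>2)) \<longlonglongrightarrow> 0" using tendsto_mult[OF tendsto_const n0, of "K * t\<^sup>2"] by simp
  qed
  from tendsto_add[OF this pw] show ?thesis by simp
 qed
 have bnd: "\<exists>K. \<forall>n. X n \<le> K" if "X' \<longlonglongrightarrow> l" "EV n. X n \<le> X' n" for X X' :: "nat \<Rightarrow> real" and l
 proof -
  have "EV n. X' n < l + 1" by (rule order_tendstoD(2)[OF that(1)]) simp
  with that(2) have "EV n. X n \<le> l + 1" by eventually_elim linarith
  then show ?thesis by (rule eventually_bounded_imp)
 qed
 let ?A = "\<lambda>x n. 1 + (max (\<bar>f x\<bar> / B n) 0)\<^sup>2"
 have "\<exists>K. \<forall>n. real n * (LINT x|M. min ((f x)\<^sup>2) ((B n)\<^sup>2)) / (B n)\<^sup>2 \<le> K"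
 proof (rule bnd[OF even(2)[OF kernel_square]])
  show "EV n. real n * (LINT x|M. min ((f x)\<^sup>2) ((B n)\<^sup>2)) / (B n)\<^sup>2
    \<le> real n * (LINT x|M. 2 * (max (\<bar>f x\<bar> / B n) 0)\<^sup>2 / (1 + (max (\<bar>f x\<bar> / B n) 0)\<^sup>2))"
   using eventually_ge_at_top[of 1] even(1)[OF kernel_square]
  proof eventually_elim
   case (elim n)
   have "(LINT x|M. min ((f x)\<^sup>2) ((B n)\<^sup>2) / (B n)\<^sup>2) \<le> (LINT x|M. 2 * (max (\<bar>f x\<bar> / B n) 0)\<^sup>2 / (?A x n))"
   proof (rule integral_mono[OF _ elim(2)])
    show "integrable M (\<lambda>x. min ((f x)\<^sup>2) ((B n)\<^sup>2) / (B n)\<^sup>2)"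
     by (intro integrable_divide integrable_const_bound[where B="(B n)\<^sup>2"]) auto
    fix x
    have gen: "min z 1 \<le> 2 * z / (1 + z)" if "0 \<le> z" for z :: real
    proof -
     have "z * (1 + z) \<le> 2 * z" if "z \<le> 1" using mult_left_mono[OF that \<open>0 \<le> z\<close>] by (simp add: distrib_left)
     then show ?thesis using that by (auto simp: min_def pos_le_divide_eq)
    qed
    have "min ((f x)\<^sup>2) ((B n)\<^sup>2) / (B n)\<^sup>2 = min ((\<bar>f x\<bar> / B n)\<^sup>2) 1"
     using Bpos[OF elim(1)] by (auto simp: min_def power_divide)
    then show "min ((f x)\<^sup>2) ((B n)\<^sup>2) / (B n)\<^sup>2 \<le> 2 * (max (\<bar>f x\<bar> / B n) 0)\<^sup>2 / (?A x n)"
     unfolding mx[OF elim(1)] using gen[of "(\<bar>f x\<bar> / B n)\<^sup>2"] by simp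
   qed
   then have "real n * ((LINT x|M. min ((f x)\<^sup>2) ((B n)\<^sup>2)) / (B n)\<^sup>2) \<le> real n * (LINT x|M. 2 * (max (\<bar>f x\<bar> / B n) 0)\<^sup>2 / (?A x n))"
    by (intro mult_left_mono) auto
   then show ?case by (simp only: times_divide_eq_right)
  qed
 qed
 then obtain K1 where K1: "\<And>n. real n * (LINT x|M. min ((f x)\<^sup>2) ((B n)\<^sup>2)) / (B n)\<^sup>2 \<le> K1" by (elim exE) blast
 have "\<exists>K. \<forall>n. real n * (LINT x|M. max (\<bar>f x\<bar> - B n) 0) / B n \<le> K"
 proof (rule bnd[OF even(2)[OF kernel_sqrt]])
  show "EV n. real n * (LINT x|M. max (\<bar>f x\<bar> - B n) 0) / B n
    \<le> real n * (LINT x|M. sqrt (1 + (max (\<bar>f x\<bar> / B n) 0)\<^sup>2) - 1)"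
   using eventually_ge_at_top[of 1] even(1)[OF kernel_sqrt]
  proof eventually_elim
   case (elim n)
   have "(LINT x|M. max (\<bar>f x\<bar> - B n) 0 / B n) \<le> (LINT x|M. sqrt (?A x n) - 1)"
   proof (rule integral_mono[OF _ elim(2)])
    show "integrable M (\<lambda>x. max (\<bar>f x\<bar> - B n) 0 / B n)" using f_int by auto
    fix x
    have "max (\<bar>f x\<bar> - B n) 0 / B n = max (\<bar>f x\<bar> / B n - 1) 0"
     using Bpos[OF elim(1)] by (auto simp: max_def diff_divide_distrib)
    moreover have "z \<le> sqrt (1 + z\<^sup>2)" for z :: real by (rule real_le_rsqrt) simp
    ultimately show "max (\<bar>f x\<bar> - B n) 0 / B n \<le> sqrt (?A x n) - 1"
     unfolding mx[OF elim(1)] by simp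
   qed
   then have "real n * ((LINT x|M. max (\<bar>f x\<bar> - B n) 0) / B n) \<le> real n * (LINT x|M. sqrt (?A x n) - 1)"
    by (intro mult_left_mono) auto
   then show ?case by (simp only: times_divide_eq_right)
  qed
 qed
 then obtain K2 where K2: "\<And>n. real n * (LINT x|M. max (\<bar>f x\<bar> - B n) 0) / B n \<le> K2" by (elim exE) blast
 have "\<exists>K. \<forall>n. real n / (B n)\<^sup>2 \<le> K" by (rule bnd[OF n0]) simp
 then obtain K3 where K3: "\<And>n. real n / (B n)\<^sup>2 \<le> K3" by (elim exE) blast
 define K where "K = max K1 (max K2 K3)"
 have K: "K1 \<le> K" "K2 \<le> K" "K3 \<le> K" by (auto simp: K_def)
 have nrm: "normalizing B K" unfolding normalizing_def
 proof (intro allI impI conjI)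
  fix n :: nat assume n: "1 \<le> n"
  show b: "0 < B n" by (rule Bpos[OF n])
  then have b2: "0 < (B n)\<^sup>2" by simp
  show "real n * (LINT x|M. min ((f x)\<^sup>2) ((B n)\<^sup>2)) \<le> K * (B n)\<^sup>2"
   using order_trans[OF K1[of n] K(1)] b2 by (simp only: pos_divide_le_eq)
  show "real n * (LINT x|M. max (\<bar>f x\<bar> - B n) 0) \<le> K * B n"
   using order_trans[OF K2[of n] K(2)] b by (simp only: pos_divide_le_eq)
  show "real n \<le> K * (B n)\<^sup>2"
   using order_trans[OF K3[of n] K(3)] b2 by (simp only: pos_divide_le_eq)
 qed
 have m: "(\<lambda>x. Sn f n x / B n) \<in> borel_measurable M" for n by measurable
 obtain W where W: "real_distribution W" "\<And>t. char W t = ch t"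
  using tight_char_limit[OF tight_sums[OF nrm], of ch] lim by (auto simp: char_distr[OF m])
 obtain CB \<rho> where r: "0 \<le> CB" "0 < \<rho>" "\<rho> \<le> 1" "\<And>k n. 1 \<le> k \<Longrightarrow> k \<le> n \<Longrightarrow> B k / B n \<le> CB * (real k / real n) powr \<rho>"
  using renormalizing_growth(3)[OF R] by blast
 have "limits_to B W"
  by (rule conclude_limit[OF nrm r W(1)]) (use lim W(2) in auto)
 with W show ?thesis unfolding ch_def by blast
qed

section \<open>Condition III: convergence to the stable law\<close>

lemma scaled_powr_integral:
 fixes g :: "real \<Rightarrow> real"
 assumes [measurable]: "g \<in> borel_measurable borel" and r: "0 < r"
 shows "(LBINT u. step u * ((r * g (r * u)) * u powr (- p))) = r powr p * (LBINT u. step u * (g u * u powr (- p)))"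
proof -
 let ?F = "\<lambda>u. step u * (g u * u powr (- p))"
 have "(LBINT u. ?F u) = r * (LBINT u. ?F (0 + r * u))"
  using lborel_integral_real_affine[of r ?F 0] r by simp
 also have "r * (LBINT u. ?F (0 + r * u)) = (LBINT u. r powr (- p) * (step u * ((r * g (r * u)) * u powr (- p))))"
  unfolding integral_mult_right_zero[symmetric]
 proof (rule int_cong[OF refl])
  fix u :: real
  show "r * ?F (0 + r * u) = r powr (- p) * (step u * ((r * g (r * u)) * u powr (- p)))"
   using r by (cases "0 < u") (auto simp: indicator_def zero_less_mult_iff powr_mult)
 qed
 also have "\<dots> = r powr (- p) * (LBINT u. step u * ((r * g (r * u)) * u powr (- p)))" by simp
 finally have "r powr p * (LBINT u. ?F u) = r powr p * (r powr (- p) * (LBINT u. step u * ((r * g (r * u)) * u powr (- p))))" by simp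
 also have "\<dots> = (LBINT u. step u * ((r * g (r * u)) * u powr (- p)))"
  using r by (simp add: mult.assoc[symmetric] powr_add[symmetric])
 finally show ?thesis by simp
qed

lemma
 fixes p :: real
 assumes p: "1 < p" "p < 2"
 shows sin_powr_integral_scaled: "(LBINT u. step u * (- (t * sin (t * u)) * u powr (- p))) = - (\<bar>t\<bar> powr p * (Gamma (1 - p) * cos (p * pi / 2)))" (is ?P)
  and cos_powr_integral_scaled: "(LBINT u. step u * ((t * (cos (t * u) - 1)) * u powr (- p))) = sgn t * (\<bar>t\<bar> powr p * (Gamma (1 - p) * sin (p * pi / 2)))"
proof -
 have "(LBINT u. step u * (- (t * sin (t * u)) * u powr (- p))) = - (\<bar>t\<bar> powr p * (Gamma (1 - p) * cos (p * pi / 2))) \<and>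
  (LBINT u. step u * ((t * (cos (t * u) - 1)) * u powr (- p))) = sgn t * (\<bar>t\<bar> powr p * (Gamma (1 - p) * sin (p * pi / 2)))"
 proof (cases "t = 0")
  case False
  define r where "r = \<bar>t\<bar>"
  have r: "0 < r" using False by (simp add: r_def)
  have e1: "- (t * sin (t * u)) = r * - sin (r * u)" for u by (cases "0 \<le> t") (auto simp: r_def)
  have e2: "t * (cos (t * u) - 1) = sgn t * (r * - (1 - cos (r * u)))" for u
   using False by (cases "0 < t") (auto simp: r_def algebra_simps)
  have 1: "(LBINT u. step u * (- sin u * u powr (- p))) = - (Gamma (1 - p) * cos (p * pi / 2))"
   unfolding sin_powr_integral[OF p, symmetric] integral_minus[symmetric] by (intro int_cong) auto
  have 2: "(LBINT u. step u * (- (1 - cos u) * u powr (- p))) = Gamma (1 - p) * sin (p * pi / 2)"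
  proof -
   have "(LBINT u. step u * (- (1 - cos u) * u powr (- p))) = - (LBINT u. step u * ((1 - cos u) * u powr (- p)))"
    unfolding integral_minus[symmetric] by (intro int_cong) (auto simp: algebra_simps)
   then show ?thesis unfolding cos_powr_integral[OF p] by simp
  qed
  have "(LBINT u. step u * (- (t * sin (t * u)) * u powr (- p))) = r powr p * - (Gamma (1 - p) * cos (p * pi / 2))"
   unfolding e1 using scaled_powr_integral[of "\<lambda>u. - sin u" r p] r 1 by simp
  moreover have "(LBINT u. step u * ((t * (cos (t * u) - 1)) * u powr (- p))) = sgn t * (r powr p * (Gamma (1 - p) * sin (p * pi / 2)))"
  proof -
   have "(LBINT u. step u * ((t * (cos (t * u) - 1)) * u powr (- p)))
    = sgn t * (LBINT u. step u * ((r * - (1 - cos (r * u))) * u powr (- p)))"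
    unfolding e2 integral_mult_right_zero[symmetric] by (intro int_cong) (simp_all only: ac_simps)
   then show ?thesis using scaled_powr_integral[of "\<lambda>u. - (1 - cos u)" r p] r 2 by simp
  qed
  ultimately show ?thesis by (simp add: r_def)
 qed simp
 then show ?P
  "(LBINT u. step u * ((t * (cos (t * u) - 1)) * u powr (- p))) = sgn t * (\<bar>t\<bar> powr p * (Gamma (1 - p) * sin (p * pi / 2)))"
  by auto
qed

text \<open>The choice of \<open>B\<close> makes \<open>n L(B\<^sub>n)\<close> divided by
  \<open>B\<^sub>n powr p\<close> tend to 1, and slow variation lets \<open>L(u B\<^sub>n)\<close>
  be replaced by \<open>L(B\<^sub>n)\<close>; what remains is the power of \<open>u\<close>.\<close>

lemma regular_tail_limit:
 assumes sv: "slowly_varying L" and Bpos: "\<And>n. 1 \<le> n \<Longrightarrow> 0 < B n" and Binf: "filterlim B at_top sequentially"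
  and asy: "(\<lambda>n. real n * L (B n)) \<sim>[sequentially] (\<lambda>n. B n powr p)"
  and e: "(e \<longlongrightarrow> 0) at_top" and F: "\<And>x. 0 < x \<Longrightarrow> F x = (c + e x) * x powr (- p) * L x" and u: "0 < (u::real)"
 shows "(\<lambda>n. real n * F (B n * u)) \<longlonglongrightarrow> c * u powr (- p)"
proof -
 have Lpos: "0 < L x" if "0 < x" for x using sv that by (simp add: slowly_varying_def)
 have Bu: "filterlim (\<lambda>n. B n * u) at_top sequentially"
  using filterlim_tendsto_pos_mult_at_top[OF tendsto_const u Binf] by (simp add: mult.commute)
 have "(\<lambda>n. if real n * L (B n) = 0 \<and> B n powr p = 0 then 1 else real n * L (B n) / B n powr p) \<longlonglongrightarrow> 1"
  by (rule asymp_equivD[OF asy])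
 then have a: "(\<lambda>n. real n * L (B n) / B n powr p) \<longlonglongrightarrow> 1"
 proof (rule Lim_transform_eventually)
  show "EV n. (if real n * L (B n) = 0 \<and> B n powr p = 0 then 1 else real n * L (B n) / B n powr p) = real n * L (B n) / B n powr p"
   using eventually_ge_at_top[of 1] by eventually_elim (use Bpos in \<open>simp add: less_le\<close>)
 qed
 have b: "(\<lambda>n. L (u * B n) / L (B n)) \<longlonglongrightarrow> 1"
  by (rule filterlim_compose[OF _ Binf]) (use sv u in \<open>simp add: slowly_varying_def\<close>)
 have d: "(\<lambda>n. c + e (B n * u)) \<longlonglongrightarrow> c + 0" by (intro tendsto_add tendsto_const filterlim_compose[OF e Bu])
 have "(\<lambda>n. (c + e (B n * u)) * u powr (- p) * (real n * L (B n) / B n powr p) * (L (u * B n) / L (B n))) \<longlonglongrightarrow> (c + 0) * u powr (- p) * 1 * 1"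
  by (intro tendsto_mult tendsto_const a b d)
 then have "(\<lambda>n. real n * F (B n * u)) \<longlonglongrightarrow> (c + 0) * u powr (- p) * 1 * 1"
 proof (rule Lim_transform_eventually)
  show "EV n. (c + e (B n * u)) * u powr (- p) * (real n * L (B n) / B n powr p) * (L (u * B n) / L (B n)) = real n * F (B n * u)"
   using eventually_ge_at_top[of 1]
  proof eventually_elim
   case (elim n)
   have gen: "x * y * (m * l / z) * (w / l) = m * (x * (y / z) * w)" if "0 < l" for x y m l z w :: real
    using that by (simp add: ac_simps)
   have b: "0 < B n" by (rule Bpos[OF elim])
   have l: "0 < L (B n)" by (rule Lpos[OF b])
   have "F (B n * u) = (c + e (B n * u)) * (B n * u) powr (- p) * L (B n * u)" by (rule F) (use b u in simp)
   also have "(B n * u) powr (- p) = u powr (- p) / B n powr p" using b u by (simp add: powr_mult powr_minus divide_inverse mult.commute)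
   finally show ?case unfolding mult.commute[of u "B n"] by (simp only: gen[OF l])
  qed
 qed
 then show ?thesis by simp
qed

lemma (in gm_obs) case_III:
 assumes att: "attraction_III M f p c1 c2 L" and R: "renormalizing_sequence B"
  and asy: "(\<lambda>n. real n * L (B n)) \<sim>[sequentially] (\<lambda>n. B n powr p)"
 shows "\<exists>W. is_stable_law p ((c1 + c2) * Gamma (1 - p) * cos (p * pi / 2)) ((c1 - c2) / (c1 + c2)) W \<and>
  limits_to B W"
proof -
 have p: "1 < p" "p < 2" and c12: "0 \<le> c1" "0 \<le> c2" "0 < c1 + c2" and sv: "slowly_varying L"
  using att unfolding attraction_III_def by auto
 obtain e1 where e1: "(e1 \<longlongrightarrow> 0) at_top" "\<And>x. 0 < x \<Longrightarrow> prob {y\<in>space M. f y > x} = (c1 + e1 x) * x powr (-p) * L x"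
  using att unfolding attraction_III_def by auto
 obtain e2 where e2: "(e2 \<longlongrightarrow> 0) at_top" "\<And>x. 0 < x \<Longrightarrow> prob {y\<in>space M. f y < - x} = (c2 + e2 x) * x powr (-p) * L x"
  using att unfolding attraction_III_def by auto
 have Lpos: "0 < L x" if "0 < x" for x using sv that by (simp add: slowly_varying_def)
 have fm[measurable]: "rv f" by (rule f_meas)
 note Bpos = renormalizing_growth(1)[OF R] and Binf = renormalizing_growth(2)[OF R]
 define c where "c = c1 + c2"
 define e where "e x = e1 x + e2 x" for x
 have e: "(e \<longlongrightarrow> 0) at_top" unfolding e_def using tendsto_add[OF e1(1) e2(1)] by simp
 define G where "G x = prob {y\<in>space M. x < \<bar>f y\<bar>}" for x
 have Geq: "G x = (c + e x) * x powr (- p) * L x" if x: "0 < x" for x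
 proof -
  have "{y\<in>space M. x < \<bar>f y\<bar>} = {y\<in>space M. f y > x} \<union> {y\<in>space M. f y < - x}" using x by auto
  then have "G x = prob {y\<in>space M. f y > x} + prob {y\<in>space M. f y < - x}"
   unfolding G_def using x by (subst finite_measure_Union[symmetric]) auto
  then show ?thesis unfolding e1(2)[OF x] e2(2)[OF x] by (simp add: c_def e_def algebra_simps)
 qed
 have mono: "G y \<le> G x" if "x \<le> y" for x y
  unfolding G_def using that by (intro finite_measure_mono) auto
 have le1: "G x \<le> 1" for x by (simp add: G_def)
 have ece: "\<forall>\<^sub>F x in at_top. 0 < c + e x"
 proof (rule order_tendstoD(1))
  show "((\<lambda>x. c + e x) \<longlongrightarrow> c + 0) at_top" by (intro tendsto_intros e)
 qed (use c12 in \<open>simp add: c_def\<close>)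
 have pos: "0 < G x" for x
 proof -
  have "\<forall>\<^sub>F y in at_top. 0 < c + e y \<and> max x 1 \<le> y" using ece eventually_ge_at_top[of "max x 1"] by eventually_elim simp
  then obtain y where y: "0 < c + e y" "max x 1 \<le> y" using eventually_happens'[OF trivial_limit_at_top_linorder] by blast
  then have "0 < G y" using Geq[of y] Lpos[of y] by simp
  then show ?thesis using mono[of x y] y by linarith
 qed
 have ratio: "((\<lambda>x. G (2 * x) / G x) \<longlongrightarrow> 2 powr (- p)) at_top"
 proof -
  have d: "filterlim (\<lambda>x. 2 * x :: real) at_top at_top"
   by (rule filterlim_tendsto_pos_mult_at_top[OF tendsto_const _ filterlim_ident]) simp
  have c0: "c + 0 \<noteq> 0" using c12 by (simp add: c_def)
  have "((\<lambda>x. (c + e (2 * x)) / (c + e x) * 2 powr (- p) * (L (2 * x) / L x)) \<longlongrightarrow> (c + 0) / (c + 0) * 2 powr (- p) * 1) at_top"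
   by (intro tendsto_intros filterlim_compose[OF e d] e c0) (use sv in \<open>simp add: slowly_varying_def\<close>)
  moreover have "\<forall>\<^sub>F x in at_top. (c + e (2 * x)) / (c + e x) * 2 powr (- p) * (L (2 * x) / L x) = G (2 * x) / G x"
   using ece eventually_gt_at_top[of 0]
  proof eventually_elim
   case (elim x)
   have gen: "a / b * y * (l / m) = (a * (y * z) * l) / (b * z * m)" if "z \<noteq> 0" for a b y l m z :: real
    using that by simp
   have "(2 * x) powr (- p) = 2 powr (- p) * x powr (- p)" using elim by (simp add: powr_mult)
   then show ?case using Geq[of x] Geq[of "2 * x"] elim gen[of "x powr (- p)"] by simp
  qed
  ultimately have "((\<lambda>x. G (2 * x) / G x) \<longlongrightarrow> (c + 0) / (c + 0) * 2 powr (- p) * 1) at_top" by (rule Lim_transform_eventually)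
  then show ?thesis using c0 by simp
 qed
 \<comment> \<open>The exponents \<open>q1\<close> and \<open>q2\<close> are the midpoints between
   \<open>p\<close> and 2 and between 1 and \<open>p\<close>, so that \<open>envelope\<close> is
   integrable against \<open>min 1 u\<close>.\<close>
 define q1 where "q1 = (p + 2) / 2"
 define q2 where "q2 = (p + 1) / 2"
 have q: "0 < q2" "q2 < p" "p < q1" "q1 < 2" "1 < q2" using p by (auto simp: q1_def q2_def)
 obtain K x0 where K: "0 < K" "0 < x0" "\<And>z u. x0 \<le> z \<Longrightarrow> 0 < u \<Longrightarrow> G (z * u) \<le> K * G z * envelope q1 q2 u"
  using potter_bound[of G p q2 q1, OF mono pos le1 ratio q(1-3)] by blast
 have tl: "(\<lambda>n. real n * F (B n * u)) \<longlonglongrightarrow> c * u powr (- p)"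
  if "(e \<longlongrightarrow> 0) at_top" "\<And>x. 0 < x \<Longrightarrow> F x = (c + e x) * x powr (- p) * L x" "0 < u" for F c e u
  by (rule regular_tail_limit[OF sv _ Binf asy that(1)]) (use Bpos that in auto)
 have nG: "(\<lambda>n. real n * G (B n)) \<longlonglongrightarrow> c" using tl[OF e Geq, of 1] by simp
 have large: "EV n. x0 \<le> B n \<and> real n * G (B n) \<le> c + 1"
 proof -
  have "EV n. real n * G (B n) < c + 1" by (rule order_tendstoD(2)[OF nG]) simp
  moreover have "EV n. x0 \<le> B n" using Binf by (simp add: filterlim_at_top)
  ultimately show ?thesis by eventually_elim simp
 qed
 have ev: "EV n. \<forall>u>0. real n * G (B n * u) \<le> (K * (c + 1)) * envelope q1 q2 u"
  using large
 proof eventually_elim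
  case (elim n)
  show ?case
  proof (intro allI impI)
   fix u :: real assume u: "0 < u"
   have "real n * G (B n * u) \<le> real n * (K * G (B n) * envelope q1 q2 u)" using K(3)[of "B n" u] elim u by (intro mult_left_mono) auto
   also have "\<dots> = (real n * G (B n)) * (K * envelope q1 q2 u)" by (simp only: ac_simps)
   also have "\<dots> \<le> (c + 1) * (K * envelope q1 q2 u)" using elim K(1) envelope_nonneg by (intro mult_right_mono) auto
   finally show "real n * G (B n * u) \<le> (K * (c + 1)) * envelope q1 q2 u" by (simp only: ac_simps)
  qed
 qed
 \<comment> \<open>When \<open>c1\<close> or \<open>c2\<close> is 0, a one-sided tail need not vary
   regularly; both therefore inherit their domination from \<open>G\<close>, the tail of
   \<open>|f|\<close>.\<close>
 have ev': "EV n. \<forall>u>0. real n * prob {x\<in>space M. B n * u < Y x} \<le> (K * (c + 1)) * envelope q1 q2 u"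
  if "\<And>x. Y x \<le> \<bar>f x\<bar>" "rv Y" for Y
  using ev
 proof eventually_elim
  case (elim n)
  have "prob {x\<in>space M. B n * u < Y x} \<le> G (B n * u)" for u
   unfolding G_def using that(1) less_le_trans by (intro finite_measure_mono) auto
  then have "real n * prob {x\<in>space M. B n * u < Y x} \<le> real n * G (B n * u)" for u by (intro mult_left_mono) auto
  then show ?case using elim order_trans by blast
 qed
 have l1: "(\<lambda>n. real n * prob {x\<in>space M. B n * u < f x}) \<longlonglongrightarrow> c1 * u powr (- p)" if "0 < u" for u
  using tl[OF e1 that] by simp
 have neg: "{x\<in>space M. y < - f x} = {x\<in>space M. f x < - y}" for y by auto
 have l2: "(\<lambda>n. real n * prob {x\<in>space M. B n * u < - f x}) \<longlonglongrightarrow> c2 * u powr (- p)" if "0 < u" for u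
  using tl[OF e2 that] by (simp only: neg)
 have l0: "(\<lambda>n. real n * prob {x\<in>space M. B n * u < \<bar>f x\<bar>}) \<longlonglongrightarrow> c * u powr (- p)" if "0 < u" for u
  using tl[OF e Geq that] by (simp add: G_def)
 define I where "I h = (LBINT u. step u * (h u * u powr (- p)))" for h
 have lims: "(EV n. integrable M (\<lambda>x. H (max (Y x / B n) 0))) \<and>
   (\<lambda>n. real n * (LINT x|M. H (max (Y x / B n) 0))) \<longlonglongrightarrow> cc * I h"
  if Y: "rv Y" "\<And>x. Y x \<le> \<bar>f x\<bar>" and k: "kernel K H h"
   and l: "\<And>u. 0 < u \<Longrightarrow> (\<lambda>n. real n * prob {x\<in>space M. B n * u < Y x}) \<longlonglongrightarrow> cc * u powr (- p)" for Y K H h cc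
  unfolding I_def
  using tail_limit[where B=B, OF Y(1) _ k q(4,5) ev'[OF Y(2,1)] l] Bpos by auto
 have absm: "(\<lambda>x. \<bar>f x\<bar>) \<in> borel_measurable M" and negm: "(\<lambda>x. - f x) \<in> borel_measurable M" by measurable
 have t1: "(EV n. integrable M (\<lambda>x. sin (t * max (f x / B n) 0) - t * max (f x / B n) 0)) \<and>
   (\<lambda>n. real n * (LINT x|M. sin (t * max (f x / B n) 0) - t * max (f x / B n) 0)) \<longlonglongrightarrow> c1 * I (\<lambda>u. t * (cos (t * u) - 1))" for t
  by (rule lims[OF fm abs_ge_self kernel_sin l1])
 have t2: "(EV n. integrable M (\<lambda>x. sin (t * max (- f x / B n) 0) - t * max (- f x / B n) 0)) \<and>
   (\<lambda>n. real n * (LINT x|M. sin (t * max (- f x / B n) 0) - t * max (- f x / B n) 0)) \<longlonglongrightarrow> c2 * I (\<lambda>u. t * (cos (t * u) - 1))" for t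
  by (rule lims[OF negm abs_ge_minus_self kernel_sin l2])
 \<comment> \<open>Potter's bound at \<open>u = x0 / B n\<close> compares the fixed number
   \<open>G x0\<close> with \<open>G (B n) * B n powr q1\<close>. As \<open>n * G (B n)\<close> is
   eventually bounded, \<open>n\<close> is at most a multiple of \<open>B n powr q1\<close>, and
   \<open>q1 < 2\<close>.\<close>
 have n0: "(\<lambda>n. real n / (B n)\<^sup>2) \<longlonglongrightarrow> 0"
 proof (rule tendsto_sandwich[OF _ _ tendsto_const])
  define D where "D = K * x0 powr (- q1) / G x0"
  show "EV n. real n / (B n)\<^sup>2 \<le> D * (c + 1) * B n powr (q1 - 2)"
   using large
  proof eventually_elim
   case (elim n)
   then have b: "0 < B n" using K(2) by linarith
   have "G (B n * (x0 / B n)) \<le> K * G (B n) * envelope q1 q2 (x0 / B n)" using elim K(2) b by (intro K(3)) auto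
   moreover have "envelope q1 q2 (x0 / B n) = x0 powr (- q1) * B n powr q1"
    using elim K(2) b by (simp add: envelope_def powr_divide powr_minus field_simps)
   ultimately have "G x0 \<le> K * G (B n) * (x0 powr (- q1) * B n powr q1)" using b by simp
   then have "1 \<le> D * (G (B n) * B n powr q1)" using pos[of x0] by (simp add: D_def pos_le_divide_eq ac_simps)
   then have "real n * 1 \<le> real n * (D * (G (B n) * B n powr q1))" by (rule mult_left_mono) simp
   also have "\<dots> = (real n * G (B n)) * (D * B n powr q1)" by (simp only: ac_simps)
   also have "\<dots> \<le> (c + 1) * (D * B n powr q1)" using elim K pos[of x0] by (intro mult_right_mono) (auto simp: D_def)
   finally have "real n / (B n)\<^sup>2 \<le> (c + 1) * (D * B n powr q1) / (B n)\<^sup>2" by (intro divide_right_mono) auto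
   also have "\<dots> = D * (c + 1) * B n powr (q1 - 2)" using b by (simp add: powr_diff powr_realpow)
   finally show ?case .
  qed
  have "(\<lambda>n. B n powr (q1 - 2)) \<longlonglongrightarrow> 0" by (rule tendsto_neg_powr[OF _ Binf]) (use q in simp)
  from tendsto_mult[OF tendsto_const this] show "(\<lambda>n. D * (c + 1) * B n powr (q1 - 2)) \<longlonglongrightarrow> 0" by simp
 qed simp
 define X where "X t = sgn t * (\<bar>t\<bar> powr p * (Gamma (1 - p) * sin (p * pi / 2)))" for t
 \<comment> \<open>The linear term \<open>t / B n * f\<close> has mean 0, so the sine may be
   replaced by the kernel \<open>sin (t * u) - t * u\<close>, applied to the positive and negative
   parts of \<open>f\<close> separately.\<close>
 have odd: "(\<lambda>n. real n * (LINT x|M. sin (t / B n * f x))) \<longlonglongrightarrow> c1 * X t - c2 * X t" for t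
 proof -
  let ?D = "\<lambda>u. sin (t * u) - t * u"
  have "(\<lambda>n. real n * (LINT x|M. ?D (max (f x / B n) 0)) - real n * (LINT x|M. ?D (max (- f x / B n) 0))) \<longlonglongrightarrow> c1 * X t - c2 * X t"
   using tendsto_diff[OF conjunct2[OF t1[of t]] conjunct2[OF t2[of t]]] unfolding I_def cos_powr_integral_scaled[OF p] X_def by simp
  then show ?thesis
  proof (rule Lim_transform_eventually)
   show "EV n. real n * (LINT x|M. ?D (max (f x / B n) 0)) - real n * (LINT x|M. ?D (max (- f x / B n) 0)) = real n * (LINT x|M. sin (t / B n * f x))"
    using eventually_ge_at_top[of 1] conjunct1[OF t1[of t]] conjunct1[OF t2[of t]]
   proof eventually_elim
    case (elim n)
    have b: "0 < B n" by (rule Bpos[OF elim(1)])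
    have si: "integrable M (\<lambda>x. sin (t / B n * f x))" by (rule integrable_const_bound[where B=1]) auto
    have "?D (max (f x / B n) 0) - ?D (max (- f x / B n) 0) = sin (t / B n * f x) - t / B n * f x" for x
    proof (cases "0 \<le> f x")
     case True
     then have "0 \<le> f x / B n" "- f x / B n \<le> 0" using b by auto
     then show ?thesis by (simp add: max_absorb1 max_absorb2)
    next
     case False
     then have "f x / B n \<le> 0" "0 \<le> - f x / B n" using b by (auto simp: divide_nonpos_pos)
     then show ?thesis by (simp add: max_absorb1 max_absorb2)
    qed
    then have "(LINT x|M. ?D (max (f x / B n) 0)) - (LINT x|M. ?D (max (- f x / B n) 0)) = (LINT x|M. sin (t / B n * f x) - t / B n * f x)"
     using lint_diff[OF elim(2,3)] by (simp only:)
    also have "\<dots> = (LINT x|M. sin (t / B n * f x))" using si f_int f_mean by simp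
    finally show ?case by (simp only: right_diff_distrib[symmetric])
   qed
  qed
 qed
 have "\<exists>W. real_distribution W \<and> (\<forall>t. char W t = exp (Complex (c * I (\<lambda>u. - (t * sin (t * u)))) (c1 * X t - c2 * X t))) \<and>
  limits_to B W"
  proof (rule limit_law[OF R n0 _ _ odd])
  fix K :: real and H h assume "kernel K H h"
  from lims[OF absm order_refl this l0]
  show "EV n. integrable M (\<lambda>x. H (max (\<bar>f x\<bar> / B n) 0))"
   "(\<lambda>n. real n * (LINT x|M. H (max (\<bar>f x\<bar> / B n) 0))) \<longlonglongrightarrow> c * I h" by auto
 qed
 then obtain W where W: "real_distribution W" "\<And>t. char W t = exp (Complex (c * I (\<lambda>u. - (t * sin (t * u)))) (c1 * X t - c2 * X t))"
  "limits_to B W"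
  by (elim exE conjE) blast
 have "char W t = exp (- complex_of_real ((c1 + c2) * Gamma (1 - p) * cos (p * pi / 2) * \<bar>t\<bar> powr p) *
       (1 - \<i> * complex_of_real ((c1 - c2) / (c1 + c2) * sgn t * tan (p * pi / 2))))" for t
 proof -
  have cn: "cos (p * pi / 2) \<noteq> 0" using cos_lt_zero_pi[of "p * pi / 2"] p by auto
  have "c * I (\<lambda>u. - (t * sin (t * u))) = - ((c1 + c2) * Gamma (1 - p) * cos (p * pi / 2) * \<bar>t\<bar> powr p)"
   unfolding I_def sin_powr_integral_scaled[OF p] by (simp add: c_def)
  moreover have "c1 * X t - c2 * X t = (c1 + c2) * Gamma (1 - p) * cos (p * pi / 2) * \<bar>t\<bar> powr p * ((c1 - c2) / (c1 + c2) * sgn t * tan (p * pi / 2))"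
   unfolding X_def tan_def using cn c12 by (simp add: left_diff_distrib[symmetric])
  ultimately show ?thesis unfolding W(2) by (intro arg_cong[of _ _ exp]) (simp add: complex_eq_iff)
 qed
 then have "is_stable_law p ((c1 + c2) * Gamma (1 - p) * cos (p * pi / 2)) ((c1 - c2) / (c1 + c2)) W"
  unfolding is_stable_law_def using W(1) by blast
 with W(3) show ?thesis by blast
qed

section \<open>Truncated second moments\<close>

text \<open>When \<open>G\<close> is the tail of \<open>|f|\<close>, this is the expectation of
  \<open>min (f\<^sup>2) (x\<^sup>2)\<close>.\<close>

definition tmoment :: "(real \<Rightarrow> real) \<Rightarrow> real \<Rightarrow> real" where
 "tmoment G x = (LBINT u. indicator {0<..x} u * (2 * u * G u))"

lemma antimono_borel: "(\<And>x y. x \<le> y \<Longrightarrow> G y \<le> G x) \<Longrightarrow> G \<in> borel_measurable borel" for G :: "real \<Rightarrow> real"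
 using borel_measurable_uminus[OF borel_measurable_mono[of "\<lambda>x. - G x"]] by (simp add: mono_def)

locale tail =
 fixes G :: "real \<Rightarrow> real"
 assumes mono: "\<And>x y. x \<le> y \<Longrightarrow> G y \<le> G x" and nonneg: "\<And>x. 0 \<le> G x" and le1: "\<And>x. G x \<le> 1"
begin

lemma G_meas [measurable]: "G \<in> borel_measurable borel" by (rule antimono_borel[OF mono])

lemma moment_integrable_scaled: "integrable lborel (\<lambda>u. indicator {0<..x} u * (2 * u * G (b * u)))"
proof (rule int_dom)
 show "integrable lborel (\<lambda>u. (2 * \<bar>x\<bar>) * indicator {0..x} u)"
  by (intro integrable_mult_right integrable_real_indicator) (auto simp: emeasure_lborel_Icc_eq)
 show "AE u in lborel. norm (indicator {0<..x} u * (2 * u * G (b * u))) \<le> norm ((2 * \<bar>x\<bar>) * indicator {0..x} u)"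
 proof (rule AE_I2)
  fix u
  have "2 * u * G (b * u) \<le> 2 * x * 1" if "0 < u" "u \<le> x" using that le1[of "b * u"] nonneg[of "b * u"] by (intro mult_mono) auto
  then show "norm (indicator {0<..x} u * (2 * u * G (b * u))) \<le> norm ((2 * \<bar>x\<bar>) * indicator {0..x} u)"
   using nonneg[of "b * u"] by (auto simp: indicator_def abs_mult)
 qed
qed measurable

lemma moment_integrable: "integrable lborel (\<lambda>u. indicator {0<..x} u * (2 * u * G u))"
 using moment_integrable_scaled[of x 1] by simp

lemma moment_diff:
 assumes "0 \<le> x" "x \<le> y"
 shows "integrable lborel (\<lambda>u. indicator {x<..y} u * (2 * u * G u))" (is ?Q)
  "tmoment G y - tmoment G x = (LBINT u. indicator {x<..y} u * (2 * u * G u))" (is ?P)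
proof -
 have eq: "indicator {0<..y} u * (2 * u * G u) - indicator {0<..x} u * (2 * u * G u) = indicator {x<..y} u * (2 * u * G u)" for u
  using assms by (auto simp: indicator_def)
 show ?Q
  using int_diff[OF moment_integrable[of y] moment_integrable[of x]] unfolding eq .
 show ?P
  unfolding tmoment_def lint_diff[OF moment_integrable[of y] moment_integrable[of x], symmetric] eq ..
qed

lemma moment_mono:
 assumes "0 \<le> x" "x \<le> y"
 shows "tmoment G x \<le> tmoment G y"
proof -
 have "0 \<le> (LBINT u. indicator {x<..y} u * (2 * u * G u))"
  using assms nonneg by (intro int_nonneg) (auto simp: indicator_def)
 then show ?thesis using moment_diff(2)[OF assms] by linarith
qed

lemma moment_nonneg: "0 \<le> tmoment G x"
 unfolding tmoment_def using nonneg by (intro int_nonneg) (auto simp: indicator_def)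

text \<open>Between \<open>x\<close> and \<open>2 * x\<close> the integrand of
  \<open>tmoment\<close> is at least \<open>2 * x * G (2 * x)\<close>. The tail is thus controlled
  by an increment of the truncated moment, which is relatively small once that moment varies
  slowly.\<close>

lemma moment_double:
 assumes x: "0 < x"
 shows "(2 * x)\<^sup>2 * G (2 * x) \<le> 2 * (tmoment G (2 * x) - tmoment G x)"
proof -
 have "(LBINT u. (2 * x * G (2 * x)) * indicator {x<..2 * x} u) \<le> (LBINT u. indicator {x<..2 * x} u * (2 * u * G u))"
 proof (rule integral_mono)
  show "integrable lborel (\<lambda>u. (2 * x * G (2 * x)) * indicator {x<..2 * x} u)" using x by simp
  show "integrable lborel (\<lambda>u. indicator {x<..2 * x} u * (2 * u * G u))" by (rule moment_diff) (use x in auto)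
  fix u
  have "2 * x * G (2 * x) \<le> 2 * u * G u" if "x < u" "u \<le> 2 * x"
   using that x nonneg mono by (intro mult_mono) auto
  then show "(2 * x * G (2 * x)) * indicator {x<..2 * x} u \<le> indicator {x<..2 * x} u * (2 * u * G u)"
   by (auto simp: indicator_def)
 qed
 also have "\<dots> = tmoment G (2 * x) - tmoment G x" by (rule moment_diff(2)[symmetric]) (use x in auto)
 finally show ?thesis using x by (simp add: power2_eq_square algebra_simps)
qed

lemma moment_scale:
 assumes b: "0 < b"
 shows "(LBINT u. indicator {0<..r} u * (2 * u * G (b * u))) = tmoment G (b * r) / b\<^sup>2"
proof -
 have "tmoment G (b * r) = b * (LBINT u. indicator {0<..b * r} (0 + b * u) * (2 * (0 + b * u) * G (0 + b * u)))"
  unfolding tmoment_def using lborel_integral_real_affine[of b "\<lambda>u. indicator {0<..b * r} u * (2 * u * G u)" 0] b by simp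
 also have "\<dots> = (LBINT u. b\<^sup>2 * (indicator {0<..r} u * (2 * u * G (b * u))))"
  unfolding integral_mult_right_zero[symmetric]
  by (rule int_cong[OF refl]) (use b in \<open>auto simp: indicator_def power2_eq_square zero_less_mult_iff\<close>)
 finally show ?thesis using b by simp
qed

text \<open>The integrands \<open>2 u G(u)\<close> and \<open>2 l(u) / u\<close> are asymptotically
  equal, and so are their divergent integrals. All comparisons go through increments of
  \<open>tmoment G\<close>, whose integrand is nonnegative.\<close>

lemma log_integral_asymp:
 assumes asy: "G \<sim>[at_top] (\<lambda>x. x powr (-2) * l x)" and si: "\<And>x. 1 \<le> x \<Longrightarrow> set_integrable lborel {1..x} (\<lambda>u. l u / u)"
  and unb: "\<not> bounded (log_integral l ` {1..})"
 shows "filterlim (tmoment G) at_top at_top" (is ?Q) "((\<lambda>x. log_integral l x / tmoment G x) \<longlongrightarrow> 1) at_top" (is ?P)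
proof -
 have i1: "integrable lborel (\<lambda>u. indicator {1..x} u * (2 * (l u / u)))" if "1 \<le> x" for x
  using integrable_mult_right[OF si[OF that, unfolded set_integrable_def], of 2] by (simp only: real_scaleR_def mult.left_commute[of 2])
 have LI: "log_integral l x = (LBINT u. indicator {1..x} u * (2 * (l u / u)))" for x
  unfolding log_integral_def set_lebesgue_integral_def integral_mult_right_zero[symmetric] by (simp only: real_scaleR_def mult.left_commute[of 2])
 have close: "\<exists>X\<ge>1. \<forall>x\<ge>X. \<bar>(log_integral l x - log_integral l X) - (tmoment G x - tmoment G X)\<bar> \<le> \<epsilon> * (tmoment G x - tmoment G X)"
  if e: "0 < \<epsilon>" for \<epsilon>
 proof -
  have "(\<lambda>x. x powr (-2) * l x) \<sim>[at_top] G" using asy by (simp add: asymp_equiv_sym)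
  then have "(\<lambda>x. x powr (-2) * l x - G x) \<in> o[at_top](G)" by (simp add: asymp_equiv_altdef)
  from landau_o.smallD[OF this e] obtain X0 where X0: "\<And>x. X0 \<le> x \<Longrightarrow> norm (x powr (-2) * l x - G x) \<le> \<epsilon> * norm (G x)"
   by (auto simp: eventually_at_top_linorder)
  define X where "X = max X0 1"
  have X: "1 \<le> X" "X0 \<le> X" by (auto simp: X_def)
  show ?thesis
  proof (intro exI[of _ X] conjI X(1) allI impI)
   fix x assume x: "X \<le> x"
   have eqi: "indicator {1..x} u * (2 * (l u / u)) - indicator {1..X} u * (2 * (l u / u)) = indicator {X<..x} u * (2 * (l u / u))" for u
    using X x by (auto simp: indicator_def)
   have x1: "1 \<le> x" "0 \<le> X" using X x by auto
   have li: "integrable lborel (\<lambda>u. indicator {X<..x} u * (2 * (l u / u)))"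
    using int_diff[OF i1[OF x1(1)] i1[OF X(1)]] unfolding eqi .
   have ld: "log_integral l x - log_integral l X = (LBINT u. indicator {X<..x} u * (2 * (l u / u)))"
    unfolding LI lint_diff[OF i1[OF x1(1)] i1[OF X(1)], symmetric] eqi ..
   note gi = moment_diff(1)[OF x1(2) x] and gd = moment_diff(2)[OF x1(2) x]
   have "(log_integral l x - log_integral l X) - (tmoment G x - tmoment G X)
     = (LBINT u. indicator {X<..x} u * (2 * (l u / u)) - indicator {X<..x} u * (2 * u * G u))"
    unfolding ld gd by (rule lint_diff[OF li gi, symmetric])
   then have "norm ((log_integral l x - log_integral l X) - (tmoment G x - tmoment G X))
     \<le> (LBINT u. norm (indicator {X<..x} u * (2 * (l u / u)) - indicator {X<..x} u * (2 * u * G u)))"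
    using integral_norm_bound by (simp only:)
   also have "\<dots> \<le> (LBINT u. \<epsilon> * (indicator {X<..x} u * (2 * u * G u)))"
   proof (rule integral_mono)
    show "integrable lborel (\<lambda>u. norm (indicator {X<..x} u * (2 * (l u / u)) - indicator {X<..x} u * (2 * u * G u)))"
     by (intro integrable_norm int_diff li gi)
    show "integrable lborel (\<lambda>u. \<epsilon> * (indicator {X<..x} u * (2 * u * G u)))" using gi by simp
    fix u
    show "norm (indicator {X<..x} u * (2 * (l u / u)) - indicator {X<..x} u * (2 * u * G u)) \<le> \<epsilon> * (indicator {X<..x} u * (2 * u * G u))"
    proof (cases "u \<in> {X<..x}")
     case True
     then have u: "0 < u" "X0 \<le> u" using X by auto
     have "2 * (l u / u) - 2 * u * G u = (2 * u) * (u powr (-2) * l u - G u)"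
     proof -
      have "u powr (-2) * l u = l u / u / u" using u by (simp add: powr_minus power2_eq_square divide_inverse)
      then show ?thesis using u by (simp add: right_diff_distrib)
     qed
     then have "\<bar>2 * (l u / u) - 2 * u * G u\<bar> = (2 * u) * \<bar>u powr (-2) * l u - G u\<bar>" using u by (simp add: abs_mult)
     also have "\<dots> \<le> (2 * u) * (\<epsilon> * G u)" using X0[OF u(2)] nonneg[of u] u by (intro mult_left_mono) auto
     finally show ?thesis using True by (simp add: ac_simps)
    qed simp
   qed
   also have "\<dots> = \<epsilon> * (tmoment G x - tmoment G X)" unfolding gd by simp
   finally show "\<bar>(log_integral l x - log_integral l X) - (tmoment G x - tmoment G X)\<bar> \<le> \<epsilon> * (tmoment G x - tmoment G X)" by simp
  qed
 qed
 \<comment> \<open>A bounded \<open>tmoment G\<close> would bound \<open>log_integral l\<close>: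
   beyond \<open>X\<close> through \<open>close\<close> with constant 1, before \<open>X\<close>
   through the absolute integral \<open>K'\<close>.\<close>
 have big: "\<exists>x\<ge>0. K < tmoment G x" for K
 proof (rule ccontr)
  assume "\<not> ?thesis"
  then have K: "tmoment G x \<le> K" if "0 \<le> x" for x using that not_less by blast
  obtain X where X: "1 \<le> X" "\<And>x. X \<le> x \<Longrightarrow> \<bar>(log_integral l x - log_integral l X) - (tmoment G x - tmoment G X)\<bar> \<le> 1 * (tmoment G x - tmoment G X)"
   using close[OF zero_less_one] by auto
  define K' where "K' = (LBINT u. norm (indicator {1..X} u * (2 * (l u / u))))"
  have "\<bar>log_integral l x\<bar> \<le> K' + \<bar>log_integral l X\<bar> + 2 * \<bar>K\<bar>" if x: "1 \<le> x" for x
  proof (cases "x \<le> X")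
   case True
   have "norm (log_integral l x) \<le> (LBINT u. norm (indicator {1..x} u * (2 * (l u / u))))"
    unfolding LI by (rule integral_norm_bound)
   also have "\<dots> \<le> K'" unfolding K'_def
    by (rule integral_mono[OF integrable_norm[OF i1[OF x]] integrable_norm[OF i1[OF X(1)]]]) (use True in \<open>auto simp: indicator_def\<close>)
   finally show ?thesis by simp
  next
   case False
   then have Xx: "X \<le> x" and x0: "0 \<le> x" using X by auto
   have "0 \<le> K'" by (simp add: K'_def)
   moreover have "\<bar>log_integral l x - log_integral l X\<bar> \<le> 2 * K"
    using X(2)[OF Xx] K[OF x0] moment_nonneg[of X] by (simp add: abs_le_iff)
   moreover have "K \<le> \<bar>K\<bar>" by simp
   ultimately show ?thesis by linarith
  qed
  then have "bounded (log_integral l ` {1..})" unfolding bounded_iff by (intro exI[of _ "K' + \<bar>log_integral l X\<bar> + 2 * \<bar>K\<bar>"]) auto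
  with unb show False by simp
 qed
 show inf: ?Q unfolding filterlim_at_top
 proof
  fix K
  obtain x where x: "0 \<le> x" "K < tmoment G x" using big by blast
  show "\<forall>\<^sub>F y in at_top. K \<le> tmoment G y"
   using eventually_ge_at_top[of x] by eventually_elim (use x moment_mono[of x] in force)
 qed
 show ?P
 proof (rule tendstoI)
  fix \<epsilon> :: real assume e: "0 < \<epsilon>"
  obtain X where X: "1 \<le> X" "\<And>x. X \<le> x \<Longrightarrow> \<bar>(log_integral l x - log_integral l X) - (tmoment G x - tmoment G X)\<bar> \<le> \<epsilon> / 2 * (tmoment G x - tmoment G X)"
   using close[of "\<epsilon> / 2"] e by auto
  define D where "D = \<bar>log_integral l X\<bar> + tmoment G X + 1"
  have D: "0 < D" using moment_nonneg[of X] by (simp add: D_def)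
  have "\<forall>\<^sub>F x in at_top. 2 * D / \<epsilon> + 1 \<le> tmoment G x" using inf unfolding filterlim_at_top by blast
  with eventually_ge_at_top[of X] show "\<forall>\<^sub>F x in at_top. dist (log_integral l x / tmoment G x) 1 < \<epsilon>"
  proof eventually_elim
   case (elim x)
   let ?V = "tmoment G x"
   have V: "2 * D / \<epsilon> < ?V" using elim(2) by linarith
   then have V0: "0 < ?V" using D e by (intro less_trans[OF _ V]) simp
   have "D < \<epsilon> / 2 * ?V" using V e by (simp add: pos_divide_less_eq mult.commute)
   moreover have "\<epsilon> / 2 * (?V - tmoment G X) \<le> \<epsilon> / 2 * ?V" using e moment_nonneg[of X] by (intro mult_left_mono) auto
   ultimately have "\<bar>log_integral l x - ?V\<bar> < \<epsilon> * ?V" using X(2)[OF elim(1)] moment_nonneg[of X] unfolding D_def by linarith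
   moreover have "log_integral l x / ?V - 1 = (log_integral l x - ?V) / ?V" using V0 by (simp add: diff_divide_distrib)
   ultimately show ?case using V0 by (simp add: dist_real_def pos_divide_less_eq)
  qed
 qed
qed

end

text \<open>
 The measures \<open>u a\<^sub>n(u) du\<close> concentrate at \<open>0\<close> with mass \<open>1 / 2\<close>, so only the slope of \<open>h\<close> at \<open>0\<close> survives.
\<close>
lemma kernel_concentration:
 fixes a :: "nat \<Rightarrow> real \<Rightarrow> real"
 assumes m: "\<And>n. a n \<in> borel_measurable borel" and nn: "\<And>n u. 0 \<le> a n u"
  and i0: "\<And>n r. integrable lborel (\<lambda>u. indicator {0<..r} u * (2 * u * a n u))"
  and l0: "\<And>r. 0 < r \<Longrightarrow> (\<lambda>n. LBINT u. indicator {0<..r} u * (2 * u * a n u)) \<longlonglongrightarrow> 1"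
  and i1: "EV n. integrable lborel (\<lambda>u. indicator {1<..} u * a n u)"
  and l1: "(\<lambda>n. LBINT u. indicator {1<..} u * a n u) \<longlonglongrightarrow> 0"
  and k: "kernel c H h"
 shows "EV n. integrable lborel (\<lambda>u. step u * (h u * a n u))" (is ?Q)
  "(\<lambda>n. LBINT u. step u * (h u * a n u)) \<longlonglongrightarrow> deriv h 0 / 2" (is ?P)
proof -
 note [measurable] = m
 have hc: "\<And>u. isCont h u" and hb: "\<And>u. 0 < u \<Longrightarrow> \<bar>h u\<bar> \<le> c * min 1 u" and h0: "h 0 = 0" and hd: "h field_differentiable (at 0)"
  using k by (auto simp: kernel_def)
 have hm[measurable]: "h \<in> borel_measurable borel"
  using hc by (intro borel_measurable_continuous_onI) (simp add: continuous_on_eq_continuous_at)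
 define \<delta> where "\<delta> = deriv h 0"
 have c: "0 \<le> c" using hb[of 1] by simp
 have dlim: "((\<lambda>u. h u / u) \<longlongrightarrow> \<delta>) (at 0)"
  using DERIV_deriv_iff_field_differentiable[THEN iffD2, OF hd] by (simp add: has_field_derivative_iff \<delta>_def h0)
 \<comment> \<open>The linear part of \<open>h\<close> carries the limit. The remainder
   \<open>r\<close> is \<open>o(u)\<close> at 0, and \<open>u * a n u\<close> loses its mass on
   every interval from a positive \<open>q\<close> to 1.\<close>
 define r where "r u = h u - \<delta> * u" for u
 have rm[measurable]: "r \<in> borel_measurable borel" unfolding r_def[abs_def] by measurable
 let ?B = "c + \<bar>\<delta>\<bar>"
 have rb: "\<bar>r u\<bar> \<le> ?B * u" if "0 < u" "u \<le> 1" for u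
 proof -
  have "\<bar>r u\<bar> \<le> \<bar>h u\<bar> + \<bar>\<delta>\<bar> * u" using that abs_triangle_ineq4[of "h u" "\<delta> * u"] by (simp add: r_def abs_mult)
  also have "\<dots> \<le> ?B * u" using hb[OF that(1)] that by (simp add: distrib_right)
  finally show ?thesis .
 qed
 let ?A = "\<lambda>n s. (LBINT u. indicator {0<..s} u * (2 * u * a n u))"
 let ?T = "\<lambda>n. (LBINT u. indicator {1<..} u * a n u)"
 let ?C = "\<lambda>u n. indicator {0<..1} u * (2 * u * a n u)"
 have ri: "integrable lborel (\<lambda>u. indicator {0<..1} u * (r u * a n u))" for n
 proof (rule int_dom)
  show "integrable lborel (\<lambda>u. ?B * (?C u n))" using i0[of 1 n] by simp
  show "AE u in lborel. norm (indicator {0<..1} u * (r u * a n u)) \<le> norm (?B * (?C u n))"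
  proof (rule AE_I2)
   fix u :: real
   show "norm (indicator {0<..1} u * (r u * a n u)) \<le> norm (?B * (?C u n))"
   proof (cases "0 < u \<and> u \<le> 1")
    case True
    have "\<bar>r u\<bar> * a n u \<le> ?B * u * a n u" using rb True nn by (intro mult_right_mono) auto
    moreover have "0 \<le> ?B * u * a n u" using c True nn by simp
    moreover have "?B * (2 * u * a n u) = 2 * (?B * u * a n u)" by (simp only: ac_simps)
    ultimately have "\<bar>r u\<bar> * a n u \<le> \<bar>?B * (2 * u * a n u)\<bar>" by linarith
    then show ?thesis using True nn[of n u] by (simp only: real_norm_def abs_mult) simp
   qed auto
  qed
 qed measurable
 have ti: "integrable lborel (\<lambda>u. indicator {1<..} u * (h u * a n u))" and tb: "\<bar>LBINT u. indicator {1<..} u * (h u * a n u)\<bar> \<le> c * ?T n"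
  if i: "integrable lborel (\<lambda>u. indicator {1<..} u * a n u)" for n
 proof -
  have bd: "norm (indicator {1<..} u * (h u * a n u)) \<le> c * (indicator {1<..} u * a n u)" for u
   using mult_right_mono[OF hb[of u] nn[of n u]] nn[of n u] by (auto simp: indicator_def abs_mult)
  show "integrable lborel (\<lambda>u. indicator {1<..} u * (h u * a n u))"
  proof (rule int_dom)
   show "integrable lborel (\<lambda>u. c * (indicator {1<..} u * a n u))" using i by simp
   show "AE u in lborel. norm (indicator {1<..} u * (h u * a n u)) \<le> norm (c * (indicator {1<..} u * a n u))"
    using bd abs_ge_self unfolding real_norm_def by (intro AE_I2) (rule order_trans)
  qed measurable
  have "norm (LBINT u. indicator {1<..} u * (h u * a n u)) \<le> (LBINT u. c * (indicator {1<..} u * a n u))"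
   by (rule Bochner_Integration.integral_norm_bound_integral) (use i bd \<open>integrable lborel (\<lambda>u. indicator {1<..} u * (h u * a n u))\<close> in auto)
  then show "\<bar>LBINT u. indicator {1<..} u * (h u * a n u)\<bar> \<le> c * ?T n" by simp
 qed
 have split: "step u * (h u * a n u) = \<delta> / 2 * (?C u n) + indicator {0<..1} u * (r u * a n u) + indicator {1<..} u * (h u * a n u)" for n u
  by (auto simp: indicator_def r_def algebra_simps)
 have hi: "integrable lborel (\<lambda>u. step u * (h u * a n u))" and
  hs: "(LBINT u. step u * (h u * a n u)) = \<delta> / 2 * ?A n 1 + (LBINT u. indicator {0<..1} u * (r u * a n u)) + (LBINT u. indicator {1<..} u * (h u * a n u))"
  if i: "integrable lborel (\<lambda>u. indicator {1<..} u * a n u)" for n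
 proof -
  note j = integrable_mult_right[OF i0[of 1 n], of "\<delta> / 2"]
  note j2 = int_add[OF j ri]
  show "integrable lborel (\<lambda>u. step u * (h u * a n u))"
   unfolding split by (rule int_add[OF j2 ti[OF i]])
  show "(LBINT u. step u * (h u * a n u)) = \<delta> / 2 * ?A n 1 + (LBINT u. indicator {0<..1} u * (r u * a n u)) + (LBINT u. indicator {1<..} u * (h u * a n u))"
   unfolding split lint_add[OF j2 ti[OF i]] lint_add[OF j ri] by (simp only: integral_mult_right_zero)
 qed
 show ?Q
  using i1 by eventually_elim (rule hi)
 have R: "(\<lambda>n. LBINT u. indicator {0<..1} u * (r u * a n u)) \<longlonglongrightarrow> 0"
 proof (rule tendstoI)
  fix \<epsilon> :: real assume e: "0 < \<epsilon>"
  have "\<forall>\<^sub>F u in at 0. dist (h u / u) \<delta> < \<epsilon>" using dlim e by (rule tendstoD)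
  then obtain s where s: "0 < s" "\<And>u. u \<noteq> 0 \<Longrightarrow> \<bar>u\<bar> < s \<Longrightarrow> \<bar>h u / u - \<delta>\<bar> < \<epsilon>"
   by (auto simp: eventually_at dist_real_def)
  define q where "q = min (s / 2) 1"
  have q: "0 < q" "q < s" "q \<le> 1" using s by (auto simp: q_def min_def)
  have small: "\<bar>r u\<bar> \<le> \<epsilon> * u" if "0 < u" "u \<le> q" for u
  proof -
   have "\<bar>h u / u - \<delta>\<bar> \<le> \<epsilon>" using s(2)[of u] that q by auto
   then have "\<bar>h u / u - \<delta>\<bar> * u \<le> \<epsilon> * u" using that by (intro mult_right_mono) auto
   moreover have "r u = (h u / u - \<delta>) * u" using that by (simp add: r_def left_diff_distrib)
   ultimately show ?thesis using that by (simp add: abs_mult)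
  qed
  define C where "C = c + \<bar>\<delta>\<bar>"
  have bd: "norm (indicator {0<..1} u * (r u * a n u)) \<le> (\<epsilon> / 2) * (?C u n) + (C / 2) * (indicator {0<..1} u * (2 * u * a n u) - indicator {0<..q} u * (2 * u * a n u))" for n u
  proof (cases "0 < u \<and> u \<le> 1")
   case True
   show ?thesis
   proof (cases "u \<le> q")
    case True
    have "\<bar>r u\<bar> * a n u \<le> \<epsilon> * u * a n u" if "0 < u" using small[OF that True] nn by (intro mult_right_mono)
    then show ?thesis using True q \<open>0 < u \<and> u \<le> 1\<close> nn[of n u] by (simp add: abs_mult)
   next
    case False
    have "\<bar>r u\<bar> * a n u \<le> C * u * a n u" using rb[of u] True nn unfolding C_def by (intro mult_right_mono) auto
    moreover have "0 \<le> \<epsilon> * (u * a n u)" using e True nn by simp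
    ultimately show ?thesis using False True nn[of n u] by (simp add: abs_mult mult.assoc)
   qed
  qed (use q in \<open>auto simp: indicator_def\<close>)
  have "norm (LBINT u. indicator {0<..1} u * (r u * a n u)) \<le> (\<epsilon> / 2) * ?A n 1 + (C / 2) * (?A n 1 - ?A n q)" for n
  proof -
   have "norm (LBINT u. indicator {0<..1} u * (r u * a n u)) \<le> (LBINT u. (\<epsilon> / 2) * (?C u n) + (C / 2) * (indicator {0<..1} u * (2 * u * a n u) - indicator {0<..q} u * (2 * u * a n u)))"
    by (rule Bochner_Integration.integral_norm_bound_integral[OF ri _ bd]) (intro int_add int_diff integrable_mult_right i0)
   also have "\<dots> = (\<epsilon> / 2) * ?A n 1 + (C / 2) * (?A n 1 - ?A n q)"
   proof -
    note d = int_diff[OF i0[of 1 n] i0[of q n]]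
    show ?thesis
     unfolding lint_add[OF integrable_mult_right[OF i0[of 1 n], of "\<epsilon> / 2"] integrable_mult_right[OF d, of "C / 2"]]
      integral_mult_right_zero lint_diff[OF i0[of 1 n] i0[of q n]] ..
   qed
   finally show ?thesis .
  qed
  moreover have "EV n. (\<epsilon> / 2) * ?A n 1 + (C / 2) * (?A n 1 - ?A n q) < \<epsilon>"
  proof (rule order_tendstoD(2))
   show "(\<lambda>n. (\<epsilon> / 2) * ?A n 1 + (C / 2) * (?A n 1 - ?A n q)) \<longlonglongrightarrow> (\<epsilon> / 2) * 1 + (C / 2) * (1 - 1)"
    by (intro tendsto_intros l0 q) simp_all
  qed (use e in simp)
  ultimately show "EV n. dist (LBINT u. indicator {0<..1} u * (r u * a n u)) 0 < \<epsilon>"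
   by (auto elim!: eventually_mono intro: le_less_trans simp: dist_real_def)
 qed
 have Tl: "(\<lambda>n. LBINT u. indicator {1<..} u * (h u * a n u)) \<longlonglongrightarrow> 0"
 proof (rule Lim_null_comparison)
  show "EV n. norm (LBINT u. indicator {1<..} u * (h u * a n u)) \<le> c * ?T n"
   using i1 by eventually_elim (use tb in simp)
  show "(\<lambda>n. c * ?T n) \<longlonglongrightarrow> 0" using tendsto_mult[OF tendsto_const l1, of c] by simp
 qed
 have "(\<lambda>n. \<delta> / 2 * ?A n 1 + (LBINT u. indicator {0<..1} u * (r u * a n u)) + (LBINT u. indicator {1<..} u * (h u * a n u))) \<longlonglongrightarrow> \<delta> / 2 * 1 + 0 + 0"
  by (intro tendsto_add tendsto_mult tendsto_const l0 R Tl) simp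
 then have "(\<lambda>n. LBINT u. step u * (h u * a n u)) \<longlonglongrightarrow> \<delta> / 2 * 1 + 0 + 0"
  by (rule Lim_transform_eventually) (use i1 hs in \<open>auto elim!: eventually_mono\<close>)
 then show ?P by (simp add: \<delta>_def)
qed

text \<open>Write \<open>V\<close> for \<open>tmoment G\<close>. By \<open>moment_double\<close> and
  the slow variation of \<open>V\<close>, \<open>y\<^sup>2 G(y)\<close> is at most
  \<open>\<eta> / 2 * V(y)\<close>. A doubling multiplies \<open>V\<close> by at most
  \<open>1 + \<delta> \<le> sqrt 2\<close>, so \<open>V(z u)\<close> is at most
  \<open>2 * u powr (1 / 2) * V(z)\<close>; division by \<open>u\<^sup>2\<close> leaves the
  integrable power \<open>- 3 / 2\<close>.\<close>

lemma (in tail) tail_bound: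
 assumes inf: "filterlim (tmoment G) at_top at_top"
  and ratio: "((\<lambda>x. tmoment G (2 * x) / tmoment G x) \<longlongrightarrow> 1) at_top" and \<eta>: "0 < \<eta>"
 shows "\<exists>Y>0. \<forall>z\<ge>Y. \<forall>u\<ge>1. G (z * u) \<le> \<eta> * (tmoment G z / z\<^sup>2) * u powr (- 3 / 2)"
proof -
 let ?V = "tmoment G"
 define \<delta> where "\<delta> = min (1 / 4) (\<eta> / 4)"
 have \<delta>: "0 < \<delta>" "\<delta> \<le> 1 / 4" "\<delta> \<le> \<eta> / 4" using \<eta> by (auto simp: \<delta>_def)
 have "\<forall>\<^sub>F x in at_top. ?V (2 * x) / ?V x < 1 + \<delta>" by (rule order_tendstoD(2)[OF ratio]) (use \<delta> in simp)
 moreover have "\<forall>\<^sub>F x in at_top. 1 \<le> ?V x" using inf unfolding filterlim_at_top by blast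
 ultimately have "\<forall>\<^sub>F x in at_top. ?V (2 * x) \<le> (1 + \<delta>) * ?V x \<and> 0 < ?V x"
  by eventually_elim (simp add: pos_divide_less_eq less_imp_le)
 then obtain Y0 where Y0: "\<And>x. Y0 \<le> x \<Longrightarrow> ?V (2 * x) \<le> (1 + \<delta>) * ?V x \<and> 0 < ?V x"
  by (auto simp: eventually_at_top_linorder)
 define Y where "Y = max 1 (2 * \<bar>Y0\<bar>)"
 have Y: "0 < Y" by (simp add: Y_def)
 have g: "y\<^sup>2 * G y \<le> \<eta> / 2 * ?V y" if y: "Y \<le> y" for y
 proof -
  have y2: "0 < y / 2" "Y0 \<le> y / 2" using y by (auto simp: Y_def)
  have "y\<^sup>2 * G y \<le> 2 * (?V y - ?V (y / 2))" using moment_double[OF y2(1)] by simp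
  also have "\<dots> \<le> 2 * (\<delta> * ?V (y / 2))" using Y0[OF y2(2)] by (simp add: distrib_right)
  also have "\<dots> \<le> 2 * (\<eta> / 4 * ?V y)"
   using moment_mono[of "y / 2" y] moment_nonneg \<delta> y2 by (intro mult_left_mono mult_mono) auto
  finally show ?thesis by simp
 qed
 have dy: "?V (2 ^ k * z) \<le> (sqrt 2) ^ k * ?V z" if z: "Y \<le> z" for k z
 proof (induction k)
  case (Suc k)
  have "1 * z \<le> 2 ^ k * z" using z Y by (intro mult_right_mono) auto
  moreover have "Y0 \<le> z" using z unfolding Y_def by linarith
  ultimately have k: "Y0 \<le> 2 ^ k * z" by linarith
  have s: "1 + \<delta> \<le> sqrt 2"
  proof -
   have "(1 + \<delta>)\<^sup>2 \<le> (5 / 4)\<^sup>2" using \<delta> by (intro power_mono) auto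
   also have "\<dots> \<le> (2::real)" by (simp add: power2_eq_square)
   finally show ?thesis by (rule real_le_rsqrt)
  qed
  have "?V (2 ^ Suc k * z) \<le> (1 + \<delta>) * ?V (2 ^ k * z)" using Y0[OF k] by (simp add: mult.assoc)
  also have "\<dots> \<le> sqrt 2 * ((sqrt 2) ^ k * ?V z)" using s Suc \<delta> moment_nonneg by (intro mult_mono) auto
  finally show ?case by (simp add: mult.assoc)
 qed simp
 have "G (z * u) \<le> \<eta> * (?V z / z\<^sup>2) * u powr (- 3 / 2)" if z: "Y \<le> z" and u: "1 \<le> u" for z u
 proof -
  obtain k :: nat where k: "2 ^ k \<le> u" "u < 2 ^ Suc k" by (rule dyadic_bracket[OF u])
  have z0: "0 < z" using z Y by simp
  have zu: "z * 1 \<le> z * u" using u z0 by (intro mult_left_mono) auto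
  have "z * u \<le> 2 ^ Suc k * z" using mult_left_mono[of u "2 ^ Suc k" z] k z0 by (simp add: mult.commute)
  then have "?V (z * u) \<le> ?V (2 ^ Suc k * z)" using z0 u by (intro moment_mono) auto
  also have "\<dots> \<le> (sqrt 2) ^ Suc k * ?V z" by (rule dy[OF z])
  also have "\<dots> \<le> (2 * u powr (1 / 2)) * ?V z"
  proof (intro mult_right_mono moment_nonneg)
   have "(2 ^ k) powr (1 / 2) \<le> u powr (1 / 2)" by (rule powr_mono2) (use k in auto)
   then have "(sqrt 2) ^ k \<le> u powr (1 / 2)" unfolding powr_two_power by (simp add: powr_half_sqrt)
   moreover have "sqrt 2 \<le> 2" by (rule real_le_lsqrt) auto
   ultimately show "(sqrt 2) ^ Suc k \<le> 2 * u powr (1 / 2)" unfolding power_Suc by (intro mult_mono) auto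
  qed
  finally have v: "?V (z * u) \<le> 2 * u powr (1 / 2) * ?V z" .
  have "(z * u)\<^sup>2 * G (z * u) \<le> \<eta> / 2 * ?V (z * u)" by (rule g) (use z zu in simp)
  also have "\<dots> \<le> \<eta> / 2 * (2 * u powr (1 / 2) * ?V z)" using v \<eta> by (intro mult_left_mono) auto
  finally have "G (z * u) \<le> \<eta> * u powr (1 / 2) * ?V z / (z * u)\<^sup>2"
   using z0 u by (simp add: pos_le_divide_eq ac_simps)
  also have "\<dots> = \<eta> * (?V z / z\<^sup>2) * (u powr (1 / 2) / u\<^sup>2)" by (simp add: power_mult_distrib)
  also have "u powr (1 / 2) / u\<^sup>2 = u powr (- 3 / 2)"
   using u powr_diff[of u "1 / 2" 2] by simp
  finally show ?thesis .
 qed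
 with Y show ?thesis by blast
qed

section \<open>Condition II: the normal law with non-standard normalization\<close>

context gm_obs begin

lemma case_II:
 assumes att: "attraction_II M f l" and R: "renormalizing_sequence B"
  and asy: "(\<lambda>n. real n * log_integral l (B n)) \<sim>[sequentially] (\<lambda>n. (B n)\<^sup>2)"
 shows "limits_to B (centered_normal 1)"
proof -
 have fm[measurable]: "rv f" by (rule f_meas)
 note Bpos = renormalizing_growth(1)[OF R] and Binf = renormalizing_growth(2)[OF R]
 define G where "G x = prob {y\<in>space M. x < \<bar>f y\<bar>}" for x
 have Gasy: "G \<sim>[at_top] (\<lambda>x. x powr (-2) * l x)" and si: "\<And>x. 1 \<le> x \<Longrightarrow> set_integrable lborel {1..x} (\<lambda>u. l u / u)"
  and svx: "\<exists>L. slowly_varying L \<and> (\<forall>\<^sub>F x in at_top. log_integral l x = L x)"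
  and unb: "\<not> bounded (log_integral l ` {1..})"
  using att unfolding attraction_II_def G_def[abs_def] by auto
 obtain L where L: "slowly_varying L" "\<forall>\<^sub>F x in at_top. log_integral l x = L x" using svx by blast
 have Lpos: "0 < L x" if "0 < x" for x using L that by (simp add: slowly_varying_def)
 interpret tail G
 proof
  show "G y \<le> G x" if "x \<le> y" for x y
   unfolding G_def using that by (intro finite_measure_mono) auto
 qed (auto simp: G_def)
 let ?V = "tmoment G" and ?LI = "log_integral l"
 note inf = log_integral_asymp(1)[OF Gasy si unb] and lv = log_integral_asymp(2)[OF Gasy si unb]
 have scale: "filterlim (\<lambda>x. r * x :: real) at_top at_top" if "0 < r" for r
  by (rule filterlim_tendsto_pos_mult_at_top[OF tendsto_const that filterlim_ident])
 have Vpos: "\<forall>\<^sub>F x in at_top. 0 < ?V x \<and> 0 < ?LI x"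
 proof -
  have "\<forall>\<^sub>F x in at_top. 1 \<le> ?V x" using inf unfolding filterlim_at_top by blast
  with L(2) eventually_gt_at_top[of 0] show ?thesis by eventually_elim (use Lpos in auto)
 qed
 have ratio: "((\<lambda>x. ?V (r * x) / ?V x) \<longlongrightarrow> 1) at_top" if r: "0 < r" for r
 proof -
  have l: "((\<lambda>x. L (r * x) / L x) \<longlongrightarrow> 1) at_top" using L r by (simp add: slowly_varying_def)
  have "((\<lambda>x. (L (r * x) / L x) * (?LI x / ?V x) / (?LI (r * x) / ?V (r * x))) \<longlongrightarrow> 1 * 1 / 1) at_top"
   by (intro tendsto_intros l lv filterlim_compose[OF lv scale[OF r]]) simp_all
  moreover have "\<forall>\<^sub>F x in at_top. (L (r * x) / L x) * (?LI x / ?V x) / (?LI (r * x) / ?V (r * x)) = ?V (r * x) / ?V x"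
   using L(2) Vpos eventually_compose_filterlim[OF L(2) scale[OF r]] eventually_compose_filterlim[OF Vpos scale[OF r]]
   by eventually_elim simp
  ultimately have "((\<lambda>x. ?V (r * x) / ?V x) \<longlongrightarrow> 1 * 1 / 1) at_top" by (rule Lim_transform_eventually)
  then show ?thesis by simp
 qed
 have nV: "(\<lambda>n. real n * ?V (B n) / (B n)\<^sup>2) \<longlonglongrightarrow> 1"
 proof -
  have "(\<lambda>n. if real n * ?LI (B n) = 0 \<and> (B n)\<^sup>2 = 0 then 1 else real n * ?LI (B n) / (B n)\<^sup>2) \<longlonglongrightarrow> 1"
   by (rule asymp_equivD[OF asy])
  then have "(\<lambda>n. (if real n * ?LI (B n) = 0 \<and> (B n)\<^sup>2 = 0 then 1 else real n * ?LI (B n) / (B n)\<^sup>2) / (?LI (B n) / ?V (B n))) \<longlonglongrightarrow> 1 / 1"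
   by (intro tendsto_divide filterlim_compose[OF lv Binf]) auto
  then have "(\<lambda>n. real n * ?V (B n) / (B n)\<^sup>2) \<longlonglongrightarrow> 1 / 1"
  proof (rule Lim_transform_eventually)
   show "EV n. (if real n * ?LI (B n) = 0 \<and> (B n)\<^sup>2 = 0 then 1 else real n * ?LI (B n) / (B n)\<^sup>2) / (?LI (B n) / ?V (B n)) = real n * ?V (B n) / (B n)\<^sup>2"
    using eventually_ge_at_top[of 1] eventually_compose_filterlim[OF Vpos Binf]
    by eventually_elim (use Bpos in \<open>simp add: less_le\<close>)
  qed
  then show ?thesis by simp
 qed
 \<comment> \<open>The integral of \<open>2 u a\<^sub>n(u)\<close> up to \<open>r\<close> is
   \<open>n V(r B\<^sub>n) / B\<^sub>n\<^sup>2\<close>, where \<open>V\<close> is the truncated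
   moment; it tends to 1 for every \<open>r\<close>, by the choice of \<open>B\<close> and slow
   variation, which is the concentration at 0.\<close>
 define a where "a n u = real n * G (B n * u)" for n u
 have l0: "(\<lambda>n. LBINT u. indicator {0<..r} u * (2 * u * a n u)) \<longlonglongrightarrow> 1" if r: "0 < r" for r
 proof -
  have "(\<lambda>n. (real n * ?V (B n) / (B n)\<^sup>2) * (?V (r * B n) / ?V (B n))) \<longlonglongrightarrow> 1 * 1"
   by (intro tendsto_mult nV filterlim_compose[OF ratio[OF r] Binf])
  then have "(\<lambda>n. LBINT u. indicator {0<..r} u * (2 * u * a n u)) \<longlonglongrightarrow> 1 * 1"
  proof (rule Lim_transform_eventually)
   show "EV n. (real n * ?V (B n) / (B n)\<^sup>2) * (?V (r * B n) / ?V (B n)) = (LBINT u. indicator {0<..r} u * (2 * u * a n u))"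
    using eventually_ge_at_top[of 1] eventually_compose_filterlim[OF Vpos Binf]
   proof eventually_elim
    case (elim n)
    have "(LBINT u. indicator {0<..r} u * (2 * u * a n u)) = (LBINT u. real n * (indicator {0<..r} u * (2 * u * G (B n * u))))"
     by (simp add: a_def ac_simps)
    also have "\<dots> = real n * (?V (B n * r) / (B n)\<^sup>2)" using moment_scale[OF Bpos[OF elim(1)], of r] by simp
    finally show ?case using elim by (simp add: mult.commute)
   qed
  qed
  then show ?thesis by simp
 qed
 have am: "a n \<in> borel_measurable borel" for n unfolding a_def[abs_def] by measurable
 have an: "0 \<le> a n u" for n u using nonneg by (simp add: a_def)
 have i0: "integrable lborel (\<lambda>u. indicator {0<..r} u * (2 * u * a n u))" for n r
  using integrable_mult_right[OF moment_integrable_scaled[of r "B n"], of "real n"] by (simp add: a_def ac_simps)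
 define P where "P = (LBINT u. indicator {1..} u * u powr (- 3 / 2 :: real))"
 have Pi: "integrable lborel (\<lambda>u. indicator {1..} u * u powr (- 3 / 2 :: real))" by (rule powr_integrable_1_inf) simp
 have P0: "0 \<le> P" unfolding P_def by (intro int_nonneg) (auto simp: indicator_def)
 have tailb: "EV n. integrable lborel (\<lambda>u. indicator {1<..} u * a n u) \<and> (LBINT u. indicator {1<..} u * a n u) \<le> \<eta> * P"
  if \<eta>: "0 < \<eta>" for \<eta>
 proof -
  obtain Y where Y: "0 < Y" "\<And>z u. Y \<le> z \<Longrightarrow> 1 \<le> u \<Longrightarrow> G (z * u) \<le> (\<eta> / 2) * (?V z / z\<^sup>2) * u powr (- 3 / 2)"
   using tail_bound[OF inf ratio, of "\<eta> / 2"] \<eta> by auto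
  have "EV n. Y \<le> B n" using Binf by (simp add: filterlim_at_top)
  moreover have "EV n. real n * ?V (B n) / (B n)\<^sup>2 < 2" by (rule order_tendstoD(2)[OF nV]) simp
  ultimately show ?thesis
  proof eventually_elim
   case (elim n)
   have bd: "a n u \<le> \<eta> * u powr (- 3 / 2)" if u: "1 \<le> u" for u
   proof -
    have "a n u \<le> real n * ((\<eta> / 2) * (?V (B n) / (B n)\<^sup>2) * u powr (- 3 / 2))"
     unfolding a_def by (intro mult_left_mono Y elim u) simp
    also have "\<dots> = (real n * ?V (B n) / (B n)\<^sup>2) * (\<eta> / 2 * u powr (- 3 / 2))" by (simp add: ac_simps)
    also have "\<dots> \<le> 2 * (\<eta> / 2 * u powr (- 3 / 2))" using elim \<eta> by (intro mult_right_mono) auto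
    finally show ?thesis by simp
   qed
   let ?B = "\<lambda>u. indicator {1..} u * u powr (- 3 / 2)"
   have bi: "integrable lborel (\<lambda>u. \<eta> * (?B u))" using Pi by simp
   have b: "indicator {1<..} u * a n u \<le> \<eta> * (?B u)" for u
    using bd[of u] \<eta> by (auto simp: indicator_def)
   have i: "integrable lborel (\<lambda>u. indicator {1<..} u * a n u)"
   proof (rule int_dom[OF bi])
    show "(\<lambda>u. indicator {1<..} u * a n u) \<in> borel_measurable lborel" using am[of n] by measurable
    show "AE u in lborel. norm (indicator {1<..} u * a n u) \<le> norm (\<eta> * (?B u))"
    proof (rule AE_I2)
     fix u
     have "norm (indicator {1<..} u * a n u) = indicator {1<..} u * a n u" using an[of n u] by (simp add: abs_mult)
     then show "norm (indicator {1<..} u * a n u) \<le> norm (\<eta> * (?B u))"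
      using order_trans[OF b[of u] abs_ge_self] by simp
    qed
   qed
   have "(LBINT u. indicator {1<..} u * a n u) \<le> (LBINT u. \<eta> * (?B u))"
    by (rule integral_mono[OF i bi b])
   then show ?case using i by (simp add: P_def)
  qed
 qed
 have i1: "EV n. integrable lborel (\<lambda>u. indicator {1<..} u * a n u)"
  using tailb[of 1] by (auto elim!: eventually_mono)
 have l1: "(\<lambda>n. LBINT u. indicator {1<..} u * a n u) \<longlonglongrightarrow> 0"
 proof (rule tendstoI)
  fix \<epsilon> :: real assume e: "0 < \<epsilon>"
  have pos: "0 \<le> (LBINT u. indicator {1<..} u * a n u)" for n using an by (intro int_nonneg) auto
  have "\<epsilon> / (P + 1) * P < \<epsilon>" using e P0 by (simp add: field_simps)
  then show "EV n. dist (LBINT u. indicator {1<..} u * a n u) 0 < \<epsilon>"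
   using tailb[of "\<epsilon> / (P + 1)"] e P0 pos by (auto elim!: eventually_mono simp: dist_real_def)
 qed
 let ?A = "\<lambda>x n. max (\<bar>f x\<bar> / B n) 0"
 have lims: "(EV n. integrable M (\<lambda>x. H (max (\<bar>f x\<bar> / B n) 0))) \<and>
   (\<lambda>n. real n * (LINT x|M. H (max (\<bar>f x\<bar> / B n) 0))) \<longlonglongrightarrow> deriv h 0 / 2" if k: "kernel c H h" for c H h
 proof -
  have H: "\<And>u. (H has_real_derivative h u) (at u)" and h: "\<And>u. isCont h u" and H0: "H 0 = 0" using k by (auto simp: kernel_def)
  have kc: "EV n. integrable lborel (\<lambda>u. step u * (h u * a n u))"
   "(\<lambda>n. LBINT u. step u * (h u * a n u)) \<longlonglongrightarrow> deriv h 0 / 2"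
   using kernel_concentration[OF am an i0 _ i1 l1 k] l0 by auto
  have lc: "EV n. integrable M (\<lambda>x. H (max (\<bar>f x\<bar> / B n) 0)) \<and>
    (LBINT u. step u * (h u * a n u)) = real n * (LINT x|M. H (max (\<bar>f x\<bar> / B n) 0))"
   using eventually_ge_at_top[of 1] kc(1)
  proof eventually_elim
   case (elim n)
   have eq: "step u * (h u * a n u) = real n * (step u * (h u * prob {x\<in>space M. B n * u < \<bar>f x\<bar>}))" for u
    by (simp add: a_def G_def)
   have i: "integrable lborel (\<lambda>u. step u * (h u * prob {x\<in>space M. B n * u < \<bar>f x\<bar>}))"
    using elim unfolding eq by (subst (asm) integrable_mult_left_iff) auto
   have absm: "(\<lambda>x. \<bar>f x\<bar>) \<in> borel_measurable M" by measurable
   show ?case unfolding eq integral_mult_right_zero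
    using layer_cake[OF absm Bpos[OF elim(1)] H h H0 i] by simp
  qed
  then have "EV n. integrable M (\<lambda>x. H (?A x n))" by (auto elim!: eventually_mono)
  moreover have "(\<lambda>n. real n * (LINT x|M. H (?A x n))) \<longlonglongrightarrow> deriv h 0 / 2"
   by (rule Lim_transform_eventually[OF kc(2)]) (use lc in \<open>auto elim!: eventually_mono\<close>)
  ultimately show ?thesis by blast
 qed
 have n0: "(\<lambda>n. real n / (B n)\<^sup>2) \<longlonglongrightarrow> 0"
 proof -
  have "(\<lambda>n. inverse (?V (B n))) \<longlonglongrightarrow> 0"
   by (rule tendsto_inverse_0_at_top[OF filterlim_compose[OF inf Binf]])
  from tendsto_mult[OF nV this] have "(\<lambda>n. real n * ?V (B n) / (B n)\<^sup>2 * inverse (?V (B n))) \<longlonglongrightarrow> 0" by simp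
  then show ?thesis
  proof (rule Lim_transform_eventually)
   show "EV n. real n * ?V (B n) / (B n)\<^sup>2 * inverse (?V (B n)) = real n / (B n)\<^sup>2"
    using eventually_compose_filterlim[OF Vpos Binf] by eventually_elim (simp add: field_simps)
  qed
 qed
 \<comment> \<open>Nothing is known about the balance of the two tails, so absolute values are
   taken: \<open>|sin z - z|\<close> is even, hence given by the sine kernel at \<open>|f|\<close>,
   and the slope at 0 of that kernel's derivative is 0.\<close>
 have odd: "(\<lambda>n. real n * (LINT x|M. sin (t / B n * f x))) \<longlonglongrightarrow> 0" for t
 proof -
  let ?D = "\<lambda>u. sin (t * u) - t * u"
  have D0: "deriv (\<lambda>u. t * (cos (t * u) - 1)) 0 = 0" by (rule DERIV_imp_deriv) (auto intro!: derivative_eq_intros)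
  note K = lims[OF kernel_sin[of t], unfolded D0]
  show ?thesis
  proof (rule Lim_null_comparison)
   show "EV n. norm (real n * (LINT x|M. sin (t / B n * f x))) \<le> \<bar>real n * (LINT x|M. ?D (?A x n))\<bar>"
    using eventually_ge_at_top[of 1] conjunct1[OF K]
   proof eventually_elim
    case (elim n)
    have b: "0 < B n" by (rule Bpos[OF elim(1)])
    have si: "integrable M (\<lambda>x. sin (t / B n * f x))" by (rule integrable_const_bound[where B=1]) auto
    have "(LINT x|M. sin (t / B n * f x) - t / B n * f x) = (LINT x|M. sin (t / B n * f x))" using si f_int f_mean by simp
    then have "\<bar>LINT x|M. sin (t / B n * f x)\<bar> \<le> (LINT x|M. \<bar>sin (t / B n * f x) - t / B n * f x\<bar>)"
     using integral_norm_bound[of M "\<lambda>x. sin (t / B n * f x) - t / B n * f x"] by simp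
    also have "\<dots> = (LINT x|M. - sgn t * ?D (?A x n))"
    proof (rule int_cong[OF refl])
     fix x
     have odd: "\<bar>sin z - z\<bar> = \<bar>sin \<bar>z\<bar> - \<bar>z\<bar>\<bar>" for z :: real by (cases "0 \<le> z") (auto simp: abs_if)
     have le: "sin \<bar>z\<bar> - \<bar>z\<bar> \<le> 0" for z :: real using sin_x_le_x[of "\<bar>z\<bar>"] by simp
     let ?y = "\<bar>f x\<bar> / B n"
     have y: "max ?y 0 = ?y" using b by simp
     have "\<bar>sin (t / B n * f x) - t / B n * f x\<bar> = - (sin \<bar>t * ?y\<bar> - \<bar>t * ?y\<bar>)"
      using odd[of "t / B n * f x"] le[of "t * ?y"] b by (simp add: abs_mult)
     also have "\<dots> = - sgn t * ?D ?y"
     proof (cases "0 < t")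
      case True
      then show ?thesis using b by (simp add: abs_mult)
     next
      case False
      then show ?thesis using b by (cases "t = 0") (auto simp: abs_mult)
     qed
     finally show "\<bar>sin (t / B n * f x) - t / B n * f x\<bar> = - sgn t * ?D (max ?y 0)" unfolding y .
    qed
    also have "\<dots> = - sgn t * (LINT x|M. ?D (?A x n))" by (rule integral_mult_right_zero)
    also have "\<dots> \<le> \<bar>LINT x|M. ?D (?A x n)\<bar>"
     using abs_ge_self abs_ge_minus_self by (auto simp: sgn_if)
    finally have "real n * \<bar>LINT x|M. sin (t / B n * f x)\<bar> \<le> real n * \<bar>LINT x|M. ?D (?A x n)\<bar>"
     by (rule mult_left_mono) simp
    then show ?case by (simp add: abs_mult)
   qed
   show "(\<lambda>n. \<bar>real n * (LINT x|M. ?D (?A x n))\<bar>) \<longlonglongrightarrow> 0"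
    using tendsto_rabs[OF conjunct2[OF K]] by simp
  qed
 qed
 have "\<exists>W. real_distribution W \<and> (\<forall>t. char W t = exp (Complex (deriv (\<lambda>u. - (t * sin (t * u))) 0 / 2) 0)) \<and>
  limits_to B W"
  by (rule limit_law[OF R n0 conjunct1[OF lims] conjunct2[OF lims] odd])
 then obtain W where W: "real_distribution W" "\<And>t. char W t = exp (Complex (deriv (\<lambda>u. - (t * sin (t * u))) 0 / 2) 0)"
  "limits_to B W"
  by (elim exE conjE) blast
 have "char W = char (centered_normal 1)"
 proof
  fix t :: real
  \<comment> \<open>Half of this slope is the exponent \<open>- t\<^sup>2 / 2\<close> of the
    standard normal law.\<close>
  have "deriv (\<lambda>u. - (t * sin (t * u))) 0 = - t\<^sup>2"
   by (rule DERIV_imp_deriv) (auto intro!: derivative_eq_intros simp: power2_eq_square)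
  then show "char W t = char (centered_normal 1) t"
   unfolding W(2) by (subst char_centered_normal(2)) (auto simp: complex_of_real_def)
 qed
 then have "W = centered_normal 1" by (intro Levy_uniqueness W(1) char_centered_normal(1)) auto
 with W(3) show ?thesis by simp
qed

end

section \<open>From the Lipschitz hypothesis to the class \<open>reg\<close>\<close>

context gm_map begin

text \<open>A null element would have a null image, against the lower bound \<open>\<eta>\<close>.
  Averages over elements therefore make sense.\<close>

lemma prob_element_pos:
 assumes a: "a \<in> \<alpha>"
 shows "0 < prob a"
proof (rule ccontr)
 assume "\<not> 0 < prob a"
 then have "a \<in> null_sets M" using sets_\<alpha>[OF a] by (simp add: null_sets_def emeasure_eq_measure not_less measure_le_0_iff)
 then have "(\<integral>\<^sup>+x. ennreal (1 / J x) * indicator a x \<partial>M) = 0" by (rule nn_integral_null_set)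
 then have "emeasure M (T ` a) = 0" using emeasure_image[OF a sets_\<alpha>[OF a]] by simp
 then show False using big_image[OF a] \<eta>_pos by (simp add: measure_def)
qed

lemma integrable_restrictions:
 fixes f :: "'a \<Rightarrow> real"
 assumes [measurable]: "integrable M f"
 shows "integrable cs (\<lambda>a. LINT x|M. indicator a x * \<bar>f x\<bar>)"
proof (rule integrableI_nonneg)
 have i: "integrable M (\<lambda>x. indicator a x * \<bar>f x\<bar>)" if "a \<in> \<alpha>" for a
  using integrable_mult_indicator[OF sets_\<alpha>[OF that] integrable_abs[OF assms]] by simp
 have "(\<integral>\<^sup>+a. ennreal (LINT x|M. indicator a x * \<bar>f x\<bar>) \<partial>cs) = (\<integral>\<^sup>+a. (\<integral>\<^sup>+x\<in>a. ennreal \<bar>f x\<bar> \<partial>M) \<partial>cs)"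
 proof (rule nn_integral_cong)
  fix a assume "a \<in> space cs"
  then have a: "a \<in> \<alpha>" by simp
  have "ennreal (LINT x|M. indicator a x * \<bar>f x\<bar>) = (\<integral>\<^sup>+x. ennreal (indicator a x * \<bar>f x\<bar>) \<partial>M)"
   by (rule nn_integral_eq_integral[OF i[OF a], symmetric]) (simp add: AE_I2)
  also have "\<dots> = (\<integral>\<^sup>+x\<in>a. ennreal \<bar>f x\<bar> \<partial>M)" by (intro nn_integral_cong) (auto simp: indicator_def)
  finally show "ennreal (LINT x|M. indicator a x * \<bar>f x\<bar>) = (\<integral>\<^sup>+x\<in>a. ennreal \<bar>f x\<bar> \<partial>M)" .
 qed
 also have "\<dots> = (\<integral>\<^sup>+x. ennreal \<bar>f x\<bar> \<partial>M)" by (rule nn_integral_\<alpha>[symmetric]) measurable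
 also have "\<dots> < \<infinity>" using assms by (simp add: integrable_iff_bounded)
 finally show "(\<integral>\<^sup>+a. ennreal (LINT x|M. indicator a x * \<bar>f x\<bar>) \<partial>cs) < \<infinity>" .
qed (auto simp: AE_count_space)

text \<open>Averaging \<open>|f x| \<le> |f y| + D a * \<delta>\<close> over \<open>y\<close> in
  \<open>a\<close> bounds \<open>f\<close> on \<open>a\<close> by the mean of \<open>|f|\<close>
  plus the oscillation. The means \<open>I a / prob a\<close>, weighted by \<open>prob a\<close>,
  sum to the integral of \<open>|f|\<close>, so integrability of \<open>f\<close> makes
  \<open>e\<close> admissible.\<close>

lemma regular_of_Lipschitz:
 assumes f: "integrable M f" and D0: "\<And>a. a \<in> \<alpha> \<Longrightarrow> 0 \<le> D a" and Di: "integrable cs (\<lambda>a. prob a * D a)"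
  and lip: "\<And>a x y. \<lbrakk>a \<in> \<alpha>; x \<in> a; y \<in> a\<rbrakk> \<Longrightarrow> \<bar>f x - f y\<bar> \<le> D a * d x y"
 obtains e where "reg e f" "admissible e"
proof -
 have fm: "rv f" using f by simp
 define I where "I a = (LINT x|M. indicator a x * \<bar>f x\<bar>)" for a
 have I0: "0 \<le> I a" for a by (simp add: I_def)
 define e where "e a = D a * (1 + \<delta>) + I a / prob a" for a
 have De: "D a \<le> e a" "0 \<le> e a" if a: "a \<in> \<alpha>" for a
 proof -
  have "0 \<le> D a * \<delta>" using D0[OF a] \<delta>_pos by simp
  moreover have "0 \<le> I a / prob a" using I0 by simp
  ultimately show "D a \<le> e a" unfolding e_def by (simp add: distrib_left)
  with D0[OF a] show "0 \<le> e a" by linarith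
 qed
 have sup: "\<bar>f x\<bar> \<le> e a" if a: "a \<in> \<alpha>" and x: "x \<in> a" for a x
 proof -
  have aM: "a \<in> sets M" using sets_\<alpha>[OF a] .
  have i: "integrable M (\<lambda>y. indicator a y * \<bar>f y\<bar>)" using integrable_mult_indicator[OF aM integrable_abs[OF f]] by simp
  have j: "integrable M (\<lambda>y. c * indicator a y)" for c :: real
   using aM by (intro integrable_mult_right integrable_real_indicator) (auto simp: emeasure_eq_measure)
  have "(LINT y|M. \<bar>f x\<bar> * indicator a y) \<le> (LINT y|M. indicator a y * \<bar>f y\<bar> + D a * \<delta> * indicator a y)"
  proof (rule integral_mono[OF j int_add[OF i j]])
   fix y
   have "\<bar>f x\<bar> \<le> \<bar>f y\<bar> + D a * \<delta>" if y: "y \<in> a"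
   proof -
    have "\<bar>f x - f y\<bar> \<le> D a * d x y" by (rule lip[OF a x y])
    also have "\<dots> \<le> D a * \<delta>" using d_bound[OF in_space[OF a x] in_space[OF a y]] D0[OF a] by (rule mult_left_mono)
    finally show ?thesis by linarith
   qed
   then show "\<bar>f x\<bar> * indicator a y \<le> indicator a y * \<bar>f y\<bar> + D a * \<delta> * indicator a y" by (simp add: indicator_def)
  qed
  also have "\<dots> = I a + D a * \<delta> * prob a" unfolding lint_add[OF i j] I_def using aM by simp
  finally have "\<bar>f x\<bar> * prob a \<le> I a + D a * \<delta> * prob a" using aM by simp
  then have "\<bar>f x\<bar> \<le> I a / prob a + D a * \<delta>" using prob_element_pos[OF a] by (simp add: field_simps)
  then show ?thesis using D0[OF a] by (simp add: e_def distrib_left)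
 qed
 have "reg e f" unfolding reg_def
 proof (intro conjI ballI impI)
  show "\<bar>f x\<bar> \<le> e a" if "a \<in> \<alpha>" "x \<in> a \<inter> G" for a x using sup that by blast
  show "\<bar>f x - f x'\<bar> \<le> e a * d (T x) (T x')" if a: "a \<in> \<alpha>" and "x \<in> a \<inter> G" "x' \<in> a \<inter> G" for a x x'
  proof -
   have x: "x \<in> a" "x' \<in> a" using that by auto
   have "\<bar>f x - f x'\<bar> \<le> D a * d x x'" by (rule lip[OF a x])
   also have "\<dots> \<le> e a * d (T x) (T x')" by (rule mult_mono[OF De(1)[OF a] expanding_le[OF a x] De(2)[OF a] d_nonneg])
   finally show ?thesis .
  qed
 qed (rule fm)
 moreover have "admissible e" unfolding admissible_def
 proof (intro conjI ballI De(2))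
  have "integrable cs (\<lambda>a. (1 + \<delta>) * (prob a * D a) + I a)"
   using Di integrable_restrictions[OF f] unfolding I_def by (intro int_add integrable_mult_right)
  then show "integrable cs (\<lambda>a. prob a * e a)"
   by (rule Bochner_Integration.integrable_cong[THEN iffD1, rotated -1])
    (use prob_element_pos in \<open>auto simp: e_def field_simps less_imp_neq[THEN not_sym]\<close>)
 qed
 ultimately show thesis by (rule that)
qed

end

text \<open>Elements have positive measure, so a finite total forces each Lipschitz constant to be
  finite and \<open>enn2real\<close> loses nothing; the infinite sum then becomes an integral over
  the counting measure, the form used in \<open>admissible\<close>.\<close>

lemma lip_const_finite:
 assumes "prob_space M" and \<alpha>: "\<alpha> \<subseteq> sets M" and lip: "(\<Sum>\<^sub>\<infinity>a\<in>\<alpha>. emeasure M a * lip_const d f a) < \<infinity>"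
  and pos: "\<And>a. a \<in> \<alpha> \<Longrightarrow> 0 < measure M a"
 shows "\<And>a. a \<in> \<alpha> \<Longrightarrow> lip_const d f a < \<infinity>"
  "integrable (count_space \<alpha>) (\<lambda>a. measure M a * enn2real (lip_const d f a))" (is ?P)
proof -
 interpret prob_space M by fact
 let ?S = "\<Sum>\<^sub>\<infinity>a\<in>\<alpha>. emeasure M a * lip_const d f a"
 have fin: "(\<Sum>a\<in>F. emeasure M a * lip_const d f a) \<le> ?S" if "finite F" "F \<subseteq> \<alpha>" for F
  using that by (subst nonneg_infsum_complete) (auto intro!: SUP_upper)
 show lf: "lip_const d f a < \<infinity>" if a: "a \<in> \<alpha>" for a
 proof (rule ccontr)
  assume "\<not> ?thesis"
  then have "lip_const d f a = \<infinity>" by (simp add: less_top[symmetric])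
  then have "emeasure M a * lip_const d f a = \<infinity>" using pos[OF a] by (simp add: emeasure_eq_measure ennreal_mult_top)
  then show False using fin[of "{a}"] a lip by (auto simp: top_unique)
 qed
 have "(\<lambda>a. measure M a * enn2real (lip_const d f a)) summable_on \<alpha>"
 proof (rule nonneg_bdd_above_summable_on)
  show "bdd_above (sum (\<lambda>a. measure M a * enn2real (lip_const d f a)) ` {F. F \<subseteq> \<alpha> \<and> finite F})"
  proof (rule bdd_aboveI2)
   fix F assume F: "F \<in> {F. F \<subseteq> \<alpha> \<and> finite F}"
   have "ennreal (\<Sum>a\<in>F. measure M a * enn2real (lip_const d f a)) = (\<Sum>a\<in>F. emeasure M a * lip_const d f a)"
    using F lf by (subst sum_ennreal[symmetric]) (auto intro!: sum.cong simp: ennreal_mult' emeasure_eq_measure subset_iff)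
   also have "\<dots> \<le> ?S" using F by (intro fin) auto
   also have "?S = ennreal (enn2real ?S)" using lip by simp
   finally show "(\<Sum>a\<in>F. measure M a * enn2real (lip_const d f a)) \<le> enn2real ?S" by simp
  qed
 qed simp
 then have "Infinite_Sum.abs_summable_on (\<lambda>a. measure M a * enn2real (lip_const d f a)) \<alpha>" by simp
 then show ?P
  unfolding abs_summable_equivalent abs_summable_on_def .
qed

theorem theorem2p10:
  fixes M :: "'a measure" and d :: "'a \<Rightarrow> 'a \<Rightarrow> real" and T :: "'a \<Rightarrow> 'a"
    and \<alpha> :: "'a set set" and f :: "'a \<Rightarrow> real"
  assumes gm: "gibbs_markov M d T \<alpha>"
    and erg: "ergodic_map M T"
    and meas: "f \<in> borel_measurable M"
    and lip: "(\<Sum>\<^sub>\<infinity>a\<in>\<alpha>. emeasure M a * lip_const d f a) < \<infinity>"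
    and int: "integrable M f"
    and mean: "(\<integral>x. f x \<partial>M) = 0"
  shows
    "(attraction_I M f \<longrightarrow>
        (\<exists>v\<ge>0.
          converges_with_tight_maxima M (birkhoff_sum T f) (\<lambda>n. sqrt (real n)) (centered_normal v) \<and>
          almost_sure_limit_theorem M (birkhoff_sum T f) (\<lambda>n. sqrt (real n)) (centered_normal v))) \<and>
     (\<forall>l B. attraction_II M f l \<longrightarrow> renormalizing_sequence B \<longrightarrow>
        (\<lambda>n. real n * log_integral l (B n)) \<sim>[sequentially] (\<lambda>n. (B n)\<^sup>2) \<longrightarrow>
          converges_with_tight_maxima M (birkhoff_sum T f) B (centered_normal 1) \<and>
          almost_sure_limit_theorem M (birkhoff_sum T f) B (centered_normal 1)) \<and>
     (\<forall>p c1 c2 L B. attraction_III M f p c1 c2 L \<longrightarrow> renormalizing_sequence B \<longrightarrow>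
        (\<lambda>n. real n * L (B n)) \<sim>[sequentially] (\<lambda>n. B n powr p) \<longrightarrow>
        (\<exists>W. is_stable_law p ((c1 + c2) * Gamma (1 - p) * cos (p * pi / 2))
                ((c1 - c2) / (c1 + c2)) W \<and>
          converges_with_tight_maxima M (birkhoff_sum T f) B W \<and>
          almost_sure_limit_theorem M (birkhoff_sum T f) B W))"
proof -
  have ps: "prob_space M" and ms: "Metric_space (space M) d" and bd: "Metric_space.mbounded (space M) d (space M)"
    and Tm: "T \<in> measurable M M" and Ti: "distr M M T = M" and \<alpha>c: "countable \<alpha>" and \<alpha>s: "\<alpha> \<subseteq> sets M" and \<alpha>p: "partition_on (space M) \<alpha>"
    and inj: "\<And>a. a \<in> \<alpha> \<Longrightarrow> inj_on T a" and im: "\<And>a. a \<in> \<alpha> \<Longrightarrow> \<exists>\<beta>\<subseteq>\<alpha>. T ` a = \<Union>\<beta>"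
    and inf: "0 < (INF a\<in>\<alpha>. measure M (T ` a))"
    using gm unfolding gibbs_markov_def by auto
  interpret X: Metric_space "space M" d by (rule ms)
  obtain \<delta> where \<delta>: "0 < \<delta>" "\<And>x y. x \<in> space M \<Longrightarrow> y \<in> space M \<Longrightarrow> d x y \<le> \<delta>"
    using bd unfolding X.mbounded_alt_pos by blast
  have "\<exists>\<kappa>>1. \<forall>a\<in>\<alpha>. \<forall>x\<in>a. \<forall>y\<in>a. \<kappa> * d x y \<le> d (T x) (T y)"
    using gm unfolding gibbs_markov_def by (elim conjE)
  then obtain \<kappa> where \<kappa>: "1 < \<kappa>" "\<forall>a\<in>\<alpha>. \<forall>x\<in>a. \<forall>y\<in>a. \<kappa> * d x y \<le> d (T x) (T y)"
    by (elim exE conjE)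
  have "\<exists>J. inverse_jacobian M T \<alpha> J \<and> (\<exists>C>0. \<forall>a\<in>\<alpha>. \<forall>x\<in>a. \<forall>y\<in>a. \<bar>1 - J x / J y\<bar> \<le> C * d (T x) (T y))"
    using gm unfolding gibbs_markov_def by (elim conjE)
  then obtain J C where J: "inverse_jacobian M T \<alpha> J" "0 < C" "\<forall>a\<in>\<alpha>. \<forall>x\<in>a. \<forall>y\<in>a. \<bar>1 - J x / J y\<bar> \<le> C * d (T x) (T y)"
    by (elim exE conjE)
  have "gm_map M d T \<alpha> \<kappa> J C \<delta> (INF a\<in>\<alpha>. measure M (T ` a))"
  proof (intro gm_map.intro gm_map_axioms.intro ps)
    show "(INF a\<in>\<alpha>. measure M (T ` a)) \<le> measure M (T ` a)" if "a \<in> \<alpha>" for a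
      by (rule cINF_lower[OF bdd_belowI2[where m=0] that]) simp
  qed (use J \<kappa> \<delta> Tm Ti \<alpha>c \<alpha>s \<alpha>p inj im inf in \<open>simp_all add: less_imp_le\<close>)
  then interpret gm_map M d T \<alpha> \<kappa> J C \<delta> "INF a\<in>\<alpha>. measure M (T ` a)" .
  note lf = lip_const_finite[OF ps \<alpha>s lip prob_element_pos]
  have lipD: "\<bar>f x - f y\<bar> \<le> enn2real (lip_const d f a) * d x y" if a: "a \<in> \<alpha>" and xy: "x \<in> a" "y \<in> a" for a x y
  proof (cases "x = y")
    case False
    have pos: "0 < d x y" using X.mdist_pos_less[OF False in_space[OF a xy(1)] in_space[OF a xy(2)]] .
    have "ennreal (\<bar>f x - f y\<bar> / d x y) \<le> lip_const d f a"
      unfolding lip_const_def by (rule SUP_upper2[of "(x, y)"]) (use False xy in auto)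
    also have "lip_const d f a = ennreal (enn2real (lip_const d f a))" using lf(1)[OF _ a] by simp
    finally show ?thesis using pos by (simp add: pos_divide_le_eq)
  qed simp
  obtain e where e: "reg e f" "admissible e"
    by (rule regular_of_Lipschitz[OF int _ _ lipD]) (use lf(2) in auto)
  interpret gm_obs M d T \<alpha> \<kappa> J C \<delta> "INF a\<in>\<alpha>. measure M (T ` a)" f e
    by unfold_locales (use erg e mean in auto)
  show ?thesis using case_I case_II case_III unfolding attraction_I_def by blast
qed

end
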